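(* Let $\mu$ be a finite positive measure on $\mathbb{R}$. Let $A=\{a_n\}_{n\in\mathbb{Z}}$ be a $d$-uniform sequence of real numbers such that $$\sum_n\frac{\log\mu\big((a_n-\varepsilon_n,a_n+\varepsilon_n)\big)}{1+n^2}>-\infty,\qquad\text{where }\ \varepsilon_n=\tfrac13\min\big(a_{n+1}-a_n,\ a_n-a_{n-1}\big).$$ Then $\mathcal{G}^\infty_\mu\geqslant 2\pi d$.
   Context: Discrete sequences are enumerated in increasing order with indices in $\mathbb{Z}$. For a finite positive Borel measure $\mu$ on $\mathbb{R}$ and $1\leqslant p\leqslant\infty$, $$\mathcal{G}^p_\mu=\sup\Big\{a>0:\ \exists\, f\in L^p(\mu),\ f\neq 0,\ \int f(x)e^{i\lambda x}\,d\mu(x)=0\ \ \forall\lambda\in[0,a]\Big\},$$ with $\mathcal{G}^p_\mu=0$ if the set is empty. A short partition of $\mathbb{R}$: points $\dots<c_{-1}<c_0=0<c_1<\dots$, $I_n=(c_n,c_{n+1}]$, with $|I_n|\to\infty$ as $n\to\pm\infty$ and $\sum_n |I_n|^2/(1+\operatorname{dist}^2(0,I_n))<\infty$. A discrete $\Lambda\subset\mathbb{R}$ is $d$-uniform ($d>0$) if for some short partition, with $\Delta_n=\#(\Lambda\cap I_n)$ and $E_n=\sum\log|\lambda_k-\lambda_l|$ over ordered pairs of distinct $\lambda_k,\lambda_l\in\Lambda\cap I_n$: $\Delta_n=d|I_n|+o(|I_n|)$ as $n\to\pm\infty$ and $\sum_n\frac{\Delta_n^2\log|I_n|-E_n}{1+\operatorname{dist}^2(0,I_n)}<\infty$.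 *)

theory Defs
  imports "HOL-Analysis.Analysis" "HOL-Library.Landau_Symbols"
begin

definition gap_witness :: "real measure \<Rightarrow> real \<Rightarrow> bool" where
  "gap_witness \<mu> a \<longleftrightarrow> a > 0 \<and>
     (\<exists>f :: real \<Rightarrow> complex.
        f \<in> borel_measurable \<mu> \<and> (\<exists>C. AE x in \<mu>. norm (f x) \<le> C) \<and>
        \<not> (AE x in \<mu>. f x = 0) \<and>
        (\<forall>t\<in>{0..a}. (LINT x|\<mu>. f x * cis (t * x)) = 0))"

definition gap_infty :: "real measure \<Rightarrow> ereal" where
  "gap_infty \<mu> = (if {a. gap_witness \<mu> a} = {} then 0
                   else Sup (ereal ` {a. gap_witness \<mu> a}))"

definition part_int :: "(int \<Rightarrow> real) \<Rightarrow> int \<Rightarrow> real set" where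
  "part_int c n = {c n<..c (n+1)}"

definition short_partition :: "(int \<Rightarrow> real) \<Rightarrow> bool" where
  "short_partition c \<longleftrightarrow> strict_mono c \<and> c 0 = 0 \<and>
     filterlim (\<lambda>n. c (n+1) - c n) at_top at_top \<and>
     filterlim (\<lambda>n. c (n+1) - c n) at_top at_bot \<and>
     (\<lambda>n. (c (n+1) - c n)\<^sup>2 / (1 + (infdist 0 (part_int c n))\<^sup>2)) summable_on UNIV"

definition discrete_set :: "real set \<Rightarrow> bool" where
  "discrete_set \<Lambda> \<longleftrightarrow> (\<forall>r s. finite (\<Lambda> \<inter> {r..s}))"

definition energy :: "real set \<Rightarrow> real" where
  "energy S = (\<Sum>(x,y)\<in>{(x,y). x \<in> S \<and> y \<in> S \<and> x \<noteq> y}. ln \<bar>x - y\<bar>)"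

definition d_uniform :: "real \<Rightarrow> real set \<Rightarrow> bool" where
  "d_uniform d \<Lambda> \<longleftrightarrow> d > 0 \<and> discrete_set \<Lambda> \<and>
     (\<exists>c. short_partition c \<and>
        (let \<Delta> = (\<lambda>n. real (card (\<Lambda> \<inter> part_int c n)));
             L = (\<lambda>n. c (n+1) - c n)
         in (\<lambda>n. \<Delta> n - d * L n) \<in> o[at_top](L) \<and>
            (\<lambda>n. \<Delta> n - d * L n) \<in> o[at_bot](L) \<and>
            (\<lambda>n. ((\<Delta> n)\<^sup>2 * ln (L n) - energy (\<Lambda> \<inter> part_int c n))
                   / (1 + (infdist 0 (part_int c n))\<^sup>2)) summable_on UNIV))"

end

theory Submission
  imports Defs "HOL-Complex_Analysis.Complex_Analysis" "HOL-Real_Asymp.Real_Asymp"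
begin

text \<open>
  Fix \<open>b < \<pi> d\<close>. By duality (an orthogonal projection in a weighted sequence space of averages over
  the intervals around the \<open>a\<^sub>n\<close>), a bounded function whose Fourier transform vanishes on an interval
  of length \<open>2 b\<close> exists as soon as \<open>norm (h \<i>)\<close> is bounded uniformly over all entire \<open>h\<close> of
  exponential type \<open>b\<close>, small at infinity on the real line, that satisfy \<open>norm (h x\<^sub>n) \<le> exp (W\<^sub>n)\<close> at
  some points \<open>x\<^sub>n\<close> of these intervals, where \<open>W\<close> is summable against \<open>1 / (1 + n\<^sup>2)\<close>.

  For the uniform bound let \<open>\<sigma>\<close> be the least 1-Lipschitz majorant of a multiple of
  \<open>ln (max 1 (norm (h x)))\<close> and consider a contact point \<open>t\<close>, with \<open>s = \<sigma> t\<close>. If the Poisson integral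
  of \<open>\<sigma>\<close> is under control at \<open>t\<close>, then \<open>h\<close> grows at most like \<open>exp (b \<bar>Im z\<bar> + \<theta> s)\<close> on the disc of
  radius \<open>s\<close>. Uniformity of the sequence provides more than \<open>(b / \<pi>) s\<close> nodes per length \<open>s\<close>, of small
  energy, in the disc, except where a fixed Poisson-summable density \<open>q\<close> has mass at least \<open>s\<^sup>2\<close>.
  Lagrange interpolation at these nodes, compared with the lattice, makes \<open>h t\<close> smaller than the
  contact condition allows. Hence every contact point lies in an exceptional window or sees a large
  Poisson integral, and a Vitali covering turns this into a bound of the Poisson integral of \<open>\<sigma>\<close> by
  that of \<open>q\<close>. The covering argument presupposes that the Poisson integral is not too large; this is
  removed by applying it to \<open>exp (- c) h\<close> and letting \<open>c\<close> decrease to zero.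
\<close>

section \<open>Lagrange interpolation in a disc\<close>

lemma partial_fractions_prod:
  fixes W :: "'a::field set"
  assumes "finite W" "W \<noteq> {}" "z \<notin> W"
  shows "1 / (\<Prod>w\<in>W. z - w) = (\<Sum>w\<in>W. 1 / ((\<Prod>w'\<in>W-{w}. w - w') * (z - w)))"
  using assms
proof (induction W arbitrary: z rule: finite_ne_induct)
  case (singleton x)
  then show ?case by simp
next
  case (insert v F)
  let ?g = "\<lambda>w. 1 / (\<Prod>w'\<in>F-{w}. w - w')"
  have at_v: "1 / (\<Prod>w\<in>F. v - w) = (\<Sum>w\<in>F. ?g w / (v - w))"
    using insert.IH[of v] insert.hyps by simp
  have at_z: "1 / (\<Prod>w\<in>F. z - w) = (\<Sum>w\<in>F. ?g w / (z - w))"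
    using insert.IH[of z] insert.prems by simp
  have coeff: "(\<Prod>w'\<in>insert v F-{w}. w - w') = (w - v) * (\<Prod>w'\<in>F-{w}. w - w')" if "w \<in> F" for w
  proof -
    have "insert v F - {w} = insert v (F - {w})" using that insert.hyps by auto
    then show ?thesis using insert.hyps by simp
  qed
  have two_poles: "?g w / ((v - w) * (z - v)) + ?g w / ((w - v) * (z - w)) = ?g w / (z - w) / (z - v)"
    if "w \<in> F" for w
  proof -
    have "v - w \<noteq> 0" "z - v \<noteq> 0" "z - w \<noteq> 0" "w - v = - (v - w)" using that insert by auto
    then have "1 / ((v - w) * (z - v)) + 1 / ((w - v) * (z - w)) = 1 / ((z - w) * (z - v))"
      by (simp add: divide_simps) (simp add: algebra_simps)
    then have "?g w * (1 / ((v - w) * (z - v)) + 1 / ((w - v) * (z - w))) = ?g w * (1 / ((z - w) * (z - v)))"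
      by simp
    then show ?thesis by (simp add: distrib_left)
  qed
  have "(\<Sum>w\<in>insert v F. 1 / ((\<Prod>w'\<in>insert v F-{w}. w - w') * (z - w)))
     = 1 / (\<Prod>w\<in>F. v - w) / (z - v) + (\<Sum>w\<in>F. ?g w / ((w - v) * (z - w)))"
    using insert.hyps coeff by (simp add: mult_ac)
  also have "\<dots> = (\<Sum>w\<in>F. ?g w / ((v - w) * (z - v)) + ?g w / ((w - v) * (z - w)))"
    unfolding at_v sum_divide_distrib by (simp add: sum.distrib mult.assoc)
  also have "\<dots> = 1 / (\<Prod>w\<in>F. z - w) / (z - v)"
    unfolding at_z sum_divide_distrib by (intro sum.cong refl two_poles)
  also have "\<dots> = 1 / (\<Prod>w\<in>insert v F. z - w)"
    using insert.hyps by (simp add: mult_ac)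
  finally show ?case by simp
qed

lemma has_contour_integral_circlepath_pole:
  assumes holo: "H holomorphic_on UNIV" and r: "0 < r" and off: "norm w \<noteq> r"
  shows "((\<lambda>u. H u / (u - w)) has_contour_integral (if norm w < r then 2 * of_real pi * \<i> * H w else 0))
           (circlepath 0 r)"
proof (cases "norm w < r")
  case True
  have "((\<lambda>u. H u / (u - w)) has_contour_integral (2 * of_real pi * \<i> * H w)) (circlepath 0 r)"
    by (rule Cauchy_integral_circlepath)
      (use True holo in \<open>auto intro: holomorphic_on_subset holomorphic_on_imp_continuous_on\<close>)
  then show ?thesis using True by simp
next
  case False
  have "((\<lambda>u. H u / (u - w)) has_contour_integral 0) (circlepath 0 r)"
  proof (rule Cauchy_theorem_disc_simple)
    show "(\<lambda>u. H u / (u - w)) holomorphic_on ball 0 (norm w)"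
      by (intro holomorphic_intros holomorphic_on_subset[OF holo]) auto
    show "path_image (circlepath 0 r) \<subseteq> ball 0 (norm w)"
      using False off r by (auto simp: sphere_def)
  qed auto
  then show ?thesis using False by simp
qed

lemma Cauchy_integral_circlepath_prod:
  assumes holo: "H holomorphic_on UNIV" and W: "finite W" "W \<noteq> {}" and r: "0 < r"
    and off: "\<And>w. w \<in> W \<Longrightarrow> norm w \<noteq> r"
  shows "((\<lambda>u. H u / (\<Prod>w\<in>W. u - w)) has_contour_integral
           2 * of_real pi * \<i> * (\<Sum>w\<in>{w\<in>W. norm w < r}. H w / (\<Prod>w'\<in>W-{w}. w - w'))) (circlepath 0 r)"
proof -
  define coeff where "coeff w = 1 / (\<Prod>w'\<in>W-{w}. w - w')" for w
  have "((\<lambda>u. \<Sum>w\<in>W. coeff w * (H u / (u - w))) has_contour_integral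
          (\<Sum>w\<in>W. coeff w * (if norm w < r then 2 * of_real pi * \<i> * H w else 0))) (circlepath 0 r)"
    by (intro has_contour_integral_sum has_contour_integral_lmul has_contour_integral_circlepath_pole)
      (use assms in auto)
  also have "(\<Sum>w\<in>W. coeff w * (if norm w < r then 2 * of_real pi * \<i> * H w else 0))
      = 2 * of_real pi * \<i> * (\<Sum>w\<in>{w\<in>W. norm w < r}. H w / (\<Prod>w'\<in>W-{w}. w - w'))"
    unfolding sum_distrib_left sum.inter_filter[OF W(1)] by (intro sum.cong) (auto simp: coeff_def)
  finally show ?thesis
  proof (rule has_contour_integral_eq)
    fix u assume "u \<in> path_image (circlepath 0 r)"
    then have "norm u = r" using r by (auto simp: sphere_def)
    then have "u \<notin> W" using off by auto
    from partial_fractions_prod[OF W this]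
    have "H u / (\<Prod>w\<in>W. u - w) = H u * (\<Sum>w\<in>W. 1 / ((\<Prod>w'\<in>W-{w}. w - w') * (u - w)))"
      by (simp add: divide_inverse)
    then show "(\<Sum>w\<in>W. coeff w * (H u / (u - w))) = H u / (\<Prod>w\<in>W. u - w)"
      unfolding sum_distrib_left coeff_def by simp
  qed
qed

lemma norm_sum_residues_le:
  assumes holo: "H holomorphic_on UNIV" and W: "finite W" "W \<noteq> {}" and r: "0 < r" and C: "C \<ge> 0"
    and off: "\<And>w. w \<in> W \<Longrightarrow> norm w \<noteq> r"
    and circle: "\<And>z. norm z = r \<Longrightarrow> norm (H z) \<le> C * norm (\<Prod>w\<in>W. z - w)"
  shows "norm (\<Sum>w\<in>{w\<in>W. norm w < r}. H w / (\<Prod>w'\<in>W-{w}. w - w')) \<le> C * r" (is "norm ?S \<le> _")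
proof -
  have "norm (2 * of_real pi * \<i> * ?S) \<le> C * (2 * pi * r)"
  proof (rule has_contour_integral_bound_circlepath[OF Cauchy_integral_circlepath_prod])
    fix x :: complex assume "norm (x - 0) = r"
    then have x: "norm x = r" by simp
    then have "norm (\<Prod>w\<in>W. x - w) > 0" using W off by (auto simp: prod_zero_iff)
    then show "norm (H x / (\<Prod>w\<in>W. x - w)) \<le> C"
      using circle[OF x] by (simp add: norm_divide pos_divide_le_eq)
  qed (use assms in auto)
  then show ?thesis by (simp add: norm_mult)
qed

lemma norm_le_lagrange_sum:
  fixes H :: "complex \<Rightarrow> complex"
  assumes holo: "H holomorphic_on UNIV" and fin: "finite Y" and nonzero: "0 \<notin> Y"
    and r: "0 < r" and C: "C \<ge> 0"
    and off: "\<And>y. y \<in> Y \<Longrightarrow> norm y \<noteq> r"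
    and circle: "\<And>z. norm z = r \<Longrightarrow> norm (H z) \<le> C * norm (\<Prod>y\<in>Y. z - y)"
  shows "norm (H 0) \<le> (\<Prod>y\<in>Y. norm y) * C
     + (\<Sum>y\<in>{y\<in>Y. norm y < r}. norm (H y) * (\<Prod>w\<in>Y-{y}. norm w / norm (y - w)))"
proof -
  let ?W = "insert 0 Y" and ?P = "\<Prod>y\<in>Y. norm y" and ?In = "{y\<in>Y. norm y < r}"
  let ?res = "\<lambda>w. H w / (\<Prod>w'\<in>?W-{w}. w - w')"
  have P_pos: "?P > 0" using fin nonzero by (intro prod_pos) auto
  have res_zero: "?P * norm (?res 0) = norm (H 0)"
    using P_pos nonzero by (simp add: norm_divide prod_norm[symmetric])
  have res_node: "?P * norm (?res y) = norm (H y) * (\<Prod>w\<in>Y-{y}. norm w / norm (y - w))" if "y \<in> Y" for y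
  proof -
    have "y \<noteq> 0" using that nonzero by auto
    then have "?W - {y} = insert 0 (Y - {y})" by auto
    then have "norm (?res y) = norm (H y) / (norm y * (\<Prod>w\<in>Y-{y}. norm (y - w)))"
      using fin nonzero by (simp add: norm_divide norm_mult prod_norm)
    moreover have "?P = norm y * (\<Prod>w\<in>Y-{y}. norm w)" using fin that by (simp add: prod.remove)
    ultimately show ?thesis using \<open>y \<noteq> 0\<close> by (simp add: prod_dividef)
  qed
  have "norm (\<Sum>w\<in>{w\<in>?W. norm w < r}. ?res w) \<le> C / r * r"
  proof (rule norm_sum_residues_le[OF holo _ _ r])
    show "norm (H z) \<le> C / r * norm (\<Prod>w\<in>?W. z - w)" if "norm z = r" for z
      using circle[OF that] that r fin nonzero by (simp add: norm_mult)
  qed (use fin C r off in auto)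
  moreover have "{w\<in>?W. norm w < r} = insert 0 ?In" using r by auto
  ultimately have "norm (?res 0 + (\<Sum>y\<in>?In. ?res y)) \<le> C"
    using fin nonzero r by simp
  then have "norm (?res 0) \<le> C + norm (\<Sum>y\<in>?In. ?res y)"
    using norm_diff_ineq[of "?res 0" "\<Sum>y\<in>?In. ?res y"] by linarith
  also have "\<dots> \<le> C + (\<Sum>y\<in>?In. norm (?res y))"
    by (intro add_left_mono norm_sum)
  finally have "?P * norm (?res 0) \<le> ?P * (C + (\<Sum>y\<in>?In. norm (?res y)))"
    using P_pos by (intro mult_left_mono) auto
  also have "\<dots> = ?P * C + (\<Sum>y\<in>?In. norm (H y) * (\<Prod>w\<in>Y-{y}. norm w / norm (y - w)))"
    unfolding distrib_left sum_distrib_left using res_node by simp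
  finally show ?thesis using res_zero by simp
qed

section \<open>Products over the integer lattice and its perturbations\<close>

lemma cos_two_pi_Re_nonpos:
  fixes z :: complex and n :: nat
  assumes z: "norm z = real n + 1/2" and Im_small: "\<bar>Im z\<bar> \<le> 1/4"
  shows "cos (2 * (pi * Re z)) \<le> 0"
proof -
  define x where "x = \<bar>Re z\<bar>"
  define \<delta> where "\<delta> = real n + 1/2 - x"
  have circle: "x\<^sup>2 + (Im z)\<^sup>2 = (real n + 1/2)\<^sup>2"
    using cmod_power2[of z] unfolding z x_def by simp
  have "x \<le> real n + 1/2" using abs_Re_le_cmod[of z] z by (simp add: x_def)
  then have \<delta>_nonneg: "\<delta> \<ge> 0" by (simp add: \<delta>_def)
  have "(Im z)\<^sup>2 \<le> (1/4)\<^sup>2" using Im_small by (intro power2_le_iff_abs_le[THEN iffD2]) auto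
  moreover have "\<delta> * (real n + 1/2 + x) = (Im z)\<^sup>2"
    using circle by (simp add: \<delta>_def power2_eq_square algebra_simps)
  moreover have "\<delta> * (1/2) \<le> \<delta> * (real n + 1/2 + x)"
    by (intro mult_left_mono) (auto simp: \<delta>_nonneg x_def)
  ultimately have \<delta>_le: "\<delta> \<le> 1/8" by (simp add: power2_eq_square)
  have "cos (2 * (pi * Re z)) = cos (2 * (pi * x))"
    unfolding x_def by (cases "Re z \<ge> 0") simp_all
  also have "2 * (pi * x) = (pi - 2 * pi * \<delta>) + 2 * pi * real n" by (simp add: \<delta>_def algebra_simps)
  also have "cos \<dots> = - cos (2 * pi * \<delta>)"
    using cos_int_2pin[of "int n"] sin_int_2pin[of "int n"] by (simp add: cos_add mult_ac)
  also have "\<dots> \<le> 0"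
  proof -
    have "2 * pi * \<delta> \<le> 2 * pi * (1/8)" using \<delta>_le by (intro mult_left_mono) auto
    moreover have "0 \<le> 2 * pi * \<delta>" using \<delta>_nonneg by simp
    ultimately have "0 \<le> cos (2 * pi * \<delta>)" using pi_gt_zero by (intro cos_ge_zero) linarith+
    then show ?thesis by simp
  qed
  finally show ?thesis .
qed

lemma norm_sin_pi_half_integer_circle:
  fixes z :: complex and n :: nat
  assumes z: "norm z = real n + 1/2"
  shows "exp (pi * \<bar>Im z\<bar>) / 10 \<le> norm (sin (of_real pi * z))"
proof -
  define T where "T = exp (2 * (pi * \<bar>Im z\<bar>))"
  define u where "u = inverse T"
  define co where "co = cos (2 * (pi * Re z))"
  have T_pos: "T > 0" and u_nonneg: "0 \<le> u" by (simp_all add: T_def u_def)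
  have norm_sq: "norm (sin (of_real pi * z)) ^ 2 = (T + u - 2 * co) / 4"
    unfolding norm_sin_squared T_def u_def co_def
    by (cases "Im z \<ge> 0") (simp_all add: exp_minus field_simps)
  have "T / 100 \<le> (T + u - 2 * co) / 4"
  proof (cases "\<bar>Im z\<bar> \<ge> 1/4")
    case True
    have "1 + 2 * (pi * \<bar>Im z\<bar>) \<le> T" unfolding T_def by (rule exp_ge_add_one_self)
    moreover have "pi * \<bar>Im z\<bar> \<ge> 3 * (1/4)" by (rule mult_mono) (use True pi_gt3 in auto)
    ultimately have "T \<ge> 5/2" by linarith
    moreover have "co \<le> 1" by (simp add: co_def)
    ultimately show ?thesis using u_nonneg by (simp add: field_simps)
  next
    case False
    then have "co \<le> 0" unfolding co_def using cos_two_pi_Re_nonpos[OF z] by simp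
    then show ?thesis using T_pos u_nonneg by (simp add: field_simps)
  qed
  then have "(exp (pi * \<bar>Im z\<bar>) / 10)\<^sup>2 \<le> norm (sin (of_real pi * z)) ^ 2"
    unfolding norm_sq by (simp add: T_def power_divide exp_double)
  then show ?thesis by (rule power2_le_imp_le) simp
qed

lemma sum_inverse_squares_tail:
  fixes K n :: nat
  assumes "K \<ge> 1" "n \<ge> K"
  shows "(\<Sum>k=Suc K..n. 1 / (real k)\<^sup>2) \<le> 1 / real K - 1 / real n"
  using assms(2)
proof (induction n rule: dec_induct)
  case base then show ?case by simp
next
  case (step n)
  have "real n > 0" using step.hyps assms by auto
  then have "1 / (real (Suc n))\<^sup>2 \<le> 1 / real n - 1 / real (Suc n)"
    by (simp add: divide_simps power2_eq_square)
  then show ?case using step by (simp add: sum.nat_ivl_Suc')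
qed

lemma prod_sine_factors_le:
  fixes z :: complex and K n :: nat
  assumes K: "K \<ge> 1" and n: "n \<ge> K"
  shows "(\<Prod>k=Suc K..n. norm (1 - z\<^sup>2 / (of_nat k)\<^sup>2)) \<le> exp ((norm z)\<^sup>2 / real K)"
proof -
  have "(\<Prod>k=Suc K..n. norm (1 - z\<^sup>2 / (of_nat k)\<^sup>2)) \<le> (\<Prod>k=Suc K..n. exp ((norm z)\<^sup>2 * (1 / (real k)\<^sup>2)))"
  proof (intro prod_mono conjI)
    fix k assume "k \<in> {Suc K..n}"
    have "norm (1 - z\<^sup>2 / (of_nat k)\<^sup>2) \<le> 1 + norm (z\<^sup>2 / (of_nat k)\<^sup>2)"
      using norm_triangle_ineq4[of 1 "z\<^sup>2 / (of_nat k)\<^sup>2"] by simp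
    also have "\<dots> \<le> exp ((norm z)\<^sup>2 * (1 / (real k)\<^sup>2))"
      by (simp add: norm_divide norm_power)
    finally show "norm (1 - z\<^sup>2 / (of_nat k)\<^sup>2) \<le> exp ((norm z)\<^sup>2 * (1 / (real k)\<^sup>2))" .
  qed auto
  also have "\<dots> = exp ((norm z)\<^sup>2 * (\<Sum>k=Suc K..n. 1 / (real k)\<^sup>2))"
    by (simp add: exp_sum sum_distrib_left)
  also have "\<dots> \<le> exp ((norm z)\<^sup>2 * (1 / real K))"
  proof -
    have "(\<Sum>k=Suc K..n. 1 / (real k)\<^sup>2) \<le> 1 / real K"
      using sum_inverse_squares_tail[OF K n] by (smt (verit) divide_nonneg_nonneg of_nat_0_le_iff)
    then show ?thesis by (simp add: mult_left_mono del: times_divide_eq_right)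
  qed
  finally show ?thesis by simp
qed

lemma norm_sin_le_partial_product:
  fixes z :: complex and K :: nat
  assumes K: "K \<ge> 1"
  shows "norm (sin (of_real pi * z))
      \<le> pi * norm z * (\<Prod>k=1..K. norm (1 - z\<^sup>2 / (of_nat k)\<^sup>2)) * exp ((norm z)\<^sup>2 / real K)"
proof (rule Lim_bounded)
  show "(\<lambda>n. norm (of_real pi * z * (\<Prod>k=1..n. 1 - z^2 / of_nat k^2))) \<longlonglongrightarrow> norm (sin (of_real pi * z))"
    by (intro tendsto_norm sin_product_formula_complex)
  show "\<forall>n\<ge>K. norm (of_real pi * z * (\<Prod>k=1..n. 1 - z^2 / of_nat k^2))
      \<le> pi * norm z * (\<Prod>k=1..K. norm (1 - z\<^sup>2 / (of_nat k)\<^sup>2)) * exp ((norm z)\<^sup>2 / real K)"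
  proof (intro allI impI)
    fix n assume n: "n \<ge> K"
    let ?f = "\<lambda>k. norm (1 - z\<^sup>2 / (of_nat k)\<^sup>2)"
    have "{1..n} = {1..K} \<union> {Suc K..n}" using n K by auto
    then have "(\<Prod>k=1..n. ?f k) = (\<Prod>k=1..K. ?f k) * (\<Prod>k=Suc K..n. ?f k)"
      by (simp add: prod.union_disjoint)
    also have "\<dots> \<le> (\<Prod>k=1..K. ?f k) * exp ((norm z)\<^sup>2 / real K)"
      by (intro mult_left_mono prod_sine_factors_le K n prod_nonneg) auto
    finally show "norm (of_real pi * z * (\<Prod>k=1..n. 1 - z^2 / of_nat k^2))
      \<le> pi * norm z * (\<Prod>k=1..K. ?f k) * exp ((norm z)\<^sup>2 / real K)"
      by (simp add: norm_mult prod_norm[symmetric] mult.assoc mult_left_mono)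
  qed
qed

lemma self_power_le_exp_fact: "(real n) ^ n \<le> exp (real n) * fact n"
proof -
  have "(\<Sum>k\<in>{n}. (real n)^k /\<^sub>R fact k) \<le> (\<Sum>k. (real n)^k /\<^sub>R fact k)"
    by (rule sum_le_suminf) (use exp_converges[of "real n"] in \<open>auto simp: sums_iff\<close>)
  also have "\<dots> = exp (real n)" using exp_converges[of "real n"] by (simp add: sums_iff)
  finally show ?thesis by (simp add: field_simps)
qed

lemma fact_add_le_power: "fact (K + E) \<le> fact K * real (K + E) ^ E"
proof -
  have "fact (K + j) \<le> fact K * real (K + E) ^ j" if "j \<le> E" for j
    using that
  proof (induction j)
    case (Suc j)
    have "(fact (K + Suc j) :: real) = real (K + Suc j) * fact (K + j)" by simp
    also have "\<dots> \<le> real (K + E) * (fact K * real (K + E) ^ j)" using Suc by (intro mult_mono) auto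
    finally show ?case by (simp add: mult_ac)
  qed simp
  then show ?thesis by blast
qed

lemma prod_shift_ratio_le:
  fixes K E :: nat
  assumes "E \<ge> 1"
  shows "(\<Prod>k=1..K. (real k + real E) / real k) \<le> (exp 1 * (real (K + E) / real E)) ^ E"
proof -
  have "(\<Prod>k=1..K. (real k + real E) / real k) = fact (K + E) / (fact K * fact E)"
  proof (induction K)
    case (Suc K)
    have "(\<Prod>k=1..Suc K. (real k + real E) / real k)
        = (fact (K + E) / (fact K * fact E)) * ((real (Suc K) + real E) / real (Suc K))"
      using Suc by simp
    also have "\<dots> = fact (Suc K + E) / (fact (Suc K) * fact E)"
      by (simp add: mult_ac add_ac)
    finally show ?case .
  qed simp
  also have "\<dots> \<le> real (K + E) ^ E * (1 / fact E)"
    using fact_add_le_power[of K E] by (simp add: field_simps)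
  also have "\<dots> \<le> real (K + E) ^ E * (exp (real E) / real E ^ E)"
    using self_power_le_exp_fact[of E] assms by (intro mult_left_mono) (auto simp: field_simps)
  also have "\<dots> = (exp 1 * (real (K + E) / real E)) ^ E"
    by (simp add: power_mult_distrib power_divide exp_of_nat_mult[symmetric])
  finally show ?thesis .
qed

definition nonzero_ints :: "nat \<Rightarrow> int set" where
  "nonzero_ints K = {- int K..int K} - {0}"

lemma mem_nonzero_ints: "k \<in> nonzero_ints K \<longleftrightarrow> k \<noteq> 0 \<and> \<bar>k\<bar> \<le> int K"
  by (auto simp: nonzero_ints_def)

lemma finite_nonzero_ints: "finite (nonzero_ints K)"
  by (simp add: nonzero_ints_def)

lemma card_nonzero_ints: "card (nonzero_ints K) = 2 * K"
  by (simp add: nonzero_ints_def card_Diff_subset)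

lemma prod_nonzero_ints:
  fixes f :: "int \<Rightarrow> 'a::comm_monoid_mult"
  shows "(\<Prod>k\<in>nonzero_ints K. f k) = (\<Prod>k=1..K. f (int k) * f (- int k))"
proof (induction K)
  case (Suc K)
  have "nonzero_ints (Suc K) = insert (int (Suc K)) (insert (- int (Suc K)) (nonzero_ints K))"
    by (auto simp: nonzero_ints_def)
  then show ?case using Suc by (simp add: mult_ac finite_nonzero_ints mem_nonzero_ints)
qed (simp add: nonzero_ints_def)

lemma prod_lattice_norm:
  fixes z :: complex
  shows "(\<Prod>k\<in>nonzero_ints K. norm (z - of_int k)) = (fact K)\<^sup>2 * (\<Prod>k=1..K. norm (1 - z\<^sup>2 / (of_nat k)\<^sup>2))"
proof -
  have "(\<Prod>k\<in>nonzero_ints K. norm (z - of_int k)) = (\<Prod>k=1..K. norm (z - of_nat k) * norm (z + of_nat k))"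
    unfolding prod_nonzero_ints by simp
  also have "\<dots> = (\<Prod>k=1..K. (real k)\<^sup>2 * norm (1 - z\<^sup>2 / (of_nat k)\<^sup>2))"
  proof (intro prod.cong refl)
    fix k assume "k \<in> {1..K}"
    then have "(of_nat k :: complex) \<noteq> 0" by simp
    then have "(z - of_nat k) * (z + of_nat k) = - ((of_nat k)\<^sup>2 * (1 - z\<^sup>2 / (of_nat k)\<^sup>2))"
      by (simp add: field_simps power2_eq_square)
    then have "norm ((z - of_nat k) * (z + of_nat k)) = norm ((of_nat k)\<^sup>2 * (1 - z\<^sup>2 / (of_nat k)\<^sup>2))"
      by (simp only: norm_minus_cancel)
    then show "norm (z - of_nat k) * norm (z + of_nat k) = (real k)\<^sup>2 * norm (1 - z\<^sup>2 / (of_nat k)\<^sup>2)"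
      by (simp add: norm_mult norm_power)
  qed
  also have "\<dots> = (\<Prod>k=1..K. real k)\<^sup>2 * (\<Prod>k=1..K. norm (1 - z\<^sup>2 / (of_nat k)\<^sup>2))"
    by (simp add: prod.distrib prod_power_distrib)
  also have "(\<Prod>k=1..K. real k) = fact K" by (simp add: fact_prod)
  finally show ?thesis .
qed

lemma prod_abs_nonzero_ints: "(\<Prod>k\<in>nonzero_ints K. \<bar>real_of_int k\<bar>) = (fact K)\<^sup>2"
  using prod_lattice_norm[of 0 K] by (simp add: norm_minus_commute)

lemma prod_lattice_half_integer_circle_ge:
  fixes z :: complex
  assumes z: "norm z = real n + 1/2" and K: "K \<ge> 1"
  shows "(fact K)\<^sup>2 * exp (pi * \<bar>Im z\<bar>) / (10 * pi * norm z * exp ((norm z)\<^sup>2 / real K))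
      \<le> (\<Prod>k\<in>nonzero_ints K. norm (z - of_int k))"
proof -
  let ?p = "\<Prod>k=1..K. norm (1 - z\<^sup>2 / (of_nat k)\<^sup>2)" and ?e = "exp ((norm z)\<^sup>2 / real K)"
  have z_pos: "norm z > 0" using z by linarith
  have "exp (pi * \<bar>Im z\<bar>) / 10 \<le> pi * norm z * ?p * ?e"
    using norm_sin_pi_half_integer_circle[OF z] norm_sin_le_partial_product[OF K, of z] by linarith
  then have "exp (pi * \<bar>Im z\<bar>) / (10 * pi * norm z * ?e) \<le> ?p"
    using z_pos by (simp add: field_simps)
  then have "(fact K)\<^sup>2 * (exp (pi * \<bar>Im z\<bar>) / (10 * pi * norm z * ?e)) \<le> (fact K)\<^sup>2 * ?p"
    by (rule mult_left_mono) simp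
  then show ?thesis by (simp add: prod_lattice_norm)
qed

lemma fact_square_le:
  assumes "j \<le> K"
  shows "(fact K)\<^sup>2 \<le> (fact (K + j) * fact (K - j) :: real)"
  using assms
proof (induction j)
  case (Suc j)
  have reduce: "fact (K - j) = real (K - j) * fact (K - Suc j)"
    using fact_reduce[of "K - j", where 'a=real] Suc.prems by simp
  have "(fact K)\<^sup>2 \<le> fact (K + j) * (fact (K - j) :: real)" using Suc by simp
  also have "\<dots> = real (K - j) * (fact (K + j) * fact (K - Suc j))" by (simp add: reduce)
  also have "\<dots> \<le> real (K + Suc j) * (fact (K + j) * fact (K - Suc j))" by (intro mult_right_mono) auto
  also have "\<dots> = fact (K + Suc j) * fact (K - Suc j)" by simp
  finally show ?case .
qed (simp add: power2_eq_square)

lemma prod_lattice_differences: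
  assumes k: "\<bar>k\<bar> \<le> int K"
  shows "(\<Prod>l\<in>{- int K..int K}-{k}. \<bar>real_of_int k - of_int l\<bar>)
      = fact (nat (int K + k)) * fact (nat (int K - k))"
proof -
  have "{- int K..int K}-{k} = {- int K..k-1} \<union> {k+1..int K}" using k by auto
  then have "(\<Prod>l\<in>{- int K..int K}-{k}. \<bar>real_of_int k - of_int l\<bar>) =
      (\<Prod>l\<in>{- int K..k-1}. \<bar>real_of_int k - of_int l\<bar>) * (\<Prod>l\<in>{k+1..int K}. \<bar>real_of_int k - of_int l\<bar>)"
    by (simp add: prod.union_disjoint)
  also have "(\<Prod>l\<in>{- int K..k-1}. \<bar>real_of_int k - of_int l\<bar>) = (\<Prod>i=1..nat (int K + k). real i)"
    by (rule prod.reindex_bij_witness[of _ "\<lambda>i. k - int i" "\<lambda>l. nat (k - l)"]) auto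
  also have "(\<Prod>l\<in>{k+1..int K}. \<bar>real_of_int k - of_int l\<bar>) = (\<Prod>i=1..nat (int K - k). real i)"
    by (rule prod.reindex_bij_witness[of _ "\<lambda>i. k + int i" "\<lambda>l. nat (l - k)"]) auto
  finally show ?thesis by (simp add: fact_prod)
qed

lemma prod_lattice_row_ge:
  assumes k: "k \<in> nonzero_ints K"
  shows "(\<Prod>l\<in>nonzero_ints K-{k}. \<bar>real_of_int l\<bar>) \<le> (\<Prod>l\<in>nonzero_ints K-{k}. \<bar>real_of_int k - of_int l\<bar>)"
proof -
  have k_pos: "\<bar>real_of_int k\<bar> > 0" and k_le: "\<bar>k\<bar> \<le> int K" using k by (auto simp: mem_nonzero_ints)
  have "\<bar>real_of_int k\<bar> * (\<Prod>l\<in>nonzero_ints K-{k}. \<bar>real_of_int l\<bar>) = (fact K)\<^sup>2"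
    using k finite_nonzero_ints by (simp add: prod.remove flip: prod_abs_nonzero_ints)
  also have "\<dots> \<le> fact (nat (int K + k)) * fact (nat (int K - k))"
  proof (cases "k \<ge> 0")
    case True
    then have "nat (int K + k) = K + nat k" "nat (int K - k) = K - nat k" "nat k \<le> K" using k_le by auto
    then show ?thesis using fact_square_le[of "nat k" K] by simp
  next
    case False
    then have "nat (int K + k) = K - nat (-k)" "nat (int K - k) = K + nat (-k)" "nat (-k) \<le> K"
      using k_le by auto
    then show ?thesis using fact_square_le[of "nat (-k)" K] by (simp add: mult.commute)
  qed
  also have "\<dots> = (\<Prod>l\<in>{- int K..int K}-{k}. \<bar>real_of_int k - of_int l\<bar>)"
    by (rule prod_lattice_differences[symmetric, OF k_le])
  also have "{- int K..int K}-{k} = insert 0 (nonzero_ints K - {k})"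
    using k by (auto simp: nonzero_ints_def)
  also have "(\<Prod>l\<in>\<dots>. \<bar>real_of_int k - of_int l\<bar>)
      = \<bar>real_of_int k\<bar> * (\<Prod>l\<in>nonzero_ints K-{k}. \<bar>real_of_int k - of_int l\<bar>)"
    using finite_nonzero_ints by (simp add: mem_nonzero_ints)
  finally show ?thesis using k_pos by simp
qed

lemma prod_shift_ratio_ints_le:
  fixes Y :: "int \<Rightarrow> real" and K E :: nat
  assumes close: "\<And>k. k \<in> nonzero_ints K \<Longrightarrow> \<bar>Y k - of_int k\<bar> \<le> real E" and E: "E \<ge> 1"
    and S: "S \<subseteq> nonzero_ints K"
  shows "(\<Prod>k\<in>S. \<bar>Y k\<bar>) \<le> ((exp 1 * (real (K + E) / real E)) ^ E)\<^sup>2 * (\<Prod>k\<in>S. \<bar>real_of_int k\<bar>)"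
proof -
  let ?r = "\<lambda>k::int. (\<bar>real_of_int k\<bar> + real E) / \<bar>real_of_int k\<bar>"
  have "(\<Prod>k\<in>S. \<bar>Y k\<bar>) \<le> (\<Prod>k\<in>S. ?r k * \<bar>real_of_int k\<bar>)"
  proof (rule prod_mono, safe)
    fix k assume "k \<in> S"
    then have "k \<in> nonzero_ints K" "k \<noteq> 0" using S by (auto simp: mem_nonzero_ints)
    then show "\<bar>Y k\<bar> \<le> ?r k * \<bar>real_of_int k\<bar>" using close[of k] by simp
  qed auto
  also have "\<dots> = (\<Prod>k\<in>S. ?r k) * (\<Prod>k\<in>S. \<bar>real_of_int k\<bar>)" by (rule prod.distrib)
  also have "(\<Prod>k\<in>S. ?r k) \<le> (\<Prod>k\<in>nonzero_ints K. ?r k)"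
    by (rule prod_mono2[OF finite_nonzero_ints S]) (auto simp: mem_nonzero_ints)
  also have "\<dots> = (\<Prod>k=1..K. (real k + real E) / real k)\<^sup>2"
    unfolding prod_nonzero_ints by (simp only: power2_eq_square prod.distrib) simp
  also have "\<dots> \<le> ((exp 1 * (real (K + E) / real E)) ^ E)\<^sup>2"
    by (intro power_mono prod_shift_ratio_le E prod_nonneg) auto
  finally show ?thesis by (simp add: mult_right_mono prod_nonneg)
qed

lemma card_int_near:
  fixes x :: real and D :: nat
  shows "finite {k::int. \<bar>x - of_int k\<bar> < real D}" "card {k::int. \<bar>x - of_int k\<bar> < real D} \<le> 2 * D + 1"
proof -
  have sub: "{k::int. \<bar>x - of_int k\<bar> < real D} \<subseteq> {\<lfloor>x\<rfloor> - int D..\<lfloor>x\<rfloor> + int D}"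
    by (auto simp: abs_less_iff) linarith+
  then show "finite {k::int. \<bar>x - of_int k\<bar> < real D}" by (rule finite_subset) simp
  show "card {k::int. \<bar>x - of_int k\<bar> < real D} \<le> 2 * D + 1"
    using card_mono[OF _ sub] by simp
qed

lemma prod_two_valued_ge:
  fixes \<alpha> \<beta> :: real
  assumes fin: "finite J" and \<alpha>: "0 \<le> \<alpha>" "\<alpha> \<le> 1" and \<beta>: "0 \<le> \<beta>" "\<beta> \<le> 1"
    and card_P: "card {k\<in>J. P k} \<le> p" and card_J: "card J \<le> q"
  shows "\<alpha> ^ p * \<beta> ^ q \<le> (\<Prod>k\<in>J. if P k then \<alpha> else \<beta>)"
proof -
  have "(\<Prod>k\<in>J. if P k then \<alpha> else \<beta>) = (\<Prod>k\<in>{k\<in>J. P k}. \<alpha>) * (\<Prod>k\<in>{k\<in>J. \<not> P k}. \<beta>)"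
    using fin by (simp add: prod.If_cases Int_def)
  also have "\<dots> = \<alpha> ^ card {k\<in>J. P k} * \<beta> ^ card {k\<in>J. \<not> P k}" by simp
  also have "\<dots> \<ge> \<alpha> ^ p * \<beta> ^ q"
  proof (intro mult_mono power_decreasing)
    show "card {k\<in>J. \<not> P k} \<le> q" using card_mono[OF fin, of "{k\<in>J. \<not> P k}"] card_J by auto
  qed (use \<alpha> \<beta> card_P in auto)
  finally show ?thesis .
qed

lemma prod_ge_of_few_near:
  fixes u v :: "'a \<Rightarrow> real"
  assumes fin: "finite J" and card_J: "card J \<le> q" and few_near: "card {k\<in>J. u k < D} \<le> p"
    and u_nonneg: "\<And>k. k \<in> J \<Longrightarrow> 0 \<le> u k"
    and near: "\<And>k. k \<in> J \<Longrightarrow> u k < D \<Longrightarrow> g \<le> v k" and far: "\<And>k. k \<in> J \<Longrightarrow> u k - e \<le> v k"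
    and g: "0 < g" "g \<le> D" and e: "0 \<le> e" "e \<le> D"
  shows "(g / D) ^ p * (1 - e / D) ^ q * (\<Prod>k\<in>J. u k) \<le> (\<Prod>k\<in>J. v k)"
proof -
  let ?\<rho> = "\<lambda>k. if u k < D then g / D else 1 - e / D"
  have D: "D > 0" using g by linarith
  have "(g / D) ^ p * (1 - e / D) ^ q \<le> (\<Prod>k\<in>J. ?\<rho> k)"
    by (rule prod_two_valued_ge[OF fin _ _ _ _ few_near card_J]) (use g e D in auto)
  then have "(g / D) ^ p * (1 - e / D) ^ q * (\<Prod>k\<in>J. u k) \<le> (\<Prod>k\<in>J. ?\<rho> k) * (\<Prod>k\<in>J. u k)"
    by (intro mult_right_mono prod_nonneg u_nonneg)
  also have "\<dots> = (\<Prod>k\<in>J. ?\<rho> k * u k)" by (rule prod.distrib[symmetric])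
  also have "\<dots> \<le> (\<Prod>k\<in>J. v k)"
  proof (rule prod_mono, intro conjI)
    fix k assume k: "k \<in> J"
    show "?\<rho> k * u k \<le> v k"
    proof (cases "u k < D")
      case True
      then have "g / D * u k \<le> g / D * D" using g D by (intro mult_left_mono) auto
      then show ?thesis using near[OF k True] True D by simp
    next
      case False
      then have "e * 1 \<le> e * (u k / D)" using e D by (intro mult_left_mono) (auto simp: field_simps)
      then show ?thesis using far[OF k] False by (simp add: algebra_simps)
    qed
    show "0 \<le> ?\<rho> k * u k" using u_nonneg[OF k] g e D by simp
  qed
  finally show ?thesis .
qed

lemma perturbed_lattice_prod_ge:
  fixes Y :: "int \<Rightarrow> real" and z :: complex and K D :: nat
  assumes close: "\<And>k. k \<in> nonzero_ints K \<Longrightarrow> \<bar>Y k - of_int k\<bar> \<le> E"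
    and sep: "\<And>k. k \<in> nonzero_ints K \<Longrightarrow> g \<le> norm (z - of_real (Y k))"
    and g: "0 < g" "g \<le> real D" and E: "0 \<le> E" "E \<le> real D"
  shows "(g / real D) ^ (2*D+1) * (1 - E / real D) ^ (2*K) * (\<Prod>k\<in>nonzero_ints K. norm (z - of_int k))
      \<le> (\<Prod>k\<in>nonzero_ints K. norm (z - of_real (Y k)))"
proof (rule prod_ge_of_few_near)
  have "\<bar>Re z - of_int k\<bar> \<le> norm (z - of_int k)" for k
    using abs_Re_le_cmod[of "z - of_int k"] by simp
  then have "{k\<in>nonzero_ints K. norm (z - of_int k) < real D} \<subseteq> {k. \<bar>Re z - of_int k\<bar> < real D}"
    using le_less_trans by blast
  then have "card {k\<in>nonzero_ints K. norm (z - of_int k) < real D} \<le> card {k. \<bar>Re z - of_int k\<bar> < real D}"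
    by (intro card_mono card_int_near(1))
  then show "card {k\<in>nonzero_ints K. norm (z - of_int k) < real D} \<le> 2 * D + 1"
    using card_int_near(2)[of "Re z" D] by linarith
  fix k assume k: "k \<in> nonzero_ints K"
  have "norm (z - of_int k) \<le> norm (z - of_real (Y k)) + norm (of_real (Y k) - of_int k :: complex)"
    by norm
  moreover have "norm (of_real (Y k) - of_int k :: complex) = \<bar>Y k - of_int k\<bar>"
    by (metis norm_of_real of_real_diff of_real_of_int_eq)
  ultimately show "norm (z - of_int k) - E \<le> norm (z - of_real (Y k))" using close[OF k] by linarith
qed (use sep g E card_nonzero_ints finite_nonzero_ints in auto)

lemma perturbed_lattice_row_ge:
  fixes Y :: "int \<Rightarrow> real" and K D :: nat and k :: int
  defines "J \<equiv> nonzero_ints K"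
  assumes k: "k \<in> J" and close: "\<And>l. l \<in> J \<Longrightarrow> \<bar>Y l - of_int l\<bar> \<le> E" and F: "F \<subseteq> J"
    and sep: "\<And>l. l \<in> J - F \<Longrightarrow> l \<noteq> k \<Longrightarrow> g \<le> \<bar>Y k - Y l\<bar>"
    and near: "exp (- \<tau>) \<le> (\<Prod>l\<in>{l\<in>F-{k}. \<bar>real_of_int k - of_int l\<bar> < real D}. \<bar>Y k - Y l\<bar> / real D)"
    and g: "0 < g" "g \<le> real D" and E: "0 \<le> E" "2 * E \<le> real D"
  shows "exp (- \<tau>) * ((g / real D) ^ (2*D+1) * (1 - 2 * E / real D) ^ (2*K)) * (\<Prod>l\<in>J-{k}. \<bar>real_of_int k - of_int l\<bar>)
      \<le> (\<Prod>l\<in>J-{k}. \<bar>Y k - Y l\<bar>)"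
proof -
  let ?near = "\<lambda>l. l \<in> F \<and> \<bar>real_of_int k - of_int l\<bar> < real D"
  let ?\<sigma> = "\<lambda>l. if ?near l then \<bar>Y k - Y l\<bar> / real D else 1"
  let ?v = "\<lambda>l. if ?near l then real D else \<bar>Y k - Y l\<bar>"
  let ?q = "(g / real D) ^ (2*D+1) * (1 - 2 * E / real D) ^ (2*K)"
  have D: "real D > 0" using g by linarith
  have fin: "finite (J - {k})" by (simp add: J_def finite_nonzero_ints)
  have "{l\<in>F-{k}. \<bar>real_of_int k - of_int l\<bar> < real D} = {l\<in>J-{k}. ?near l}" using F by auto
  then have near_factors: "exp (- \<tau>) \<le> (\<Prod>l\<in>J-{k}. ?\<sigma> l)"
    using near by (simp only: prod.inter_filter[OF fin])
  have other_factors: "?q * (\<Prod>l\<in>J-{k}. \<bar>real_of_int k - of_int l\<bar>) \<le> (\<Prod>l\<in>J-{k}. ?v l)"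
  proof (rule prod_ge_of_few_near[OF fin])
    have "card {l\<in>J-{k}. \<bar>real_of_int k - of_int l\<bar> < real D} \<le> card {l. \<bar>real_of_int k - of_int l\<bar> < real D}"
      by (rule card_mono) (use card_int_near(1) in auto)
    then show "card {l\<in>J-{k}. \<bar>real_of_int k - of_int l\<bar> < real D} \<le> 2 * D + 1"
      using card_int_near(2)[of "of_int k" D] by linarith
    show "card (J - {k}) \<le> 2 * K"
      using card_Diff1_le[of J k] card_nonzero_ints[of K] by (simp add: J_def)
    show "\<bar>real_of_int k - of_int l\<bar> - 2 * E \<le> ?v l" if "l \<in> J - {k}" for l
      using close[OF k] close[of l] that E by auto
    show "g \<le> ?v l" if "l \<in> J - {k}" "\<bar>real_of_int k - of_int l\<bar> < real D" for l
      using that sep[of l] g by auto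
  qed (use g E in auto)
  have "exp (- \<tau>) * (?q * (\<Prod>l\<in>J-{k}. \<bar>real_of_int k - of_int l\<bar>)) \<le> (\<Prod>l\<in>J-{k}. ?\<sigma> l) * (\<Prod>l\<in>J-{k}. ?v l)"
  proof (rule mult_mono[OF near_factors other_factors])
    show "0 \<le> (\<Prod>l\<in>J-{k}. ?\<sigma> l)" using D by (intro prod_nonneg) auto
    show "0 \<le> ?q * (\<Prod>l\<in>J-{k}. \<bar>real_of_int k - of_int l\<bar>)"
      using g E D by (intro mult_nonneg_nonneg zero_le_power prod_nonneg) (auto simp: divide_le_eq)
  qed
  also have "\<dots> = (\<Prod>l\<in>J-{k}. \<bar>Y k - Y l\<bar>)"
    unfolding prod.distrib[symmetric] using D by (intro prod.cong) auto
  finally show ?thesis by (simp only: mult.assoc)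
qed

section \<open>Interpolation with nodes in a window and lattice points outside\<close>

text \<open>Sites up to \<open>half_window\<close> carry the nodes at which a function is controlled, the lattice continues
  them up to \<open>extent\<close>, and pairs of sites closer than \<open>near_range\<close> are not compared with the lattice.
  Separating these scales by powers of \<open>A\<close> makes every error a factor \<open>exp (O(loss))\<close>, where \<open>loss\<close> is
  a small fraction of the number of nodes.\<close>

locale interpolation_scale =
  fixes N A :: nat
  assumes N: "N \<ge> 1" and A: "A \<ge> 4"
begin

definition half_window :: nat where "half_window = A ^ 4 * N"
definition near_range :: nat where "near_range = A ^ 2 * N"
definition extent :: nat where "extent = A * half_window"
definition loss :: real where "loss = real half_window / real A"
definition radius :: real where "radius = real half_window - real N + 1/2"
definition inner_sites :: "int set" where
  "inner_sites = {k\<in>nonzero_ints extent. \<bar>k\<bar> \<le> int half_window - 2 * int N}"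

lemma real_A_ge: "real A \<ge> 4" and real_N_ge: "real N \<ge> 1"
  using A N by auto

lemma real_half_window: "real half_window = real A ^ 4 * real N"
  by (simp add: half_window_def)

lemma real_near_range: "real near_range = real A ^ 2 * real N"
  by (simp add: near_range_def)

lemma real_extent: "real extent = real A * real half_window"
  by (simp add: extent_def)

lemma loss_eq: "loss = real A ^ 3 * real N"
  using A by (simp add: loss_def half_window_def power_eq_if)

lemma A_power_ge: "4 ^ i \<le> real A ^ i"
  using power_mono[OF real_A_ge, of i] by simp

lemma half_window_ge: "256 * real N \<le> real half_window"
  using A_power_ge[of 4] real_N_ge by (simp add: real_half_window)

lemma near_range_ge: "16 * real N \<le> real near_range"
  using A_power_ge[of 2] real_N_ge by (simp add: real_near_range)

lemma loss_nonneg: "0 \<le> loss"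
  by (simp add: loss_def)

lemma radius_pos: "0 < radius" and radius_le: "radius \<le> real half_window"
  using half_window_ge real_N_ge by (auto simp: radius_def)

lemma half_window_le_extent: "half_window \<le> extent"
  using A by (simp add: extent_def)

lemma inner_subset: "inner_sites \<subseteq> nonzero_ints extent"
  by (auto simp: inner_sites_def)

lemma finite_inner: "finite inner_sites"
  using inner_subset finite_nonzero_ints by (rule finite_subset)

lemma inner_eq: "inner_sites = {k. k \<noteq> 0 \<and> \<bar>k\<bar> \<le> int half_window - 2 * int N}"
  using half_window_le_extent by (auto simp: inner_sites_def mem_nonzero_ints)

lemma card_inner_le: "card inner_sites \<le> 2 * half_window"
proof -
  have "inner_sites \<subseteq> nonzero_ints half_window" by (auto simp: inner_sites_def mem_nonzero_ints)
  from card_mono[OF finite_nonzero_ints this] show ?thesis by (simp add: card_nonzero_ints)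
qed

lemma exp_neg_loss_le_near: "exp (- 6 * loss) \<le> (1 / real A ^ 2) ^ (2 * near_range + 1)"
proof -
  have A_pos: "real A > 0" using A by simp
  have "real (2 * near_range + 1) * ln (real A ^ 2) \<le> (3 * real near_range) * (2 * real A)"
  proof (rule mult_mono)
    show "ln (real A ^ 2) \<le> 2 * real A"
      using ln_le_minus_one[OF A_pos] A_pos by (simp add: ln_realpow)
    show "real (2 * near_range + 1) \<le> 3 * real near_range"
      using near_range_ge real_N_ge by simp
    show "0 \<le> ln (real A ^ 2)" using A_power_ge[of 2] by simp
  qed simp
  also have "\<dots> = 6 * loss" by (simp add: loss_eq near_range_def power2_eq_square power3_eq_cube)
  finally have "- 6 * loss \<le> real (2 * near_range + 1) * ln (1 / real A ^ 2)"
    using A_pos by (simp add: ln_div)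
  then have "exp (- 6 * loss) \<le> exp (real (2 * near_range + 1) * ln (1 / real A ^ 2))"
    by (simp only: exp_le_cancel_iff)
  also have "\<dots> = (1 / real A ^ 2) ^ (2 * near_range + 1)"
    unfolding exp_of_nat_mult using A_pos by (subst exp_ln) auto
  finally show ?thesis .
qed

lemma exp_neg_loss_le_far: "exp (- 16 * loss) \<le> (1 - 4 / real A ^ 2) ^ (2 * extent)"
proof -
  define x where "x = 4 / real A ^ 2"
  have x: "0 \<le> x" "x \<le> 1/2" using A_power_ge[of 2] A by (auto simp: x_def field_simps)
  have "1 \<le> (1 - x) * (1 + 2 * x)"
    using mult_nonneg_nonneg[of x "1 - 2 * x"] x by (simp add: algebra_simps)
  also have "\<dots> \<le> (1 - x) * exp (2 * x)" using x by (intro mult_left_mono exp_ge_add_one_self) auto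
  finally have "exp (- (2 * x)) \<le> 1 - x" by (simp add: exp_minus field_simps)
  then have "exp (- (2 * x)) ^ (2 * extent) \<le> (1 - x) ^ (2 * extent)" by (rule power_mono) simp
  also have "exp (- (2 * x)) ^ (2 * extent) = exp (real (2 * extent) * (- (2 * x)))"
    by (simp only: exp_of_nat_mult)
  also have "real (2 * extent) * (- (2 * x)) = - 16 * loss"
    using A by (simp add: real_extent x_def loss_def power2_eq_square)
  finally show ?thesis by (simp add: x_def)
qed

lemma exp_neg_loss_le:
  "exp (- 22 * loss) \<le> (1 / real A ^ 2) ^ (2 * near_range + 1) * (1 - 4 / real A ^ 2) ^ (2 * extent)"
proof -
  have "exp (- 22 * loss) = exp (- 6 * loss) * exp (- 16 * loss)"
    unfolding exp_add[symmetric] by simp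
  also have "\<dots> \<le> (1 / real A ^ 2) ^ (2 * near_range + 1) * (1 - 4 / real A ^ 2) ^ (2 * extent)"
    by (intro mult_mono exp_neg_loss_le_near exp_neg_loss_le_far) auto
  finally show ?thesis .
qed

lemma shift_ratio_le_exp_loss:
  "((exp 1 * (real (extent + 2 * N) / real (2 * N))) ^ (2 * N))\<^sup>2 \<le> exp (6 * loss)"
proof -
  have A_pos: "real A > 0" and N_pos: "real N > 0" using A N by auto
  have "real (extent + 2 * N) / real (2 * N) = real A ^ 5 / 2 + 1"
    using N_pos by (simp add: real_extent half_window_def field_simps power_eq_if)
  also have "\<dots> \<le> real A ^ 5"
    using A_power_ge[of 5] by simp
  finally have "exp 1 * (real (extent + 2 * N) / real (2 * N)) \<le> exp 1 * real A ^ 5"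
    by (rule mult_left_mono) simp
  also have "\<dots> = exp (1 + 5 * ln (real A))"
    using A_pos exp_of_nat_mult[of 5 "ln (real A)"] by (simp add: exp_add)
  also have "\<dots> \<le> exp (6 * real A)" using ln_le_minus_one[OF A_pos] A_pos by simp
  finally have "(exp 1 * (real (extent + 2 * N) / real (2 * N))) ^ (2 * N) \<le> exp (6 * real A) ^ (2 * N)"
    by (intro power_mono) auto
  also have "\<dots> = exp (real (2 * N) * (6 * real A))" by (simp only: exp_of_nat_mult)
  finally have "((exp 1 * (real (extent + 2 * N) / real (2 * N))) ^ (2 * N))\<^sup>2
      \<le> (exp (real (2 * N) * (6 * real A)))\<^sup>2"
    by (intro power_mono) auto
  also have "\<dots> = exp (24 * (real A * real N))" by (simp flip: exp_double)
  also have "24 * (real A * real N) \<le> 6 * loss"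
  proof -
    have "4 * real A \<le> real A ^ 3"
      using mult_right_mono[OF A_power_ge[of 2], of "real A"] by (simp add: power_eq_if)
    then show ?thesis using N_pos by (simp add: loss_eq)
  qed
  finally show ?thesis by simp
qed

lemma exp_radius_sq_le: "exp (radius\<^sup>2 / real extent) \<le> exp loss"
proof -
  have "real A > 0" "real half_window > 0" using A half_window_ge real_N_ge by auto
  moreover have "radius\<^sup>2 \<le> (real half_window)\<^sup>2"
    using radius_le radius_pos by (intro power_mono) auto
  ultimately show ?thesis by (simp add: real_extent loss_def field_simps power2_eq_square)
qed

end

locale perturbed_lattice = interpolation_scale +
  fixes Y :: "int \<Rightarrow> real"
  assumes inj: "inj_on Y (nonzero_ints extent)"
    and nonzero: "k \<in> nonzero_ints extent \<Longrightarrow> Y k \<noteq> 0"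
    and close: "k \<in> nonzero_ints extent \<Longrightarrow> \<bar>Y k - of_int k\<bar> \<le> 2 * real N"
    and inner_le: "k \<in> inner_sites \<Longrightarrow> \<bar>Y k\<bar> \<le> real half_window - 2 * real N"
    and outer_ge: "k \<in> nonzero_ints extent - inner_sites \<Longrightarrow> real half_window + 1 \<le> \<bar>Y k\<bar>"
begin

definition nodes :: "complex set" where
  "nodes = (\<lambda>k. complex_of_real (Y k)) ` nonzero_ints extent"

lemma inj_complex: "inj_on (\<lambda>k. complex_of_real (Y k)) (nonzero_ints extent)"
  using inj by (auto simp: inj_on_def)

lemma finite_nodes: "finite nodes"
  by (simp add: nodes_def finite_nonzero_ints)

lemma node_far_from_circle:
  fixes z :: complex
  assumes z: "norm z = radius" and k: "k \<in> nonzero_ints extent"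
  shows "real N \<le> norm (z - of_real (Y k))"
proof -
  have "\<bar>radius - \<bar>Y k\<bar>\<bar> \<le> norm (z - of_real (Y k))"
    using norm_triangle_ineq3[of z "of_real (Y k)"] z by simp
  then show ?thesis
    using inner_le[of k] outer_ge[of k] k by (cases "k \<in> inner_sites") (auto simp: radius_def)
qed

lemma nodes_in_disc: "{y\<in>nodes. norm y < radius} = (\<lambda>k. complex_of_real (Y k)) ` inner_sites"
proof -
  have "\<bar>Y k\<bar> < radius \<longleftrightarrow> k \<in> inner_sites" if "k \<in> nonzero_ints extent" for k
    using inner_le[of k] outer_ge[of k] that real_N_ge by (cases "k \<in> inner_sites") (auto simp: radius_def)
  then show ?thesis using inner_subset by (auto simp: nodes_def)
qed

lemma prod_nodes_circle_ge:
  assumes z: "norm z = radius"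
  shows "exp (- 22 * loss) * ((fact extent)\<^sup>2 * exp (pi * \<bar>Im z\<bar>) / (10 * pi * radius * exp loss))
      \<le> norm (\<Prod>y\<in>nodes. z - y)"
proof -
  let ?q = "(real N / real near_range) ^ (2 * near_range + 1)
      * (1 - 2 * real N / real near_range) ^ (2 * extent)"
  have ratio: "real N / real near_range = 1 / real A ^ 2"
    using real_N_ge by (simp add: near_range_def)
  have far_nonneg: "0 \<le> 1 - 4 / real A ^ 2" using A_power_ge[of 2] A by (simp add: field_simps)
  have "4 / real A ^ 2 \<ge> 2 / real A ^ 2" by (intro divide_right_mono) auto
  then have "(1 / real A ^ 2) ^ (2 * near_range + 1) * (1 - 4 / real A ^ 2) ^ (2 * extent) \<le> ?q"
    unfolding ratio times_divide_eq_right[symmetric] using far_nonneg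
    by (intro mult_left_mono power_mono) auto
  then have loss_q: "exp (- 22 * loss) \<le> ?q" using exp_neg_loss_le by linarith
  have z_half: "norm z = real (half_window - N) + 1/2"
    using z half_window_ge real_N_ge by (simp add: radius_def of_nat_diff)
  have extent_pos: "1 \<le> extent" using half_window_le_extent half_window_ge real_N_ge by linarith
  have "(fact extent)\<^sup>2 * exp (pi * \<bar>Im z\<bar>) / (10 * pi * radius * exp loss)
      \<le> (fact extent)\<^sup>2 * exp (pi * \<bar>Im z\<bar>) / (10 * pi * radius * exp (radius\<^sup>2 / real extent))"
    using radius_pos exp_radius_sq_le by (intro divide_left_mono mult_left_mono mult_pos_pos) auto
  also have "\<dots> \<le> (\<Prod>k\<in>nonzero_ints extent. norm (z - of_int k))"
    using prod_lattice_half_integer_circle_ge[OF z_half extent_pos] z by simp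
  finally have "exp (- 22 * loss) * ((fact extent)\<^sup>2 * exp (pi * \<bar>Im z\<bar>) / (10 * pi * radius * exp loss))
      \<le> ?q * (\<Prod>k\<in>nonzero_ints extent. norm (z - of_int k))"
    using loss_q order.trans[OF exp_ge_zero loss_q] radius_pos by (intro mult_mono) auto
  also have "\<dots> \<le> (\<Prod>k\<in>nonzero_ints extent. norm (z - of_real (Y k)))"
    by (rule perturbed_lattice_prod_ge)
      (use close node_far_from_circle[OF z] near_range_ge real_N_ge in auto)
  also have "\<dots> = norm (\<Prod>y\<in>nodes. z - y)"
    unfolding nodes_def prod.reindex[OF inj_complex] by (simp add: prod_norm)
  finally show ?thesis .
qed

lemma prod_abs_le_exp_loss:
  assumes S: "S \<subseteq> nonzero_ints extent"
  shows "(\<Prod>k\<in>S. \<bar>Y k\<bar>) \<le> exp (6 * loss) * (\<Prod>k\<in>S. \<bar>real_of_int k\<bar>)"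
proof -
  have "(\<Prod>k\<in>S. \<bar>Y k\<bar>)
      \<le> ((exp 1 * (real (extent + 2 * N) / real (2 * N))) ^ (2 * N))\<^sup>2 * (\<Prod>k\<in>S. \<bar>real_of_int k\<bar>)"
    by (rule prod_shift_ratio_ints_le[OF _ _ S]) (use close N in auto)
  also have "\<dots> \<le> exp (6 * loss) * (\<Prod>k\<in>S. \<bar>real_of_int k\<bar>)"
    by (intro mult_right_mono shift_ratio_le_exp_loss prod_nonneg) auto
  finally show ?thesis .
qed

lemma prod_norm_nodes_le: "(\<Prod>y\<in>nodes. norm y) \<le> exp (6 * loss) * (fact extent)\<^sup>2"
  unfolding nodes_def prod.reindex[OF inj_complex]
  using prod_abs_le_exp_loss[OF subset_refl] by (simp add: prod_abs_nonzero_ints)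

definition separated_at :: "real \<Rightarrow> int \<Rightarrow> bool" where
  "separated_at \<tau> k \<longleftrightarrow> exp (- \<tau>) \<le>
     (\<Prod>l\<in>{l\<in>inner_sites-{k}. \<bar>real_of_int k - of_int l\<bar> < real near_range}. \<bar>Y k - Y l\<bar> / real near_range)"

lemma row_product_ge:
  assumes k: "k \<in> inner_sites" and near: "separated_at \<tau> k"
  shows "exp (- \<tau>) * exp (- 22 * loss) * (\<Prod>l\<in>nonzero_ints extent-{k}. \<bar>real_of_int l\<bar>)
      \<le> (\<Prod>l\<in>nonzero_ints extent-{k}. \<bar>Y k - Y l\<bar>)"
proof -
  let ?J = "nonzero_ints extent"
  let ?q = "(real N / real near_range) ^ (2 * near_range + 1)
      * (1 - 2 * (2 * real N) / real near_range) ^ (2 * extent)"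
  have kJ: "k \<in> ?J" using k inner_subset by auto
  have q_eq: "?q = (1 / real A ^ 2) ^ (2 * near_range + 1) * (1 - 4 / real A ^ 2) ^ (2 * extent)"
    using real_N_ge by (simp add: near_range_def)
  have "exp (- 22 * loss) \<le> ?q" unfolding q_eq by (rule exp_neg_loss_le)
  then have "exp (- \<tau>) * exp (- 22 * loss) * (\<Prod>l\<in>?J-{k}. \<bar>real_of_int l\<bar>)
      \<le> exp (- \<tau>) * ?q * (\<Prod>l\<in>?J-{k}. \<bar>real_of_int k - of_int l\<bar>)"
    by (intro mult_mono mult_left_mono prod_lattice_row_ge kJ)
      (auto intro!: prod_nonneg mult_nonneg_nonneg elim: order.trans[OF exp_ge_zero])
  also have "\<dots> \<le> (\<Prod>l\<in>?J-{k}. \<bar>Y k - Y l\<bar>)"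
  proof (rule perturbed_lattice_row_ge[OF kJ _ inner_subset])
    show "real N \<le> \<bar>Y k - Y l\<bar>" if "l \<in> ?J - inner_sites" for l
      using outer_ge[OF that] inner_le[OF k] real_N_ge by linarith
    show "exp (- \<tau>) \<le> (\<Prod>l\<in>{l\<in>inner_sites-{k}. \<bar>real_of_int k - of_int l\<bar> < real near_range}. \<bar>Y k - Y l\<bar> / real near_range)"
      using near by (simp add: separated_at_def)
  qed (use close near_range_ge real_N_ge in auto)
  finally show ?thesis .
qed

lemma row_ratio_le:
  assumes k: "k \<in> inner_sites" and near: "separated_at \<tau> k"
  shows "(\<Prod>w\<in>nodes-{of_real (Y k)}. norm w / norm (of_real (Y k) - w)) \<le> exp (28 * loss + \<tau>)"
proof -
  let ?J = "nonzero_ints extent"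
  let ?T = "\<Prod>l\<in>?J-{k}. \<bar>real_of_int l\<bar>"
  have kJ: "k \<in> ?J" using k inner_subset by auto
  have T_pos: "?T > 0" by (intro prod_pos) (auto simp: mem_nonzero_ints)
  have "nodes - {of_real (Y k)} = (\<lambda>l. complex_of_real (Y l)) ` (?J - {k})"
    using kJ inj_complex by (auto simp: nodes_def inj_on_def)
  moreover have "inj_on (\<lambda>l. complex_of_real (Y l)) (?J - {k})" using inj_complex by (rule inj_on_subset) auto
  ultimately have "(\<Prod>w\<in>nodes-{of_real (Y k)}. norm w / norm (of_real (Y k) - w))
      = (\<Prod>l\<in>?J-{k}. \<bar>Y l\<bar> / \<bar>Y k - Y l\<bar>)"
    by (simp add: prod.reindex flip: of_real_diff)
  also have "\<dots> = (\<Prod>l\<in>?J-{k}. \<bar>Y l\<bar>) / (\<Prod>l\<in>?J-{k}. \<bar>Y k - Y l\<bar>)" by (rule prod_dividef)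
  also have "\<dots> \<le> (exp (6 * loss) * ?T) / (exp (- \<tau>) * exp (- 22 * loss) * ?T)"
    by (rule frac_le[OF _ prod_abs_le_exp_loss _ row_product_ge[OF k near]]) (use T_pos in auto)
  also have "\<dots> = exp (6 * loss) / (exp (- \<tau>) * exp (- 22 * loss))" using T_pos by simp
  also have "\<dots> = exp (28 * loss + \<tau>)"
    unfolding exp_add[symmetric] exp_diff[symmetric] by simp
  finally show ?thesis .
qed

theorem norm_at_zero_le:
  fixes G :: "complex \<Rightarrow> complex"
  assumes holo: "G holomorphic_on UNIV" and B: "B \<ge> 0" and U: "U \<ge> 0"
    and circle: "\<And>z. norm z = radius \<Longrightarrow> norm (G z) \<le> B * exp (pi * \<bar>Im z\<bar>)"
    and at_nodes: "\<And>k. k \<in> inner_sites \<Longrightarrow> norm (G (of_real (Y k))) \<le> U"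
    and near: "\<And>k. k \<in> inner_sites \<Longrightarrow> separated_at \<tau> k"
  shows "norm (G 0) \<le> 10 * pi * real half_window * exp (29 * loss) * B
     + 2 * real half_window * exp (28 * loss + \<tau>) * U"
proof -
  define C where "C = B * (10 * pi * radius * exp loss) / (exp (- 22 * loss) * (fact extent)\<^sup>2)"
  have C_nonneg: "C \<ge> 0" unfolding C_def using B radius_pos by simp
  have circle_C: "norm (G z) \<le> C * norm (\<Prod>y\<in>nodes. z - y)" if z: "norm z = radius" for z
  proof -
    have "B * exp (pi * \<bar>Im z\<bar>)
        = C * (exp (- 22 * loss) * ((fact extent)\<^sup>2 * exp (pi * \<bar>Im z\<bar>) / (10 * pi * radius * exp loss)))"
      unfolding C_def using radius_pos by simp
    also have "\<dots> \<le> C * norm (\<Prod>y\<in>nodes. z - y)"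
      by (rule mult_left_mono[OF prod_nodes_circle_ge[OF z] C_nonneg])
    finally show ?thesis using circle[OF z] by linarith
  qed
  have off_circle: "norm y \<noteq> radius" if "y \<in> nodes" for y
    using that node_far_from_circle[of y] real_N_ge by (force simp: nodes_def)
  have "(\<Prod>y\<in>nodes. norm y) * C \<le> exp (6 * loss) * (fact extent)\<^sup>2 * C"
    using prod_norm_nodes_le C_nonneg by (rule mult_right_mono)
  also have "\<dots> = 10 * pi * radius * (exp (6 * loss) * exp loss / exp (- 22 * loss)) * B"
    unfolding C_def by simp
  also have "exp (6 * loss) * exp loss / exp (- 22 * loss) = exp (29 * loss)"
    unfolding exp_add[symmetric] exp_diff[symmetric] by simp
  also have "10 * pi * radius * exp (29 * loss) * B \<le> 10 * pi * real half_window * exp (29 * loss) * B"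
    using radius_le B by (intro mult_right_mono mult_left_mono) auto
  finally have integral_term: "(\<Prod>y\<in>nodes. norm y) * C \<le> 10 * pi * real half_window * exp (29 * loss) * B" .
  have "(\<Sum>y\<in>{y\<in>nodes. norm y < radius}. norm (G y) * (\<Prod>w\<in>nodes-{y}. norm w / norm (y - w)))
      = (\<Sum>k\<in>inner_sites. norm (G (of_real (Y k))) * (\<Prod>w\<in>nodes-{of_real (Y k)}. norm w / norm (of_real (Y k) - w)))"
    unfolding nodes_in_disc using sum.reindex[OF inj_on_subset[OF inj_complex inner_subset]] by simp
  also have "\<dots> \<le> (\<Sum>k\<in>inner_sites. U * exp (28 * loss + \<tau>))"
    by (intro sum_mono mult_mono at_nodes row_ratio_le near U prod_nonneg) auto
  also have "\<dots> \<le> real (2 * half_window) * (U * exp (28 * loss + \<tau>))"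
    using card_inner_le U by (simp only: sum_constant) (intro mult_right_mono, auto)
  finally have "(\<Sum>y\<in>{y\<in>nodes. norm y < radius}. norm (G y) * (\<Prod>w\<in>nodes-{y}. norm w / norm (y - w)))
      \<le> 2 * real half_window * exp (28 * loss + \<tau>) * U" by (simp add: mult_ac)
  moreover have "norm (G 0) \<le> (\<Prod>y\<in>nodes. norm y) * C
     + (\<Sum>y\<in>{y\<in>nodes. norm y < radius}. norm (G y) * (\<Prod>w\<in>nodes-{y}. norm w / norm (y - w)))"
    by (rule norm_le_lagrange_sum[OF holo finite_nodes _ radius_pos C_nonneg off_circle circle_C])
      (use nonzero in \<open>auto simp: nodes_def\<close>)
  ultimately show ?thesis using integral_term by linarith
qed

end

section \<open>Nodes filling the cells of a disc\<close>

definition fills_cells :: "real \<Rightarrow> nat \<Rightarrow> real \<Rightarrow> real \<Rightarrow> real set \<Rightarrow> bool" where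
  "fills_cells d m t s Z \<longleftrightarrow> finite Z \<and> (\<forall>j::int. - int m \<le> j \<longrightarrow> j < int m \<longrightarrow>
     d * s / real m \<le> real (card (Z \<inter> {t + s * of_int j / real m<..t + s * (of_int j + 1) / real m})))"

definition low_energy :: "real \<Rightarrow> real \<Rightarrow> real \<Rightarrow> real set \<Rightarrow> bool" where
  "low_energy \<kappa> \<tau> s Z \<longleftrightarrow>
     (\<forall>y\<in>Z. (\<Sum>y'\<in>{y'\<in>Z. y' \<noteq> y \<and> \<bar>y - y'\<bar> < \<kappa> * s}. ln (s / \<bar>y - y'\<bar>)) \<le> \<tau> * s)"

lemma fills_cells_rescale:
  assumes fills: "fills_cells d m t s Z" and s: "s > 0"
  shows "fills_cells (d * s) m 0 1 ((\<lambda>x. (x - t) / s) ` Z)"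
  unfolding fills_cells_def
proof (intro conjI allI impI)
  show "finite ((\<lambda>x. (x - t) / s) ` Z)" using fills by (simp add: fills_cells_def)
  fix j :: int assume "- int m \<le> j" "j < int m"
  then have "d * s / real m \<le> real (card (Z \<inter> {t + s * of_int j / real m<..t + s * (of_int j + 1) / real m}))"
    using fills by (simp add: fills_cells_def)
  moreover have "u < (x - t) / s \<longleftrightarrow> t + s * u < x" "(x - t) / s \<le> u \<longleftrightarrow> x \<le> t + s * u" for u x
    using s by (simp_all add: pos_less_divide_eq pos_divide_le_eq algebra_simps)
  then have "(\<lambda>x. (x - t) / s) ` Z \<inter> {0 + 1 * of_int j / real m<..0 + 1 * (of_int j + 1) / real m}
      = (\<lambda>x. (x - t) / s) ` (Z \<inter> {t + s * of_int j / real m<..t + s * (of_int j + 1) / real m})"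
    by auto
  moreover have "inj_on (\<lambda>x. (x - t) / s) A" for A using s by (auto simp: inj_on_def)
  ultimately show "d * s * 1 / real m
      \<le> real (card ((\<lambda>x. (x - t) / s) ` Z \<inter> {0 + 1 * of_int j / real m<..0 + 1 * (of_int j + 1) / real m}))"
    by (simp only: card_image mult_1_right)
qed

lemma low_energy_rescale:
  assumes energy: "low_energy \<kappa> \<tau> s Z" and s: "s > 0"
  shows "low_energy \<kappa> (\<tau> * s) 1 ((\<lambda>x. (x - t) / s) ` Z)"
  unfolding low_energy_def
proof
  let ?f = "\<lambda>x. (x - t) / s"
  have inj: "inj_on ?f A" for A using s by (auto simp: inj_on_def)
  have dist: "\<bar>?f x - ?f y\<bar> = \<bar>x - y\<bar> / s" for x y
    using s by (simp add: diff_divide_distrib[symmetric] abs_divide)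
  fix v assume "v \<in> ?f ` Z"
  then obtain y where y: "y \<in> Z" "v = ?f y" by auto
  have "?f x \<noteq> v \<and> \<bar>v - ?f x\<bar> < \<kappa> * 1 \<longleftrightarrow> x \<noteq> y \<and> \<bar>y - x\<bar> < \<kappa> * s" for x
    unfolding y(2) dist using s by (auto simp: divide_less_eq)
  then have "{y'\<in>?f ` Z. y' \<noteq> v \<and> \<bar>v - y'\<bar> < \<kappa> * 1} = ?f ` {x\<in>Z. x \<noteq> y \<and> \<bar>y - x\<bar> < \<kappa> * s}"
    by auto
  then have "(\<Sum>y'\<in>{y'\<in>?f ` Z. y' \<noteq> v \<and> \<bar>v - y'\<bar> < \<kappa> * 1}. ln (1 / \<bar>v - y'\<bar>))
      = (\<Sum>x\<in>{x\<in>Z. x \<noteq> y \<and> \<bar>y - x\<bar> < \<kappa> * s}. ln (s / \<bar>y - x\<bar>))"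
    by (simp only: sum.reindex[OF inj] o_def y(2) dist) simp
  then show "(\<Sum>y'\<in>{y'\<in>?f ` Z. y' \<noteq> v \<and> \<bar>v - y'\<bar> < \<kappa> * 1}. ln (1 / \<bar>v - y'\<bar>)) \<le> \<tau> * s * 1"
    using energy y(1) by (simp add: low_energy_def)
qed

text \<open>Closes the gap left by the missing site 0, so that blocks of \<open>N\<close> sites correspond to the cells.\<close>

definition gapless :: "int \<Rightarrow> int" where
  "gapless k = (if k > 0 then k - 1 else k)"

lemma gapless_div_bounds:
  assumes "k \<noteq> 0" "\<bar>k\<bar> \<le> int (i * N)" "N \<ge> 1"
  shows "- int i \<le> gapless k div int N" "gapless k div int N < int i"
proof -
  define j where "j = gapless k div int N"
  have range: "- int i * int N \<le> gapless k" "gapless k < int i * int N"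
    using assms by (auto simp: gapless_def)
  have block: "j * int N \<le> gapless k" "gapless k < (j + 1) * int N"
    using assms(3) by (simp_all add: j_def distrib_right minus_mod_eq_div_mult[symmetric])
  have "- int i * int N < (j + 1) * int N" "j * int N < int i * int N"
    using range block by linarith+
  then show "- int i \<le> gapless k div int N" "gapless k div int N < int i"
    using assms(3) unfolding j_def[symmetric] mult_less_cancel_right by auto
qed

lemma gapless_block:
  assumes "N \<ge> 1"
  shows "of_int (gapless k div int N) * real N \<le> of_int k"
    "of_int k \<le> of_int (gapless k div int N) * real N + real N"
proof -
  define j where "j = gapless k div int N"
  have "gapless k = j * int N + gapless k mod int N" by (simp add: j_def)
  moreover have "0 \<le> gapless k mod int N" "gapless k mod int N < int N" using assms by auto
  ultimately have "j * int N \<le> gapless k" "gapless k + 1 \<le> j * int N + int N" by linarith+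
  then have "j * int N \<le> k" "k \<le> j * int N + int N" by (auto simp: gapless_def split: if_splits)
  then have "real_of_int (j * int N) \<le> of_int k" "real_of_int k \<le> of_int (j * int N + int N)"
    by linarith+
  then show "of_int (gapless k div int N) * real N \<le> of_int k"
    "of_int k \<le> of_int (gapless k div int N) * real N + real N"
    by (simp_all add: j_def)
qed

lemma injective_choice_from_disjoint_blocks:
  fixes cell :: "int \<Rightarrow> 'a set"
  assumes card: "\<And>j. j \<in> J \<Longrightarrow> N \<le> card (cell j)" and fin: "\<And>j. j \<in> J \<Longrightarrow> finite (cell j)"
    and disj: "\<And>i j u. u \<in> cell i \<Longrightarrow> u \<in> cell j \<Longrightarrow> i = j" and N: "N \<ge> 1"
  shows "\<exists>y. inj_on y {k. gapless k div int N \<in> J \<and> k \<noteq> 0} \<and>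
    (\<forall>k. gapless k div int N \<in> J \<longrightarrow> y k \<in> cell (gapless k div int N))"
proof -
  have "\<exists>f. inj_on f {..<N} \<and> f ` {..<N} \<subseteq> cell j" if "j \<in> J" for j
    using card_le_inj[of "{..<N}" "cell j"] card[OF that] fin[OF that] by auto
  then obtain f where f: "\<And>j. j \<in> J \<Longrightarrow> inj_on (f j) {..<N} \<and> f j ` {..<N} \<subseteq> cell j" by metis
  define slot where "slot k = nat (gapless k mod int N)" for k
  define y where "y k = f (gapless k div int N) (slot k)" for k
  have slot_less: "slot k < N" for k using N by (simp add: slot_def nat_less_iff)
  have y_cell: "y k \<in> cell (gapless k div int N)" if "gapless k div int N \<in> J" for k
    using f[OF that] slot_less[of k] unfolding y_def by blast
  have "inj_on y {k. gapless k div int N \<in> J \<and> k \<noteq> 0}"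
  proof (rule inj_onI, clarify)
    fix k l assume k: "gapless k div int N \<in> J" "k \<noteq> 0" and l: "gapless l div int N \<in> J" "l \<noteq> 0"
      and eq: "y k = y l"
    have same_block: "gapless k div int N = gapless l div int N"
      using y_cell[OF k(1)] y_cell[OF l(1)] disj unfolding eq by blast
    then have "slot k = slot l"
      using f[OF k(1)] eq slot_less unfolding y_def by (auto dest!: inj_onD)
    then have "gapless k mod int N = gapless l mod int N" using N by (simp add: slot_def nat_eq_iff)
    then have "gapless k = gapless l" using same_block by (metis div_mult_mod_eq)
    then show "k = l" using k(2) l(2) by (auto simp: gapless_def split: if_splits)
  qed
  then show ?thesis using y_cell by blast
qed

lemma cell_unique:
  fixes m u :: real
  assumes "m > 0" "u \<in> {of_int i / m<..(of_int i + 1) / m}" "u \<in> {of_int j / m<..(of_int j + 1) / m}"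
  shows "i = j"
proof -
  have "of_int j < of_int i + (1::real)" "of_int i < of_int j + (1::real)"
    using assms by (auto simp: field_simps)
  then show ?thesis by linarith
qed

lemma near_scaled_site_of_cell:
  assumes "m \<ge> 1" "N \<ge> 1" and u: "u \<in> {of_int (gapless k div int N) / real m<..(of_int (gapless k div int N) + 1) / real m}"
  shows "\<bar>u - of_int k / real (m * N)\<bar> \<le> 1 / real m"
proof -
  have m_pos: "real m > 0" and N_pos: "real N > 0" using assms by auto
  have "of_int (gapless k div int N) / real m \<le> of_int k / real (m * N)"
    "of_int k / real (m * N) \<le> (of_int (gapless k div int N) + 1) / real m"
    using gapless_block[OF assms(2), of k] m_pos N_pos by (simp_all add: field_simps)
  moreover have "(of_int (gapless k div int N) + 1) / real m - of_int (gapless k div int N) / real m = 1 / real m"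
    using m_pos by (simp add: field_simps)
  ultimately show ?thesis using u by (auto simp: abs_le_iff)
qed

lemma enumerate_cells:
  fixes Z :: "real set" and m N :: nat
  assumes fin: "finite Z" and m: "m \<ge> 1" and N: "N \<ge> 1"
    and cells: "\<And>j::int. - int m \<le> j \<Longrightarrow> j < int m
        \<Longrightarrow> N \<le> card (Z \<inter> {of_int j / real m<..(of_int j + 1) / real m})"
  obtains y :: "int \<Rightarrow> real" where "inj_on y (nonzero_ints (m * N))" "y ` nonzero_ints (m * N) \<subseteq> Z"
    "\<And>k. k \<in> nonzero_ints (m * N) \<Longrightarrow> \<bar>y k - of_int k / real (m * N)\<bar> \<le> 1 / real m"
    "\<And>k i. i \<le> m \<Longrightarrow> k \<in> nonzero_ints (i * N) \<Longrightarrow> \<bar>y k\<bar> \<le> real i / real m"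
proof -
  let ?cell = "\<lambda>j::int. Z \<inter> {of_int j / real m<..(of_int j + 1) / real m}"
  let ?block = "\<lambda>k. gapless k div int N"
  have m_pos: "real m > 0" using m by simp
  have "\<exists>y. inj_on y {k. ?block k \<in> {- int m..<int m} \<and> k \<noteq> 0} \<and>
      (\<forall>k. ?block k \<in> {- int m..<int m} \<longrightarrow> y k \<in> ?cell (?block k))"
  proof (rule injective_choice_from_disjoint_blocks[OF _ _ _ N])
    show "N \<le> card (?cell j)" if "j \<in> {- int m..<int m}" for j using cells that by auto
    show "finite (?cell j)" for j using fin by simp
    show "i = j" if "u \<in> ?cell i" "u \<in> ?cell j" for i j u using that m_pos by (intro cell_unique) auto
  qed
  then obtain y where inj: "inj_on y {k. ?block k \<in> {- int m..<int m} \<and> k \<noteq> 0}"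
    and y_cell: "\<And>k. ?block k \<in> {- int m..<int m} \<Longrightarrow> y k \<in> ?cell (?block k)" by blast
  have block: "?block k \<in> {- int i..<int i}" if "k \<in> nonzero_ints (i * N)" for k i
    using gapless_div_bounds[of k i N] that N by (auto simp: mem_nonzero_ints)
  have y_in: "y k \<in> ?cell (?block k)" if "k \<in> nonzero_ints (m * N)" for k
    using y_cell block that by blast
  show thesis
  proof
    show "inj_on y (nonzero_ints (m * N))"
      by (rule inj_on_subset[OF inj]) (use block in \<open>auto simp: mem_nonzero_ints\<close>)
    show "y ` nonzero_ints (m * N) \<subseteq> Z" using y_in by blast
  next
    fix k assume k: "k \<in> nonzero_ints (m * N)"
    show "\<bar>y k - of_int k / real (m * N)\<bar> \<le> 1 / real m"
      by (rule near_scaled_site_of_cell[OF m N]) (use y_in[OF k] in auto)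
  next
    fix k :: int and i :: nat assume i: "i \<le> m" and k: "k \<in> nonzero_ints (i * N)"
    have "int (i * N) \<le> int (m * N)" using i by (simp only: of_nat_le_iff mult_le_mono1)
    then have "k \<in> nonzero_ints (m * N)" using k by (auto simp: mem_nonzero_ints)
    moreover have "- int i \<le> ?block k" "?block k + 1 \<le> int i" using block[OF k] by auto
    then have "- real i / real m \<le> of_int (?block k) / real m"
      "(of_int (?block k) + 1) / real m \<le> real i / real m"
      using m_pos by (intro divide_right_mono; linarith)+
    ultimately show "\<bar>y k\<bar> \<le> real i / real m" using y_in[of k] by auto
  qed
qed

context interpolation_scale
begin

definition extended_nodes :: "(int \<Rightarrow> real) \<Rightarrow> int \<Rightarrow> real" where
  "extended_nodes y k =
     (if k \<in> inner_sites then real half_window * y k else of_int k + 2 * real N * of_int (sgn k))"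

lemma inner_sites_half_window: "inner_sites \<subseteq> nonzero_ints half_window"
  by (auto simp: inner_sites_def mem_nonzero_ints)

lemma abs_extended_nodes_outer:
  assumes "k \<in> nonzero_ints extent - inner_sites"
  shows "real half_window + 1 \<le> \<bar>extended_nodes y k\<bar>"
proof -
  have k: "k \<noteq> 0" "\<bar>k\<bar> \<ge> int half_window - 2 * int N + 1"
    using assms by (auto simp: inner_eq mem_nonzero_ints)
  then have "\<bar>extended_nodes y k\<bar> = \<bar>of_int k\<bar> + 2 * real N"
    using assms by (cases "k > 0") (auto simp: extended_nodes_def sgn_if)
  then show ?thesis using k(2) by linarith
qed

lemma inj_on_extended_nodes:
  assumes inj: "inj_on y (nonzero_ints half_window)"
    and inner_le: "\<And>k. k \<in> inner_sites \<Longrightarrow> \<bar>extended_nodes y k\<bar> \<le> real half_window - 2 * real N"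
  shows "inj_on (extended_nodes y) (nonzero_ints extent)"
proof (rule inj_onI)
  fix k l assume k: "k \<in> nonzero_ints extent" and l: "l \<in> nonzero_ints extent"
    and eq: "extended_nodes y k = extended_nodes y l"
  have same_side: "k \<in> inner_sites \<longleftrightarrow> l \<in> inner_sites"
    using inner_le[of k] inner_le[of l] abs_extended_nodes_outer[of k y] abs_extended_nodes_outer[of l y]
      k l eq real_N_ge by fastforce
  show "k = l"
  proof (cases "k \<in> inner_sites")
    case True
    then have "y k = y l" using same_side eq half_window_ge real_N_ge by (auto simp: extended_nodes_def)
    then show ?thesis using inj inner_sites_half_window True same_side by (auto dest: inj_onD)
  next
    case False
    then have "of_int k + 2 * real N * of_int (sgn k) = of_int l + 2 * real N * of_int (sgn l)"
      using same_side eq by (auto simp: extended_nodes_def)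
    then show ?thesis using k l real_N_ge by (auto simp: mem_nonzero_ints sgn_if split: if_splits)
  qed
qed

lemma extended_nodes_close:
  assumes close: "\<And>k. k \<in> nonzero_ints half_window \<Longrightarrow> \<bar>y k - of_int k / real half_window\<bar> \<le> 1 / real A ^ 4"
    and k: "k \<in> nonzero_ints extent"
  shows "\<bar>extended_nodes y k - of_int k\<bar> \<le> 2 * real N"
proof (cases "k \<in> inner_sites")
  case True
  have M_pos: "real half_window > 0" using half_window_ge real_N_ge by linarith
  have "\<bar>extended_nodes y k - of_int k\<bar> = real half_window * \<bar>y k - of_int k / real half_window\<bar>"
    using True M_pos
    by (subst abs_of_pos[OF M_pos, symmetric], subst abs_mult[symmetric]) (simp add: extended_nodes_def algebra_simps)
  also have "\<dots> \<le> real half_window * (1 / real A ^ 4)"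
    using close True inner_sites_half_window by (intro mult_left_mono) auto
  also have "\<dots> = real N" using A by (simp add: half_window_def)
  finally show ?thesis using real_N_ge by linarith
qed (use k in \<open>auto simp: extended_nodes_def sgn_if\<close>)

lemma perturbed_lattice_of_cells:
  assumes fin: "finite Z" and zero: "0 \<notin> Z"
    and cells: "\<And>j::int. - int (A ^ 4) \<le> j \<Longrightarrow> j < int (A ^ 4) \<Longrightarrow>
      N \<le> card (Z \<inter> {of_int j / real (A ^ 4)<..(of_int j + 1) / real (A ^ 4)})"
  obtains Y where "perturbed_lattice N A Y" "\<And>k. k \<in> inner_sites \<Longrightarrow> Y k / real half_window \<in> Z"
proof -
  obtain y where inj: "inj_on y (nonzero_ints half_window)" and y_in: "y ` nonzero_ints half_window \<subseteq> Z"
    and y_close: "\<And>k. k \<in> nonzero_ints half_window \<Longrightarrow> \<bar>y k - of_int k / real half_window\<bar> \<le> 1 / real A ^ 4"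
    and y_le: "\<And>k i. i \<le> A ^ 4 \<Longrightarrow> k \<in> nonzero_ints (i * N) \<Longrightarrow> \<bar>y k\<bar> \<le> real i / real A ^ 4"
    using enumerate_cells[OF fin _ N cells] A unfolding half_window_def of_nat_power by auto
  have M_pos: "real half_window > 0" using half_window_ge real_N_ge by linarith
  have A4: "A ^ 4 \<ge> 2" using A_power_ge[of 4] by (simp flip: of_nat_power)
  have inner_le: "\<bar>extended_nodes y k\<bar> \<le> real half_window - 2 * real N" if k: "k \<in> inner_sites" for k
  proof -
    have "k \<in> nonzero_ints ((A ^ 4 - 2) * N)"
      using k A4 by (auto simp: inner_sites_def mem_nonzero_ints half_window_def of_nat_diff algebra_simps)
    then have "real half_window * \<bar>y k\<bar> \<le> real half_window * (real (A ^ 4 - 2) / real A ^ 4)"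
      by (intro mult_left_mono y_le) auto
    also have "\<dots> = real half_window - 2 * real N"
      using A A4 by (simp add: half_window_def of_nat_diff field_simps)
    finally show ?thesis using k by (simp add: extended_nodes_def abs_mult)
  qed
  have y_inner: "y k \<in> Z" if "k \<in> inner_sites" for k using that y_in inner_sites_half_window by blast
  then have y_nonzero: "y k \<noteq> 0" if "k \<in> inner_sites" for k using that zero by metis
  have "perturbed_lattice N A (extended_nodes y)"
  proof unfold_locales
    show "extended_nodes y k \<noteq> 0" if "k \<in> nonzero_ints extent" for k
      using abs_extended_nodes_outer[of k y] that y_nonzero[of k] M_pos
      by (cases "k \<in> inner_sites") (auto simp: extended_nodes_def)
  qed (intro inj_on_extended_nodes extended_nodes_close inj inner_le y_close abs_extended_nodes_outer; assumption)+
  moreover have "extended_nodes y k / real half_window \<in> Z" if "k \<in> inner_sites" for k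
    using that y_inner M_pos by (simp add: extended_nodes_def)
  ultimately show thesis by (rule that)
qed

end

context perturbed_lattice
begin

lemma half_window_near_range: "real half_window = real A ^ 2 * real near_range"
  by (simp add: half_window_def near_range_def power_eq_if)

lemma inner_scaled_distance_less:
  assumes k: "k \<in> inner_sites" and l: "l \<in> inner_sites"
    and near: "\<bar>real_of_int k - of_int l\<bar> < real near_range"
  shows "\<bar>Y k / real half_window - Y l / real half_window\<bar> < 5 / real A"
proof -
  have "real N > 0" using real_N_ge by simp
  have "k \<in> nonzero_ints extent" "l \<in> nonzero_ints extent" using k l inner_subset by auto
  then have "\<bar>Y k - Y l\<bar> < real near_range + 4 * real N"
    using close[of k] close[of l] near by linarith
  then have "\<bar>Y k - Y l\<bar> / real half_window < (real near_range + 4 * real N) / real half_window"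
    using half_window_ge real_N_ge by (intro divide_strict_right_mono) auto
  also have "\<dots> = 1 / real A ^ 2 + 4 / real A ^ 4"
    using A \<open>real N > 0\<close> by (simp add: real_half_window real_near_range add_divide_distrib power_eq_if)
  also have "\<dots> \<le> 1 / real A + 4 / real A"
    using A self_le_power[of "real A" 2] self_le_power[of "real A" 4]
    by (intro add_mono divide_left_mono) auto
  finally show ?thesis by (simp add: diff_divide_distrib[symmetric] abs_divide)
qed

lemma separated_at_of_low_energy:
  assumes fin: "finite Z" and in_Z: "\<And>k. k \<in> inner_sites \<Longrightarrow> Y k / real half_window \<in> Z"
    and \<kappa>: "5 / real A \<le> \<kappa>" "\<kappa> \<le> 1" and energy: "low_energy \<kappa> \<tau> 1 Z" and k: "k \<in> inner_sites"
  shows "separated_at \<tau> k"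
proof -
  let ?y = "\<lambda>k. Y k / real half_window"
  let ?S = "{l\<in>inner_sites-{k}. \<bar>real_of_int k - of_int l\<bar> < real near_range}"
  let ?Near = "{y'\<in>Z. y' \<noteq> ?y k \<and> \<bar>?y k - y'\<bar> < \<kappa> * 1}"
  have M_pos: "real half_window > 0" and D_pos: "real near_range > 0"
    using half_window_ge near_range_ge real_N_ge by linarith+
  have neq: "?y l \<noteq> ?y k" if "l \<in> ?S" for l
    using inj inner_subset k that M_pos by (auto dest: inj_onD)
  have inj_S: "inj_on ?y ?S"
    using inj inner_subset M_pos by (auto simp: inj_on_def)
  have "?y ` ?S \<subseteq> ?Near"
    using in_Z neq inner_scaled_distance_less[OF k] \<kappa>(1) by fastforce
  then have "(\<Sum>y'\<in>?y ` ?S. ln (1 / \<bar>?y k - y'\<bar>)) \<le> (\<Sum>y'\<in>?Near. ln (1 / \<bar>?y k - y'\<bar>))"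
    by (rule sum_mono2[rotated]) (use fin \<kappa>(2) in auto)
  also have "\<dots> \<le> \<tau>"
    using energy in_Z[OF k] by (simp add: low_energy_def)
  finally have "(\<Sum>l\<in>?S. ln (1 / \<bar>?y k - ?y l\<bar>)) \<le> \<tau>"
    by (simp only: sum.reindex[OF inj_S] o_def)
  then have "exp (- \<tau>) \<le> exp (\<Sum>l\<in>?S. - ln (1 / \<bar>?y k - ?y l\<bar>))" by (simp add: sum_negf)
  also have "\<dots> = (\<Prod>l\<in>?S. exp (- ln (1 / \<bar>?y k - ?y l\<bar>)))"
    by (rule exp_sum) (use finite_inner in auto)
  also have "\<dots> = (\<Prod>l\<in>?S. \<bar>?y k - ?y l\<bar>)"
  proof (rule prod.cong[OF refl])
    fix l assume "l \<in> ?S"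
    then have "\<bar>?y k - ?y l\<bar> > 0" using neq[of l] by force
    then show "exp (- ln (1 / \<bar>?y k - ?y l\<bar>)) = \<bar>?y k - ?y l\<bar>" by (simp add: ln_div)
  qed
  also have "\<dots> \<le> (\<Prod>l\<in>?S. \<bar>Y k - Y l\<bar> / real near_range)"
  proof (rule prod_mono, safe)
    fix l
    have "\<bar>Y k - Y l\<bar> / real near_range = real A ^ 2 * \<bar>?y k - ?y l\<bar>"
      using M_pos D_pos A by (simp add: half_window_near_range diff_divide_distrib[symmetric] abs_divide)
    moreover have "1 * \<bar>?y k - ?y l\<bar> \<le> real A ^ 2 * \<bar>?y k - ?y l\<bar>"
      using A_power_ge[of 2] by (intro mult_right_mono) auto
    ultimately show "\<bar>?y k - ?y l\<bar> \<le> \<bar>Y k - Y l\<bar> / real near_range" by simp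
  qed auto
  finally show ?thesis by (simp add: separated_at_def)
qed

end

section \<open>Interpolation with Gaussian damping\<close>

lemma norm_gaussian: "norm (exp (- of_real c * z\<^sup>2)) = exp (- c * ((norm z)\<^sup>2 - 2 * (Im z)\<^sup>2))"
  using cmod_power2[of z] by (simp add: norm_exp_eq_Re power2_eq_square)

context interpolation_scale
begin

definition damped :: "real \<Rightarrow> (complex \<Rightarrow> complex) \<Rightarrow> complex \<Rightarrow> complex" where
  "damped c H \<zeta> = H (\<zeta> / of_real (real half_window)) * exp (- of_real c * (\<zeta> / of_real (real half_window))\<^sup>2)"

lemma norm_damped_le_on_circle:
  assumes growth: "\<And>z. norm z \<le> 1 \<Longrightarrow> norm (H z) \<le> exp (s * (b * \<bar>Im z\<bar> + \<gamma> / 4))"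
    and type: "pi * d = b + 4 * \<gamma>" and \<gamma>: "\<gamma> > 0" and s: "s > 0"
    and many: "d * s - real A ^ 4 \<le> real half_window" and \<zeta>: "norm \<zeta> = radius"
  shows "norm (damped (\<gamma> * s) H \<zeta>) \<le> exp (pi * real A ^ 4 - \<gamma> * s / 2) * exp (pi * \<bar>Im \<zeta>\<bar>)"
proof -
  define z where "z = \<zeta> / of_real (real half_window)"
  define v where "v = \<bar>Im z\<bar>"
  have M_pos: "real half_window > 0" using half_window_ge real_N_ge by linarith
  have "norm z * real half_window = real half_window - real N + 1/2"
    using \<zeta> M_pos by (simp add: z_def norm_divide radius_def)
  then have "norm z * real half_window \<le> 1 * real half_window"
    "(7/8) * real half_window \<le> norm z * real half_window"
    using half_window_ge real_N_ge by linarith+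
  then have z_le: "norm z \<le> 1" and z_ge: "7/8 \<le> norm z"
    using M_pos by (simp_all only: mult_le_cancel_right_pos)
  have "(7/8)\<^sup>2 \<le> (norm z)\<^sup>2" using z_ge by (intro power_mono) auto
  then have z_sq: "3/4 \<le> (norm z)\<^sup>2" by (simp add: power2_eq_square)
  have v: "0 \<le> v" "v \<le> 1" using abs_Im_le_cmod[of z] z_le by (auto simp: v_def)
  have Im_\<zeta>: "\<bar>Im \<zeta>\<bar> = real half_window * v" using M_pos by (simp add: z_def v_def)
  have "norm (damped (\<gamma> * s) H \<zeta>) \<le> exp (s * (b * v + \<gamma> / 4)) * exp (- (\<gamma> * s) * ((norm z)\<^sup>2 - 2 * v\<^sup>2))"
    unfolding damped_def z_def[symmetric] norm_mult norm_gaussian v_def power2_abs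
    by (intro mult_right_mono growth z_le) simp
  also have "\<dots> = exp (s * (b * v + \<gamma> / 4) - (\<gamma> * s) * ((norm z)\<^sup>2 - 2 * v\<^sup>2))"
    by (simp add: exp_add[symmetric])
  also have "\<dots> \<le> exp (pi * real A ^ 4 - \<gamma> * s / 2 + pi * (real half_window * v))"
  proof -
    have "(pi * v) * (d * s - real A ^ 4) \<le> (pi * v) * real half_window"
      using many v by (intro mult_left_mono) auto
    moreover have "pi * real A ^ 4 * v \<le> pi * real A ^ 4 * 1" using v by (intro mult_left_mono) auto
    moreover have "(b + 4 * \<gamma>) * (v * s) = (pi * v) * (d * s - real A ^ 4) + pi * real A ^ 4 * v"
      unfolding type[symmetric] by (simp add: algebra_simps)
    moreover have "pi * v * real half_window = pi * (real half_window * v)" by simp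
    ultimately have linear: "(b + 4 * \<gamma>) * (v * s) \<le> pi * (real half_window * v) + pi * real A ^ 4"
      by linarith
    have "v * v \<le> 1 * v" using v by (intro mult_right_mono) auto
    then have "0 \<le> 4 * v - 2 * v\<^sup>2" using v by (simp add: power2_eq_square)
    then have "0 \<le> \<gamma> * s * (((norm z)\<^sup>2 - 3/4) + (4 * v - 2 * v\<^sup>2))"
      using \<gamma> s z_sq by (intro mult_nonneg_nonneg) auto
    then show ?thesis using linear by (simp add: algebra_simps)
  qed
  finally show ?thesis by (simp add: Im_\<zeta> exp_add)
qed

lemma norm_at_zero_le_of_cells:
  assumes holo: "H holomorphic_on UNIV" and fin: "finite Z" and zero: "0 \<notin> Z"
    and cells: "\<And>j::int. - int (A ^ 4) \<le> j \<Longrightarrow> j < int (A ^ 4) \<Longrightarrow>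
      N \<le> card (Z \<inter> {of_int j / real (A ^ 4)<..(of_int j + 1) / real (A ^ 4)})"
    and \<kappa>: "5 / real A \<le> \<kappa>" "\<kappa> \<le> 1" and energy: "low_energy \<kappa> \<tau> 1 Z"
    and at_nodes: "\<And>y. y \<in> Z \<Longrightarrow> norm (H (of_real y)) \<le> exp \<tau>"
    and growth: "\<And>z. norm z \<le> 1 \<Longrightarrow> norm (H z) \<le> exp (s * (b * \<bar>Im z\<bar> + \<gamma> / 4))"
    and type: "pi * d = b + 4 * \<gamma>" and \<gamma>: "\<gamma> > 0" and s: "s > 0"
    and many: "d * s - real A ^ 4 \<le> real half_window"
  shows "norm (H 0) \<le> 10 * pi * real half_window * exp (29 * loss + (pi * real A ^ 4 - \<gamma> * s / 2))
     + 2 * real half_window * exp (28 * loss + 2 * \<tau>)"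
proof -
  obtain Y where Y: "perturbed_lattice N A Y" and in_Z: "\<And>k. k \<in> inner_sites \<Longrightarrow> Y k / real half_window \<in> Z"
    using perturbed_lattice_of_cells[OF fin zero cells] by blast
  interpret perturbed_lattice N A Y by (rule Y)
  have "norm (damped (\<gamma> * s) H 0) \<le> 10 * pi * real half_window * exp (29 * loss) * exp (pi * real A ^ 4 - \<gamma> * s / 2)
     + 2 * real half_window * exp (28 * loss + \<tau>) * exp \<tau>"
  proof (rule norm_at_zero_le)
    show "damped (\<gamma> * s) H holomorphic_on UNIV"
      unfolding damped_def[abs_def] using half_window_ge real_N_ge
      by (intro holomorphic_intros holomorphic_on_compose_gen[OF _ holo, unfolded o_def]) auto
    show "norm (damped (\<gamma> * s) H (of_real (Y k))) \<le> exp \<tau>" if "k \<in> inner_sites" for k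
    proof -
      have "norm (exp (- of_real (\<gamma> * s) * (complex_of_real (Y k / real half_window))\<^sup>2)) \<le> 1"
        using \<gamma> s unfolding norm_gaussian by simp
      then show ?thesis
        using mult_mono[OF at_nodes[OF in_Z[OF that]], of _ 1] by (simp add: damped_def norm_mult)
    qed
    show "norm (damped (\<gamma> * s) H \<zeta>) \<le> exp (pi * real A ^ 4 - \<gamma> * s / 2) * exp (pi * \<bar>Im \<zeta>\<bar>)"
      if "norm \<zeta> = radius" for \<zeta>
      using norm_damped_le_on_circle[OF growth type \<gamma> s many that] .
    show "separated_at \<tau> k" if "k \<in> inner_sites" for k
      using separated_at_of_low_energy[OF fin in_Z \<kappa> energy that] .
  qed auto
  moreover have "exp (29 * loss + (pi * real A ^ 4 - \<gamma> * s / 2))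
      = exp (29 * loss) * exp (pi * real A ^ 4 - \<gamma> * s / 2)"
    "exp (28 * loss + 2 * \<tau>) = exp (28 * loss + \<tau>) * exp \<tau>"
    unfolding exp_add[symmetric] by simp_all
  ultimately show ?thesis by (simp add: damped_def mult.assoc)
qed

lemma loss_le:
  assumes "real half_window \<le> d * s" "29 * d / real A \<le> r" "s > 0"
  shows "29 * loss \<le> r * s"
proof -
  have "29 * loss \<le> 29 * d / real A * s" using assms(1) A by (simp add: loss_def divide_right_mono)
  also have "\<dots> \<le> r * s" using assms by (intro mult_right_mono) auto
  finally show ?thesis .
qed

end

lemma eventually_interpolation_terms_less:
  fixes \<gamma> \<Theta> d c :: real
  assumes "\<gamma> > 0" "\<Theta> > 0" "d > 0"
  shows "\<forall>\<^sub>F s in at_top. 10 * pi * (d * s) * exp (c - \<gamma> * s) + 2 * (d * s) * exp (3 / 8 * \<Theta> * s)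
      < exp (\<Theta> * s)"
proof -
  have decay: "((\<lambda>s::real. s * exp (- r * s)) \<longlongrightarrow> 0) at_top" if "r > 0" for r :: real
    using that by real_asymp
  have "((\<lambda>s. 10 * pi * d * exp c * (s * exp (- (\<Theta> + \<gamma>) * s)) + 2 * d * (s * exp (- (5 / 8 * \<Theta>) * s)))
      \<longlongrightarrow> 10 * pi * d * exp c * 0 + 2 * d * 0) at_top"
    using assms by (intro tendsto_intros decay) auto
  then have "\<forall>\<^sub>F s in at_top. 10 * pi * d * exp c * (s * exp (- (\<Theta> + \<gamma>) * s))
      + 2 * d * (s * exp (- (5 / 8 * \<Theta>) * s)) < 1"
    by (rule order_tendstoD(2)) simp
  then show ?thesis
  proof eventually_elim
    case (elim s)
    then have "exp (\<Theta> * s) * (10 * pi * d * exp c * (s * exp (- (\<Theta> + \<gamma>) * s)) + 2 * d * (s * exp (- (5 / 8 * \<Theta>) * s)))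
        < exp (\<Theta> * s) * 1" by (intro mult_strict_left_mono) auto
    moreover have "exp (c - \<gamma> * s) = exp (\<Theta> * s) * exp c * exp (- (\<Theta> + \<gamma>) * s)"
      "exp (3 / 8 * \<Theta> * s) = exp (\<Theta> * s) * exp (- (5 / 8 * \<Theta>) * s)"
      unfolding exp_add[symmetric] by (simp_all add: algebra_simps)
    ultimately show ?case by (simp add: algebra_simps)
  qed
qed

lemma interpolation_unit_disc:
  assumes holo: "H holomorphic_on UNIV"
    and growth: "\<And>z. norm z \<le> 1 \<Longrightarrow> norm (H z) \<le> exp (s * (b * \<bar>Im z\<bar> + \<gamma> / 4))"
    and fills: "fills_cells (d * s) (A ^ 4) 0 1 Z" and energy: "low_energy \<kappa> (\<Theta> / 8 * s) 1 Z"
    and at_nodes: "\<And>y. y \<in> Z \<Longrightarrow> norm (H (of_real y)) \<le> exp (\<Theta> / 8 * s)"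
    and type: "pi * d = b + 4 * \<gamma>" and pos: "\<gamma> > 0" "\<Theta> > 0" "s > 0" "d > 0"
    and A_large: "A \<ge> 4" "5 / real A \<le> \<kappa>" and \<kappa>: "\<kappa> \<le> 1" and ds: "real A ^ 4 \<le> d * s"
    and loss_rate: "29 * d / real A \<le> \<Theta> / 8" "29 * d / real A \<le> \<gamma> / 8"
    and terms: "10 * pi * (d * s) * exp (pi * real A ^ 4 - 3 / 8 * \<gamma> * s) + 2 * (d * s) * exp (3 / 8 * \<Theta> * s)
        < exp (\<Theta> * s)"
  shows "norm (H 0) < exp (\<Theta> * s)"
proof (cases "0 \<in> Z")
  case True
  then have "norm (H 0) \<le> exp (\<Theta> / 8 * s)" using at_nodes by force
  also have "\<dots> < exp (\<Theta> * s)" using pos by simp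
  finally show ?thesis .
next
  case False
  define N where "N = nat \<lfloor>d * s / real A ^ 4\<rfloor>"
  have "\<lfloor>d * s / real A ^ 4\<rfloor> \<ge> 1" using ds A_large by (simp add: le_floor_iff)
  then have N_bounds: "N \<ge> 1" "real N \<le> d * s / real A ^ 4" "d * s / real A ^ 4 < real N + 1"
    unfolding N_def by linarith+
  interpret interpolation_scale N A using N_bounds A_large by unfold_locales
  have "real A ^ 4 > 0" using A_large by simp
  then have window: "real half_window \<le> d * s" "d * s - real A ^ 4 \<le> real half_window"
    using N_bounds by (simp_all add: real_half_window pos_le_divide_eq pos_divide_less_eq algebra_simps)
  have cells: "N \<le> card (Z \<inter> {of_int j / real (A ^ 4)<..(of_int j + 1) / real (A ^ 4)})"
    if "- int (A ^ 4) \<le> j" "j < int (A ^ 4)" for j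
    using fills that N_bounds(2) unfolding fills_cells_def by fastforce
  have "finite Z" using fills by (simp add: fills_cells_def)
  then have "norm (H 0) \<le> 10 * pi * real half_window * exp (29 * loss + (pi * real A ^ 4 - \<gamma> * s / 2))
      + 2 * real half_window * exp (28 * loss + 2 * (\<Theta> / 8 * s))"
    by (rule norm_at_zero_le_of_cells[OF holo _ False cells A_large(2) \<kappa> energy at_nodes growth type pos(1,3) window(2)])
  also have "\<dots> \<le> 10 * pi * (d * s) * exp (pi * real A ^ 4 - 3 / 8 * \<gamma> * s)
      + 2 * (d * s) * exp (3 / 8 * \<Theta> * s)"
  proof (intro add_mono mult_mono)
    show "exp (29 * loss + (pi * real A ^ 4 - \<gamma> * s / 2)) \<le> exp (pi * real A ^ 4 - 3 / 8 * \<gamma> * s)"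
      using loss_le[OF window(1) loss_rate(2) pos(3)] by simp
    show "exp (28 * loss + 2 * (\<Theta> / 8 * s)) \<le> exp (3 / 8 * \<Theta> * s)"
      using loss_le[OF window(1) loss_rate(1) pos(3)] loss_nonneg by simp
  qed (use window pos in auto)
  also have "\<dots> < exp (\<Theta> * s)" by (rule terms)
  finally show ?thesis .
qed

lemma interpolation_disc_of_scale:
  assumes holo: "h holomorphic_on UNIV"
    and growth: "\<And>z. norm (z - of_real t) \<le> s \<Longrightarrow> norm (h z) \<le> exp (b * \<bar>Im z\<bar> + \<gamma> / 4 * s)"
    and nodes: "fills_cells d (A ^ 4) t s Z" "low_energy \<kappa> (\<Theta> / 8) s Z"
    and at_nodes: "\<And>y. y \<in> Z \<Longrightarrow> norm (h (of_real y)) \<le> exp (\<Theta> / 8 * s)"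
    and type: "pi * d = b + 4 * \<gamma>" and pos: "\<gamma> > 0" "\<Theta> > 0" "s > 0" "d > 0"
    and A: "A \<ge> 4" "5 / real A \<le> \<kappa>" and \<kappa>: "\<kappa> \<le> 1" and ds: "real A ^ 4 \<le> d * s"
    and loss_rate: "29 * d / real A \<le> \<Theta> / 8" "29 * d / real A \<le> \<gamma> / 8"
    and terms: "10 * pi * (d * s) * exp (pi * real A ^ 4 - 3 / 8 * \<gamma> * s) + 2 * (d * s) * exp (3 / 8 * \<Theta> * s)
        < exp (\<Theta> * s)"
  shows "norm (h (of_real t)) < exp (\<Theta> * s)"
proof -
  define H where "H z = h (of_real t + of_real s * z)" for z
  have holo_H: "H holomorphic_on UNIV" unfolding H_def
    by (intro holomorphic_on_compose_gen[OF _ holo, unfolded o_def] holomorphic_intros) auto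
  have growth_H: "norm (H z) \<le> exp (s * (b * \<bar>Im z\<bar> + \<gamma> / 4))" if "norm z \<le> 1" for z
  proof -
    have "norm (of_real t + of_real s * z - of_real t) \<le> s" using that pos(3) by (simp add: norm_mult)
    then have "norm (H z) \<le> exp (b * \<bar>s * Im z\<bar> + \<gamma> / 4 * s)"
      using growth unfolding H_def by fastforce
    then show ?thesis using pos(3) by (simp add: abs_mult algebra_simps)
  qed
  have nodes_H: "norm (H (of_real v)) \<le> exp (\<Theta> / 8 * s)" if "v \<in> (\<lambda>x. (x - t) / s) ` Z" for v
    using that at_nodes pos(3) by (auto simp: H_def simp flip: of_real_mult of_real_add)
  have "norm (H 0) < exp (\<Theta> * s)"
    by (rule interpolation_unit_disc[OF holo_H growth_H fills_cells_rescale[OF nodes(1) pos(3)]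
        low_energy_rescale[OF nodes(2) pos(3)] nodes_H type pos A \<kappa> ds loss_rate terms])
  then show ?thesis by (simp add: H_def)
qed

theorem interpolation_disc:
  fixes b d \<Theta> \<kappa> :: real
  assumes b: "0 \<le> b" "b < pi * d" and \<Theta>: "0 < \<Theta>" and \<kappa>: "0 < \<kappa>" "\<kappa> \<le> 1"
  shows "\<exists>m\<ge>1. \<forall>\<^sub>F s in at_top. \<forall>h t Z. h holomorphic_on UNIV \<longrightarrow>
     (\<forall>z. norm (z - of_real t) \<le> s \<longrightarrow> norm (h z) \<le> exp (b * \<bar>Im z\<bar> + (pi * d - b) / 16 * s)) \<longrightarrow>
     fills_cells d m t s Z \<longrightarrow> low_energy \<kappa> (\<Theta> / 8) s Z \<longrightarrow>
     (\<forall>y\<in>Z. norm (h (of_real y)) \<le> exp (\<Theta> / 8 * s)) \<longrightarrow> norm (h (of_real t)) < exp (\<Theta> * s)"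
proof -
  define \<gamma> where "\<gamma> = (pi * d - b) / 4"
  have \<gamma>: "\<gamma> > 0" "3 / 8 * \<gamma> > 0" "(pi * d - b) / 16 = \<gamma> / 4" and type: "pi * d = b + 4 * \<gamma>"
    using b by (simp_all add: \<gamma>_def field_simps)
  have d: "d > 0" using b by (metis le_less_trans pi_gt_zero zero_less_mult_pos)
  obtain A0 :: nat where A0: "real A0 > max (max (29 * d / (\<Theta> / 8)) (29 * d / (\<gamma> / 8))) (5 / \<kappa>)"
    using reals_Archimedean2 by blast
  define A where "A = max 4 A0"
  have A: "A \<ge> 4" "real A > 0" and "real A \<ge> real A0" by (auto simp: A_def)
  then have "29 * d / (\<Theta> / 8) \<le> real A" "29 * d / (\<gamma> / 8) \<le> real A" "5 / \<kappa> \<le> real A" using A0 by linarith+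
  then have loss_rate: "29 * d / real A \<le> \<Theta> / 8" "29 * d / real A \<le> \<gamma> / 8" and A_\<kappa>: "5 / real A \<le> \<kappa>"
    using \<Theta> \<gamma> \<kappa> A by (simp_all add: field_simps)
  have "\<forall>\<^sub>F s in at_top. \<forall>h t Z. h holomorphic_on UNIV \<longrightarrow>
     (\<forall>z. norm (z - of_real t) \<le> s \<longrightarrow> norm (h z) \<le> exp (b * \<bar>Im z\<bar> + \<gamma> / 4 * s)) \<longrightarrow>
     fills_cells d (A ^ 4) t s Z \<longrightarrow> low_energy \<kappa> (\<Theta> / 8) s Z \<longrightarrow>
     (\<forall>y\<in>Z. norm (h (of_real y)) \<le> exp (\<Theta> / 8 * s)) \<longrightarrow> norm (h (of_real t)) < exp (\<Theta> * s)"
    using eventually_ge_at_top[of "real A ^ 4 / d"] eventually_gt_at_top[of 0]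
      eventually_interpolation_terms_less[OF \<gamma>(2) \<Theta> d, of "pi * real A ^ 4"]
  proof eventually_elim
    case (elim s)
    have "real A ^ 4 \<le> d * s" using elim(1) d by (simp add: field_simps)
    then show ?case
      using interpolation_disc_of_scale[OF _ _ _ _ _ type \<gamma>(1) \<Theta> elim(2) d A(1) A_\<kappa> \<kappa>(2) _ loss_rate elim(3)]
      by blast
  qed
  moreover have "1 \<le> A ^ 4" using A by simp
  ultimately show ?thesis unfolding \<gamma>(3) by blast
qed

section \<open>Growth bounds from Poisson integrals\<close>

definition poisson_kernel :: "real \<Rightarrow> real \<Rightarrow> real \<Rightarrow> real" where
  "poisson_kernel x y u = y / ((x - u)\<^sup>2 + y\<^sup>2)"

lemma poisson_kernel_nonneg: "0 \<le> y \<Longrightarrow> 0 \<le> poisson_kernel x y u"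
  by (simp add: poisson_kernel_def)

lemma continuous_on_poisson_kernel: "y \<noteq> 0 \<Longrightarrow> continuous_on S (poisson_kernel x y)"
  unfolding poisson_kernel_def by (intro continuous_intros) (simp add: sum_power2_eq_zero_iff)

lemma poisson_kernel_window:
  assumes \<delta>: "\<delta> > 0" and \<eta>: "\<eta> > 0"
  shows "(poisson_kernel x \<delta> has_integral 2 * arctan (\<eta> / \<delta>)) {x - \<eta>..x + \<eta>}"
proof -
  have "(poisson_kernel x \<delta> has_integral arctan ((x + \<eta> - x) / \<delta>) - arctan ((x - \<eta> - x) / \<delta>)) {x - \<eta>..x + \<eta>}"
  proof (rule fundamental_theorem_of_calculus)
    fix u assume "u \<in> {x - \<eta>..x + \<eta>}"
    have "1 + ((u - x) / \<delta>)\<^sup>2 = ((x - u)\<^sup>2 + \<delta>\<^sup>2) / \<delta>\<^sup>2"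
      using \<delta> by (simp add: field_simps power2_commute)
    then have "inverse (1 + ((u - x) / \<delta>)\<^sup>2) * (1 / \<delta>) = poisson_kernel x \<delta> u"
      using \<delta> by (simp add: poisson_kernel_def power2_eq_square)
    moreover have "((\<lambda>u. arctan ((u - x) / \<delta>)) has_real_derivative inverse (1 + ((u - x) / \<delta>)\<^sup>2) * (1 / \<delta>)) (at u)"
      using \<delta> by (auto intro!: derivative_eq_intros)
    ultimately show "((\<lambda>u. arctan ((u - x) / \<delta>)) has_vector_derivative poisson_kernel x \<delta> u) (at u within {x - \<eta>..x + \<eta>})"
      by (simp add: has_real_derivative_iff_has_vector_derivative[symmetric] has_field_derivative_at_within)
  qed (use \<eta> in auto)
  then show ?thesis by (simp add: arctan_minus)
qed

lemma Cauchy_transform_linepath_holomorphic: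
  assumes cont: "continuous_on (closed_segment a b) k"
  shows "(\<lambda>w. contour_integral (linepath a b) (\<lambda>u. k u / (u - w))) holomorphic_on - closed_segment a b"
proof -
  define g where "g w = contour_integral (linepath a b) (\<lambda>u. k u / (u - w))" for w
  have integral: "((\<lambda>u. k u / (u - w) ^ 1) has_contour_integral g w) (linepath a b)"
    if "w \<in> UNIV - closed_segment a b" for w
    using that unfolding g_def power_one_right
    by (intro has_contour_integral_integral contour_integrable_continuous_linepath continuous_intros cont) auto
  have "(g has_field_derivative (of_nat 1 * contour_integral (linepath a b) (\<lambda>u. k u / (u - w) ^ Suc 1))) (at w)"
    if "w \<in> UNIV - closed_segment a b" for w
    by (rule Cauchy_next_derivative(2)[where S = UNIV and B = "norm (b - a)"])
      (use that integral cont in \<open>auto simp: vector_derivative_linepath_at\<close>)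
  then show ?thesis
    unfolding holomorphic_on_def field_differentiable_def g_def[symmetric]
    using has_field_derivative_at_within by blast
qed

lemma poisson_integral_is_Re_holomorphic:
  fixes \<phi> :: "real \<Rightarrow> real"
  assumes cont: "continuous_on UNIV \<phi>" and T: "T > 0"
  obtains f where "f holomorphic_on {z. Im z > 0}"
    "\<And>z. Im z > 0 \<Longrightarrow> Re (f z) = integral {-T..T} (\<lambda>u. \<phi> u * poisson_kernel (Re z) (Im z) u)"
proof -
  define \<gamma> where "\<gamma> = linepath (complex_of_real (-T)) (complex_of_real T)"
  define k where "k u = complex_of_real (\<phi> (Re u))" for u
  define g where "g w = contour_integral \<gamma> (\<lambda>u. k u / (u - w))" for w
  have k_cont: "continuous_on S k" for S
    unfolding k_def by (intro continuous_intros continuous_on_compose2[OF cont]) auto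
  have half_plane: "{z. Im z > 0} \<subseteq> - closed_segment (complex_of_real (-T)) (complex_of_real T)"
    unfolding closed_segment_of_real by auto
  show thesis
  proof
    have "g holomorphic_on {z. Im z > 0}"
      unfolding g_def \<gamma>_def
      by (rule holomorphic_on_subset[OF Cauchy_transform_linepath_holomorphic[OF k_cont] half_plane])
    then show "(\<lambda>z. - \<i> * g z) holomorphic_on {z. Im z > 0}" by (intro holomorphic_intros)
  next
    fix z assume z: "Im z > 0"
    have "((\<lambda>u. k u / (u - z)) has_contour_integral g z) \<gamma>"
      unfolding g_def \<gamma>_def using half_plane z
      by (intro has_contour_integral_integral contour_integrable_continuous_linepath continuous_intros k_cont) auto
    then have "((\<lambda>x. k (of_real x) / (of_real x - z)) has_integral g z) {-T..T}"
      unfolding \<gamma>_def using T by (subst (asm) has_contour_integral_linepath_Reals_iff) auto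
    from has_integral_linear[OF this bounded_linear_Im]
    have "((\<lambda>x. Im (k (of_real x) / (of_real x - z))) has_integral Im (g z)) {-T..T}" by (simp add: o_def)
    moreover have "Im (k (of_real x) / (of_real x - z)) = \<phi> x * poisson_kernel (Re z) (Im z) x" for x
      by (simp add: k_def Im_divide poisson_kernel_def power2_commute)
    ultimately show "Re (- \<i> * g z) = integral {-T..T} (\<lambda>u. \<phi> u * poisson_kernel (Re z) (Im z) u)"
      by (simp add: integral_unique)
  qed
qed

lemma half_plane_maximum_principle:
  fixes F :: "complex \<Rightarrow> complex"
  assumes holo: "F holomorphic_on {z. Im z > - \<delta>}" and \<delta>: "\<delta> > 0"
    and decay: "\<And>z. Im z \<ge> 0 \<Longrightarrow> norm (F z) \<le> C / (1 + norm z)"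
    and on_real: "\<And>x::real. norm (F (of_real x)) \<le> B" and B: "B > 0" and z: "Im z > 0"
  shows "norm (F z) \<le> B"
proof -
  define R where "R = max (norm z + 1) (C / B)"
  define S where "S = ball (0::complex) R \<inter> {w. Im w > 0}"
  have S_open: "open S" unfolding S_def by (intro open_Int open_halfspace_Im_gt) auto
  have closure_S: "closure S \<subseteq> cball 0 R \<inter> {w. Im w \<ge> 0}"
    by (rule closure_minimal) (auto simp: S_def intro!: closed_Int closed_halfspace_Im_ge)
  show ?thesis
  proof (rule maximum_modulus_frontier[of F S])
    show "F holomorphic_on interior S" unfolding interior_open[OF S_open]
      by (rule holomorphic_on_subset[OF holo]) (use \<delta> in \<open>auto simp: S_def\<close>)
    show "continuous_on (closure S) F"
      by (rule holomorphic_on_imp_continuous_on, rule holomorphic_on_subset[OF holo]) (use closure_S \<delta> in auto)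
    show "bounded S" by (auto simp: S_def)
    show "z \<in> S" using z by (auto simp: S_def R_def)
    fix w assume "w \<in> frontier S"
    then have w_frontier: "w \<in> closure S" "w \<notin> S" using S_open by (auto simp: frontier_def interior_open)
    then have w_closed: "norm w \<le> R" "Im w \<ge> 0" using closure_S by auto
    show "norm (F w) \<le> B"
    proof (cases "Im w = 0")
      case True
      then have "w = of_real (Re w)" by (simp add: complex_eq_iff)
      then show ?thesis using on_real by metis
    next
      case False
      then have w_norm: "norm w = R" using w_frontier w_closed by (auto simp: S_def)
      have R_pos: "R > 0" by (simp add: R_def less_max_iff_disj add_nonneg_pos)
      have "C / B \<le> R" by (simp add: R_def)
      then have "C \<le> B * (1 + R)" using B by (simp add: field_simps)
      then have "C / (1 + R) \<le> B" using R_pos by (simp add: field_simps)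
      then show ?thesis using decay[OF w_closed(2)] w_norm by simp
    qed
  qed
qed

definition decaying_exp_type :: "real \<Rightarrow> (complex \<Rightarrow> complex) \<Rightarrow> bool" where
  "decaying_exp_type b h \<longleftrightarrow> h holomorphic_on UNIV \<and>
     (\<exists>C. \<forall>z. norm (h z) \<le> C * exp (b * \<bar>Im z\<bar>) / (1 + norm z))"

lemma decaying_exp_type_upper_half_plane:
  assumes "decaying_exp_type b h"
  shows "\<exists>C. \<forall>w. Im w \<ge> 0 \<longrightarrow> norm (h w) * exp (- b * Im w) \<le> C / (1 + norm w)"
proof -
  obtain C where C: "\<And>z. norm (h z) \<le> C * exp (b * \<bar>Im z\<bar>) / (1 + norm z)"
    using assms by (auto simp: decaying_exp_type_def)
  have "norm (h w) * exp (- b * Im w) \<le> C / (1 + norm w)" if "Im w \<ge> 0" for w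
  proof -
    have "norm (h w) * exp (- b * Im w) \<le> (C * exp (b * \<bar>Im w\<bar>) / (1 + norm w)) * exp (- b * Im w)"
      by (intro mult_right_mono C) simp
    also have "\<dots> = C / (1 + norm w)" using that by (simp add: exp_minus)
    finally show ?thesis .
  qed
  then show ?thesis by blast
qed

lemma decaying_exp_type_reflect:
  assumes "decaying_exp_type b h"
  shows "decaying_exp_type b (\<lambda>z. cnj (h (cnj z)))"
proof -
  obtain C where holo: "h holomorphic_on UNIV" and C: "\<And>z. norm (h z) \<le> C * exp (b * \<bar>Im z\<bar>) / (1 + norm z)"
    using assms by (auto simp: decaying_exp_type_def)
  have "(cnj \<circ> h \<circ> cnj) holomorphic_on UNIV"
    by (rule holomorphic_on_compose_cnj_cnj) (use holo in \<open>auto intro: holomorphic_on_subset\<close>)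
  moreover have "norm (cnj (h (cnj z))) \<le> C * exp (b * \<bar>Im z\<bar>) / (1 + norm z)" for z
    using C[of "cnj z"] by simp
  ultimately show ?thesis unfolding decaying_exp_type_def o_def by blast
qed

locale lipschitz_bump =
  fixes \<phi> :: "real \<Rightarrow> real" and L T :: real
  assumes nonneg: "0 \<le> \<phi> x" and L_nonneg: "0 \<le> L" and lipschitz: "\<bar>\<phi> x - \<phi> y\<bar> \<le> L * \<bar>x - y\<bar>"
    and T_pos: "0 < T" and support: "\<bar>x\<bar> > T \<Longrightarrow> \<phi> x = 0"
begin

lemma continuous: "continuous_on S \<phi>"
  using lipschitz L_nonneg
  by (intro lipschitz_on_continuous_on[of L] lipschitz_onI) (auto simp: dist_real_def)

lemma bounded_above: "\<phi> x \<le> L * (2 * T + 2)"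
proof (cases "\<bar>x\<bar> \<le> T")
  case True
  then have "\<bar>x - (T + 1)\<bar> \<le> 2 * T + 2" by linarith
  then have "L * \<bar>x - (T + 1)\<bar> \<le> L * (2 * T + 2)" using L_nonneg by (rule mult_left_mono)
  moreover have "\<phi> (T + 1) = 0" using T_pos by (intro support) auto
  ultimately show ?thesis using lipschitz[of x "T + 1"] by linarith
qed (use support L_nonneg T_pos in simp)

definition poisson :: "real \<Rightarrow> real \<Rightarrow> real" where
  "poisson x y = 1 / pi * integral {-T..T} (\<lambda>u. \<phi> u * poisson_kernel x y u)"

lemma kernel_integrable: "y \<noteq> 0 \<Longrightarrow> (\<lambda>u. \<phi> u * poisson_kernel x y u) integrable_on {p..q}"
  by (intro integrable_continuous_interval continuous_intros continuous continuous_on_poisson_kernel)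

lemma poisson_nonneg: "y > 0 \<Longrightarrow> 0 \<le> poisson x y"
  unfolding poisson_def
  by (intro mult_nonneg_nonneg integral_nonneg kernel_integrable) (auto simp: nonneg poisson_kernel_nonneg)

lemma poisson_ge_window:
  assumes \<eta>: "\<eta> > 0" and large: "\<phi> x > L * \<eta>" and y: "y > 0"
  shows "(\<phi> x - L * \<eta>) * (2 / pi * arctan (\<eta> / y)) \<le> poisson x y"
proof -
  have near: "\<phi> x - L * \<eta> \<le> \<phi> u" if "u \<in> {x - \<eta>..x + \<eta>}" for u
  proof -
    have "\<bar>x - u\<bar> \<le> \<eta>" using that by (auto simp: abs_if)
    then have "L * \<bar>x - u\<bar> \<le> L * \<eta>" using L_nonneg by (rule mult_left_mono)
    then show ?thesis using lipschitz[of x u] by linarith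
  qed
  have window: "{x - \<eta>..x + \<eta>} \<subseteq> {-T..T}"
  proof
    fix u assume "u \<in> {x - \<eta>..x + \<eta>}"
    then have "\<phi> u > 0" using near large by fastforce
    then have "\<not> \<bar>u\<bar> > T" using support by force
    then show "u \<in> {-T..T}" by auto
  qed
  have "(\<phi> x - L * \<eta>) * (2 * arctan (\<eta> / y)) \<le> integral {x - \<eta>..x + \<eta>} (\<lambda>u. \<phi> u * poisson_kernel x y u)"
  proof (rule has_integral_le)
    show "((\<lambda>u. (\<phi> x - L * \<eta>) * poisson_kernel x y u) has_integral (\<phi> x - L * \<eta>) * (2 * arctan (\<eta> / y))) {x - \<eta>..x + \<eta>}"
      by (intro has_integral_mult_right poisson_kernel_window y \<eta>)
    show "((\<lambda>u. \<phi> u * poisson_kernel x y u) has_integral integral {x - \<eta>..x + \<eta>} (\<lambda>u. \<phi> u * poisson_kernel x y u)) {x - \<eta>..x + \<eta>}"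
      using y by (intro integrable_integral kernel_integrable) auto
  qed (use near y in \<open>auto intro!: mult_right_mono poisson_kernel_nonneg\<close>)
  also have "\<dots> \<le> integral {-T..T} (\<lambda>u. \<phi> u * poisson_kernel x y u)"
    by (rule integral_subset_le[OF window kernel_integrable kernel_integrable])
      (use y in \<open>auto simp: nonneg poisson_kernel_nonneg\<close>)
  finally have "1 / pi * ((\<phi> x - L * \<eta>) * (2 * arctan (\<eta> / y))) \<le> poisson x y"
    unfolding poisson_def by (intro mult_left_mono) auto
  then show ?thesis by simp
qed

definition smoothing_error :: "real \<Rightarrow> real" where
  "smoothing_error \<delta> = L * sqrt \<delta> + L * (2 * T + 2) * (1 - 2 / pi * arctan (1 / sqrt \<delta>))"

lemma le_poisson_add_error:
  assumes \<delta>: "\<delta> > 0"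
  shows "\<phi> x - poisson x \<delta> \<le> smoothing_error \<delta>"
proof -
  define q where "q = 2 / pi * arctan (1 / sqrt \<delta>)"
  have "2 / pi * arctan (1 / sqrt \<delta>) \<le> 2 / pi * (pi / 2)"
    using arctan_ubound by (intro mult_left_mono less_imp_le) auto
  then have q: "0 \<le> q" "q \<le> 1" using \<delta> by (simp_all add: q_def)
  have bound_nonneg: "0 \<le> L * (2 * T + 2)" using L_nonneg T_pos by simp
  show ?thesis
  proof (cases "\<phi> x \<le> L * sqrt \<delta>")
    case True
    have "0 \<le> L * (2 * T + 2) * (1 - q)" using bound_nonneg q by simp
    then show ?thesis using True poisson_nonneg[OF \<delta>, of x] unfolding smoothing_error_def q_def by linarith
  next
    case False
    have "sqrt \<delta> / \<delta> = 1 / sqrt \<delta>" using \<delta> by (simp add: field_simps)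
    then have "(\<phi> x - L * sqrt \<delta>) * q \<le> poisson x \<delta>"
      using poisson_ge_window[of "sqrt \<delta>" x \<delta>] False \<delta> by (simp add: q_def)
    then have "\<phi> x - poisson x \<delta> \<le> \<phi> x * (1 - q) + L * sqrt \<delta> * q" by (simp add: algebra_simps)
    also have "\<dots> \<le> L * (2 * T + 2) * (1 - q) + L * sqrt \<delta> * 1"
      using bounded_above q L_nonneg \<delta> by (intro add_mono mult_right_mono mult_left_mono) auto
    finally show ?thesis by (simp add: smoothing_error_def q_def)
  qed
qed

lemma smoothing_error_tendsto: "(smoothing_error \<longlongrightarrow> 0) (at_right 0)"
proof -
  have sqrt_lim: "(sqrt \<longlongrightarrow> 0) (at_right 0)"
    using tendsto_real_sqrt[OF tendsto_ident_at[of 0 "{0<..}"]] by simp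
  have "filterlim sqrt (at_right 0) (at_right 0)"
    unfolding filterlim_at using sqrt_lim by (auto simp: eventually_at intro!: exI[of _ 1])
  then have "filterlim (\<lambda>\<delta>. inverse (sqrt \<delta>)) at_top (at_right 0)"
    by (rule filterlim_compose[OF filterlim_inverse_at_top_right])
  then have "((\<lambda>\<delta>. arctan (1 / sqrt \<delta>)) \<longlongrightarrow> pi / 2) (at_right 0)"
    using filterlim_compose[OF tendsto_arctan_at_top] by (simp add: inverse_eq_divide)
  then have "((\<lambda>\<delta>. L * sqrt \<delta> + L * (2 * T + 2) * (1 - 2 / pi * arctan (1 / sqrt \<delta>)))
      \<longlongrightarrow> L * 0 + L * (2 * T + 2) * (1 - 2 / pi * (pi / 2))) (at_right 0)"
    by (intro tendsto_intros sqrt_lim)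
  then show ?thesis by (simp add: smoothing_error_def[abs_def])
qed

lemma poisson_raise_le:
  assumes y: "y > 0" and \<delta>: "\<delta> > 0"
  shows "poisson x (y + \<delta>) \<le> (y + \<delta>) / y * poisson x y"
proof -
  have "integral {-T..T} (\<lambda>u. \<phi> u * poisson_kernel x (y + \<delta>) u)
      \<le> integral {-T..T} (\<lambda>u. (y + \<delta>) / y * (\<phi> u * poisson_kernel x y u))"
  proof (intro integral_le kernel_integrable integrable_on_mult_right)
    fix u
    have "\<phi> u * (y + \<delta>) / ((x - u)\<^sup>2 + (y + \<delta>)\<^sup>2) \<le> \<phi> u * (y + \<delta>) / ((x - u)\<^sup>2 + y\<^sup>2)"
      using nonneg[of u] y \<delta>
      by (intro divide_left_mono add_left_mono power_mono mult_pos_pos) (auto intro!: add_nonneg_pos)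
    then show "\<phi> u * poisson_kernel x (y + \<delta>) u \<le> (y + \<delta>) / y * (\<phi> u * poisson_kernel x y u)"
      using y by (simp add: poisson_kernel_def mult_ac)
  qed (use y \<delta> in auto)
  also have "\<dots> = (y + \<delta>) / y * integral {-T..T} (\<lambda>u. \<phi> u * poisson_kernel x y u)"
    by (rule integral_mult_right)
  finally have "1 / pi * integral {-T..T} (\<lambda>u. \<phi> u * poisson_kernel x (y + \<delta>) u)
      \<le> 1 / pi * ((y + \<delta>) / y * integral {-T..T} (\<lambda>u. \<phi> u * poisson_kernel x y u))"
    by (rule mult_left_mono) simp
  then show ?thesis by (simp add: poisson_def mult_ac)
qed

text \<open>The boundary values of \<open>exp (- f)\<close>, where \<open>Re f\<close> is the Poisson integral, are avoided by raising the
  argument by \<open>i \<delta>\<close>; the error \<open>smoothing_error \<delta>\<close> tends to 0.\<close>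

lemma norm_le_raised_poisson:
  assumes h: "decaying_exp_type b h" and major: "\<And>x::real. norm (h (of_real x)) \<le> exp (\<phi> x)"
    and z: "Im z > 0" and \<delta>: "\<delta> > 0"
  shows "norm (h z) \<le> exp (b * Im z + smoothing_error \<delta> + poisson (Re z) (Im z + \<delta>))"
proof -
  have holo: "h holomorphic_on UNIV" using h by (simp add: decaying_exp_type_def)
  obtain C where C: "\<And>w. Im w \<ge> 0 \<Longrightarrow> norm (h w) * exp (- b * Im w) \<le> C / (1 + norm w)"
    using decaying_exp_type_upper_half_plane[OF h] by blast
  obtain f where f_holo: "f holomorphic_on {z. Im z > 0}"
    and "\<And>z. Im z > 0 \<Longrightarrow> Re (f z) = integral {-T..T} (\<lambda>u. \<phi> u * poisson_kernel (Re z) (Im z) u)"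
    using poisson_integral_is_Re_holomorphic[OF continuous T_pos] by blast
  then have Re_f: "1 / pi * Re (f (w + \<i> * of_real \<delta>)) = poisson (Re w) (Im w + \<delta>)" if "Im w \<ge> 0" for w
    using that \<delta> by (simp add: poisson_def)
  define F where "F w = h w * exp (\<i> * of_real b * w)
      * exp (- (of_real (1/pi) * f (w + \<i> * of_real \<delta>)))" for w
  have norm_F: "norm (F w) = norm (h w) * exp (- b * Im w) * exp (- poisson (Re w) (Im w + \<delta>))"
    if "Im w \<ge> 0" for w
    using Re_f[OF that] by (simp add: F_def norm_mult norm_exp_eq_Re)
  have "norm (F z) \<le> exp (smoothing_error \<delta>)"
  proof (rule half_plane_maximum_principle[of F \<delta> C])
    have "(\<lambda>w. f (w + \<i> * of_real \<delta>)) holomorphic_on {z. Im z > - \<delta>}"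
      by (rule holomorphic_on_compose_gen[OF _ f_holo, unfolded o_def]) (auto intro!: holomorphic_intros)
    then show "F holomorphic_on {z. Im z > - \<delta>}"
      unfolding F_def by (intro holomorphic_intros holomorphic_on_subset[OF holo]) auto
  next
    fix w assume w: "Im w \<ge> 0"
    have "norm (F w) \<le> norm (h w) * exp (- b * Im w) * 1"
      unfolding norm_F[OF w] using poisson_nonneg[of "Im w + \<delta>"] w \<delta> by (intro mult_left_mono) auto
    also have "\<dots> \<le> C / (1 + norm w)" using C[OF w] by simp
    finally show "norm (F w) \<le> C / (1 + norm w)" .
  next
    fix x :: real
    have "norm (F (of_real x)) \<le> exp (\<phi> x) * exp (- poisson x \<delta>)"
      using norm_F[of "of_real x"] major[of x] by simp
    also have "\<dots> \<le> exp (smoothing_error \<delta>)"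
      using le_poisson_add_error[OF \<delta>] by (simp add: exp_add[symmetric])
    finally show "norm (F (of_real x)) \<le> exp (smoothing_error \<delta>)" .
  qed (use \<delta> z in auto)
  then have "norm (F z) * exp (b * Im z + poisson (Re z) (Im z + \<delta>))
      \<le> exp (smoothing_error \<delta>) * exp (b * Im z + poisson (Re z) (Im z + \<delta>))"
    by (rule mult_right_mono) simp
  moreover have "norm (F z) * exp (b * Im z + poisson (Re z) (Im z + \<delta>)) = norm (h z)"
    using z unfolding norm_F[OF less_imp_le[OF z]] mult.assoc exp_add[symmetric] by simp
  ultimately show ?thesis by (simp add: exp_add[symmetric] add_ac)
qed

lemma norm_le_poisson_upper:
  assumes h: "decaying_exp_type b h" and major: "\<And>x::real. norm (h (of_real x)) \<le> exp (\<phi> x)" and z: "Im z > 0"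
  shows "norm (h z) \<le> exp (b * Im z + poisson (Re z) (Im z))"
proof -
  let ?bound = "\<lambda>\<delta>. exp (b * Im z + smoothing_error \<delta> + (Im z + \<delta>) / Im z * poisson (Re z) (Im z))"
  have "(?bound \<longlongrightarrow> exp (b * Im z + 0 + (Im z + 0) / Im z * poisson (Re z) (Im z))) (at_right 0)"
    using z by (intro tendsto_intros smoothing_error_tendsto) auto
  then have "norm (h z) \<le> exp (b * Im z + 0 + (Im z + 0) / Im z * poisson (Re z) (Im z))"
  proof (rule tendsto_lowerbound)
    have "norm (h z) \<le> ?bound \<delta>" if "\<delta> > 0" for \<delta>
      using norm_le_raised_poisson[OF h major z that] poisson_raise_le[OF z that, of "Re z"]
      by (elim order.trans) simp
    then show "\<forall>\<^sub>F \<delta> in at_right 0. norm (h z) \<le> ?bound \<delta>"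
      by (auto simp: eventually_at intro!: exI[of _ 1])
  qed simp
  then show ?thesis using z by simp
qed

lemma norm_le_poisson:
  assumes h: "decaying_exp_type b h" and major: "\<And>x::real. norm (h (of_real x)) \<le> exp (\<phi> x)" and z: "Im z \<noteq> 0"
  shows "norm (h z) \<le> exp (b * \<bar>Im z\<bar> + poisson (Re z) \<bar>Im z\<bar>)"
proof (cases "Im z > 0")
  case True
  then show ?thesis using norm_le_poisson_upper[OF h major True] by simp
next
  case False
  then have "Im (cnj z) > 0" using z by simp
  from norm_le_poisson_upper[OF decaying_exp_type_reflect[OF h] _ this]
  show ?thesis using major False by simp
qed

lemma norm_le_exp_of_nn_integral:
  assumes h: "decaying_exp_type b h" and major: "\<And>x::real. norm (h (of_real x)) \<le> exp (\<phi> x)" and z: "Im z \<noteq> 0"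
    and r: "r \<ge> 0" "(\<integral>\<^sup>+u. ennreal (\<phi> u * poisson_kernel (Re z) \<bar>Im z\<bar> u) \<partial>lborel) \<le> ennreal r"
  shows "norm (h z) \<le> exp (b * \<bar>Im z\<bar> + r / pi)"
proof -
  let ?g = "\<lambda>u. \<phi> u * poisson_kernel (Re z) \<bar>Im z\<bar> u"
  have g_nonneg: "?g u \<ge> 0" for u by (simp add: nonneg poisson_kernel_nonneg)
  have "(?g has_integral integral {-T..T} ?g) {-T..T}"
    using z by (intro integrable_integral kernel_integrable) auto
  from nn_integral_has_integral_lebesgue'[OF _ this]
  have "ennreal (integral {-T..T} ?g) = (\<integral>\<^sup>+u. ennreal (?g u) * indicator {-T..T} u \<partial>lborel)"
    using g_nonneg by simp
  also have "\<dots> \<le> (\<integral>\<^sup>+u. ennreal (?g u) \<partial>lborel)"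
    by (intro nn_integral_mono) (auto simp: indicator_def)
  also have "\<dots> \<le> ennreal r" by (rule r)
  finally have "integral {-T..T} ?g \<le> r" using r(1) by (simp add: ennreal_le_iff)
  then have "poisson (Re z) \<bar>Im z\<bar> \<le> r / pi" by (simp add: poisson_def divide_right_mono)
  then show ?thesis using norm_le_poisson[OF h major z] by (elim order.trans) simp
qed

end

section \<open>Lipschitz majorants\<close>

definition bump :: "(real \<Rightarrow> real) \<Rightarrow> bool" where
  "bump u \<longleftrightarrow> continuous_on UNIV u \<and> (\<forall>x. 0 \<le> u x) \<and> (\<exists>T. \<forall>x. \<bar>x\<bar> > T \<longrightarrow> u x = 0)"

definition lip_majorant :: "(real \<Rightarrow> real) \<Rightarrow> real \<Rightarrow> real" where
  "lip_majorant u x = (SUP t. u t - \<bar>x - t\<bar>)"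

lemma bump_bounded:
  assumes "bump u"
  obtains B where "B > 0" "\<And>x. u x \<le> B"
proof -
  obtain T where T: "\<And>x. \<bar>x\<bar> > T \<Longrightarrow> u x = 0" using assms by (auto simp: bump_def)
  have "compact (u ` {-T..T})"
    using assms by (intro compact_continuous_image) (auto simp: bump_def intro: continuous_on_subset)
  then have "bounded (u ` {-T..T})" by (rule compact_imp_bounded)
  then obtain B where B: "B > 0" "\<And>y. y \<in> u ` {-T..T} \<Longrightarrow> norm y \<le> B" by (auto simp: bounded_pos)
  have "u x \<le> B" for x
  proof (cases "\<bar>x\<bar> > T")
    case False
    then have "x \<in> {-T..T}" by auto
    then have "norm (u x) \<le> B" using B by blast
    then show ?thesis by simp
  qed (use T B in auto)
  with B that show thesis by blast
qed

lemma lip_majorant_attained: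
  assumes u: "bump u"
  obtains t where "lip_majorant u x = u t - \<bar>x - t\<bar>" "\<And>t'. u t' - \<bar>x - t'\<bar> \<le> u t - \<bar>x - t\<bar>"
proof -
  obtain B where B: "B > 0" "\<And>x. u x \<le> B" using bump_bounded[OF u] by blast
  have "\<exists>t\<in>{x-B..x+B}. \<forall>t'\<in>{x-B..x+B}. u t' - \<bar>x - t'\<bar> \<le> u t - \<bar>x - t\<bar>"
  proof (rule continuous_attains_sup)
    show "continuous_on {x-B..x+B} (\<lambda>t. u t - \<bar>x - t\<bar>)"
      using u by (intro continuous_intros) (auto simp: bump_def intro: continuous_on_subset)
  qed (use B in auto)
  then obtain t where t: "\<And>t'. t'\<in>{x-B..x+B} \<Longrightarrow> u t' - \<bar>x - t'\<bar> \<le> u t - \<bar>x - t\<bar>" by blast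
  have maximal: "u t' - \<bar>x - t'\<bar> \<le> u t - \<bar>x - t\<bar>" for t'
  proof (cases "t' \<in> {x-B..x+B}")
    case False
    then have "\<bar>x - t'\<bar> > B" by auto
    then have "u t' - \<bar>x - t'\<bar> \<le> 0" using B(2)[of t'] by linarith
    also have "0 \<le> u x - \<bar>x - x\<bar>" using u by (simp add: bump_def)
    also have "\<dots> \<le> u t - \<bar>x - t\<bar>" by (rule t) (use B in auto)
    finally show ?thesis .
  qed (rule t)
  then have "lip_majorant u x = u t - \<bar>x - t\<bar>"
    unfolding lip_majorant_def by (intro cSup_eq_maximum) auto
  with maximal that show thesis by blast
qed

lemma lip_majorant_ge:
  assumes "bump u" shows "u t - \<bar>x - t\<bar> \<le> lip_majorant u x"
proof -
  obtain t0 where "lip_majorant u x = u t0 - \<bar>x - t0\<bar>" "\<And>t'. u t' - \<bar>x - t'\<bar> \<le> u t0 - \<bar>x - t0\<bar>"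
    using lip_majorant_attained[OF assms] by blast
  then show ?thesis by simp
qed

lemma lip_majorant_ge_self: "bump u \<Longrightarrow> u x \<le> lip_majorant u x"
  using lip_majorant_ge[of u x x] by simp

lemma lip_majorant_nonneg: "bump u \<Longrightarrow> 0 \<le> lip_majorant u x"
  using lip_majorant_ge_self[of u x] by (auto simp: bump_def intro: order.trans)

lemma lip_majorant_lipschitz:
  assumes "bump u" shows "\<bar>lip_majorant u x - lip_majorant u y\<bar> \<le> \<bar>x - y\<bar>"
proof -
  have one_sided: "lip_majorant u x \<le> lip_majorant u y + \<bar>x - y\<bar>" for x y
  proof -
    obtain t where "lip_majorant u x = u t - \<bar>x - t\<bar>" using lip_majorant_attained[OF assms] by blast
    then show ?thesis using lip_majorant_ge[OF assms, of t y] by linarith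
  qed
  show ?thesis using one_sided[of x y] one_sided[of y x] by linarith
qed

lemma lip_majorant_le_add:
  assumes "bump u" "bump v" "\<And>x. u x \<le> v x + e"
  shows "lip_majorant u x \<le> lip_majorant v x + e"
proof -
  obtain t where "lip_majorant u x = u t - \<bar>x - t\<bar>" using lip_majorant_attained[OF assms(1)] by blast
  then show ?thesis using lip_majorant_ge[OF assms(2), of t x] assms(3)[of t] by linarith
qed

lemma lip_majorant_support:
  assumes u: "bump u"
  obtains T where "T > 0" "\<And>x. \<bar>x\<bar> > T \<Longrightarrow> lip_majorant u x = 0"
proof -
  obtain B where B: "B > 0" "\<And>x. u x \<le> B" using bump_bounded[OF u] by blast
  obtain T where T: "\<And>x. \<bar>x\<bar> > T \<Longrightarrow> u x = 0" using assms by (auto simp: bump_def)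
  have "lip_majorant u x = 0" if x: "\<bar>x\<bar> > \<bar>T\<bar> + B" for x
  proof -
    obtain t where t: "lip_majorant u x = u t - \<bar>x - t\<bar>" using lip_majorant_attained[OF u] by blast
    have "lip_majorant u x \<le> 0"
    proof (cases "\<bar>t\<bar> > T")
      case True then show ?thesis using T t by simp
    next
      case False then show ?thesis using t x B(2)[of t] by linarith
    qed
    then show ?thesis using lip_majorant_nonneg[OF u, of x] by linarith
  qed
  then show thesis using that[of "\<bar>T\<bar> + B"] B by force
qed

lemma lip_majorant_contact:
  assumes u: "bump u"
  obtains t where "lip_majorant u t = u t" "lip_majorant u x = lip_majorant u t - \<bar>x - t\<bar>"
proof -
  obtain t where t: "lip_majorant u x = u t - \<bar>x - t\<bar>" using lip_majorant_attained[OF u] by blast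
  have "lip_majorant u t \<le> u t" using lip_majorant_lipschitz[OF u, of x t] t by linarith
  then have "lip_majorant u t = u t" using lip_majorant_ge_self[OF u, of t] by linarith
  with t that show thesis by simp
qed

lemma lipschitz_bump_lip_majorant:
  assumes u: "bump u" and c: "c \<ge> 0"
  obtains T where "lipschitz_bump (\<lambda>x. c * lip_majorant u x) c T"
proof -
  obtain T where T: "T > 0" "\<And>x. \<bar>x\<bar> > T \<Longrightarrow> lip_majorant u x = 0" using lip_majorant_support[OF u] by blast
  have "\<bar>c * lip_majorant u x - c * lip_majorant u y\<bar> \<le> c * \<bar>x - y\<bar>" for x y
  proof -
    have "\<bar>c * lip_majorant u x - c * lip_majorant u y\<bar> = c * \<bar>lip_majorant u x - lip_majorant u y\<bar>"
      using c by (simp add: right_diff_distrib[symmetric] abs_mult)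
    then show ?thesis using lip_majorant_lipschitz[OF u, of x y] c by (simp add: mult_left_mono)
  qed
  then have "lipschitz_bump (\<lambda>x. c * lip_majorant u x) c T"
    by unfold_locales (use T c lip_majorant_nonneg[OF u] in auto)
  then show thesis by (rule that)
qed

section \<open>Integrals against inverse squares\<close>

definition weight :: "real \<Rightarrow> real \<Rightarrow> real" where
  "weight X x = 1 / (X\<^sup>2 + x\<^sup>2)"

definition weighted_mass :: "real \<Rightarrow> (real \<Rightarrow> real) \<Rightarrow> ennreal" where
  "weighted_mass X f = (\<integral>\<^sup>+x. ennreal (f x * weight X x) \<partial>lborel)"

definition window_mass :: "(real \<Rightarrow> real) \<Rightarrow> real \<Rightarrow> real \<Rightarrow> ennreal" where
  "window_mass f t r = (\<integral>\<^sup>+x. ennreal (f x) * indicator {x. \<bar>x - t\<bar> < r} x \<partial>lborel)"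

definition tail_mass :: "(real \<Rightarrow> real) \<Rightarrow> real \<Rightarrow> real \<Rightarrow> ennreal" where
  "tail_mass f t r = (\<integral>\<^sup>+y. ennreal (f y / (y - t)\<^sup>2) * indicator {y. \<bar>y - t\<bar> > r} y \<partial>lborel)"

lemma weight_denominator_pos: "(X::real) \<ge> 1 \<Longrightarrow> 0 < X\<^sup>2 + x\<^sup>2"
  by (simp add: add_pos_nonneg)

lemma weight_pos: "X \<ge> 1 \<Longrightarrow> 0 < weight X x"
  using weight_denominator_pos[of X x] by (simp add: weight_def)

lemma weight_le_one:
  assumes "X \<ge> 1" shows "weight X x \<le> 1"
proof -
  have "1 \<le> X\<^sup>2" using assms by (simp add: one_le_power)
  then show ?thesis by (simp add: weight_def divide_le_eq add_increasing2)
qed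

lemma weight_measurable [measurable]: "weight X \<in> borel_measurable borel"
  unfolding weight_def by measurable

lemma weight_comparison:
  assumes X: "X \<ge> 1" and near: "X + \<bar>t\<bar> \<le> 2 * (X + \<bar>x\<bar>)"
  shows "weight X x \<le> 8 * weight X t"
proof -
  have square: "(X + \<bar>y\<bar>)\<^sup>2 = X\<^sup>2 + y\<^sup>2 + 2 * (X * \<bar>y\<bar>)" for y by (simp add: power2_sum)
  have "0 \<le> (X - \<bar>x\<bar>)\<^sup>2" by simp
  then have "2 * (X * \<bar>x\<bar>) \<le> X\<^sup>2 + x\<^sup>2" by (simp add: power2_diff)
  then have "(X + \<bar>x\<bar>)\<^sup>2 \<le> 2 * (X\<^sup>2 + x\<^sup>2)" unfolding square by simp
  moreover have "X\<^sup>2 + t\<^sup>2 \<le> (X + \<bar>t\<bar>)\<^sup>2" unfolding square using X by simp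
  moreover have "(X + \<bar>t\<bar>)\<^sup>2 \<le> (2 * (X + \<bar>x\<bar>))\<^sup>2" using near X by (intro power_mono) auto
  then have "(X + \<bar>t\<bar>)\<^sup>2 \<le> 4 * (X + \<bar>x\<bar>)\<^sup>2" by (simp only: power_mult_distrib) simp
  ultimately have "X\<^sup>2 + t\<^sup>2 \<le> 8 * (X\<^sup>2 + x\<^sup>2)" by linarith
  then show ?thesis
    unfolding weight_def using weight_denominator_pos[OF X, of x] weight_denominator_pos[OF X, of t]
    by (simp add: field_simps)
qed

lemma weighted_mass_tends_to_zero:
  assumes q: "q \<in> borel_measurable borel" "\<And>x. q x \<ge> 0"
    and fin: "weighted_mass 1 q < top" and \<epsilon>: "\<epsilon> > 0"
  obtains X where "X \<ge> 1" "weighted_mass X q < ennreal \<epsilon>"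
proof -
  note q(1)[measurable]
  have "(\<lambda>n. \<integral>\<^sup>+x. ennreal (q x * weight (real n + 1) x) \<partial>lborel) \<longlonglongrightarrow> (\<integral>\<^sup>+x. 0 \<partial>(lborel :: real measure))"
  proof (rule nn_integral_dominated_convergence[where w = "\<lambda>x. ennreal (q x * weight 1 x)"])
    show "AE x in lborel. ennreal (q x * weight (real n + 1) x) \<le> ennreal (q x * weight 1 x)" for n
    proof (intro AE_I2 ennreal_leI mult_left_mono q)
      fix x
      have "1 \<le> (real n + 1)\<^sup>2" by (simp add: one_le_power)
      then show "weight (real n + 1) x \<le> weight 1 x"
        unfolding weight_def by (intro divide_left_mono mult_pos_pos) (auto intro!: add_pos_nonneg)
    qed
    show "AE x in lborel. (\<lambda>n. ennreal (q x * weight (real n + 1) x)) \<longlonglongrightarrow> 0"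
    proof (rule AE_I2)
      fix x
      have "(\<lambda>n. weight (real n + 1) x) \<longlonglongrightarrow> 0" unfolding weight_def by real_asymp
      then have "(\<lambda>n. ennreal (q x * weight (real n + 1) x)) \<longlonglongrightarrow> ennreal (q x * 0)"
        by (intro tendsto_ennrealI tendsto_mult tendsto_const)
      then show "(\<lambda>n. ennreal (q x * weight (real n + 1) x)) \<longlonglongrightarrow> 0" by simp
    qed
  qed (use fin in \<open>auto simp: weighted_mass_def\<close>)
  then have "(\<lambda>n. weighted_mass (real n + 1) q) \<longlonglongrightarrow> 0" by (simp add: weighted_mass_def)
  then have "eventually (\<lambda>n. weighted_mass (real n + 1) q < ennreal \<epsilon>) sequentially"
    by (rule order_tendstoD(2)) (use \<epsilon> in simp)
  then obtain n where "weighted_mass (real n + 1) q < ennreal \<epsilon>" by (auto simp: eventually_sequentially)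
  then show thesis using that[of "real n + 1"] by simp
qed

lemma nn_integral_inverse_square_tail:
  fixes y r :: real
  assumes r: "r > 0"
  shows "(\<integral>\<^sup>+u. ennreal (1 / (u - y)\<^sup>2) * indicator {u. \<bar>u - y\<bar> \<ge> r} u \<partial>lborel) \<le> ennreal (2 / r)"
proof -
  have right: "(\<integral>\<^sup>+u. ennreal (1 / (u - y)\<^sup>2) * indicator {y + r..} u \<partial>lborel) = ennreal (1 / r)"
  proof -
    have "(\<integral>\<^sup>+u. ennreal (1 / (u - y)\<^sup>2) * indicator {y + r..} u \<partial>lborel) = ennreal (0 - (- 1 / (y + r - y)))"
    proof (rule nn_integral_FTC_atLeast)
      show "((\<lambda>u. - 1 / (u - y)) has_real_derivative 1 / (u - y)\<^sup>2) (at u)" if "y + r \<le> u" for u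
        using that r by (auto intro!: derivative_eq_intros simp: power2_eq_square)
      show "((\<lambda>u. - 1 / (u - y)) \<longlongrightarrow> 0) at_top" by real_asymp
    qed auto
    then show ?thesis by simp
  qed
  have left: "(\<integral>\<^sup>+u. ennreal (1 / (u - y)\<^sup>2) * indicator {..y - r} u \<partial>lborel) = ennreal (1 / r)"
  proof -
    have "(\<integral>\<^sup>+u. ennreal (1 / (u - y)\<^sup>2) * indicator {..y - r} u \<partial>lborel)
       = (\<integral>\<^sup>+u. ennreal (1 / (u - y)\<^sup>2) * indicator {y + r..} u \<partial>lborel)"
      by (subst nn_integral_real_affine[where c = "-1" and t = "2 * y"])
        (auto intro!: nn_integral_cong simp: power2_eq_square indicator_def algebra_simps)
    then show ?thesis using right by simp
  qed
  have "(\<integral>\<^sup>+u. ennreal (1 / (u - y)\<^sup>2) * indicator {u. \<bar>u - y\<bar> \<ge> r} u \<partial>lborel)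
     \<le> (\<integral>\<^sup>+u. ennreal (1 / (u - y)\<^sup>2) * indicator {y + r..} u + ennreal (1 / (u - y)\<^sup>2) * indicator {..y - r} u \<partial>lborel)"
    by (intro nn_integral_mono) (auto simp: indicator_def)
  also have "\<dots> = ennreal (1 / r) + ennreal (1 / r)"
    by (subst nn_integral_add) (auto simp: left right)
  also have "\<dots> = ennreal (2 / r)" using r by (simp flip: ennreal_plus)
  finally show ?thesis .
qed

lemma disjoint_sum_indicator_le:
  fixes g :: ennreal
  assumes "finite C" "\<And>t t'. t \<in> C \<Longrightarrow> t' \<in> C \<Longrightarrow> u \<in> A t \<Longrightarrow> u \<in> A t' \<Longrightarrow> t = t'"
    "\<And>t. t \<in> C \<Longrightarrow> u \<in> A t \<Longrightarrow> g \<le> f"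
  shows "(\<Sum>t\<in>C. g * indicator (A t) u) \<le> f"
proof (cases "\<exists>t\<in>C. u \<in> A t")
  case True
  then obtain t where t: "t \<in> C" "u \<in> A t" by blast
  have "(\<Sum>t'\<in>C. g * indicator (A t') u) = (\<Sum>t'\<in>C. if t' = t then g else 0)"
    by (rule sum.cong) (use assms t in \<open>auto simp: indicator_def\<close>)
  also have "\<dots> = g" using assms(1) t by simp
  finally show ?thesis using assms(3)[OF t] by simp
qed (auto simp: indicator_def)

lemma inverse_square_ball_ge:
  fixes y t s :: real
  assumes s: "s > 0" and far: "3 * s \<le> \<bar>y - t\<bar>"
  shows "ennreal (s / (2 * (y - t)\<^sup>2))
      \<le> (\<integral>\<^sup>+u. ennreal (1 / (u - y)\<^sup>2) * indicator {u. \<bar>u - t\<bar> < s} u \<partial>lborel)"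
proof -
  have ball: "{u. \<bar>u - t\<bar> < s} = {t - s<..<t + s}" by (auto simp: abs_less_iff)
  have "ennreal (s / (2 * (y - t)\<^sup>2))
      = (\<integral>\<^sup>+u. ennreal (1 / (4 * (y - t)\<^sup>2)) * indicator {u. \<bar>u - t\<bar> < s} u \<partial>lborel)"
    unfolding ball
    using s by (simp add: nn_integral_cmult_indicator ennreal_mult[symmetric] del: ennreal_le_iff)
  also have "\<dots> \<le> (\<integral>\<^sup>+u. ennreal (1 / (u - y)\<^sup>2) * indicator {u. \<bar>u - t\<bar> < s} u \<partial>lborel)"
  proof (rule nn_integral_mono)
    fix u
    show "ennreal (1 / (4 * (y - t)\<^sup>2)) * indicator {u. \<bar>u - t\<bar> < s} u
        \<le> ennreal (1 / (u - y)\<^sup>2) * indicator {u. \<bar>u - t\<bar> < s} u"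
    proof (cases "\<bar>u - t\<bar> < s")
      case True
      have "\<bar>u - y\<bar> \<le> \<bar>u - t\<bar> + \<bar>y - t\<bar>" "\<bar>y - t\<bar> \<le> \<bar>u - y\<bar> + \<bar>u - t\<bar>" by linarith+
      then have uy: "\<bar>u - y\<bar> \<le> 2 * \<bar>y - t\<bar>" "\<bar>u - y\<bar> > 0" and "\<bar>y - t\<bar> > 0" using True far s by linarith+
      have "(u - y)\<^sup>2 \<le> (2 * \<bar>y - t\<bar>)\<^sup>2" using uy(1) by (metis abs_ge_zero power2_abs power_mono)
      then have "(u - y)\<^sup>2 \<le> 4 * (y - t)\<^sup>2" by (simp add: power_mult_distrib)
      then have "1 / (4 * (y - t)\<^sup>2) \<le> 1 / (u - y)\<^sup>2"
        using uy(2) \<open>\<bar>y - t\<bar> > 0\<close> by (intro divide_left_mono mult_pos_pos) auto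
      then show ?thesis using True by (simp add: ennreal_leI)
    qed simp
  qed
  finally show ?thesis .
qed

lemma disjoint_balls_inverse_square_sum:
  fixes s :: "real \<Rightarrow> real"
  assumes fin: "finite C" and s: "\<And>t. t \<in> C \<Longrightarrow> s t > 0"
    and disj: "\<And>t t' u. t \<in> C \<Longrightarrow> t' \<in> C \<Longrightarrow> \<bar>u - t\<bar> < s t \<Longrightarrow> \<bar>u - t'\<bar> < s t' \<Longrightarrow> t = t'"
    and K: "K \<ge> 4" and Y: "Y > 0"
    and small: "\<And>t. t \<in> C \<Longrightarrow> K * s t < Y" and far: "\<And>t. t \<in> C \<Longrightarrow> \<bar>y - t\<bar> \<ge> Y - s t"
  shows "(\<Sum>t\<in>C. (s t)\<^sup>2 / (y - t)\<^sup>2) \<le> 8 / K"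
proof -
  let ?f = "\<lambda>u. ennreal (1 / (u - y)\<^sup>2)" and ?ball = "\<lambda>t. {u. \<bar>u - t\<bar> < s t}"
  have s_le: "4 * s t \<le> Y" if "t \<in> C" for t
  proof -
    have "4 * s t \<le> K * s t" using K s[OF that] by (intro mult_right_mono) auto
    then show ?thesis using small[OF that] by linarith
  qed
  have "ennreal (\<Sum>t\<in>C. s t / (2 * (y - t)\<^sup>2)) = (\<Sum>t\<in>C. ennreal (s t / (2 * (y - t)\<^sup>2)))"
    using s by (subst sum_ennreal) (auto simp: less_imp_le)
  also have "\<dots> \<le> (\<Sum>t\<in>C. \<integral>\<^sup>+u. ?f u * indicator (?ball t) u \<partial>lborel)"
  proof (intro sum_mono inverse_square_ball_ge s)
    show "3 * s t \<le> \<bar>y - t\<bar>" if "t \<in> C" for t using far[OF that] s_le[OF that] by linarith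
  qed
  also have "\<dots> = (\<integral>\<^sup>+u. (\<Sum>t\<in>C. ?f u * indicator (?ball t) u) \<partial>lborel)"
    by (subst nn_integral_sum) auto
  also have "\<dots> \<le> (\<integral>\<^sup>+u. ?f u * indicator {u. \<bar>u - y\<bar> \<ge> Y / 2} u \<partial>lborel)"
  proof (rule nn_integral_mono, rule disjoint_sum_indicator_le[OF fin])
    fix u t assume t: "t \<in> C" "u \<in> ?ball t"
    have "\<bar>u - t\<bar> < s t" using t by simp
    moreover have "\<bar>y - t\<bar> \<le> \<bar>u - y\<bar> + \<bar>u - t\<bar>" by linarith
    ultimately have "\<bar>u - y\<bar> \<ge> Y / 2" using far[OF t(1)] s_le[OF t(1)] by linarith
    then show "?f u \<le> ?f u * indicator {u. \<bar>u - y\<bar> \<ge> Y / 2} u" by simp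
  qed (use disj in auto)
  also have "\<dots> \<le> ennreal (2 / (Y / 2))" by (rule nn_integral_inverse_square_tail) (use Y in simp)
  finally have sum_first_power: "(\<Sum>t\<in>C. s t / (2 * (y - t)\<^sup>2)) \<le> 4 / Y" using Y by (simp add: ennreal_le_iff)
  have "(\<Sum>t\<in>C. (s t)\<^sup>2 / (y - t)\<^sup>2) \<le> (\<Sum>t\<in>C. (2 * Y / K) * (s t / (2 * (y - t)\<^sup>2)))"
  proof (rule sum_mono)
    fix t assume t: "t \<in> C"
    have "s t \<le> Y / K" using small[OF t] K by (simp add: field_simps)
    then have "s t * (s t / (y - t)\<^sup>2) \<le> (Y / K) * (s t / (y - t)\<^sup>2)"
      using s[OF t] by (intro mult_right_mono) auto
    then show "(s t)\<^sup>2 / (y - t)\<^sup>2 \<le> (2 * Y / K) * (s t / (2 * (y - t)\<^sup>2))" by (simp add: power2_eq_square)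
  qed
  also have "\<dots> \<le> (2 * Y / K) * (4 / Y)"
    unfolding sum_distrib_left[symmetric] using sum_first_power Y K by (intro mult_left_mono) auto
  also have "\<dots> = 8 / K" using Y by simp
  finally show ?thesis .
qed

section \<open>Covering by contact points\<close>

text \<open>The covering gives \<open>G \<le> 3840 * (8 * Q + 64 / jump_ratio * G)\<close> for the weighted masses \<open>G\<close> of the
  majorant and \<open>Q\<close> of the exceptional density; \<open>jump_ratio\<close> makes \<open>3840 * 64 / jump_ratio = 1 / 4\<close>.\<close>

definition jump_ratio :: real where "jump_ratio = 983040"

definition tail_threshold :: real where "tail_threshold = 2 * jump_ratio + 2"

lemma jump_ratio_pos: "0 < jump_ratio"
  by (simp add: jump_ratio_def)

lemma finite_contact_cover:
  fixes \<sigma> :: "real \<Rightarrow> real"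
  assumes cpt: "compact S" and cover: "S \<subseteq> (\<Union>t\<in>Con. ball t (\<sigma> t))" and pos: "\<And>t. t \<in> Con \<Longrightarrow> \<sigma> t > 0"
  obtains C where "finite C" "C \<subseteq> Con"
    "\<And>t t' x. t \<in> C \<Longrightarrow> t' \<in> C \<Longrightarrow> \<bar>x - t\<bar> < 3 * \<sigma> t \<Longrightarrow> \<bar>x - t'\<bar> < 3 * \<sigma> t' \<Longrightarrow> t = t'"
    "\<And>x. x \<in> S \<Longrightarrow> \<exists>t\<in>C. \<bar>x - t\<bar> < 15 * \<sigma> t"
proof -
  obtain D where D: "D \<subseteq> Con" "finite D" "S \<subseteq> (\<Union>t\<in>D. ball t (\<sigma> t))"
    using compactE_image[OF cpt _ cover] by auto
  have radius: "0 < 3 * \<sigma> t \<and> 3 * \<sigma> t \<le> Max ((\<lambda>t. 3 * \<sigma> t) ` D)" if "t \<in> D" for t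
    using that D pos by auto
  obtain C where C: "C \<subseteq> D" and disjoint: "pairwise (\<lambda>i j. disjnt (cball i (3 * \<sigma> i)) (cball j (3 * \<sigma> j))) C"
    and absorb: "\<And>i. i \<in> D \<Longrightarrow> \<exists>j. j \<in> C \<and> \<not> disjnt (cball i (3 * \<sigma> i)) (cball j (3 * \<sigma> j))
        \<and> cball i (3 * \<sigma> i) \<subseteq> ball j (5 * (3 * \<sigma> j))"
    by (rule Vitali_covering_lemma_cballs_balls[OF radius, where a = "\<lambda>t. t"]) (blast intro: that)+
  show thesis
  proof
    show "finite C" "C \<subseteq> Con" using C D finite_subset by blast+
  next
    fix t t' x assume t: "t \<in> C" "\<bar>x - t\<bar> < 3 * \<sigma> t" and t': "t' \<in> C" "\<bar>x - t'\<bar> < 3 * \<sigma> t'"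
    have "x \<in> cball t (3 * \<sigma> t)" "x \<in> cball t' (3 * \<sigma> t')"
      using t t' by (auto simp: dist_real_def abs_minus_commute)
    then have "\<not> disjnt (cball t (3 * \<sigma> t)) (cball t' (3 * \<sigma> t'))" by (auto simp: disjnt_def)
    then show "t = t'" using disjoint t(1) t'(1) by (auto simp: pairwise_def)
  next
    fix x assume "x \<in> S"
    then obtain i where i: "i \<in> D" "x \<in> ball i (\<sigma> i)" using D(3) by blast
    obtain j where j: "j \<in> C" "cball i (3 * \<sigma> i) \<subseteq> ball j (5 * (3 * \<sigma> j))" using absorb[OF i(1)] by blast
    have "x \<in> cball i (3 * \<sigma> i)" using i D(1) pos[of i] by (auto simp: dist_real_def)
    then show "\<exists>t\<in>C. \<bar>x - t\<bar> < 15 * \<sigma> t"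
      using j by (auto simp: dist_real_def abs_minus_commute intro!: bexI[of _ j])
  qed
qed

locale light_majorant =
  fixes \<sigma> :: "real \<Rightarrow> real" and X :: real
  assumes nonneg: "0 \<le> \<sigma> x" and lipschitz: "\<bar>\<sigma> x - \<sigma> y\<bar> \<le> \<bar>x - y\<bar>" and X_ge: "1 \<le> X"
    and light: "weighted_mass X \<sigma> \<le> ennreal (1 / 4000)"
begin

lemma continuous: "continuous_on S \<sigma>"
  using lipschitz by (intro lipschitz_on_continuous_on[of 1] lipschitz_onI) (auto simp: dist_real_def)

lemma measurable [measurable]: "\<sigma> \<in> borel_measurable borel"
  by (rule borel_measurable_continuous_onI) (rule continuous)

lemma weight_nonneg: "0 \<le> weight X x"
  using weight_pos[OF X_ge] by (simp add: less_imp_le)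

lemma scaled_ennreal: "c \<ge> 0 \<Longrightarrow> ennreal (c * (\<sigma> x * weight X x)) = ennreal c * ennreal (\<sigma> x * weight X x)"
  using nonneg weight_nonneg by (simp add: ennreal_mult)

lemma forty_majorant_le: "40 * \<sigma> t \<le> X + \<bar>t\<bar>"
proof (rule ccontr)
  assume large: "\<not> 40 * \<sigma> t \<le> X + \<bar>t\<bar>"
  define r where "r = (X + \<bar>t\<bar>) / 80"
  have r: "r > 0" "X + \<bar>t\<bar> = 80 * r" "\<sigma> t \<ge> 2 * r" using X_ge large by (auto simp: r_def)
  have "ennreal (2 / 6561) = (\<integral>\<^sup>+x. ennreal (1 / (6561 * r)) * indicator {t - r<..<t + r} x \<partial>lborel)"
    using r by (simp add: nn_integral_cmult_indicator ennreal_mult[symmetric] del: ennreal_le_iff)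
  also have "\<dots> \<le> weighted_mass X \<sigma>" unfolding weighted_mass_def
  proof (rule nn_integral_mono)
    fix x
    show "ennreal (1 / (6561 * r)) * indicator {t - r<..<t + r} x \<le> ennreal (\<sigma> x * weight X x)"
    proof (cases "x \<in> {t - r<..<t + r}")
      case True
      then have xt: "\<bar>x - t\<bar> < r" by (auto simp: abs_less_iff)
      have \<sigma>_ge: "r \<le> \<sigma> x" using lipschitz[of x t] xt r(3) by linarith
      have "X\<^sup>2 + x\<^sup>2 \<le> (X + \<bar>x\<bar>)\<^sup>2" using X_ge by (simp add: power2_sum)
      also have "\<dots> \<le> (81 * r)\<^sup>2" using X_ge xt r(2) by (intro power_mono) linarith+
      finally have weight_ge: "1 / (6561 * r\<^sup>2) \<le> weight X x"
        unfolding weight_def using weight_denominator_pos[OF X_ge, of x] r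
        by (intro divide_left_mono) (auto simp: power_mult_distrib)
      have "1 / (6561 * r) = r * (1 / (6561 * r\<^sup>2))" using r by (simp add: power2_eq_square)
      also have "\<dots> \<le> \<sigma> x * weight X x" by (rule mult_mono[OF \<sigma>_ge weight_ge]) (use nonneg r in auto)
      finally show ?thesis using True by (simp add: ennreal_leI)
    qed simp
  qed
  finally have "ennreal (2 / 6561) \<le> ennreal (1 / 4000)" using light by (rule order.trans)
  then show False by (simp add: ennreal_le_iff)
qed

lemma weight_le_in_ball_15:
  assumes "\<bar>x - t\<bar> < 15 * \<sigma> t" shows "weight X x \<le> 8 * weight X t"
proof (rule weight_comparison[OF X_ge])
  have "\<bar>t\<bar> \<le> \<bar>x\<bar> + \<bar>x - t\<bar>" by linarith
  then show "X + \<bar>t\<bar> \<le> 2 * (X + \<bar>x\<bar>)" using assms forty_majorant_le[of t] X_ge abs_ge_zero[of x] by argo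
qed

lemma weight_ge_in_ball_3:
  assumes "\<bar>x - t\<bar> < 3 * \<sigma> t" shows "weight X t \<le> 8 * weight X x"
proof (rule weight_comparison[OF X_ge])
  have "\<bar>x\<bar> \<le> \<bar>t\<bar> + \<bar>x - t\<bar>" by linarith
  then show "X + \<bar>x\<bar> \<le> 2 * (X + \<bar>t\<bar>)" using assms forty_majorant_le[of t] X_ge abs_ge_zero[of t] by argo
qed

lemma inverse_square_le_weight:
  assumes far: "\<bar>y - t\<bar> > X + \<bar>t\<bar>" shows "1 / (y - t)\<^sup>2 \<le> 5 * weight X y"
proof -
  have "\<bar>y\<bar> \<le> \<bar>t\<bar> + \<bar>y - t\<bar>" by linarith
  then have "\<bar>y\<bar> \<le> 2 * \<bar>y - t\<bar>" using far X_ge by argo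
  then have "\<bar>y\<bar>\<^sup>2 \<le> (2 * \<bar>y - t\<bar>)\<^sup>2" by (rule power_mono) simp
  moreover have "X\<^sup>2 \<le> \<bar>y - t\<bar>\<^sup>2" using far X_ge by (intro power_mono) auto
  ultimately have "X\<^sup>2 + y\<^sup>2 \<le> 5 * (y - t)\<^sup>2" by (simp add: power_mult_distrib)
  moreover have "(y - t)\<^sup>2 > 0" using far X_ge by auto
  ultimately show ?thesis
    unfolding weight_def using weight_denominator_pos[OF X_ge, of y] by (simp add: field_simps)
qed

text \<open>The part of the tail that the two trivial bounds in \<open>tail_integrand_le\<close> do not cover.\<close>

definition jump_region :: "real \<Rightarrow> real set" where
  "jump_region t = {y. \<bar>y - t\<bar> > \<sigma> t \<and> \<sigma> y > jump_ratio * \<sigma> t \<and> \<bar>y - t\<bar> \<le> X + \<bar>t\<bar>}"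

lemma jump_region_measurable [measurable]: "jump_region t \<in> sets borel"
  unfolding jump_region_def by measurable

lemma tail_integrand_le:
  assumes t: "\<sigma> t > 0"
  shows "ennreal (\<sigma> y / (y - t)\<^sup>2) * indicator {y. \<bar>y - t\<bar> > \<sigma> t} y
    \<le> ennreal (jump_ratio * \<sigma> t) * (ennreal (1 / (y - t)\<^sup>2) * indicator {y. \<bar>y - t\<bar> \<ge> \<sigma> t} y)
      + (5 * ennreal (\<sigma> y * weight X y) + ennreal (\<sigma> y / (y - t)\<^sup>2) * indicator (jump_region t) y)"
    (is "?lhs \<le> ?low + (?far + ?jump)")
proof (cases "\<bar>y - t\<bar> > \<sigma> t")
  case out: True
  consider "\<sigma> y \<le> jump_ratio * \<sigma> t" | "\<bar>y - t\<bar> > X + \<bar>t\<bar>" | "y \<in> jump_region t"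
    using out by (force simp: jump_region_def)
  then show ?thesis
  proof cases
    case 1
    then have "\<sigma> y / (y - t)\<^sup>2 \<le> jump_ratio * \<sigma> t * (1 / (y - t)\<^sup>2)"
      using divide_right_mono[of "\<sigma> y" "jump_ratio * \<sigma> t" "(y - t)\<^sup>2"] by simp
    then have "ennreal (\<sigma> y / (y - t)\<^sup>2) \<le> ennreal (jump_ratio * \<sigma> t) * ennreal (1 / (y - t)\<^sup>2)"
      using t jump_ratio_pos by (subst ennreal_mult[symmetric]) (auto intro!: ennreal_leI)
    then have "?lhs \<le> ?low" using out by simp
    then show ?thesis by (rule order.trans) simp
  next
    case 2
    have "\<sigma> y * (1 / (y - t)\<^sup>2) \<le> \<sigma> y * (5 * weight X y)"
      using nonneg inverse_square_le_weight[OF 2] by (intro mult_left_mono) auto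
    then have "ennreal (\<sigma> y / (y - t)\<^sup>2) \<le> ennreal (5 * (\<sigma> y * weight X y))"
      by (intro ennreal_leI) (simp add: mult_ac)
    also have "\<dots> = ?far" by (simp add: scaled_ennreal)
    finally have "?lhs \<le> ?far" using out by simp
    then show ?thesis by (rule order.trans) (simp add: add_increasing)
  next
    case 3
    then have "?lhs \<le> ?jump" using out by simp
    then show ?thesis by (rule order.trans) (simp add: add_increasing)
  qed
qed simp

lemma jump_integral_ge_one:
  assumes t: "\<sigma> t > 0" and tail: "ennreal tail_threshold < tail_mass \<sigma> t (\<sigma> t)"
  shows "1 \<le> (\<integral>\<^sup>+y. ennreal (\<sigma> y / (y - t)\<^sup>2) * indicator (jump_region t) y \<partial>lborel)" (is "1 \<le> ?I")
proof (rule ccontr)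
  assume "\<not> 1 \<le> ?I"
  then have I_le: "?I \<le> ennreal 1" by simp
  have "tail_mass \<sigma> t (\<sigma> t) \<le> ennreal (jump_ratio * \<sigma> t) * (\<integral>\<^sup>+y. ennreal (1 / (y - t)\<^sup>2) * indicator {y. \<bar>y - t\<bar> \<ge> \<sigma> t} y \<partial>lborel)
      + (5 * weighted_mass X \<sigma> + ?I)"
    unfolding tail_mass_def weighted_mass_def
    by (rule order.trans[OF nn_integral_mono[OF tail_integrand_le[OF t]]]) (simp add: nn_integral_add nn_integral_cmult)
  also have "\<dots> \<le> ennreal (jump_ratio * \<sigma> t) * ennreal (2 / \<sigma> t) + (5 * ennreal (1 / 4000) + ennreal 1)"
    by (intro add_mono mult_left_mono nn_integral_inverse_square_tail light t I_le) auto
  also have "ennreal (jump_ratio * \<sigma> t) * ennreal (2 / \<sigma> t) = ennreal (2 * jump_ratio)"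
    using t jump_ratio_pos by (simp add: ennreal_mult[symmetric])
  also have "5 * ennreal (1 / 4000) \<le> ennreal 1"
    by (simp flip: ennreal_numeral ennreal_mult add: ennreal_le_iff del: ennreal_1 ennreal_le_1)
  also have "ennreal (2 * jump_ratio) + (ennreal 1 + ennreal 1) = ennreal tail_threshold"
    by (simp add: tail_threshold_def jump_ratio_def flip: ennreal_plus del: ennreal_1)
  finally show False using tail by (simp add: add_left_mono add_right_mono)
qed

end

locale disjoint_contacts = light_majorant +
  fixes C :: "real set"
  assumes finite_C: "finite C" and pos: "t \<in> C \<Longrightarrow> 0 < \<sigma> t"
    and disjoint: "t \<in> C \<Longrightarrow> t' \<in> C \<Longrightarrow> \<bar>x - t\<bar> < 3 * \<sigma> t \<Longrightarrow> \<bar>x - t'\<bar> < 3 * \<sigma> t' \<Longrightarrow> t = t'"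
begin

lemma weight_mult_window_mass_le:
  assumes q: "q \<in> borel_measurable borel" "\<And>x. q x \<ge> 0"
  shows "ennreal (weight X t) * window_mass q t (3 * \<sigma> t)
    \<le> (\<integral>\<^sup>+x. 8 * ennreal (q x * weight X x) * indicator {x. \<bar>x - t\<bar> < 3 * \<sigma> t} x \<partial>lborel)"
proof -
  note q(1)[measurable]
  have "ennreal (weight X t) * window_mass q t (3 * \<sigma> t)
      = (\<integral>\<^sup>+x. ennreal (weight X t) * (ennreal (q x) * indicator {x. \<bar>x - t\<bar> < 3 * \<sigma> t} x) \<partial>lborel)"
    unfolding window_mass_def by (rule nn_integral_cmult[symmetric]) measurable
  also have "\<dots> \<le> (\<integral>\<^sup>+x. 8 * ennreal (q x * weight X x) * indicator {x. \<bar>x - t\<bar> < 3 * \<sigma> t} x \<partial>lborel)"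
  proof (rule nn_integral_mono)
    fix x
    show "ennreal (weight X t) * (ennreal (q x) * indicator {x. \<bar>x - t\<bar> < 3 * \<sigma> t} x)
        \<le> 8 * ennreal (q x * weight X x) * indicator {x. \<bar>x - t\<bar> < 3 * \<sigma> t} x"
    proof (cases "\<bar>x - t\<bar> < 3 * \<sigma> t")
      case True
      have "weight X t * q x \<le> 8 * weight X x * q x"
        using weight_ge_in_ball_3[OF True] q(2) by (intro mult_right_mono) auto
      then have "ennreal (weight X t * q x) \<le> ennreal (8 * (q x * weight X x))"
        by (intro ennreal_leI) (simp add: mult_ac)
      then show ?thesis using True weight_nonneg q(2) by (simp add: ennreal_mult)
    qed simp
  qed
  finally show ?thesis .
qed

lemma sum_exceptional_le:
  assumes E: "E \<subseteq> C" and q: "q \<in> borel_measurable borel" "\<And>x. q x \<ge> 0"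
    and exceptional: "\<And>t. t \<in> E \<Longrightarrow> ennreal ((\<sigma> t)\<^sup>2) \<le> window_mass q t (3 * \<sigma> t)"
  shows "(\<Sum>t\<in>E. ennreal ((\<sigma> t)\<^sup>2 * weight X t)) \<le> 8 * weighted_mass X q"
proof -
  note q(1)[measurable]
  let ?ball = "\<lambda>t. {x. \<bar>x - t\<bar> < 3 * \<sigma> t}"
  have "ennreal ((\<sigma> t)\<^sup>2 * weight X t)
      \<le> (\<integral>\<^sup>+x. 8 * ennreal (q x * weight X x) * indicator (?ball t) x \<partial>lborel)"
    if "t \<in> E" for t
  proof -
    have "ennreal ((\<sigma> t)\<^sup>2 * weight X t) = ennreal (weight X t) * ennreal ((\<sigma> t)\<^sup>2)"
      using weight_nonneg by (simp add: ennreal_mult mult.commute)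
    also have "\<dots> \<le> ennreal (weight X t) * window_mass q t (3 * \<sigma> t)"
      by (intro mult_left_mono exceptional that) simp
    finally show ?thesis using weight_mult_window_mass_le[OF q, of t] by (rule order.trans)
  qed
  then have "(\<Sum>t\<in>E. ennreal ((\<sigma> t)\<^sup>2 * weight X t))
      \<le> (\<Sum>t\<in>E. \<integral>\<^sup>+x. 8 * ennreal (q x * weight X x) * indicator (?ball t) x \<partial>lborel)"
    by (rule sum_mono)
  also have "\<dots> = (\<integral>\<^sup>+x. (\<Sum>t\<in>E. 8 * ennreal (q x * weight X x) * indicator (?ball t) x) \<partial>lborel)"
    by (rule nn_integral_sum[symmetric]) measurable
  also have "\<dots> \<le> (\<integral>\<^sup>+x. 8 * ennreal (q x * weight X x) \<partial>lborel)"
  proof (intro nn_integral_mono disjoint_sum_indicator_le finite_subset[OF E finite_C])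
    show "t = t'" if "t \<in> E" "t' \<in> E" "x \<in> ?ball t" "x \<in> ?ball t'" for t t' x
      using disjoint[of t t' x] that E by auto
  qed simp
  also have "\<dots> = 8 * weighted_mass X q" unfolding weighted_mass_def by (rule nn_integral_cmult) measurable
  finally show ?thesis .
qed

lemma sum_over_jumps_le:
  assumes J: "J \<subseteq> C"
  shows "(\<Sum>t\<in>J. ennreal ((\<sigma> t)\<^sup>2 / (y - t)\<^sup>2) * indicator (jump_region t) y) \<le> ennreal (8 / jump_ratio)"
proof -
  define J' where "J' = {t\<in>J. y \<in> jump_region t}"
  have J': "J' \<subseteq> C" "finite J'" using J finite_subset[OF J finite_C] by (auto simp: J'_def)
  have "(\<Sum>t\<in>J. ennreal ((\<sigma> t)\<^sup>2 / (y - t)\<^sup>2) * indicator (jump_region t) y)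
      = (\<Sum>t\<in>J'. ennreal ((\<sigma> t)\<^sup>2 / (y - t)\<^sup>2))"
    unfolding J'_def sum.inter_filter[OF finite_subset[OF J finite_C]]
    by (intro sum.cong) (auto simp: indicator_def)
  also have "\<dots> = ennreal (\<Sum>t\<in>J'. (\<sigma> t)\<^sup>2 / (y - t)\<^sup>2)" by (rule sum_ennreal) auto
  also have "\<dots> \<le> ennreal (8 / jump_ratio)"
  proof (cases "J' = {}")
    case False
    then obtain t where t: "t \<in> J'" by blast
    then have "0 < jump_ratio * \<sigma> t" "jump_ratio * \<sigma> t < \<sigma> y"
      using pos J' jump_ratio_pos by (auto simp: J'_def jump_region_def)
    then have y_pos: "\<sigma> y > 0" by linarith
    show ?thesis
    proof (rule ennreal_leI, rule disjoint_balls_inverse_square_sum[OF J'(2) _ _ _ y_pos])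
      show "t = t'" if "t \<in> J'" "t' \<in> J'" "\<bar>x - t\<bar> < \<sigma> t" "\<bar>x - t'\<bar> < \<sigma> t'" for t t' x
        by (rule disjoint[of t t' x]) (use that J' nonneg[of t] nonneg[of t'] in auto)
      show "\<sigma> y - \<sigma> t \<le> \<bar>y - t\<bar>" for t using lipschitz[of y t] by linarith
    qed (use J' pos in \<open>auto simp: J'_def jump_region_def jump_ratio_def\<close>)
  qed (simp add: jump_ratio_def)
  finally show ?thesis .
qed

lemma contact_term_le_jump_integral:
  assumes t: "\<sigma> t > 0" and tail: "ennreal tail_threshold < tail_mass \<sigma> t (\<sigma> t)"
  shows "ennreal ((\<sigma> t)\<^sup>2 * weight X t)
    \<le> (\<integral>\<^sup>+y. 8 * ennreal (\<sigma> y * weight X y) * (ennreal ((\<sigma> t)\<^sup>2 / (y - t)\<^sup>2) * indicator (jump_region t) y) \<partial>lborel)"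
proof -
  have "ennreal ((\<sigma> t)\<^sup>2 * weight X t) * 1
      \<le> ennreal ((\<sigma> t)\<^sup>2 * weight X t) * (\<integral>\<^sup>+y. ennreal (\<sigma> y / (y - t)\<^sup>2) * indicator (jump_region t) y \<partial>lborel)"
    by (rule mult_left_mono[OF jump_integral_ge_one[OF t tail]]) simp
  also have "\<dots> = (\<integral>\<^sup>+y. ennreal ((\<sigma> t)\<^sup>2 * weight X t) * (ennreal (\<sigma> y / (y - t)\<^sup>2) * indicator (jump_region t) y) \<partial>lborel)"
    by (rule nn_integral_cmult[symmetric]) measurable
  also have "\<dots> \<le> (\<integral>\<^sup>+y. 8 * ennreal (\<sigma> y * weight X y) * (ennreal ((\<sigma> t)\<^sup>2 / (y - t)\<^sup>2) * indicator (jump_region t) y) \<partial>lborel)"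
  proof (rule nn_integral_mono)
    fix y
    show "ennreal ((\<sigma> t)\<^sup>2 * weight X t) * (ennreal (\<sigma> y / (y - t)\<^sup>2) * indicator (jump_region t) y)
        \<le> 8 * ennreal (\<sigma> y * weight X y) * (ennreal ((\<sigma> t)\<^sup>2 / (y - t)\<^sup>2) * indicator (jump_region t) y)"
    proof (cases "y \<in> jump_region t")
      case True
      have "weight X t \<le> 8 * weight X y"
        by (rule weight_comparison[OF X_ge]) (use True X_ge in \<open>auto simp: jump_region_def\<close>)
      then have "(\<sigma> y * ((\<sigma> t)\<^sup>2 / (y - t)\<^sup>2)) * weight X t
          \<le> (\<sigma> y * ((\<sigma> t)\<^sup>2 / (y - t)\<^sup>2)) * (8 * weight X y)"
        using nonneg by (intro mult_left_mono) auto
      then have "ennreal (((\<sigma> t)\<^sup>2 * weight X t) * (\<sigma> y / (y - t)\<^sup>2))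
          \<le> ennreal ((8 * (\<sigma> y * weight X y)) * ((\<sigma> t)\<^sup>2 / (y - t)\<^sup>2))"
        by (intro ennreal_leI) (simp add: mult_ac)
      then have "ennreal ((\<sigma> t)\<^sup>2 * weight X t) * ennreal (\<sigma> y / (y - t)\<^sup>2)
          \<le> ennreal (8 * (\<sigma> y * weight X y)) * ennreal ((\<sigma> t)\<^sup>2 / (y - t)\<^sup>2)"
        using nonneg weight_nonneg by (subst (1 2) ennreal_mult[symmetric]) auto
      then show ?thesis using True by (simp add: scaled_ennreal)
    qed simp
  qed
  finally show ?thesis by simp
qed

lemma sum_tail_heavy_le:
  assumes H: "H \<subseteq> C" and tail: "\<And>t. t \<in> H \<Longrightarrow> ennreal tail_threshold < tail_mass \<sigma> t (\<sigma> t)"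
  shows "(\<Sum>t\<in>H. ennreal ((\<sigma> t)\<^sup>2 * weight X t)) \<le> ennreal (64 / jump_ratio) * weighted_mass X \<sigma>"
proof -
  let ?k = "\<lambda>t y. ennreal ((\<sigma> t)\<^sup>2 / (y - t)\<^sup>2) * indicator (jump_region t) y"
  have "(\<Sum>t\<in>H. ennreal ((\<sigma> t)\<^sup>2 * weight X t))
      \<le> (\<Sum>t\<in>H. \<integral>\<^sup>+y. 8 * ennreal (\<sigma> y * weight X y) * ?k t y \<partial>lborel)"
    by (intro sum_mono contact_term_le_jump_integral tail pos) (use H in auto)
  also have "\<dots> = (\<integral>\<^sup>+y. (\<Sum>t\<in>H. 8 * ennreal (\<sigma> y * weight X y) * ?k t y) \<partial>lborel)"
    by (rule nn_integral_sum[symmetric]) measurable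
  also have "\<dots> \<le> (\<integral>\<^sup>+y. ennreal (64 / jump_ratio) * ennreal (\<sigma> y * weight X y) \<partial>lborel)"
  proof (rule nn_integral_mono)
    fix y
    have "8 * ennreal (\<sigma> y * weight X y) * (\<Sum>t\<in>H. ?k t y)
        \<le> 8 * ennreal (\<sigma> y * weight X y) * ennreal (8 / jump_ratio)"
      by (rule mult_left_mono[OF sum_over_jumps_le[OF H]]) simp
    also have "ennreal (64 / jump_ratio) = 8 * ennreal (8 / jump_ratio)"
      by (simp add: jump_ratio_def flip: ennreal_numeral ennreal_mult)
    then have "8 * ennreal (\<sigma> y * weight X y) * ennreal (8 / jump_ratio)
        = ennreal (64 / jump_ratio) * ennreal (\<sigma> y * weight X y)"
      by (simp add: mult_ac)
    finally show "(\<Sum>t\<in>H. 8 * ennreal (\<sigma> y * weight X y) * ?k t y)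
        \<le> ennreal (64 / jump_ratio) * ennreal (\<sigma> y * weight X y)"
      by (simp only: sum_distrib_left)
  qed
  also have "\<dots> = ennreal (64 / jump_ratio) * weighted_mass X \<sigma>"
    unfolding weighted_mass_def by (rule nn_integral_cmult) measurable
  finally show ?thesis .
qed

lemma integrand_le_covering_sum:
  assumes T: "\<And>x. \<bar>x\<bar> > T \<Longrightarrow> \<sigma> x = 0" and \<epsilon>: "\<epsilon> \<ge> 0"
    and cover: "\<And>x. \<sigma> x \<ge> \<epsilon> \<Longrightarrow> \<exists>t\<in>C. \<bar>x - t\<bar> < 15 * \<sigma> t"
  shows "ennreal (\<sigma> x * weight X x) \<le> (\<Sum>t\<in>C. ennreal (128 * \<sigma> t * weight X t) * indicator {t - 15 * \<sigma> t<..<t + 15 * \<sigma> t} x)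
      + ennreal \<epsilon> * indicator {-T..T} x" (is "_ \<le> ?sum + ?rest")
proof -
  consider "\<sigma> x \<ge> \<epsilon>" | "\<sigma> x = 0" | "\<sigma> x \<le> \<epsilon>" "x \<in> {-T..T}" using T[of x] by fastforce
  then show ?thesis
  proof cases
    case 1
    then obtain t where t: "t \<in> C" "\<bar>x - t\<bar> < 15 * \<sigma> t" using cover by blast
    have "\<sigma> x \<le> 16 * \<sigma> t" using lipschitz[of x t] t(2) by linarith
    then have "\<sigma> x * weight X x \<le> (16 * \<sigma> t) * (8 * weight X t)"
      using weight_le_in_ball_15[OF t(2)] nonneg weight_nonneg by (intro mult_mono) auto
    then have "ennreal (\<sigma> x * weight X x) \<le> ennreal (128 * \<sigma> t * weight X t)" by (intro ennreal_leI) simp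
    also have "\<dots> = ennreal (128 * \<sigma> t * weight X t) * indicator {t - 15 * \<sigma> t<..<t + 15 * \<sigma> t} x"
      using t(2) by (auto simp: indicator_def abs_less_iff)
    also have "\<dots> \<le> ?sum"
      by (rule member_le_sum[OF t(1)]) (use finite_C in auto)
    finally show ?thesis by (rule order.trans) simp
  next
    case 3
    then have "\<sigma> x * weight X x \<le> \<epsilon> * 1"
      using weight_le_one[OF X_ge] nonneg weight_nonneg \<epsilon> by (intro mult_mono) auto
    then have "ennreal (\<sigma> x * weight X x) \<le> ?rest" using 3(2) by (simp add: ennreal_leI)
    then show ?thesis by (rule order.trans) simp
  qed simp
qed

lemma weighted_mass_le_contact_sum:
  assumes T: "T > 0" "\<And>x. \<bar>x\<bar> > T \<Longrightarrow> \<sigma> x = 0" and \<epsilon>: "\<epsilon> \<ge> 0"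
    and cover: "\<And>x. \<sigma> x \<ge> \<epsilon> \<Longrightarrow> \<exists>t\<in>C. \<bar>x - t\<bar> < 15 * \<sigma> t"
  shows "weighted_mass X \<sigma> \<le> 3840 * (\<Sum>t\<in>C. ennreal ((\<sigma> t)\<^sup>2 * weight X t)) + ennreal (2 * T * \<epsilon>)"
proof -
  let ?f = "\<lambda>t x. ennreal (128 * \<sigma> t * weight X t) * indicator {t - 15 * \<sigma> t<..<t + 15 * \<sigma> t} x"
  have ball_integral: "(\<integral>\<^sup>+x. ?f t x \<partial>lborel) = 3840 * ennreal ((\<sigma> t)\<^sup>2 * weight X t)" for t
  proof -
    have "(\<integral>\<^sup>+x. ?f t x \<partial>lborel) = ennreal (128 * \<sigma> t * weight X t) * ennreal (30 * \<sigma> t)"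
      using nonneg[of t] by (simp add: nn_integral_cmult_indicator)
    also have "\<dots> = ennreal (3840 * ((\<sigma> t)\<^sup>2 * weight X t))"
      using nonneg[of t] weight_nonneg by (simp add: ennreal_mult[symmetric] power2_eq_square mult_ac)
    also have "\<dots> = 3840 * ennreal ((\<sigma> t)\<^sup>2 * weight X t)" using weight_nonneg by (simp add: ennreal_mult)
    finally show ?thesis .
  qed
  have "weighted_mass X \<sigma> \<le> (\<integral>\<^sup>+x. (\<Sum>t\<in>C. ?f t x) + ennreal \<epsilon> * indicator {-T..T} x \<partial>lborel)"
    unfolding weighted_mass_def by (intro nn_integral_mono integrand_le_covering_sum T(2) \<epsilon> cover)
  also have "\<dots> = (\<Sum>t\<in>C. \<integral>\<^sup>+x. ?f t x \<partial>lborel) + (\<integral>\<^sup>+x. ennreal \<epsilon> * indicator {-T..T} x \<partial>lborel)"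
    by (subst nn_integral_add) (auto simp: nn_integral_sum)
  also have "(\<integral>\<^sup>+x. ennreal \<epsilon> * indicator {-T..T} x \<partial>lborel) = ennreal (2 * T * \<epsilon>)"
    using T \<epsilon> by (simp add: nn_integral_cmult_indicator ennreal_mult[symmetric] mult_ac)
  finally show ?thesis unfolding ball_integral sum_distrib_left .
qed

end

lemma ennreal_absorb_quarter:
  fixes G Q :: ennreal and T :: real
  assumes G: "G < top" and T: "T > 0"
    and le: "\<And>\<epsilon>. \<epsilon> > 0 \<Longrightarrow> G \<le> 3840 * (8 * Q + ennreal (64 / jump_ratio) * G) + ennreal (2 * T * \<epsilon>)"
  shows "G \<le> 61440 * Q"
proof (cases "Q = top")
  case False
  then obtain q where q: "Q = ennreal q" "q \<ge> 0" by (metis enn2real_nonneg ennreal_enn2real_if)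
  obtain g where g: "G = ennreal g" "g \<ge> 0" using G by (metis enn2real_nonneg ennreal_enn2real_if less_irrefl)
  have "g \<le> 30720 * q + g / 4"
  proof (rule field_le_epsilon)
    fix e :: real assume e: "e > 0"
    then have "ennreal g \<le> ennreal (3840 * (8 * q + 64 / jump_ratio * g) + e)"
      using le[of "e / (2 * T)"] T q(2) g(2) unfolding g(1) q(1)
      by (simp add: jump_ratio_def ennreal_mult flip: ennreal_plus ennreal_numeral ennreal_mult)
    then have "g \<le> 3840 * (8 * q + 64 / jump_ratio * g) + e"
      using e q(2) g(2) by (subst (asm) ennreal_le_iff) (auto simp: jump_ratio_def)
    then show "g \<le> 30720 * q + g / 4 + e" by (simp add: jump_ratio_def)
  qed
  then have "ennreal g \<le> ennreal (61440 * q)" using q(2) by (intro ennreal_leI) linarith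
  also have "\<dots> = 61440 * ennreal q" using q(2) by (simp add: ennreal_mult)
  finally show ?thesis by (simp add: g(1) q(1))
qed (simp add: ennreal_mult_top)

lemma level_set_contact_cover:
  assumes u: "bump u" and \<epsilon>: "\<epsilon> > 0"
  obtains C where "finite C" "\<And>t. t \<in> C \<Longrightarrow> lip_majorant u t = u t \<and> lip_majorant u t > 0"
    "\<And>t t' x. t \<in> C \<Longrightarrow> t' \<in> C \<Longrightarrow> \<bar>x - t\<bar> < 3 * lip_majorant u t \<Longrightarrow> \<bar>x - t'\<bar> < 3 * lip_majorant u t' \<Longrightarrow> t = t'"
    "\<And>x. lip_majorant u x \<ge> \<epsilon> \<Longrightarrow> \<exists>t\<in>C. \<bar>x - t\<bar> < 15 * lip_majorant u t"
proof -
  let ?\<sigma> = "lip_majorant u"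
  define S where "S = {x. ?\<sigma> x \<ge> \<epsilon>}"
  define Con where "Con = {t. ?\<sigma> t = u t \<and> ?\<sigma> t > 0}"
  obtain T where T: "\<And>x. \<bar>x\<bar> > T \<Longrightarrow> ?\<sigma> x = 0" using lip_majorant_support[OF u] by blast
  have "continuous_on UNIV ?\<sigma>"
    using lip_majorant_lipschitz[OF u]
    by (intro lipschitz_on_continuous_on[of 1] lipschitz_onI) (auto simp: dist_real_def)
  then have "closed S" unfolding S_def by (intro closed_Collect_le) auto
  moreover have "S \<subseteq> {-T..T}"
  proof
    fix x assume "x \<in> S"
    then have "\<not> \<bar>x\<bar> > T" using T[of x] \<epsilon> by (auto simp: S_def)
    then show "x \<in> {-T..T}" by auto
  qed
  ultimately have S_compact: "compact S"
    by (metis bounded_closed_interval bounded_subset compact_eq_bounded_closed)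
  have S_cover: "S \<subseteq> (\<Union>t\<in>Con. ball t (?\<sigma> t))"
  proof
    fix x assume x: "x \<in> S"
    obtain t where "?\<sigma> t = u t" "?\<sigma> x = ?\<sigma> t - \<bar>x - t\<bar>" using lip_majorant_contact[OF u] by metis
    then have "t \<in> Con" "x \<in> ball t (?\<sigma> t)"
      using x \<epsilon> by (auto simp: S_def Con_def dist_real_def abs_minus_commute)
    then show "x \<in> (\<Union>t\<in>Con. ball t (?\<sigma> t))" by blast
  qed
  have "?\<sigma> t > 0" if "t \<in> Con" for t using that by (simp add: Con_def)
  from finite_contact_cover[OF S_compact S_cover this] obtain C where "finite C" "C \<subseteq> Con"
    "\<And>t t' x. t \<in> C \<Longrightarrow> t' \<in> C \<Longrightarrow> \<bar>x - t\<bar> < 3 * ?\<sigma> t \<Longrightarrow> \<bar>x - t'\<bar> < 3 * ?\<sigma> t' \<Longrightarrow> t = t'"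
    "\<And>x. x \<in> S \<Longrightarrow> \<exists>t\<in>C. \<bar>x - t\<bar> < 15 * ?\<sigma> t" by metis
  then show thesis by (intro that[of C]) (auto simp: S_def Con_def)
qed

theorem weighted_mass_bootstrap:
  assumes u: "bump u" and X: "X \<ge> 1" and q: "q \<in> borel_measurable borel" "\<And>x. q x \<ge> 0"
    and light: "weighted_mass X (lip_majorant u) \<le> ennreal (1 / 4000)"
    and contact: "\<And>t. lip_majorant u t = u t \<Longrightarrow> lip_majorant u t > 0 \<Longrightarrow>
        ennreal ((lip_majorant u t)\<^sup>2) \<le> window_mass q t (3 * lip_majorant u t)
        \<or> ennreal tail_threshold < tail_mass (lip_majorant u) t (lip_majorant u t)"
  shows "weighted_mass X (lip_majorant u) \<le> 61440 * weighted_mass X q"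
proof -
  define \<sigma> where "\<sigma> = lip_majorant u"
  interpret light_majorant \<sigma> X
    by unfold_locales (use lip_majorant_nonneg[OF u] lip_majorant_lipschitz[OF u] X light in \<open>auto simp: \<sigma>_def\<close>)
  obtain T where T: "T > 0" "\<And>x. \<bar>x\<bar> > T \<Longrightarrow> \<sigma> x = 0" unfolding \<sigma>_def using lip_majorant_support[OF u] by blast
  have "weighted_mass X \<sigma>
      \<le> 3840 * (8 * weighted_mass X q + ennreal (64 / jump_ratio) * weighted_mass X \<sigma>) + ennreal (2 * T * \<epsilon>)"
    if \<epsilon>: "\<epsilon> > 0" for \<epsilon>
  proof -
    obtain C where C: "finite C" "\<And>t. t \<in> C \<Longrightarrow> \<sigma> t = u t \<and> \<sigma> t > 0"
      and cover: "\<And>x. \<sigma> x \<ge> \<epsilon> \<Longrightarrow> \<exists>t\<in>C. \<bar>x - t\<bar> < 15 * \<sigma> t"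
      and disjoint: "\<And>t t' x. t \<in> C \<Longrightarrow> t' \<in> C \<Longrightarrow> \<bar>x - t\<bar> < 3 * \<sigma> t \<Longrightarrow> \<bar>x - t'\<bar> < 3 * \<sigma> t' \<Longrightarrow> t = t'"
      unfolding \<sigma>_def using level_set_contact_cover[OF u \<epsilon>] by metis
    interpret disjoint_contacts \<sigma> X C
    proof unfold_locales
      show "0 < \<sigma> t" if "t \<in> C" for t using C(2)[OF that] by blast
    qed (use C(1) disjoint in blast)+
    define E where "E = {t\<in>C. ennreal ((\<sigma> t)\<^sup>2) \<le> window_mass q t (3 * \<sigma> t)}"
    have heavy: "ennreal tail_threshold < tail_mass \<sigma> t (\<sigma> t)" if "t \<in> C - E" for t
      using contact[of t] C(2)[of t] that unfolding E_def \<sigma>_def by blast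
    have "(\<Sum>t\<in>C. ennreal ((\<sigma> t)\<^sup>2 * weight X t))
        = (\<Sum>t\<in>E. ennreal ((\<sigma> t)\<^sup>2 * weight X t)) + (\<Sum>t\<in>C - E. ennreal ((\<sigma> t)\<^sup>2 * weight X t))"
      using C(1) sum.subset_diff[of E C] by (simp add: E_def add.commute)
    also have "\<dots> \<le> 8 * weighted_mass X q + ennreal (64 / jump_ratio) * weighted_mass X \<sigma>"
      by (intro add_mono sum_exceptional_le sum_tail_heavy_le q heavy) (auto simp: E_def)
    finally have "3840 * (\<Sum>t\<in>C. ennreal ((\<sigma> t)\<^sup>2 * weight X t))
        \<le> 3840 * (8 * weighted_mass X q + ennreal (64 / jump_ratio) * weighted_mass X \<sigma>)" by (rule mult_left_mono) simp
    moreover have "weighted_mass X \<sigma> \<le> 3840 * (\<Sum>t\<in>C. ennreal ((\<sigma> t)\<^sup>2 * weight X t)) + ennreal (2 * T * \<epsilon>)"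
      using \<epsilon> by (intro weighted_mass_le_contact_sum T cover) auto
    ultimately show ?thesis by (meson add_right_mono order.trans)
  qed
  moreover have "weighted_mass X \<sigma> < top" using light by (rule order.strict_trans1) simp
  ultimately show ?thesis unfolding \<sigma>_def[symmetric] by (intro ennreal_absorb_quarter[OF _ T(1)])
qed

section \<open>A uniform bound from local control at contact points\<close>

context lipschitz_bump
begin

lemma kernel_integrand_le:
  assumes y: "0 < y" "y \<le> s" and x: "\<bar>x - t\<bar> \<le> s" and contact: "\<phi> t = L * s" and s: "s > 0"
  shows "ennreal (\<phi> u * poisson_kernel x y u)
    \<le> ennreal (3 * s * L) * (ennreal (poisson_kernel x y u) * indicator {x - 3 * s..x + 3 * s} u)
      + ennreal (4 * s) * (ennreal (\<phi> u / (u - t)\<^sup>2) * indicator {u. \<bar>u - t\<bar> > s} u)" (is "_ \<le> ?near + ?far")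
proof (cases "\<bar>u - t\<bar> \<le> 2 * s")
  case True
  have "L * \<bar>u - t\<bar> \<le> L * (2 * s)" using True L_nonneg by (rule mult_left_mono)
  then have "\<phi> u \<le> 3 * s * L" using lipschitz[of u t] contact by (simp add: algebra_simps)
  then have "\<phi> u * poisson_kernel x y u \<le> (3 * s * L) * poisson_kernel x y u"
    using y by (intro mult_right_mono poisson_kernel_nonneg) auto
  then have "ennreal (\<phi> u * poisson_kernel x y u) \<le> ennreal (3 * s * L) * ennreal (poisson_kernel x y u)"
    using L_nonneg s y by (subst ennreal_mult[symmetric]) (auto intro!: ennreal_leI poisson_kernel_nonneg)
  moreover have "\<bar>u - x\<bar> \<le> \<bar>u - t\<bar> + \<bar>x - t\<bar>" by linarith
  then have "\<bar>u - x\<bar> \<le> 3 * s" using True x by argo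
  then have "u \<in> {x - 3 * s..x + 3 * s}" by (auto simp: abs_le_iff)
  ultimately have "ennreal (\<phi> u * poisson_kernel x y u) \<le> ?near" by simp
  then show ?thesis by (rule order.trans) simp
next
  case False
  have denominator: "(x - u)\<^sup>2 + y\<^sup>2 > 0" using y(1) by (simp add: add_nonneg_pos)
  have "\<bar>u - t\<bar> \<le> \<bar>x - u\<bar> + \<bar>x - t\<bar>" by linarith
  then have "\<bar>u - t\<bar> \<le> 2 * \<bar>x - u\<bar>" using False x by argo
  then have "\<bar>u - t\<bar>\<^sup>2 \<le> (2 * \<bar>x - u\<bar>)\<^sup>2" by (rule power_mono) simp
  then have square_le: "(u - t)\<^sup>2 \<le> 4 * ((x - u)\<^sup>2 + y\<^sup>2)" by (simp add: power_mult_distrib add_increasing2)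
  have ut: "(u - t)\<^sup>2 > 0" using False s by auto
  have "poisson_kernel x y u \<le> s / ((x - u)\<^sup>2 + y\<^sup>2)"
    unfolding poisson_kernel_def using y denominator by (intro divide_right_mono) auto
  also have "\<dots> \<le> s / ((u - t)\<^sup>2 / 4)" using square_le ut denominator s by (intro divide_left_mono) auto
  also have "\<dots> = 4 * s / (u - t)\<^sup>2" by simp
  finally have "\<phi> u * poisson_kernel x y u \<le> \<phi> u * (4 * s / (u - t)\<^sup>2)"
    using nonneg by (intro mult_left_mono) auto
  then have "ennreal (\<phi> u * poisson_kernel x y u) \<le> ennreal ((4 * s) * (\<phi> u / (u - t)\<^sup>2))"
    by (intro ennreal_leI) (simp add: mult_ac)
  also have "\<dots> = ennreal (4 * s) * ennreal (\<phi> u / (u - t)\<^sup>2)" using s nonneg by (subst ennreal_mult) auto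
  also have "\<dots> = ?far" using False s by simp
  finally show ?thesis by (rule order.trans) simp
qed

lemma \<phi>_measurable [measurable]: "\<phi> \<in> borel_measurable borel"
  by (rule borel_measurable_continuous_onI) (rule continuous)

lemma nn_integral_kernel_le:
  assumes y: "0 < y" "y \<le> s" and x: "\<bar>x - t\<bar> \<le> s" and contact: "\<phi> t = L * s" and s: "s > 0"
    and B: "B \<ge> 0" and tail: "tail_mass \<phi> t s \<le> ennreal (L * B)"
  shows "(\<integral>\<^sup>+u. ennreal (\<phi> u * poisson_kernel x y u) \<partial>lborel) \<le> ennreal (pi * (L * (3 + 2 * B) * s))"
proof -
  let ?near = "\<lambda>u. ennreal (poisson_kernel x y u) * indicator {x - 3 * s..x + 3 * s} u"
  have [measurable]: "poisson_kernel x y \<in> borel_measurable borel" unfolding poisson_kernel_def by measurable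
  have "(\<integral>\<^sup>+u. ennreal (\<phi> u * poisson_kernel x y u) \<partial>lborel)
      \<le> ennreal (3 * s * L) * (\<integral>\<^sup>+u. ?near u \<partial>lborel) + ennreal (4 * s) * tail_mass \<phi> t s"
    unfolding tail_mass_def
    by (rule order.trans[OF nn_integral_mono[OF kernel_integrand_le[OF y x contact s]]])
      (simp add: nn_integral_add nn_integral_cmult)
  also have "(\<integral>\<^sup>+u. ?near u \<partial>lborel) = ennreal (2 * arctan (3 * s / y))"
    by (rule nn_integral_has_integral_lebesgue'[OF _ poisson_kernel_window])
      (use y s in \<open>auto intro: poisson_kernel_nonneg\<close>)
  also have "ennreal (3 * s * L) * ennreal (2 * arctan (3 * s / y)) + ennreal (4 * s) * tail_mass \<phi> t s
      \<le> ennreal (3 * s * L) * ennreal pi + ennreal (4 * s) * ennreal (L * B)"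
    using arctan_ubound[of "3 * s / y"] by (intro add_mono mult_left_mono ennreal_leI tail) auto
  also have "\<dots> = ennreal (3 * s * L * pi + 4 * s * (L * B))"
    using s L_nonneg B by (simp add: ennreal_mult[symmetric] flip: ennreal_plus)
  also have "\<dots> \<le> ennreal (pi * (L * (3 + 2 * B) * s))"
  proof (rule ennreal_leI)
    have "2 * (2 * s * L * B) \<le> pi * (2 * s * L * B)"
      using s L_nonneg B pi_ge_two by (intro mult_right_mono) auto
    then show "3 * s * L * pi + 4 * s * (L * B) \<le> pi * (L * (3 + 2 * B) * s)" by (simp add: algebra_simps)
  qed
  finally show ?thesis .
qed

lemma norm_le_near_contact:
  assumes h: "decaying_exp_type b h" and major: "\<And>x::real. norm (h (of_real x)) \<le> exp (\<phi> x)"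
    and contact: "\<phi> t = L * s" and s: "s > 0" and B: "B \<ge> 0" and tail: "tail_mass \<phi> t s \<le> ennreal (L * B)"
    and z: "norm (z - of_real t) \<le> s"
  shows "norm (h z) \<le> exp (b * \<bar>Im z\<bar> + L * (3 + 2 * B) * s)"
proof (cases "Im z = 0")
  case True
  then have real_z: "z = of_real (Re z)" by (simp add: complex_eq_iff)
  have "\<bar>Re z - t\<bar> \<le> s" using z abs_Re_le_cmod[of "z - of_real t"] by simp
  then have "L * \<bar>Re z - t\<bar> \<le> L * s" using L_nonneg by (rule mult_left_mono)
  then have "\<phi> (Re z) \<le> 2 * (L * s)" using lipschitz[of "Re z" t] contact by linarith
  also have "\<dots> \<le> (3 + 2 * B) * (L * s)" using s B L_nonneg by (intro mult_right_mono) auto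
  finally have "exp (\<phi> (Re z)) \<le> exp (b * \<bar>Im z\<bar> + L * (3 + 2 * B) * s)" using True by (simp add: mult_ac)
  then show ?thesis using major[of "Re z"] real_z by (metis order.trans)
next
  case False
  have "norm (h z) \<le> exp (b * \<bar>Im z\<bar> + pi * (L * (3 + 2 * B) * s) / pi)"
  proof (rule norm_le_exp_of_nn_integral[OF h major False])
    show "0 \<le> pi * (L * (3 + 2 * B) * s)" using s B L_nonneg by simp
    show "(\<integral>\<^sup>+u. ennreal (\<phi> u * poisson_kernel (Re z) \<bar>Im z\<bar> u) \<partial>lborel)
        \<le> ennreal (pi * (L * (3 + 2 * B) * s))"
      by (rule nn_integral_kernel_le[OF _ _ _ contact s B tail])
        (use False z abs_Im_le_cmod[of "z - of_real t"] abs_Re_le_cmod[of "z - of_real t"] in auto)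
  qed
  then show ?thesis by simp
qed

end

definition log_plus :: "real \<Rightarrow> (complex \<Rightarrow> complex) \<Rightarrow> real \<Rightarrow> real" where
  "log_plus \<Theta> h x = ln (max 1 (norm (h (of_real x)))) / \<Theta>"

definition log_majorant :: "real \<Rightarrow> (complex \<Rightarrow> complex) \<Rightarrow> real \<Rightarrow> real" where
  "log_majorant \<Theta> h = lip_majorant (log_plus \<Theta> h)"

lemma exp_log_plus: "\<Theta> > 0 \<Longrightarrow> exp (\<Theta> * log_plus \<Theta> h x) = max 1 (norm (h (of_real x)))"
  by (simp add: log_plus_def)

lemma log_plus_le_add:
  assumes \<Theta>: "\<Theta> > 0" and le: "norm (g (of_real x)) \<le> exp c * norm (h (of_real x))" and c: "c \<ge> 0"
  shows "log_plus \<Theta> g x \<le> log_plus \<Theta> h x + c / \<Theta>"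
proof -
  let ?a = "max 1 (norm (h (of_real x)))"
  have "1 * 1 \<le> exp c * ?a" using c by (intro mult_mono) auto
  moreover have "norm (g (of_real x)) \<le> exp c * ?a"
    using le by (elim order.trans) (auto intro!: mult_left_mono)
  ultimately have "ln (max 1 (norm (g (of_real x)))) \<le> ln (exp c * ?a)"
    by (intro ln_mono) (auto intro: less_le_trans[of 0 1])
  also have "\<dots> = c + ln ?a" by (subst ln_mult_pos) (auto intro: less_le_trans[of 0 1])
  finally show ?thesis
    unfolding log_plus_def using \<Theta> by (simp add: add_divide_distrib[symmetric] divide_right_mono add.commute)
qed

lemma decaying_exp_type_on_reals:
  assumes h: "decaying_exp_type b h"
  shows "\<exists>C>0. (\<forall>x::real. norm (h (of_real x)) \<le> C) \<and> (\<forall>x::real. \<bar>x\<bar> > C \<longrightarrow> norm (h (of_real x)) \<le> 1)"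
proof -
  obtain C where C: "\<And>z. norm (h z) \<le> C * exp (b * \<bar>Im z\<bar>) / (1 + norm z)"
    using h by (auto simp: decaying_exp_type_def)
  define D where "D = max C 1"
  have decay: "norm (h (of_real x)) \<le> D / (1 + \<bar>x\<bar>)" for x :: real
  proof -
    have "C / (1 + \<bar>x\<bar>) \<le> D / (1 + \<bar>x\<bar>)" by (intro divide_right_mono) (auto simp: D_def)
    then show ?thesis using C[of "of_real x"] by simp
  qed
  have "norm (h (of_real x)) \<le> D" for x :: real
  proof -
    have "D / (1 + \<bar>x\<bar>) \<le> D / 1" by (intro divide_left_mono) (auto simp: D_def)
    then show ?thesis using decay[of x] by simp
  qed
  moreover have "norm (h (of_real x)) \<le> 1" if "\<bar>x\<bar> > D" for x :: real
  proof -
    have "D / (1 + \<bar>x\<bar>) \<le> 1" using that by (simp add: divide_le_eq)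
    then show ?thesis using decay[of x] by linarith
  qed
  ultimately show ?thesis by (intro exI[of _ D]) (auto simp: D_def)
qed

lemma bump_log_plus:
  assumes h: "decaying_exp_type b h" and \<Theta>: "\<Theta> > 0"
  shows "bump (log_plus \<Theta> h)"
  unfolding bump_def
proof (intro conjI)
  have "continuous_on UNIV (\<lambda>x. h (complex_of_real x))"
    by (rule continuous_on_compose2[OF holomorphic_on_imp_continuous_on])
      (use h in \<open>auto simp: decaying_exp_type_def intro!: continuous_intros\<close>)
  then show "continuous_on UNIV (log_plus \<Theta> h)"
    unfolding log_plus_def using \<Theta>
    by (intro continuous_on_divide continuous_on_ln continuous_on_max continuous_on_norm continuous_on_const)
      (auto simp: max_def)
  show "\<forall>x. 0 \<le> log_plus \<Theta> h x" using \<Theta> by (simp add: log_plus_def)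
  obtain C where "\<forall>x::real. \<bar>x\<bar> > C \<longrightarrow> norm (h (of_real x)) \<le> 1"
    using decaying_exp_type_on_reals[OF h] by blast
  then show "\<exists>T. \<forall>x. \<bar>x\<bar> > T \<longrightarrow> log_plus \<Theta> h x = 0"
    by (intro exI[of _ C]) (auto simp: log_plus_def max_absorb1)
qed

lemma norm_le_exp_log_majorant:
  assumes h: "decaying_exp_type b h" and \<Theta>: "\<Theta> > 0"
  shows "norm (h (of_real x)) \<le> exp (\<Theta> * log_majorant \<Theta> h x)"
proof -
  have "norm (h (of_real x)) \<le> exp (\<Theta> * log_plus \<Theta> h x)" using exp_log_plus[OF \<Theta>, of h x] by simp
  also have "\<dots> \<le> exp (\<Theta> * log_majorant \<Theta> h x)"
    using lip_majorant_ge_self[OF bump_log_plus[OF h \<Theta>]] \<Theta> by (simp add: log_majorant_def)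
  finally show ?thesis .
qed

lemma weighted_mass_continuous_family:
  fixes \<sigma> :: "real \<Rightarrow> real \<Rightarrow> real"
  assumes X: "X \<ge> 1" and T: "T > 0" and M: "M \<ge> 0"
    and cont: "\<And>c. c \<ge> 0 \<Longrightarrow> continuous_on {-T..T} (\<sigma> c)" and nonneg: "\<And>c x. c \<ge> 0 \<Longrightarrow> 0 \<le> \<sigma> c x"
    and support: "\<And>c x. c \<ge> 0 \<Longrightarrow> \<bar>x\<bar> > T \<Longrightarrow> \<sigma> c x = 0"
    and lip: "\<And>c c' x. c \<ge> 0 \<Longrightarrow> c' \<ge> 0 \<Longrightarrow> \<bar>\<sigma> c x - \<sigma> c' x\<bar> \<le> M * \<bar>c - c'\<bar>"
  obtains g where "continuous_on {0..} g" "\<And>c. c \<ge> 0 \<Longrightarrow> weighted_mass X (\<sigma> c) = ennreal (g c)"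
proof -
  define g where "g c = integral {-T..T} (\<lambda>x. \<sigma> c x * weight X x)" for c
  have w: "0 \<le> weight X x" "weight X x \<le> 1" for x
    using weight_pos[OF X, of x] weight_le_one[OF X, of x] by auto
  have cont_weighted: "continuous_on {-T..T} (\<lambda>x. \<sigma> c x * weight X x)" if "c \<ge> 0" for c
    unfolding weight_def using weight_denominator_pos[OF X] less_imp_neq[OF weight_denominator_pos[OF X]]
    by (intro continuous_intros cont that) auto
  have "weighted_mass X (\<sigma> c) = ennreal (g c)" if c: "c \<ge> 0" for c
  proof -
    have "((\<lambda>x. \<sigma> c x * weight X x) has_integral g c) {-T..T}"
      unfolding g_def by (intro integrable_integral integrable_continuous_interval cont_weighted c)
    from nn_integral_has_integral_lebesgue'[OF _ this]
    have "(\<integral>\<^sup>+x. ennreal (\<sigma> c x * weight X x) * indicator {-T..T} x \<partial>lborel) = ennreal (g c)"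
      using nonneg[OF c] w by simp
    moreover have "ennreal (\<sigma> c x * weight X x) * indicator {-T..T} x = ennreal (\<sigma> c x * weight X x)" for x
      using support[OF c, of x] by (cases "\<bar>x\<bar> > T") (auto simp: indicator_def)
    ultimately show ?thesis by (simp add: weighted_mass_def)
  qed
  moreover have "\<bar>g c - g c'\<bar> \<le> (2 * T * M) * \<bar>c - c'\<bar>" if c: "c \<ge> 0" "c' \<ge> 0" for c c'
  proof -
    have "g c - g c' = integral {-T..T} (\<lambda>x. \<sigma> c x * weight X x - \<sigma> c' x * weight X x)"
      unfolding g_def by (intro integral_diff[symmetric] integrable_continuous_interval cont_weighted c)
    also have "norm \<dots> \<le> (M * \<bar>c - c'\<bar>) * (T - (- T))"
    proof (rule integral_bound)
      fix x
      have "\<bar>\<sigma> c x - \<sigma> c' x\<bar> * weight X x \<le> (M * \<bar>c - c'\<bar>) * 1"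
        using lip[OF c] w M by (intro mult_mono) auto
      then show "norm (\<sigma> c x * weight X x - \<sigma> c' x * weight X x) \<le> M * \<bar>c - c'\<bar>"
        using w by (simp add: left_diff_distrib[symmetric] abs_mult)
    qed (use T c in \<open>auto intro!: continuous_intros cont_weighted\<close>)
    finally show ?thesis by (simp add: mult_ac)
  qed
  then have "continuous_on {0..} g"
    using T M by (intro lipschitz_on_continuous_on[of "2 * T * M"] lipschitz_onI) (auto simp: dist_real_def)
  ultimately show thesis using that by blast
qed

definition scaled_down :: "real \<Rightarrow> (complex \<Rightarrow> complex) \<Rightarrow> complex \<Rightarrow> complex" where
  "scaled_down c h z = of_real (exp (- c)) * h z"

lemma norm_scaled_down: "norm (scaled_down c h z) = exp (- c) * norm (h z)"
  by (simp add: scaled_down_def norm_mult)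

lemma norm_scaled_down_le: "c \<ge> 0 \<Longrightarrow> norm (scaled_down c h z) \<le> norm (h z)"
  by (simp add: norm_scaled_down mult_left_le_one_le)

lemma decaying_exp_type_scaled_down:
  assumes "decaying_exp_type b h"
  shows "decaying_exp_type b (scaled_down c h)"
proof -
  obtain C where holo: "h holomorphic_on UNIV" and C: "\<And>z. norm (h z) \<le> C * exp (b * \<bar>Im z\<bar>) / (1 + norm z)"
    using assms by (auto simp: decaying_exp_type_def)
  have "norm (scaled_down c h z) \<le> (exp (- c) * C) * exp (b * \<bar>Im z\<bar>) / (1 + norm z)" for z
    using mult_left_mono[OF C[of z], of "exp (- c)"] by (simp add: norm_scaled_down mult.assoc)
  moreover have "scaled_down c h holomorphic_on UNIV"
    unfolding scaled_down_def[abs_def] by (intro holomorphic_intros holo)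
  ultimately show ?thesis unfolding decaying_exp_type_def by blast
qed

lemma log_majorant_scaled_down_lipschitz:
  assumes h: "decaying_exp_type b h" and \<Theta>: "\<Theta> > 0"
  shows "\<bar>log_majorant \<Theta> (scaled_down c h) x - log_majorant \<Theta> (scaled_down c' h) x\<bar> \<le> 1 / \<Theta> * \<bar>c - c'\<bar>"
proof -
  have one_sided: "log_majorant \<Theta> (scaled_down c h) x
      \<le> log_majorant \<Theta> (scaled_down c' h) x + \<bar>c - c'\<bar> / \<Theta>" for c c'
    unfolding log_majorant_def
  proof (intro lip_majorant_le_add bump_log_plus[OF decaying_exp_type_scaled_down[OF h] \<Theta>] log_plus_le_add[OF \<Theta>])
    fix x
    have "exp (- c) * norm (h (of_real x)) \<le> exp (\<bar>c - c'\<bar> + - c') * norm (h (of_real x))"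
      by (intro mult_right_mono) auto
    then show "norm (scaled_down c h (of_real x)) \<le> exp \<bar>c - c'\<bar> * norm (scaled_down c' h (of_real x))"
      unfolding exp_add by (simp add: norm_scaled_down mult.assoc)
  qed simp
  show ?thesis using one_sided[of c c'] one_sided[of c' c] by (simp add: abs_le_iff abs_minus_commute)
qed

text \<open>\<open>3 + 2 * B\<close> is the growth rate in \<open>norm_le_near_contact\<close>.\<close>

definition growth_factor :: real where "growth_factor = 3 + 2 * tail_threshold"

locale contact_controlled_class =
  fixes P :: "(complex \<Rightarrow> complex) \<Rightarrow> bool" and b \<Theta> :: real and q :: "real \<Rightarrow> real"
  assumes \<Theta>_pos: "\<Theta> > 0"
    and q_measurable: "q \<in> borel_measurable borel" and q_nonneg: "\<And>x. q x \<ge> 0"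
    and q_light: "weighted_mass 1 q < top"
    and P_type: "P h \<Longrightarrow> decaying_exp_type b h"
    and P_scaled_down: "P h \<Longrightarrow> c \<ge> 0 \<Longrightarrow> P (scaled_down c h)"
    and P_local: "P h \<Longrightarrow> s > 0
      \<Longrightarrow> (\<And>z. norm (z - of_real t) \<le> s \<Longrightarrow> norm (h z) \<le> exp (b * \<bar>Im z\<bar> + \<Theta> * growth_factor * s))
      \<Longrightarrow> window_mass q t (3 * s) < ennreal (s\<^sup>2) \<Longrightarrow> norm (h (of_real t)) < exp (\<Theta> * s)"
begin

lemma bump_of_class: "P h \<Longrightarrow> bump (log_plus \<Theta> h)"
  using bump_log_plus[OF P_type \<Theta>_pos] .

lemma log_majorant_nonneg: "P h \<Longrightarrow> 0 \<le> log_majorant \<Theta> h x"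
  unfolding log_majorant_def by (intro lip_majorant_nonneg bump_of_class)

lemma log_majorant_continuous: "P h \<Longrightarrow> continuous_on S (log_majorant \<Theta> h)"
  unfolding log_majorant_def using lip_majorant_lipschitz[OF bump_of_class]
  by (intro lipschitz_on_continuous_on[of 1] lipschitz_onI) (auto simp: dist_real_def)

lemma contact_alternative:
  assumes h: "P h" and contact: "log_majorant \<Theta> h t = log_plus \<Theta> h t" and pos: "log_majorant \<Theta> h t > 0"
  shows "ennreal ((log_majorant \<Theta> h t)\<^sup>2) \<le> window_mass q t (3 * log_majorant \<Theta> h t)
    \<or> ennreal tail_threshold < tail_mass (log_majorant \<Theta> h) t (log_majorant \<Theta> h t)"
proof (rule ccontr)
  let ?\<sigma> = "log_majorant \<Theta> h"
  assume "\<not> ?thesis"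
  then have light_window: "window_mass q t (3 * ?\<sigma> t) < ennreal ((?\<sigma> t)\<^sup>2)"
    and light_tail: "tail_mass ?\<sigma> t (?\<sigma> t) \<le> ennreal tail_threshold" by (auto simp: not_le not_less)
  obtain T where "lipschitz_bump (\<lambda>x. \<Theta> * ?\<sigma> x) \<Theta> T"
    unfolding log_majorant_def
    using lipschitz_bump_lip_majorant[OF bump_of_class[OF h] less_imp_le[OF \<Theta>_pos]] by blast
  then interpret lipschitz_bump "\<lambda>x. \<Theta> * ?\<sigma> x" \<Theta> T .
  have [measurable]: "?\<sigma> \<in> borel_measurable borel"
    by (intro borel_measurable_continuous_onI log_majorant_continuous h)
  have "tail_mass (\<lambda>x. \<Theta> * ?\<sigma> x) t (?\<sigma> t) = ennreal \<Theta> * tail_mass ?\<sigma> t (?\<sigma> t)"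
    unfolding tail_mass_def using \<Theta>_pos log_majorant_nonneg[OF h]
    by (subst nn_integral_cmult[symmetric])
      (auto simp: ennreal_mult[symmetric] mult.assoc[symmetric] intro!: nn_integral_cong)
  also have "\<dots> \<le> ennreal (\<Theta> * tail_threshold)"
    using mult_left_mono[OF light_tail, of "ennreal \<Theta>"] \<Theta>_pos
    by (simp add: ennreal_mult tail_threshold_def jump_ratio_def)
  finally have scaled_tail: "tail_mass (\<lambda>x. \<Theta> * ?\<sigma> x) t (?\<sigma> t) \<le> ennreal (\<Theta> * tail_threshold)" .
  have "norm (h z) \<le> exp (b * \<bar>Im z\<bar> + \<Theta> * growth_factor * ?\<sigma> t)" if "norm (z - of_real t) \<le> ?\<sigma> t" for z
    unfolding growth_factor_def
    by (rule norm_le_near_contact[OF P_type[OF h] norm_le_exp_log_majorant[OF P_type[OF h] \<Theta>_pos] refl pos _ scaled_tail that])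
      (simp add: tail_threshold_def jump_ratio_def)
  from P_local[OF h pos this light_window] have "norm (h (of_real t)) < exp (\<Theta> * ?\<sigma> t)" .
  moreover have "max 1 (norm (h (of_real t))) = exp (\<Theta> * ?\<sigma> t)"
    using exp_log_plus[OF \<Theta>_pos, of h t] contact by simp
  moreover have "exp (\<Theta> * ?\<sigma> t) > 1" using pos \<Theta>_pos by simp
  ultimately show False by linarith
qed

lemma mass_improves:
  assumes h: "P h" and X: "X \<ge> 1" "weighted_mass X q < ennreal (1 / (4000 * 61440))"
    and mass: "weighted_mass X (log_majorant \<Theta> h) \<le> ennreal (1 / 4000)"
  shows "weighted_mass X (log_majorant \<Theta> h) < ennreal (1 / 4000)"
proof -
  have "weighted_mass X (log_majorant \<Theta> h) \<le> 61440 * weighted_mass X q"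
    using mass contact_alternative[OF h] unfolding log_majorant_def
    by (intro weighted_mass_bootstrap[OF bump_of_class[OF h] X(1) q_measurable q_nonneg])
  also have "\<dots> < 61440 * ennreal (1 / (4000 * 61440))"
    using X(2) by (intro ennreal_mult_strict_left_mono) auto
  also have "\<dots> = ennreal (1 / 4000)" by (simp flip: ennreal_numeral ennreal_mult)
  finally show ?thesis .
qed

lemma log_majorant_scaled_down_eventually_zero:
  assumes h: "P h"
  obtains c where "c \<ge> 0" "\<And>x. log_majorant \<Theta> (scaled_down c h) x = 0"
proof -
  obtain C where C: "C > 0" "\<forall>x::real. norm (h (of_real x)) \<le> C"
    using decaying_exp_type_on_reals[OF P_type[OF h]] by blast
  define c where "c = max 0 (ln C)"
  have c: "c \<ge> 0" by (simp add: c_def)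
  have log_plus_zero: "log_plus \<Theta> (scaled_down c h) x = 0" for x
  proof -
    have "norm (scaled_down c h (of_real x)) \<le> exp (- c) * C"
      using mult_left_mono[OF C(2)[rule_format, of x], of "exp (- c)"] by (simp add: norm_scaled_down)
    also have "\<dots> \<le> exp (- ln C) * C" using C(1) by (intro mult_right_mono) (auto simp: c_def)
    also have "\<dots> = 1" using C(1) by (simp add: exp_minus)
    finally show ?thesis by (simp add: log_plus_def max_def)
  qed

  have "log_majorant \<Theta> (scaled_down c h) x = 0" for x
  proof (rule antisym)
    obtain t where "log_majorant \<Theta> (scaled_down c h) x = log_plus \<Theta> (scaled_down c h) t - \<bar>x - t\<bar>"
      unfolding log_majorant_def
      using lip_majorant_attained[OF bump_of_class[OF P_scaled_down[OF h c]]] by blast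
    then show "log_majorant \<Theta> (scaled_down c h) x \<le> 0" by (simp add: log_plus_zero)
  qed (rule log_majorant_nonneg[OF P_scaled_down[OF h c]])
  then show thesis by (rule that[OF c])
qed

lemma log_majorant_scaled_down_support:
  assumes h: "P h"
  obtains T where "T > 0" "\<And>c x. c \<ge> 0 \<Longrightarrow> \<bar>x\<bar> > T \<Longrightarrow> log_majorant \<Theta> (scaled_down c h) x = 0"
proof -
  obtain T where T: "T > 0" "\<And>x. \<bar>x\<bar> > T \<Longrightarrow> log_majorant \<Theta> h x = 0"
    unfolding log_majorant_def using lip_majorant_support[OF bump_of_class[OF h]] by blast
  have "log_majorant \<Theta> (scaled_down c h) x \<le> log_majorant \<Theta> h x + 0" if "c \<ge> 0" for c x
    unfolding log_majorant_def
  proof (intro lip_majorant_le_add bump_of_class P_scaled_down h that)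
    fix x
    have "norm (scaled_down c h (of_real x)) \<le> exp 0 * norm (h (of_real x))"
      using norm_scaled_down_le[OF that] by simp
    then show "log_plus \<Theta> (scaled_down c h) x \<le> log_plus \<Theta> h x + 0"
      using log_plus_le_add[OF \<Theta>_pos] by fastforce
  qed
  then have "log_majorant \<Theta> (scaled_down c h) x = 0" if "c \<ge> 0" "\<bar>x\<bar> > T" for c x
    using T(2) that log_majorant_nonneg[OF P_scaled_down[OF h that(1)]]
    by (metis add.right_neutral order_antisym)
  then show thesis by (rule that[OF T(1)])
qed

text \<open>Continuity method: the mass of \<open>scaled_down c h\<close> is continuous in \<open>c\<close>, vanishes for large \<open>c\<close>, and by
  \<open>mass_improves\<close> never equals \<open>1 / 4000\<close>.\<close>

lemma mass_le:
  assumes h: "P h" and X: "X \<ge> 1" "weighted_mass X q < ennreal (1 / (4000 * 61440))"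
  shows "weighted_mass X (log_majorant \<Theta> h) \<le> ennreal (1 / 4000)"
proof -
  let ?\<sigma> = "\<lambda>c. log_majorant \<Theta> (scaled_down c h)"
  obtain T where T: "T > 0" "\<And>c x. c \<ge> 0 \<Longrightarrow> \<bar>x\<bar> > T \<Longrightarrow> ?\<sigma> c x = 0"
    using log_majorant_scaled_down_support[OF h] by blast
  obtain g where g: "continuous_on {0..} g" "\<And>c. c \<ge> 0 \<Longrightarrow> weighted_mass X (?\<sigma> c) = ennreal (g c)"
  proof (rule weighted_mass_continuous_family[of X T "1 / \<Theta>" ?\<sigma>])
    show "\<bar>?\<sigma> c x - ?\<sigma> c' x\<bar> \<le> 1 / \<Theta> * \<bar>c - c'\<bar>" for c c' x
      by (rule log_majorant_scaled_down_lipschitz[OF P_type[OF h] \<Theta>_pos])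
  qed (use X T \<Theta>_pos h P_scaled_down log_majorant_continuous log_majorant_nonneg in auto)
  obtain c1 where c1: "c1 \<ge> 0" "\<And>x. ?\<sigma> c1 x = 0"
    using log_majorant_scaled_down_eventually_zero[OF h] by blast
  have "weighted_mass X (?\<sigma> c1) = 0" unfolding c1(2)[abs_def] by (simp add: weighted_mass_def c1(2))
  then have g_c1: "g c1 \<le> 0" using g(2)[OF c1(1)] by (metis ennreal_eq_0_iff)
  have "g 0 \<le> 1 / 4000"
  proof (rule ccontr)
    assume "\<not> ?thesis"
    then have "1 / 4000 \<le> g 0" "g c1 \<le> 1 / 4000" using g_c1 by simp_all
    then obtain c where c: "c \<ge> 0" "g c = 1 / 4000"
      using IVT2'[of g c1 "1 / 4000" 0] c1(1) continuous_on_subset[OF g(1), of "{0..c1}"] by auto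
    then have mass: "weighted_mass X (?\<sigma> c) = ennreal (1 / 4000)" using g(2) by simp
    show False using mass_improves[OF P_scaled_down[OF h c(1)] X] mass by simp
  qed
  then show ?thesis using g(2)[of 0] by (simp add: scaled_down_def[abs_def] ennreal_leI)
qed

lemma norm_at_i_le:
  assumes h: "P h" and X: "X \<ge> 1" "weighted_mass X q < ennreal (1 / (4000 * 61440))"
  shows "norm (h \<i>) \<le> exp (b + \<Theta> * X\<^sup>2 / 4000 / pi)"
proof -
  let ?\<sigma> = "log_majorant \<Theta> h"
  note nonneg_\<sigma> = log_majorant_nonneg[OF h]
  obtain T where "lipschitz_bump (\<lambda>x. \<Theta> * ?\<sigma> x) \<Theta> T"
    unfolding log_majorant_def
    using lipschitz_bump_lip_majorant[OF bump_of_class[OF h] less_imp_le[OF \<Theta>_pos]] by blast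
  then interpret lipschitz_bump "\<lambda>x. \<Theta> * ?\<sigma> x" \<Theta> T .
  have [measurable]: "?\<sigma> \<in> borel_measurable borel"
    by (intro borel_measurable_continuous_onI log_majorant_continuous h)
  have kernel_le: "poisson_kernel 0 1 y \<le> X\<^sup>2 * weight X y" for y
  proof -
    have "1 * y\<^sup>2 \<le> X\<^sup>2 * y\<^sup>2" using X by (intro mult_right_mono) (auto simp: one_le_power)
    then have "X\<^sup>2 + y\<^sup>2 \<le> X\<^sup>2 * (1 + y\<^sup>2)" by (simp add: algebra_simps)
    then show ?thesis
      unfolding poisson_kernel_def weight_def using weight_denominator_pos[OF X(1), of y]
      by (simp add: divide_simps add_pos_nonneg add.commute)
  qed
  have "(\<integral>\<^sup>+u. ennreal (\<Theta> * ?\<sigma> u * poisson_kernel 0 1 u) \<partial>lborel)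
     \<le> (\<integral>\<^sup>+u. ennreal (\<Theta> * X\<^sup>2) * ennreal (?\<sigma> u * weight X u) \<partial>lborel)"
  proof (rule nn_integral_mono)
    fix y
    have "\<Theta> * ?\<sigma> y * poisson_kernel 0 1 y \<le> \<Theta> * ?\<sigma> y * (X\<^sup>2 * weight X y)"
      using kernel_le \<Theta>_pos nonneg_\<sigma> by (intro mult_left_mono) auto
    then have "ennreal (\<Theta> * ?\<sigma> y * poisson_kernel 0 1 y) \<le> ennreal ((\<Theta> * X\<^sup>2) * (?\<sigma> y * weight X y))"
      by (intro ennreal_leI) (simp add: mult_ac)
    then show "ennreal (\<Theta> * ?\<sigma> y * poisson_kernel 0 1 y) \<le> ennreal (\<Theta> * X\<^sup>2) * ennreal (?\<sigma> y * weight X y)"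
      using \<Theta>_pos nonneg_\<sigma> weight_pos[OF X(1), of y] by (simp add: ennreal_mult)
  qed
  also have "\<dots> = ennreal (\<Theta> * X\<^sup>2) * weighted_mass X ?\<sigma>"
    unfolding weighted_mass_def by (rule nn_integral_cmult) measurable
  also have "\<dots> \<le> ennreal (\<Theta> * X\<^sup>2) * ennreal (1 / 4000)" by (intro mult_left_mono mass_le[OF h X]) simp
  also have "\<dots> = ennreal (\<Theta> * X\<^sup>2 / 4000)" using \<Theta>_pos by (simp add: ennreal_mult[symmetric])
  finally have "norm (h \<i>) \<le> exp (b * \<bar>Im \<i>\<bar> + \<Theta> * X\<^sup>2 / 4000 / pi)"
    by (intro norm_le_exp_of_nn_integral[OF P_type[OF h] norm_le_exp_log_majorant[OF P_type[OF h] \<Theta>_pos]])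
      (use \<Theta>_pos in auto)
  then show ?thesis by simp
qed

theorem uniform_bound_at_i: "\<exists>C. \<forall>h. P h \<longrightarrow> norm (h \<i>) \<le> C"
proof -
  obtain X where "X \<ge> 1" "weighted_mass X q < ennreal (1 / (4000 * 61440))"
    using weighted_mass_tends_to_zero[OF q_measurable q_nonneg q_light, of "1 / (4000 * 61440)"] by auto
  then show ?thesis using norm_at_i_le by blast
qed

end

section \<open>Selecting nodes of small energy\<close>

lemma fact_ge_power_exp: "(real n / exp 1) ^ n \<le> fact n"
  using self_power_le_exp_fact[of n] by (simp add: power_divide exp_of_nat_mult[symmetric] field_simps)

lemma prod_ge_fact_of_count:
  fixes y :: "'a \<Rightarrow> real"
  assumes "finite S" and C: "C > 0" and "\<And>l. l \<in> S \<Longrightarrow> y l > 0"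
    and "\<And>r. r > 0 \<Longrightarrow> real (card {l\<in>S. y l \<le> r}) \<le> C * r"
  shows "fact (card S) / C ^ card S \<le> (\<Prod>l\<in>S. y l)"
  using assms(1,3,4)
proof (induction "card S" arbitrary: S)
  case 0
  then show ?case by simp
next
  case (Suc n)
  then have "S \<noteq> {}" by auto
  then obtain m where m: "m \<in> S" "\<And>l. l \<in> S \<Longrightarrow> y l \<le> y m"
    using Max_in[of "y ` S"] Max_ge[of "y ` S"] Suc.prems(1)
    by (metis (no_types, lifting) finite_imageI image_iff image_is_empty imageI)
  have card: "card (S - {m}) = n" using Suc.hyps(2) m Suc.prems(1) by simp
  have "fact (card (S - {m})) / C ^ card (S - {m}) \<le> (\<Prod>l\<in>S-{m}. y l)"
  proof (rule Suc.hyps(1))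
    fix r :: real assume r: "r > 0"
    have "card {l\<in>S-{m}. y l \<le> r} \<le> card {l\<in>S. y l \<le> r}" by (rule card_mono) (use Suc.prems(1) in auto)
    then show "real (card {l\<in>S-{m}. y l \<le> r}) \<le> C * r" using Suc.prems(3)[OF r] by linarith
  qed (use card Suc.prems in auto)
  then have rest: "fact n / C ^ n \<le> (\<Prod>l\<in>S-{m}. y l)" using card by simp
  have largest_pos: "y m > 0" using Suc.prems m by auto
  have "{l\<in>S. y l \<le> y m} = S" using m by auto
  then have "real (Suc n) \<le> C * y m" using Suc.prems(3)[OF largest_pos] Suc.hyps(2) by simp
  then have "real (Suc n) / C \<le> y m" using C by (simp add: field_simps)
  then have "(real (Suc n) / C) * (fact n / C ^ n) \<le> y m * (\<Prod>l\<in>S-{m}. y l)"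
    using rest largest_pos C by (intro mult_mono) auto
  also have "\<dots> = (\<Prod>l\<in>S. y l)" using Suc.prems(1) m by (simp add: prod.remove)
  finally show ?case using Suc.hyps(2)[symmetric] by simp
qed

lemma sum_ln_le_of_count:
  fixes y :: "'a \<Rightarrow> real"
  assumes fin: "finite S" and C: "C > 0" and y: "\<And>l. l \<in> S \<Longrightarrow> y l > 0" and R: "R > 0"
    and count: "\<And>r. r > 0 \<Longrightarrow> real (card {l\<in>S. y l \<le> r}) \<le> C * r"
  shows "(\<Sum>l\<in>S. ln (R / y l)) \<le> C * R"
proof (cases "S = {}")
  case False
  define n where "n = card S"
  have n: "n > 0" using False fin by (simp add: n_def card_gt_0_iff)
  have "(real n / exp 1) ^ n / C ^ n \<le> fact n / C ^ n"
    using fact_ge_power_exp C by (intro divide_right_mono) auto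
  also have "\<dots> \<le> (\<Prod>l\<in>S. y l)" unfolding n_def by (rule prod_ge_fact_of_count[OF fin C y count])
  finally have "(real n / (exp 1 * C)) ^ n \<le> (\<Prod>l\<in>S. y l)" by (simp add: power_divide[symmetric])
  then have "ln ((real n / (exp 1 * C)) ^ n) \<le> ln (\<Prod>l\<in>S. y l)" using n C by (intro ln_mono) auto
  also have "ln (\<Prod>l\<in>S. y l) = (\<Sum>l\<in>S. ln (y l))"
    using y by (intro ln_prod) (auto simp: fin less_imp_neq[symmetric])
  finally have sum_ln_ge: "real n * ln (real n / (exp 1 * C)) \<le> (\<Sum>l\<in>S. ln (y l))"
    using n C by (simp add: ln_realpow)
  have "(\<Sum>l\<in>S. ln (R / y l)) = (\<Sum>l\<in>S. ln R - ln (y l))"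
  proof (rule sum.cong[OF refl])
    show "ln (R / y l) = ln R - ln (y l)" if "l \<in> S" for l using y[OF that] R by (simp add: ln_div)
  qed
  also have "\<dots> = real n * ln R - (\<Sum>l\<in>S. ln (y l))" by (simp add: sum_subtractf n_def)
  also have "\<dots> \<le> real n * ln R - real n * ln (real n / (exp 1 * C))" using sum_ln_ge by simp
  also have "\<dots> = real n * (ln (C * R / real n) + 1)" using n C R by (simp add: ln_div ln_mult algebra_simps)
  also have "\<dots> \<le> real n * (C * R / real n)"
    using ln_le_minus_one[of "C * R / real n"] n C R by (intro mult_left_mono) auto
  also have "\<dots> = C * R" using n by simp
  finally show ?thesis .
qed (use C R in simp)

lemma card_low_rank:
  fixes r :: real
  assumes fin: "finite J" and r: "r \<ge> 0" and trans: "transp R" and irrefl: "\<And>k. \<not> R k k"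
    and total: "\<And>k l. k \<noteq> l \<Longrightarrow> R k l \<or> R l k"
  shows "real (card {k\<in>J. real (card {j\<in>J. R j k}) < r}) \<le> r + 1"
proof -
  let ?rank = "\<lambda>k. card {j\<in>J. R j k}"
  have rank_less: "?rank k < ?rank l" if "k \<in> J" "R k l" for k l
  proof (rule psubset_card_mono)
    show "{j\<in>J. R j k} \<subset> {j\<in>J. R j l}" using that irrefl transpD[OF trans] by blast
  qed (use fin in simp)
  have "card {k\<in>J. real (?rank k) < r} \<le> card {..<nat \<lceil>r\<rceil>}"
  proof (rule card_inj_on_le)
    show "inj_on ?rank {k\<in>J. real (?rank k) < r}"
      using rank_less total by (intro inj_onI) (metis (no_types, lifting) less_irrefl mem_Collect_eq)
  qed (auto simp: less_ceiling_iff zless_nat_eq_int_zless)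
  then have "real (card {k\<in>J. real (?rank k) < r}) \<le> real (nat \<lceil>r\<rceil>)" by simp
  also have "\<dots> \<le> r + 1" using r by linarith
  finally show ?thesis .
qed

lemma card_gt_le_sum:
  fixes f :: "'a \<Rightarrow> real"
  assumes "finite S" "\<And>k. k \<in> S \<Longrightarrow> f k \<ge> 0" "\<theta> > 0"
  shows "real (card {k\<in>S. f k > \<theta>}) \<le> (\<Sum>k\<in>S. f k) / \<theta>"
proof -
  have "\<theta> * real (card {k\<in>S. f k > \<theta>}) = (\<Sum>k\<in>{k\<in>S. f k > \<theta>}. \<theta>)" by simp
  also have "\<dots> \<le> (\<Sum>k\<in>{k\<in>S. f k > \<theta>}. f k)" by (rule sum_mono) auto
  also have "\<dots> \<le> (\<Sum>k\<in>S. f k)" by (rule sum_mono2) (use assms in auto)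
  finally show ?thesis using assms(3) by (simp add: field_simps)
qed

definition gap_radius :: "(int \<Rightarrow> real) \<Rightarrow> int \<Rightarrow> real" where
  "gap_radius a k = min (a (k+1) - a k) (a k - a (k-1)) / 3"

definition perturbation :: "(int \<Rightarrow> real) \<Rightarrow> (int \<Rightarrow> real) \<Rightarrow> bool" where
  "perturbation a x \<longleftrightarrow> (\<forall>k. \<bar>x k - a k\<bar> < gap_radius a k)"

lemma perturbation_less:
  assumes "perturbation a x"
  shows "\<bar>x k - a k\<bar> < (a (k+1) - a k) / 3" "\<bar>x k - a k\<bar> < (a k - a (k-1)) / 3"
proof -
  have "\<bar>x k - a k\<bar> < gap_radius a k" using assms by (simp add: perturbation_def)
  then show "\<bar>x k - a k\<bar> < (a (k+1) - a k) / 3" "\<bar>x k - a k\<bar> < (a k - a (k-1)) / 3"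
    by (auto simp: gap_radius_def)
qed

lemma perturbation_diff_ge:
  assumes a: "strict_mono a" and x: "perturbation a x"
  shows "\<bar>a k - a l\<bar> / 3 \<le> \<bar>x k - x l\<bar>"
proof (induction k l rule: linorder_wlog)
  case (le k l)
  show ?case
  proof (cases "k = l")
    case False
    then have less: "k < l" using le by simp
    have "a (k+1) \<le> a l" "a k \<le> a (l-1)" "a k < a l"
      using less a by (auto simp: strict_mono_less_eq strict_mono_less)
    moreover have "x k - a k < (a (k+1) - a k) / 3" "a l - x l < (a l - a (l-1)) / 3"
      using perturbation_less[OF x, of k] perturbation_less[OF x, of l] by linarith+
    ultimately have "(a l - a k) / 3 \<le> x l - x k" by argo
    then show ?thesis using \<open>a k < a l\<close> by simp
  qed simp
qed (simp add: abs_minus_commute)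

lemma inj_perturbation: "strict_mono a \<Longrightarrow> perturbation a x \<Longrightarrow> inj x"
proof (rule injI)
  fix k l assume a: "strict_mono a" and x: "perturbation a x" and "x k = x l"
  then have "a k = a l" using perturbation_diff_ge[OF a x, of k l] by simp
  then show "k = l" using a by (simp add: strict_mono_eq)
qed

locale partitioned_points =
  fixes a c :: "int \<Rightarrow> real" and \<delta> D :: real
  assumes a_mono: "strict_mono a" and c_mono: "strict_mono c"
    and \<delta>_pos: "0 < \<delta>" and gap: "\<And>n. \<delta> \<le> c (n+1) - c n"
    and D_ge_one: "1 \<le> D"
    and finite_preimage: "\<And>n. finite {k. a k \<in> part_int c n}"
    and card_preimage: "\<And>n. real (card {k. a k \<in> part_int c n}) \<le> D * (c (n+1) - c n)"
begin

abbreviation cell :: "int \<Rightarrow> real set" where "cell \<equiv> part_int c"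

definition width :: "int \<Rightarrow> real" where "width n = c (n+1) - c n"
definition members :: "int \<Rightarrow> int set" where "members n = {k. a k \<in> cell n}"
definition cell_of :: "real \<Rightarrow> int" where "cell_of x = (THE n. x \<in> cell n)"
definition width_at :: "int \<Rightarrow> real" where "width_at k = width (cell_of (a k))"

lemma width_ge: "\<delta> \<le> width n"
  using gap by (simp add: width_def)

lemma width_pos: "width n > 0"
  using width_ge[of n] \<delta>_pos by linarith

lemma width_at_pos: "width_at k > 0"
  by (simp add: width_at_def width_pos)

lemma c_less_iff: "c m < c n \<longleftrightarrow> m < n"
  using c_mono by (simp add: strict_mono_less)

lemma c_le_iff: "c m \<le> c n \<longleftrightarrow> m \<le> n"
  using c_mono by (simp add: strict_mono_less_eq)

lemma c_add_ge: "c (n + int i) \<ge> c n + real i * \<delta>"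
proof (induction i)
  case (Suc i)
  then show ?case using gap[of "n + int i"] by (simp add: algebra_simps)
qed simp

lemma cell_unique: "x \<in> cell m \<Longrightarrow> x \<in> cell n \<Longrightarrow> m = n"
proof (induction m n rule: linorder_wlog)
  case (le m n)
  show ?case
  proof (rule ccontr)
    assume "m \<noteq> n"
    then have "c (m + 1) \<le> c n" using le c_le_iff by auto
    then show False using le by (auto simp: part_int_def)
  qed
qed auto

lemma cell_exists: "\<exists>n. x \<in> cell n"
proof -
  obtain i :: nat where "x - c 0 \<le> real i * \<delta>" using \<delta>_pos by (meson ex_less_of_nat_mult less_imp_le)
  then have upper: "x \<le> c (int i)" using c_add_ge[of 0 i] by simp
  obtain j :: nat where "c 0 - x < real j * \<delta>" using \<delta>_pos by (meson ex_less_of_nat_mult)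
  then have lower: "c (- int j) < x" using c_add_ge[of "- int j" j] by simp
  define below where "below = {n. - int j \<le> n \<and> n \<le> int i \<and> c n < x}"
  have finite: "finite below" by (rule finite_subset[of _ "{- int j..int i}"]) (auto simp: below_def)
  have "- int j \<in> below" using lower upper c_less_iff[of "- int j" "int i"] by (auto simp: below_def)
  then have last: "Max below \<in> below" using Max_in[OF finite] by blast
  have "\<not> c (Max below + 1) < x"
  proof
    assume less: "c (Max below + 1) < x"
    then have "c (Max below + 1) < c (int i)" using upper by linarith
    then have "Max below + 1 \<in> below" using last less c_less_iff by (auto simp: below_def)
    then show False using Max_ge[OF finite, of "Max below + 1"] by simp
  qed
  then show ?thesis using last by (auto simp: below_def part_int_def intro!: exI[of _ "Max below"])
qed

lemma cell_of_eq: "x \<in> cell n \<Longrightarrow> cell_of x = n"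
  unfolding cell_of_def using cell_unique by blast

lemma in_cell_of: "x \<in> cell (cell_of x)"
  using cell_exists[of x] cell_of_eq by metis

lemma members_iff: "k \<in> members n \<longleftrightarrow> cell_of (a k) = n"
  using in_cell_of cell_of_eq by (auto simp: members_def)

lemma finite_members: "finite (members n)"
  using finite_preimage by (simp add: members_def)

lemma card_members: "real (card (members n)) \<le> D * width n"
  using card_preimage by (simp add: members_def width_def)

lemma cell_diff: "x \<in> cell n \<Longrightarrow> y \<in> cell n \<Longrightarrow> \<bar>x - y\<bar> < width n"
  by (auto simp: part_int_def width_def)

lemma a_diff_pos: "k \<noteq> l \<Longrightarrow> \<bar>a k - a l\<bar> > 0"
  using a_mono by (simp add: strict_mono_eq)

lemma cell_fmeasurable: "cell n \<in> fmeasurable lborel"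
  unfolding part_int_def using width_pos[of n] by (intro fmeasurableI) (auto simp: width_def)

lemma measure_cell: "measure lborel (cell n) = width n"
  using width_pos[of n] by (simp add: part_int_def width_def)

lemma sum_width_le:
  assumes fin: "finite F" and sub: "\<And>n. n \<in> F \<Longrightarrow> cell n \<subseteq> {A..B}" and AB: "A \<le> B"
  shows "(\<Sum>n\<in>F. width n) \<le> B - A"
proof -
  have "(\<Sum>n\<in>F. width n) = (\<Sum>n\<in>F. measure lborel (cell n))" by (simp add: measure_cell)
  also have "\<dots> = measure lborel (\<Union>n\<in>F. cell n)"
  proof (rule measure_finite_Union[symmetric, OF fin])
    show "disjoint_family_on cell F" unfolding disjoint_family_on_def using cell_unique by blast
    show "emeasure lborel (cell n) \<noteq> \<infinity>" for n
      using cell_fmeasurable[of n] by (simp add: fmeasurable_def less_top[symmetric])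
  qed (auto simp: part_int_def)
  also have "\<dots> \<le> measure lborel {A..B}"
  proof (rule measure_mono_fmeasurable)
    show "{A..B} \<in> fmeasurable lborel" using AB by (intro fmeasurableI) auto
    show "(\<Union>n\<in>F. cell n) \<in> sets lborel" using fin by (auto simp: part_int_def)
    show "(\<Union>n\<in>F. cell n) \<subseteq> {A..B}" using sub by blast
  qed
  finally show ?thesis using AB by simp
qed

lemma le_sum_width:
  assumes fin: "finite F" and cover: "{A<..B} \<subseteq> (\<Union>n\<in>F. cell n)" and AB: "A \<le> B"
  shows "B - A \<le> (\<Sum>n\<in>F. width n)"
proof -
  have "B - A = measure lborel {A<..B}" using AB by simp
  also have "\<dots> \<le> measure lborel (\<Union>n\<in>F. cell n)"
    by (intro measure_mono_fmeasurable cover) (use fin cell_fmeasurable in \<open>auto intro!: fmeasurable.finite_UN\<close>)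
  also have "\<dots> \<le> (\<Sum>n\<in>F. measure lborel (cell n))"
    by (intro measure_UNION_le fin) (auto simp: part_int_def)
  finally show ?thesis by (simp add: measure_cell)
qed

lemma card_members_le:
  assumes fin: "finite F" and sub: "\<And>n. n \<in> F \<Longrightarrow> cell n \<subseteq> {A..B}" and AB: "A \<le> B"
    and T: "T \<subseteq> (\<Union>n\<in>F. members n)"
  shows "real (card T) \<le> D * (B - A)"
proof -
  have "card T \<le> card (\<Union>n\<in>F. members n)" by (intro card_mono) (use fin finite_members T in auto)
  also have "\<dots> \<le> (\<Sum>n\<in>F. card (members n))" by (rule card_UN_le[OF fin])
  finally have "real (card T) \<le> (\<Sum>n\<in>F. real (card (members n)))" by (metis of_nat_le_iff of_nat_sum)
  also have "\<dots> \<le> (\<Sum>n\<in>F. D * width n)" by (intro sum_mono card_members)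
  also have "\<dots> = D * (\<Sum>n\<in>F. width n)" by (rule sum_distrib_left[symmetric])
  also have "\<dots> \<le> D * (B - A)" using sum_width_le[OF fin sub AB] D_ge_one by (intro mult_left_mono) auto
  finally show ?thesis .
qed

lemma card_near_le:
  assumes fin: "finite S" and r: "r > 0"
  shows "real (card {l\<in>S. \<bar>a l - x\<bar> \<le> r \<and> width_at l \<le> r}) \<le> 4 * D * r"
proof -
  define near where "near = {l\<in>S. \<bar>a l - x\<bar> \<le> r \<and> width_at l \<le> r}"
  have "real (card near) \<le> D * ((x + 2 * r) - (x - 2 * r))"
  proof (rule card_members_le[of "(\<lambda>l. cell_of (a l)) ` near"])
    fix n assume "n \<in> (\<lambda>l. cell_of (a l)) ` near"
    then obtain l where l: "l \<in> near" "n = cell_of (a l)" by auto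
    show "cell n \<subseteq> {x - 2 * r..x + 2 * r}"
    proof
      fix y assume "y \<in> cell n"
      then have "\<bar>y - a l\<bar> < width n" using cell_diff in_cell_of[of "a l"] l by simp
      moreover have "\<bar>a l - x\<bar> \<le> r" "width n \<le> r" using l by (auto simp: near_def width_at_def)
      ultimately have "\<bar>y - a l\<bar> < r" "\<bar>a l - x\<bar> \<le> r" by auto
      then show "y \<in> {x - 2 * r..x + 2 * r}" by (auto simp: abs_le_iff abs_less_iff)
    qed
  qed (use fin r in \<open>auto simp: near_def members_iff\<close>)
  then show ?thesis by (simp add: near_def)
qed

subsection \<open>Interaction of distant nodes\<close>

definition cell_energy :: "int \<Rightarrow> real" where
  "cell_energy l = (\<Sum>j\<in>members (cell_of (a l)) - {l}. ln (width_at l / \<bar>a j - a l\<bar>))"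

definition reach :: "int \<Rightarrow> int \<Rightarrow> real" where
  "reach k l = max \<bar>a k - a l\<bar> (max (width_at k) (width_at l))"

definition interaction :: "int \<Rightarrow> int \<Rightarrow> real" where
  "interaction k l = ln (reach k l / \<bar>a k - a l\<bar>)"

text \<open>Moving every point by at most a third of the gap to its neighbours keeps the points of \<open>inner_members \<eta> n\<close>
  in their cell.\<close>

definition inner_members :: "real \<Rightarrow> int \<Rightarrow> int set" where
  "inner_members \<eta> n = {k\<in>members n.
     \<eta> * width n \<le> real (card {j\<in>members n. j < k}) \<and> \<eta> * width n \<le> real (card {j\<in>members n. k < j})}"

lemma inner_members_subset: "inner_members \<eta> n \<subseteq> members n"
  by (auto simp: inner_members_def)

lemma finite_inner_members: "finite (inner_members \<eta> n)"
  using finite_members inner_members_subset by (rule finite_subset[rotated])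

lemma reach_pos: "reach k l > 0"
  using width_at_pos[of k] by (simp add: reach_def less_max_iff_disj)

lemma interaction_commute: "interaction k l = interaction l k"
  by (simp add: interaction_def reach_def abs_minus_commute max.commute)

lemma interaction_nonneg: "k \<noteq> l \<Longrightarrow> 0 \<le> interaction k l"
  using a_diff_pos[of k l] by (simp add: interaction_def reach_def)

lemma same_cell_diff: "cell_of (a j) = cell_of (a l) \<Longrightarrow> \<bar>a j - a l\<bar> < width_at l"
  using cell_diff[OF in_cell_of[of "a j"], of "a l"] in_cell_of[of "a l"] by (simp add: width_at_def)

lemma cell_energy_term_nonneg: "j \<in> members (cell_of (a l)) - {l} \<Longrightarrow> 0 \<le> ln (width_at l / \<bar>a j - a l\<bar>)"
  using a_diff_pos[of j l] same_cell_diff[of j l] by (simp add: members_iff)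

lemma cell_energy_nonneg: "0 \<le> cell_energy l"
  unfolding cell_energy_def by (intro sum_nonneg cell_energy_term_nonneg)

lemma interaction_eq:
  "width_at k \<le> width_at l \<Longrightarrow> \<bar>a k - a l\<bar> \<le> width_at l \<Longrightarrow> interaction k l = ln (width_at l / \<bar>a k - a l\<bar>)"
  by (simp add: interaction_def reach_def)

lemma interaction_far:
  assumes "k \<noteq> l" "width_at k \<le> width_at l" "width_at l \<le> \<bar>a k - a l\<bar>"
  shows "interaction k l = 0"
  using assms a_diff_pos[of k l] by (simp add: interaction_def reach_def)

lemma inner_member_closer_members:
  assumes l: "l \<in> inner_members \<eta> (cell_of (a l))" and other_cell: "cell_of (a k) \<noteq> cell_of (a l)"
  obtains B where "B \<subseteq> members (cell_of (a l)) - {l}" "\<eta> * width_at l \<le> real (card B)"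
    "\<And>j. j \<in> B \<Longrightarrow> \<bar>a j - a l\<bar> \<le> \<bar>a k - a l\<bar>"
proof -
  let ?n = "cell_of (a l)"
  have kl: "k \<noteq> l" using other_cell by auto
  have al: "a l \<in> cell ?n" by (rule in_cell_of)
  have ak: "a k \<notin> cell ?n" using cell_of_eq[of "a k" ?n] other_cell by auto
  show thesis
  proof (cases "a k < a l")
    case True
    show thesis
    proof (rule that[of "{j\<in>members ?n. j < l}"])
      fix j assume j: "j \<in> {j\<in>members ?n. j < l}"
      then have "a j < a l" using a_mono by (simp add: strict_mono_less)
      moreover have "a k < a j" using True al ak j by (auto simp: part_int_def members_def)
      ultimately show "\<bar>a j - a l\<bar> \<le> \<bar>a k - a l\<bar>" by simp
    qed (use l in \<open>auto simp: inner_members_def width_at_def\<close>)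
  next
    case False
    show thesis
    proof (rule that[of "{j\<in>members ?n. l < j}"])
      fix j assume j: "j \<in> {j\<in>members ?n. l < j}"
      then have "a l < a j" using a_mono by (simp add: strict_mono_less)
      moreover have "a j < a k" using False al ak j a_diff_pos[OF kl] by (auto simp: part_int_def members_def)
      ultimately show "\<bar>a j - a l\<bar> \<le> \<bar>a k - a l\<bar>" by simp
    qed (use l in \<open>auto simp: inner_members_def width_at_def\<close>)
  qed
qed

lemma interaction_le_cell_energy:
  assumes l: "l \<in> inner_members \<eta> (cell_of (a l))" and \<eta>: "\<eta> > 0"
    and other_cell: "cell_of (a k) \<noteq> cell_of (a l)"
    and narrower: "width_at k \<le> width_at l" and near: "\<bar>a k - a l\<bar> < width_at l"
  shows "interaction k l \<le> cell_energy l / (\<eta> * width_at l)"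
proof -
  have kl: "k \<noteq> l" using other_cell by auto
  have eq: "interaction k l = ln (width_at l / \<bar>a k - a l\<bar>)"
    using narrower near by (intro interaction_eq) auto
  obtain B where B: "B \<subseteq> members (cell_of (a l)) - {l}" "\<eta> * width_at l \<le> real (card B)"
    "\<And>j. j \<in> B \<Longrightarrow> \<bar>a j - a l\<bar> \<le> \<bar>a k - a l\<bar>" using inner_member_closer_members[OF l other_cell] by blast
  have "\<eta> * width_at l * interaction k l \<le> real (card B) * interaction k l"
    using B(2) interaction_nonneg[OF kl] by (rule mult_right_mono)
  also have "\<dots> = (\<Sum>j\<in>B. interaction k l)" by simp
  also have "\<dots> \<le> (\<Sum>j\<in>B. ln (width_at l / \<bar>a j - a l\<bar>))"
  proof (rule sum_mono)
    fix j assume j: "j \<in> B"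
    then have "\<bar>a j - a l\<bar> > 0" using B(1) a_diff_pos by blast
    then have "width_at l / \<bar>a k - a l\<bar> \<le> width_at l / \<bar>a j - a l\<bar>"
      using B(3)[OF j] a_diff_pos[OF kl] width_at_pos[of l] by (intro divide_left_mono mult_pos_pos) auto
    then show "interaction k l \<le> ln (width_at l / \<bar>a j - a l\<bar>)" unfolding eq
      using a_diff_pos[OF kl] width_at_pos[of l] by (intro ln_mono) auto
  qed
  also have "\<dots> \<le> cell_energy l" unfolding cell_energy_def
    by (rule sum_mono2) (use B(1) finite_members cell_energy_term_nonneg in auto)
  finally have "\<eta> * width_at l * interaction k l \<le> cell_energy l" .
  moreover have "\<eta> * width_at l > 0" using \<eta> width_at_pos[of l] by simp
  ultimately show ?thesis by (simp add: field_simps)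
qed

lemma sum_interaction_same_cell_le:
  assumes "\<And>k. k \<in> S \<Longrightarrow> k \<noteq> l \<and> cell_of (a k) = cell_of (a l)"
  shows "(\<Sum>k\<in>S. interaction k l) \<le> cell_energy l"
proof -
  have "(\<Sum>k\<in>S. interaction k l) = (\<Sum>k\<in>S. ln (width_at l / \<bar>a k - a l\<bar>))"
  proof (rule sum.cong[OF refl])
    fix k assume "k \<in> S"
    then have "cell_of (a k) = cell_of (a l)" using assms by blast
    then show "interaction k l = ln (width_at l / \<bar>a k - a l\<bar>)"
      using same_cell_diff[of k l] by (intro interaction_eq) (auto simp: width_at_def)
  qed
  also have "\<dots> \<le> cell_energy l" unfolding cell_energy_def
    by (rule sum_mono2) (use finite_members cell_energy_term_nonneg assms in \<open>auto simp: members_iff\<close>)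
  finally show ?thesis .
qed

lemma sum_interaction_near_le:
  assumes fin: "finite S" and l: "l \<in> inner_members \<eta> (cell_of (a l))" and \<eta>: "\<eta> > 0"
    and S: "\<And>k. k \<in> S \<Longrightarrow> cell_of (a k) \<noteq> cell_of (a l) \<and> width_at k \<le> width_at l \<and> \<bar>a k - a l\<bar> < width_at l"
  shows "(\<Sum>k\<in>S. interaction k l) \<le> 4 * D / \<eta> * cell_energy l"
proof -
  have "{k\<in>S. \<bar>a k - a l\<bar> \<le> width_at l \<and> width_at k \<le> width_at l} = S" using S by (auto simp: less_imp_le)
  then have card: "real (card S) \<le> 4 * D * width_at l"
    using card_near_le[OF fin width_at_pos[of l], of "a l"] by simp
  have "(\<Sum>k\<in>S. interaction k l) \<le> (\<Sum>k\<in>S. cell_energy l / (\<eta> * width_at l))"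
    by (intro sum_mono interaction_le_cell_energy l \<eta>) (use S in auto)
  also have "\<dots> = real (card S) * (cell_energy l / (\<eta> * width_at l))" by simp
  also have "\<dots> \<le> (4 * D * width_at l) * (cell_energy l / (\<eta> * width_at l))"
    using card cell_energy_nonneg[of l] \<eta> width_at_pos[of l] by (intro mult_right_mono) auto
  also have "\<dots> = 4 * D / \<eta> * cell_energy l" using width_at_pos[of l] by simp
  finally show ?thesis .
qed

lemma sum_interaction_narrower_le:
  assumes fin: "finite S" and l: "l \<in> inner_members \<eta> (cell_of (a l))" and \<eta>: "\<eta> > 0"
  shows "(\<Sum>k\<in>{k\<in>S. k \<noteq> l \<and> width_at k \<le> width_at l}. interaction k l) \<le> (1 + 4 * D / \<eta>) * cell_energy l"
proof -
  define same where "same = {k\<in>S. k \<noteq> l \<and> width_at k \<le> width_at l \<and> cell_of (a k) = cell_of (a l)}"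
  define near where "near =
    {k\<in>S. width_at k \<le> width_at l \<and> cell_of (a k) \<noteq> cell_of (a l) \<and> \<bar>a k - a l\<bar> < width_at l}"
  define far where "far =
    {k\<in>S. width_at k \<le> width_at l \<and> cell_of (a k) \<noteq> cell_of (a l) \<and> \<not> \<bar>a k - a l\<bar> < width_at l}"
  have "{k\<in>S. k \<noteq> l \<and> width_at k \<le> width_at l} = same \<union> (near \<union> far)" "same \<inter> (near \<union> far) = {}"
    "near \<inter> far = {}"
    by (auto simp: same_def near_def far_def)
  then have "(\<Sum>k\<in>{k\<in>S. k \<noteq> l \<and> width_at k \<le> width_at l}. interaction k l)
      = (\<Sum>k\<in>same. interaction k l) + ((\<Sum>k\<in>near. interaction k l) + (\<Sum>k\<in>far. interaction k l))"
    using fin by (simp add: sum.union_disjoint same_def near_def far_def)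
  moreover have "(\<Sum>k\<in>same. interaction k l) \<le> cell_energy l"
    by (rule sum_interaction_same_cell_le) (simp add: same_def)
  moreover have "(\<Sum>k\<in>near. interaction k l) \<le> 4 * D / \<eta> * cell_energy l"
    by (rule sum_interaction_near_le[OF _ l \<eta>]) (use fin in \<open>auto simp: near_def\<close>)
  moreover have "(\<Sum>k\<in>far. interaction k l) = 0"
    by (intro sum.neutral ballI interaction_far) (auto simp: far_def)
  ultimately show ?thesis by (simp add: algebra_simps)
qed

lemma sum_interaction_le:
  assumes fin: "finite S" and S: "\<And>l. l \<in> S \<Longrightarrow> l \<in> inner_members \<eta> (cell_of (a l))" and \<eta>: "\<eta> > 0"
  shows "(\<Sum>k\<in>S. \<Sum>l\<in>S-{k}. interaction k l) \<le> 2 * (1 + 4 * D / \<eta>) * (\<Sum>l\<in>S. cell_energy l)"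
proof -
  let ?f = "\<lambda>k l. if k \<noteq> l \<and> width_at k \<le> width_at l then interaction k l else 0"
  have "(\<Sum>k\<in>S. \<Sum>l\<in>S-{k}. interaction k l) \<le> (\<Sum>k\<in>S. \<Sum>l\<in>S. ?f k l + ?f l k)"
  proof (rule sum_mono)
    fix k assume "k \<in> S"
    have "(\<Sum>l\<in>S-{k}. interaction k l) \<le> (\<Sum>l\<in>S-{k}. ?f k l + ?f l k)"
      by (rule sum_mono) (use interaction_commute interaction_nonneg in auto)
    also have "\<dots> \<le> (\<Sum>l\<in>S. ?f k l + ?f l k)" by (rule sum_mono2) (use fin interaction_nonneg in auto)
    finally show "(\<Sum>l\<in>S-{k}. interaction k l) \<le> (\<Sum>l\<in>S. ?f k l + ?f l k)" .
  qed
  also have "\<dots> = (\<Sum>k\<in>S. \<Sum>l\<in>S. ?f k l) + (\<Sum>k\<in>S. \<Sum>l\<in>S. ?f l k)" by (simp add: sum.distrib)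
  also have "(\<Sum>k\<in>S. \<Sum>l\<in>S. ?f k l) = (\<Sum>k\<in>S. \<Sum>l\<in>S. ?f l k)" by (rule sum.swap)
  also have "(\<Sum>k\<in>S. \<Sum>l\<in>S. ?f l k) + (\<Sum>k\<in>S. \<Sum>l\<in>S. ?f l k) = 2 * (\<Sum>l\<in>S. \<Sum>k\<in>S. ?f k l)" by simp
  also have "(\<Sum>l\<in>S. \<Sum>k\<in>S. ?f k l) \<le> (\<Sum>l\<in>S. (1 + 4 * D / \<eta>) * cell_energy l)"
  proof (rule sum_mono)
    fix l assume l: "l \<in> S"
    have "(\<Sum>k\<in>S. ?f k l) = (\<Sum>k\<in>{k\<in>S. k \<noteq> l \<and> width_at k \<le> width_at l}. interaction k l)"
      by (rule sum.inter_filter[symmetric, OF fin])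
    then show "(\<Sum>k\<in>S. ?f k l) \<le> (1 + 4 * D / \<eta>) * cell_energy l"
      using sum_interaction_narrower_le[OF fin S[OF l] \<eta>] by simp
  qed
  finally show ?thesis by (simp only: sum_distrib_left mult.assoc)
qed

lemma sum_ln_reach_le:
  assumes fin: "finite S" and R: "0 < R" "R \<le> s" and S: "\<And>l. l \<in> S \<Longrightarrow> reach k l \<le> R"
  shows "(\<Sum>l\<in>S. ln 3 + ln (s / reach k l)) \<le> 4 * D * R * (1 + ln (3 * s / R))"
proof -
  have count: "real (card {l\<in>S. reach k l \<le> r}) \<le> 4 * D * r" if "r > 0" for r
  proof -
    have "{l\<in>S. reach k l \<le> r} \<subseteq> {l\<in>S. \<bar>a l - a k\<bar> \<le> r \<and> width_at l \<le> r}"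
      by (auto simp: reach_def abs_minus_commute)
    then have "card {l\<in>S. reach k l \<le> r} \<le> card {l\<in>S. \<bar>a l - a k\<bar> \<le> r \<and> width_at l \<le> r}"
      by (intro card_mono) (use fin in auto)
    then show ?thesis using card_near_le[OF fin that, of "a k"] by linarith
  qed
  have "{l\<in>S. reach k l \<le> R} = S" using S by auto
  then have card: "real (card S) \<le> 4 * D * R" using count[OF R(1)] by simp
  have "(\<Sum>l\<in>S. ln 3 + ln (s / reach k l)) = (\<Sum>l\<in>S. ln (3 * s / R) + ln (R / reach k l))"
    using R reach_pos by (intro sum.cong refl) (simp add: ln_div ln_mult less_imp_neq[symmetric])
  also have "\<dots> = real (card S) * ln (3 * s / R) + (\<Sum>l\<in>S. ln (R / reach k l))" by (simp add: sum.distrib)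
  also have "\<dots> \<le> 4 * D * R * ln (3 * s / R) + 4 * D * R"
  proof (rule add_mono)
    have "0 \<le> ln (3 * s / R)" using R by (simp add: field_simps)
    then show "real (card S) * ln (3 * s / R) \<le> 4 * D * R * ln (3 * s / R)"
      using card by (rule mult_right_mono[rotated])
    show "(\<Sum>l\<in>S. ln (R / reach k l)) \<le> 4 * D * R"
      by (rule sum_ln_le_of_count[OF fin _ reach_pos R(1) count]) (use D_ge_one in auto)
  qed
  finally show ?thesis by (simp add: algebra_simps)
qed

lemma perturbed_in_cell:
  assumes x: "perturbation a x" and k: "k \<in> inner_members \<eta> n" and \<eta>: "\<eta> > 0"
  shows "x k \<in> cell n"
proof -
  have "0 < \<eta> * width n" using \<eta> width_pos by simp
  then have "real (card {j\<in>members n. j < k}) > 0" "real (card {j\<in>members n. k < j}) > 0"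
    using k by (auto simp: inner_members_def)
  then have "{j\<in>members n. j < k} \<noteq> {}" "{j\<in>members n. k < j} \<noteq> {}" by (auto simp: card_gt_0_iff)
  then obtain i j where i: "i \<in> members n" "i < k" and j: "j \<in> members n" "k < j" by blast
  have "a (k-1) < a k" "a k < a (k+1)" using a_mono by (auto simp: strict_mono_less)
  then have "\<bar>x k - a k\<bar> < a (k+1) - a k" "\<bar>x k - a k\<bar> < a k - a (k-1)"
    using perturbation_less[OF x, of k] by argo+
  moreover have "a i \<le> a (k-1)" "a (k+1) \<le> a j" using i j a_mono by (auto simp: strict_mono_less_eq)
  ultimately show ?thesis using i j by (auto simp: members_def part_int_def abs_less_iff)
qed

lemma card_inner_members_ge:
  assumes \<eta>: "\<eta> > 0"
  shows "real (card (members n)) - 2 * (\<eta> * width n) - 2 \<le> real (card (inner_members \<eta> n))"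
proof -
  let ?r = "\<eta> * width n"
  let ?low = "{k\<in>members n. real (card {j\<in>members n. j < k}) < ?r}"
  let ?high = "{k\<in>members n. real (card {j\<in>members n. k < j}) < ?r}"
  have r: "?r \<ge> 0" using \<eta> width_pos[of n] by simp
  have "members n \<subseteq> inner_members \<eta> n \<union> (?low \<union> ?high)" by (auto simp: inner_members_def)
  then have "card (members n) \<le> card (inner_members \<eta> n \<union> (?low \<union> ?high))"
    by (intro card_mono) (use finite_members finite_inner_members in auto)
  also have "\<dots> \<le> card (inner_members \<eta> n) + (card ?low + card ?high)"
    by (meson add_left_mono card_Un_le order.trans)
  finally have "real (card (members n))
      \<le> real (card (inner_members \<eta> n)) + (real (card ?low) + real (card ?high))" by linarith
  moreover have "real (card ?low) \<le> ?r + 1" by (rule card_low_rank[OF finite_members r]) auto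
  moreover have "real (card ?high) \<le> ?r + 1"
    by (rule card_low_rank[OF finite_members r, of "\<lambda>j k. k < j"]) (auto simp: transp_def)
  ultimately show ?thesis by linarith
qed

definition active :: "real \<Rightarrow> real \<Rightarrow> int set" where
  "active t s = {n. cell n \<inter> {t - s..t + s} \<noteq> {}}"

lemma finite_active: "finite (active t s)"
proof (rule finite_subset)
  show "active t s \<subseteq> {cell_of (t - s)..cell_of (t + s)}"
  proof
    fix n assume "n \<in> active t s"
    then obtain y where y: "y \<in> cell n" "y \<in> {t - s..t + s}" unfolding active_def by blast
    have "c (cell_of (t - s)) < c (n + 1)" "c n < c (cell_of (t + s) + 1)"
      using y in_cell_of[of "t - s"] in_cell_of[of "t + s"] by (auto simp: part_int_def)
    then show "n \<in> {cell_of (t - s)..cell_of (t + s)}" by (auto simp: c_less_iff)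
  qed
qed simp

lemma cell_of_active: "y \<in> {t - s..t + s} \<Longrightarrow> cell_of y \<in> active t s"
  using in_cell_of[of y] by (auto simp: active_def)

end

locale node_selection = partitioned_points a c \<delta> D
  for a c :: "int \<Rightarrow> real" and \<delta> D :: real +
  fixes W x :: "int \<Rightarrow> real" and irregular :: "int set" and t s d \<xi> \<tau> \<kappa> \<rho> \<epsilon> :: real
  assumes x_perturbation: "perturbation a x" and W_nonneg: "\<And>k. W k \<ge> 0"
    and s_pos: "s > 0" and d_pos: "d > 0" and \<xi>_pos: "\<xi> > 0" and \<tau>_pos: "\<tau> > 0"
    and \<kappa>_pos: "0 < \<kappa>" and \<kappa>_le: "3 * \<kappa> \<le> 1" and \<kappa>_small: "12 * D * \<kappa> * (1 + ln (1 / \<kappa>)) \<le> \<tau> / 2"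
    and \<rho>_le: "\<rho> \<le> 3 * \<kappa>" and active_width_le: "\<And>n. n \<in> active t s \<Longrightarrow> width n \<le> \<rho> * s"
    and irregular_width_le: "(\<Sum>n\<in>active t s \<inter> irregular. width n) \<le> \<rho> * s"
    and regular_dense: "\<And>n. n \<notin> irregular \<Longrightarrow> (d + 3 * \<xi>) * width n \<le> real (card (members n))"
    and regular_wide: "\<And>n. n \<notin> irregular \<Longrightarrow> 4 \<le> \<xi> * width n"
    and active_energy_le: "(\<Sum>n\<in>active t s. \<Sum>l\<in>members n. cell_energy l) \<le> \<epsilon> * s\<^sup>2"
    and active_weight_le: "(\<Sum>n\<in>active t s. \<Sum>k\<in>members n. W k) \<le> \<epsilon> * s\<^sup>2"
begin

definition candidates :: "int set" where
  "candidates = (\<Union>n\<in>active t s. inner_members (\<xi> / 4) n)"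

definition crowding :: "int \<Rightarrow> real" where
  "crowding k = (\<Sum>l\<in>candidates-{k}. interaction k l)"

definition heavy :: "int set" where
  "heavy = {k\<in>candidates. W k > \<tau> * s}"

definition crowded :: "int set" where
  "crowded = {k\<in>candidates. crowding k > \<tau> * s / 2}"

definition selected :: "int set" where
  "selected = candidates - (heavy \<union> crowded)"

lemma finite_candidates: "finite candidates"
  by (simp add: candidates_def finite_active finite_inner_members)

lemma finite_selected: "finite selected"
  by (simp add: selected_def finite_candidates)

lemma selected_subset: "selected \<subseteq> candidates"
  by (auto simp: selected_def)

lemma candidate_cell:
  assumes "k \<in> candidates"
  shows "k \<in> inner_members (\<xi> / 4) (cell_of (a k))" "cell_of (a k) \<in> active t s"
proof -
  obtain n where n: "n \<in> active t s" "k \<in> inner_members (\<xi> / 4) n" using assms by (auto simp: candidates_def)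
  then have "cell_of (a k) = n" using inner_members_subset members_iff by blast
  then show "k \<in> inner_members (\<xi> / 4) (cell_of (a k))" "cell_of (a k) \<in> active t s" using n by auto
qed

lemma sum_candidates_le:
  fixes f :: "int \<Rightarrow> real"
  assumes "\<And>k. f k \<ge> 0"
  shows "(\<Sum>k\<in>candidates. f k) \<le> (\<Sum>n\<in>active t s. \<Sum>k\<in>members n. f k)"
proof -
  have "(\<Sum>k\<in>candidates. f k) \<le> (\<Sum>k\<in>(\<Union>n\<in>active t s. members n). f k)"
  proof (rule sum_mono2)
    show "candidates \<subseteq> (\<Union>n\<in>active t s. members n)"
      unfolding candidates_def using inner_members_subset by blast
  qed (simp_all add: finite_active finite_members assms)
  also have "\<dots> = (\<Sum>n\<in>active t s. \<Sum>k\<in>members n. f k)"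
    by (rule sum.UNION_disjoint) (use finite_active finite_members in \<open>auto simp: members_iff\<close>)
  finally show ?thesis .
qed

lemma crowding_nonneg: "crowding k \<ge> 0"
  unfolding crowding_def by (intro sum_nonneg interaction_nonneg) auto

lemma card_heavy_le: "real (card heavy) \<le> \<epsilon> / \<tau> * s"
proof -
  have "real (card heavy) \<le> (\<Sum>k\<in>candidates. W k) / (\<tau> * s)"
    unfolding heavy_def by (rule card_gt_le_sum[OF finite_candidates W_nonneg]) (simp add: \<tau>_pos s_pos)
  also have "\<dots> \<le> (\<epsilon> * s\<^sup>2) / (\<tau> * s)"
    using order.trans[OF sum_candidates_le[OF W_nonneg] active_weight_le] \<tau>_pos s_pos
    by (intro divide_right_mono) auto
  also have "\<dots> = \<epsilon> / \<tau> * s" using s_pos by (simp add: power2_eq_square)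
  finally show ?thesis .
qed

lemma card_crowded_le: "real (card crowded) \<le> 4 * (1 + 16 * D / \<xi>) * \<epsilon> / \<tau> * s"
proof -
  have "(\<Sum>k\<in>candidates. crowding k) \<le> 2 * (1 + 4 * D / (\<xi> / 4)) * (\<Sum>l\<in>candidates. cell_energy l)"
    unfolding crowding_def
    by (rule sum_interaction_le[OF finite_candidates candidate_cell(1)]) (use \<xi>_pos in auto)
  also have "\<dots> \<le> 2 * (1 + 4 * D / (\<xi> / 4)) * (\<epsilon> * s\<^sup>2)"
    using order.trans[OF sum_candidates_le[OF cell_energy_nonneg] active_energy_le] \<xi>_pos D_ge_one
    by (intro mult_left_mono) auto
  finally have total: "(\<Sum>k\<in>candidates. crowding k) \<le> 2 * (1 + 4 * D / (\<xi> / 4)) * (\<epsilon> * s\<^sup>2)" .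
  have "real (card crowded) \<le> (\<Sum>k\<in>candidates. crowding k) / (\<tau> * s / 2)"
    unfolding crowded_def
    by (rule card_gt_le_sum[OF finite_candidates crowding_nonneg]) (simp add: \<tau>_pos s_pos)
  also have "\<dots> \<le> (2 * (1 + 4 * D / (\<xi> / 4)) * (\<epsilon> * s\<^sup>2)) / (\<tau> * s / 2)"
    using total \<tau>_pos s_pos by (intro divide_right_mono) auto
  also have "\<dots> = 4 * (1 + 16 * D / \<xi>) * \<epsilon> / \<tau> * s"
    using s_pos \<xi>_pos \<tau>_pos by (simp add: power2_eq_square field_simps)
  finally show ?thesis .
qed

definition full_cells :: "real \<Rightarrow> real \<Rightarrow> int set" where
  "full_cells p p' = {n\<in>active t s. cell n \<subseteq> {p<..p'} \<and> n \<notin> irregular}"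

lemma finite_full_cells: "finite (full_cells p p')"
  by (simp add: full_cells_def finite_active)

lemma interval_covered:
  assumes "t - s \<le> p" "p' \<le> t + s"
  shows "{p<..p'} \<subseteq> (\<Union>n\<in>full_cells p p' \<union> ((active t s \<inter> irregular) \<union> {cell_of p, cell_of p'}). cell n)"
proof
  fix y assume y: "y \<in> {p<..p'}"
  let ?n = "cell_of y"
  have yn: "y \<in> cell ?n" by (rule in_cell_of)
  have "?n \<in> active t s" using y assms by (intro cell_of_active) auto
  moreover have "cell_of p = ?n \<or> cell_of p' = ?n" if "\<not> cell ?n \<subseteq> {p<..p'}"
  proof -
    have "c ?n < p \<or> p' < c (?n + 1)" using that by (auto simp: part_int_def)
    then have "p \<in> cell ?n \<or> p' \<in> cell ?n" using yn y by (auto simp: part_int_def)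
    then show ?thesis using cell_of_eq by blast
  qed
  ultimately have "?n \<in> full_cells p p' \<union> ((active t s \<inter> irregular) \<union> {cell_of p, cell_of p'})"
    by (cases "cell ?n \<subseteq> {p<..p'}"; cases "?n \<in> irregular") (simp_all add: full_cells_def, metis+)
  then show "y \<in> (\<Union>n\<in>full_cells p p' \<union> ((active t s \<inter> irregular) \<union> {cell_of p, cell_of p'}). cell n)"
    using yn by blast
qed

lemma sum_width_union_le: "finite A \<Longrightarrow> finite B \<Longrightarrow> (\<Sum>n\<in>A \<union> B. width n) \<le> (\<Sum>n\<in>A. width n) + (\<Sum>n\<in>B. width n)"
  using width_pos by (simp add: sum_Un less_imp_le sum_nonneg)

lemma width_full_cells_ge:
  assumes window: "t - s \<le> p" "p \<le> p'" "p' \<le> t + s"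
  shows "p' - p - 3 * \<rho> * s \<le> (\<Sum>n\<in>full_cells p p'. width n)"
proof -
  have "p' - p \<le> (\<Sum>n\<in>full_cells p p' \<union> ((active t s \<inter> irregular) \<union> {cell_of p, cell_of p'}). width n)"
    using window by (intro le_sum_width interval_covered) (auto simp: finite_full_cells finite_active)
  also have "\<dots> \<le> (\<Sum>n\<in>full_cells p p'. width n)
      + (\<Sum>n\<in>(active t s \<inter> irregular) \<union> {cell_of p, cell_of p'}. width n)"
    by (intro sum_width_union_le) (auto simp: finite_full_cells finite_active)
  also have "(\<Sum>n\<in>(active t s \<inter> irregular) \<union> {cell_of p, cell_of p'}. width n)
      \<le> (\<Sum>n\<in>active t s \<inter> irregular. width n) + (\<Sum>n\<in>{cell_of p, cell_of p'}. width n)"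
    by (intro sum_width_union_le) (auto simp: finite_active)
  also have "(\<Sum>n\<in>{cell_of p, cell_of p'}. width n) \<le> 2 * (\<rho> * s)"
  proof -
    have "width (cell_of p) \<le> \<rho> * s" "width (cell_of p') \<le> \<rho> * s"
      using window by (auto intro!: active_width_le cell_of_active)
    then show ?thesis using width_pos[of "cell_of p"] by (cases "cell_of p = cell_of p'") auto
  qed
  finally show ?thesis using irregular_width_le by linarith
qed

lemma card_inner_members_regular_ge:
  assumes "n \<notin> irregular"
  shows "(d + 2 * \<xi>) * width n \<le> real (card (inner_members (\<xi> / 4) n))"
proof -
  have "(d + 2 * \<xi>) * width n = (d + 3 * \<xi>) * width n - \<xi> * width n" by (simp add: algebra_simps)
  also have "\<dots> \<le> real (card (members n)) - 2 * (\<xi> / 4 * width n) - 2"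
    using regular_dense[OF assms] regular_wide[OF assms] by simp
  also have "\<dots> \<le> real (card (inner_members (\<xi> / 4) n))" by (rule card_inner_members_ge) (simp add: \<xi>_pos)
  finally show ?thesis .
qed

lemma card_full_inner_members_ge:
  assumes "t - s \<le> p" "p \<le> p'" "p' \<le> t + s"
  shows "(d + 2 * \<xi>) * (p' - p - 3 * \<rho> * s) \<le> real (card (\<Union>n\<in>full_cells p p'. inner_members (\<xi> / 4) n))"
proof -
  have "(d + 2 * \<xi>) * (p' - p - 3 * \<rho> * s) \<le> (d + 2 * \<xi>) * (\<Sum>n\<in>full_cells p p'. width n)"
    using width_full_cells_ge[OF assms] d_pos \<xi>_pos by (intro mult_left_mono) auto
  also have "\<dots> = (\<Sum>n\<in>full_cells p p'. (d + 2 * \<xi>) * width n)" by (rule sum_distrib_left)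
  also have "\<dots> \<le> (\<Sum>n\<in>full_cells p p'. real (card (inner_members (\<xi> / 4) n)))"
    by (intro sum_mono card_inner_members_regular_ge) (simp add: full_cells_def)
  also have "\<dots> = real (\<Sum>n\<in>full_cells p p'. card (inner_members (\<xi> / 4) n))" by simp
  also have "(\<Sum>n\<in>full_cells p p'. card (inner_members (\<xi> / 4) n))
      = card (\<Union>n\<in>full_cells p p'. inner_members (\<xi> / 4) n)"
  proof (rule card_UN_disjoint[symmetric])
    show "\<forall>i\<in>full_cells p p'. \<forall>j\<in>full_cells p p'. i \<noteq> j
        \<longrightarrow> inner_members (\<xi> / 4) i \<inter> inner_members (\<xi> / 4) j = {}"
    proof (intro ballI impI equals0I)
      fix i j k assume "i \<noteq> j" "k \<in> inner_members (\<xi> / 4) i \<inter> inner_members (\<xi> / 4) j"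
      then have "k \<in> members i" "k \<in> members j" using inner_members_subset by blast+
      then show False using \<open>i \<noteq> j\<close> by (simp add: members_iff)
    qed
  qed (simp_all add: finite_full_cells finite_inner_members)
  finally show ?thesis .
qed

lemma card_selected_ge:
  assumes window: "t - s \<le> p" "p \<le> p'" "p' \<le> t + s"
  shows "(d + 2 * \<xi>) * (p' - p - 3 * \<rho> * s) - (\<epsilon> / \<tau> + 4 * (1 + 16 * D / \<xi>) * \<epsilon> / \<tau>) * s
    \<le> real (card {k\<in>selected. x k \<in> {p<..p'}})"
proof -
  define inside where "inside = (\<Union>n\<in>full_cells p p'. inner_members (\<xi> / 4) n)"
  have "x k \<in> {p<..p'}" if k: "k \<in> inside" for k
  proof -
    obtain n where "n \<in> full_cells p p'" "k \<in> inner_members (\<xi> / 4) n" using k by (auto simp: inside_def)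
    then show ?thesis
      using perturbed_in_cell[OF x_perturbation, of k "\<xi> / 4" n] \<xi>_pos by (auto simp: full_cells_def)
  qed
  moreover have "inside \<subseteq> candidates" by (auto simp: inside_def candidates_def full_cells_def)
  ultimately have "inside \<subseteq> {k\<in>selected. x k \<in> {p<..p'}} \<union> (heavy \<union> crowded)" by (auto simp: selected_def)
  then have "card inside \<le> card ({k\<in>selected. x k \<in> {p<..p'}} \<union> (heavy \<union> crowded))"
    by (intro card_mono) (auto simp: heavy_def crowded_def finite_candidates finite_selected)
  also have "\<dots> \<le> card {k\<in>selected. x k \<in> {p<..p'}} + (card heavy + card crowded)"
    by (meson add_left_mono card_Un_le order.trans)
  finally have "real (card inside)
      \<le> real (card {k\<in>selected. x k \<in> {p<..p'}}) + (real (card heavy) + real (card crowded))" by linarith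
  moreover have "(d + 2 * \<xi>) * (p' - p - 3 * \<rho> * s) \<le> real (card inside)"
    unfolding inside_def by (rule card_full_inner_members_ge[OF window])
  ultimately show ?thesis using card_heavy_le card_crowded_le unfolding distrib_right by linarith
qed

lemma fills_cells_selected:
  assumes m: "m \<ge> 1" and \<rho>: "(d + 2 * \<xi>) * (3 * \<rho>) \<le> \<xi> / real m"
    and \<epsilon>: "\<epsilon> / \<tau> + 4 * (1 + 16 * D / \<xi>) * \<epsilon> / \<tau> \<le> \<xi> / real m"
  shows "fills_cells d m t s (x ` selected)"
  unfolding fills_cells_def
proof (intro conjI allI impI)
  show "finite (x ` selected)" using finite_selected by simp
  fix j :: int assume j: "- int m \<le> j" "j < int m"
  let ?p = "t + s * of_int j / real m" and ?p' = "t + s * (of_int j + 1) / real m"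
  have m_pos: "real m > 0" using m by simp
  have length: "?p' - ?p = s / real m" using m_pos by (simp add: field_simps)
  have "s * (- real m) \<le> s * of_int j" "s * (of_int j + 1) \<le> s * real m"
    using s_pos j by (intro mult_left_mono; linarith)+
  then have "t - s \<le> ?p" "?p' \<le> t + s" using m_pos by (simp_all add: field_simps)
  moreover have "0 \<le> s / real m" using s_pos by simp
  then have "?p \<le> ?p'" using length by linarith
  ultimately have "(d + 2 * \<xi>) * (?p' - ?p - 3 * \<rho> * s) - (\<epsilon> / \<tau> + 4 * (1 + 16 * D / \<xi>) * \<epsilon> / \<tau>) * s
      \<le> real (card {k\<in>selected. x k \<in> {?p<..?p'}})" by (intro card_selected_ge)
  moreover have "(\<epsilon> / \<tau> + 4 * (1 + 16 * D / \<xi>) * \<epsilon> / \<tau>) * s \<le> \<xi> / real m * s"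
    using \<epsilon> s_pos by (intro mult_right_mono) auto
  moreover have "((d + 2 * \<xi>) * (3 * \<rho>)) * s \<le> (\<xi> / real m) * s" using \<rho> s_pos by (intro mult_right_mono) auto
  moreover have "(d + 2 * \<xi>) * (s / real m - 3 * \<rho> * s)
      = d * s / real m + 2 * (\<xi> / real m * s) - ((d + 2 * \<xi>) * (3 * \<rho>)) * s" using m_pos by (simp add: field_simps)
  ultimately have "d * s / real m \<le> real (card {k\<in>selected. x k \<in> {?p<..?p'}})" unfolding length by linarith
  also have "\<dots> = real (card (x ` {k\<in>selected. x k \<in> {?p<..?p'}}))"
    using inj_perturbation[OF a_mono x_perturbation] by (simp add: card_image inj_on_subset)
  also have "x ` {k\<in>selected. x k \<in> {?p<..?p'}} = x ` selected \<inter> {?p<..?p'}" by blast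
  finally show "d * s / real m \<le> real (card (x ` selected \<inter> {?p<..?p'}))" .
qed

lemma ln_perturbed_diff_le:
  assumes "l \<noteq> k"
  shows "ln (s / \<bar>x k - x l\<bar>) \<le> (ln 3 + ln (s / reach k l)) + interaction k l"
proof -
  note diff_ge = perturbation_diff_ge[OF a_mono x_perturbation, of k l]
  have a_pos: "\<bar>a k - a l\<bar> > 0" using a_diff_pos[of k l] assms by simp
  then have x_pos: "\<bar>x k - x l\<bar> > 0" using diff_ge by argo
  have "s / \<bar>x k - x l\<bar> \<le> s / (\<bar>a k - a l\<bar> / 3)"
    using diff_ge a_pos s_pos x_pos by (intro divide_left_mono) auto
  then have "ln (s / \<bar>x k - x l\<bar>) \<le> ln (s / (\<bar>a k - a l\<bar> / 3))" using s_pos x_pos by (intro ln_mono) auto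
  also have "s / (\<bar>a k - a l\<bar> / 3) = 3 * ((s / reach k l) * (reach k l / \<bar>a k - a l\<bar>))"
    using reach_pos[of k l] by simp
  also have "ln \<dots> = (ln 3 + ln (s / reach k l)) + interaction k l"
    unfolding interaction_def
    using s_pos reach_pos[of k l] a_pos by (subst ln_mult_pos, simp, simp, subst ln_mult_pos) auto
  finally show ?thesis .
qed

lemma reach_le:
  assumes "k \<in> candidates" "l \<in> candidates" "\<bar>x k - x l\<bar> < \<kappa> * s"
  shows "reach k l \<le> 3 * \<kappa> * s"
proof -
  have "width_at j \<le> 3 * \<kappa> * s" if "j \<in> candidates" for j
  proof -
    have "width_at j \<le> \<rho> * s" unfolding width_at_def by (intro active_width_le candidate_cell(2) that)
    also have "\<dots> \<le> 3 * \<kappa> * s" using \<rho>_le s_pos by (intro mult_right_mono) auto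
    finally show ?thesis .
  qed
  moreover have "\<bar>a k - a l\<bar> \<le> 3 * \<bar>x k - x l\<bar>"
    using perturbation_diff_ge[OF a_mono x_perturbation, of k l] by simp
  ultimately show ?thesis using assms by (simp add: reach_def)
qed

lemma low_energy_selected: "low_energy \<kappa> \<tau> s (x ` selected)"
  unfolding low_energy_def
proof
  have inj: "inj_on x S" for S using inj_perturbation[OF a_mono x_perturbation] by (rule inj_on_subset) simp
  fix y assume "y \<in> x ` selected"
  then obtain k where k: "k \<in> selected" "y = x k" by auto
  define V where "V = {l\<in>selected. l \<noteq> k \<and> \<bar>x k - x l\<bar> < \<kappa> * s}"
  have fin: "finite V" using finite_selected by (simp add: V_def)
  have "{y'\<in>x ` selected. y' \<noteq> y \<and> \<bar>y - y'\<bar> < \<kappa> * s} = x ` V"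
    using inj[of UNIV] by (auto simp: V_def k(2) inj_eq)
  then have "(\<Sum>y'\<in>{y'\<in>x ` selected. y' \<noteq> y \<and> \<bar>y - y'\<bar> < \<kappa> * s}. ln (s / \<bar>y - y'\<bar>))
      = (\<Sum>l\<in>V. ln (s / \<bar>x k - x l\<bar>))"
    by (simp add: sum.reindex[OF inj] k(2))
  also have "\<dots> \<le> (\<Sum>l\<in>V. (ln 3 + ln (s / reach k l)) + interaction k l)"
    by (intro sum_mono ln_perturbed_diff_le) (simp add: V_def)
  also have "\<dots> = (\<Sum>l\<in>V. ln 3 + ln (s / reach k l)) + (\<Sum>l\<in>V. interaction k l)" by (rule sum.distrib)
  also have "\<dots> \<le> \<tau> / 2 * s + \<tau> * s / 2"
  proof (rule add_mono)
    have "(\<Sum>l\<in>V. interaction k l) \<le> crowding k" unfolding crowding_def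
      by (rule sum_mono2) (use finite_candidates selected_subset interaction_nonneg in \<open>auto simp: V_def\<close>)
    also have "\<dots> \<le> \<tau> * s / 2" using k by (auto simp: selected_def crowded_def)
    finally show "(\<Sum>l\<in>V. interaction k l) \<le> \<tau> * s / 2" .
    have "3 * \<kappa> * s \<le> 1 * s" using \<kappa>_le s_pos by (intro mult_right_mono) auto
    then have "(\<Sum>l\<in>V. ln 3 + ln (s / reach k l)) \<le> 4 * D * (3 * \<kappa> * s) * (1 + ln (3 * s / (3 * \<kappa> * s)))"
      by (intro sum_ln_reach_le fin reach_le) (use \<kappa>_pos s_pos k(1) selected_subset in \<open>auto simp: V_def\<close>)
    also have "\<dots> = (12 * D * \<kappa> * (1 + ln (1 / \<kappa>))) * s" using s_pos by simp
    also have "\<dots> \<le> \<tau> / 2 * s" using \<kappa>_small s_pos by (intro mult_right_mono) auto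
    finally show "(\<Sum>l\<in>V. ln 3 + ln (s / reach k l)) \<le> \<tau> / 2 * s" .
  qed
  finally show "(\<Sum>y'\<in>{y'\<in>x ` selected. y' \<noteq> y \<and> \<bar>y - y'\<bar> < \<kappa> * s}. ln (s / \<bar>y - y'\<bar>)) \<le> \<tau> * s" by simp
qed

lemma selected_weight_le: "k \<in> selected \<Longrightarrow> W k \<le> \<tau> * s"
  by (auto simp: selected_def heavy_def)

end

subsection \<open>From a partition to a density\<close>

lemma infdist_part_int:
  assumes x: "x \<in> part_int c n"
  shows "infdist 0 (part_int c n) \<le> \<bar>x\<bar>" "\<bar>x\<bar> \<le> infdist 0 (part_int c n) + (c (n+1) - c n)"
proof -
  have nonempty: "part_int c n \<noteq> {}" using x by auto
  show "infdist 0 (part_int c n) \<le> \<bar>x\<bar>" using infdist_le[OF x, of 0] by (simp add: dist_real_def)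
  have "\<bar>x\<bar> - (c (n+1) - c n) \<le> infdist 0 (part_int c n)"
    unfolding infdist_notempty[OF nonempty]
  proof (rule cINF_greatest[OF nonempty])
    fix y assume "y \<in> part_int c n"
    then have "\<bar>x - y\<bar> \<le> c (n+1) - c n" using x by (auto simp: part_int_def abs_le_iff)
    then show "\<bar>x\<bar> - (c (n+1) - c n) \<le> dist 0 y" by (simp add: dist_real_def)
  qed
  then show "\<bar>x\<bar> \<le> infdist 0 (part_int c n) + (c (n+1) - c n)" by simp
qed

lemma summable_on_nonneg_le:
  fixes f g :: "'a \<Rightarrow> real"
  assumes "g summable_on A" "\<And>n. 0 \<le> f n" "\<And>n. f n \<le> g n"
  shows "f summable_on A"
  using summable_on_comparison_test[OF assms(1)] assms(2,3) by simp

lemma summable_on_sum_disjoint: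
  fixes g :: "'a \<Rightarrow> real"
  assumes g: "g summable_on UNIV" "\<And>k. g k \<ge> 0"
    and fin: "\<And>n. finite (J n)" and disj: "\<And>m n k. k \<in> J m \<Longrightarrow> k \<in> J n \<Longrightarrow> m = n"
  shows "(\<lambda>n. \<Sum>k\<in>J n. g k) summable_on UNIV"
proof (rule nonneg_bdd_above_summable_on)
  show "0 \<le> (\<Sum>k\<in>J n. g k)" for n using g by (intro sum_nonneg) auto
  show "bdd_above (sum (\<lambda>n. \<Sum>k\<in>J n. g k) ` {F. F \<subseteq> UNIV \<and> finite F})"
  proof (rule bdd_aboveI2)
    fix F :: "'b set" assume "F \<in> {F. F \<subseteq> UNIV \<and> finite F}"
    then have F: "finite F" by simp
    have "(\<Sum>n\<in>F. \<Sum>k\<in>J n. g k) = (\<Sum>k\<in>(\<Union>n\<in>F. J n). g k)"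
      by (rule sum.UNION_disjoint[symmetric]) (use F fin disj in auto)
    also have "\<dots> \<le> infsum g UNIV"
      by (rule finite_sum_le_infsum) (use g F fin in auto)
    finally show "(\<Sum>n\<in>F. \<Sum>k\<in>J n. g k) \<le> infsum g UNIV" .
  qed
qed

context partitioned_points
begin

definition remoteness :: "int \<Rightarrow> real" where
  "remoteness n = 1 + (infdist 0 (cell n))\<^sup>2"

definition cell_density :: "(int \<Rightarrow> real) \<Rightarrow> real \<Rightarrow> real" where
  "cell_density Q x = Q (cell_of x) / width (cell_of x)"

lemma remoteness_ge_one: "remoteness n \<ge> 1"
  by (simp add: remoteness_def)

lemma remoteness_pos: "remoteness n > 0"
  using remoteness_ge_one[of n] by linarith

lemma remoteness_le: "x \<in> cell n \<Longrightarrow> remoteness n \<le> 1 + x\<^sup>2"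
  using power_mono[OF infdist_part_int(1) infdist_nonneg, of x c n 2] by (simp add: remoteness_def)

lemma cell_of_measurable: "cell_of \<in> borel \<rightarrow>\<^sub>M count_space UNIV"
proof (subst measurable_count_space_eq2_countable, safe)
  fix n
  have "cell_of -` {n} \<inter> space borel = cell n" using in_cell_of cell_of_eq by auto
  then show "cell_of -` {n} \<inter> space borel \<in> sets borel" by (simp add: part_int_def)
qed auto

lemma cell_density_measurable [measurable]: "cell_density Q \<in> borel_measurable borel"
  unfolding cell_density_def[abs_def]
  by (rule measurable_compose[OF cell_of_measurable, of "\<lambda>n. Q n / width n"]) simp

lemma cell_density_eq: "x \<in> cell n \<Longrightarrow> cell_density Q x = Q n / width n"
  by (simp add: cell_density_def cell_of_eq)

lemma cell_density_nonneg: "(\<And>n. Q n \<ge> 0) \<Longrightarrow> cell_density Q x \<ge> 0"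
  using width_pos by (simp add: cell_density_def less_imp_le)

lemma nn_integral_cell_const: "v \<ge> 0
    \<Longrightarrow> (\<integral>\<^sup>+x. ennreal v * indicator (cell n) x \<partial>lborel) = ennreal (v * width n)"
  using width_pos[of n] by (simp add: part_int_def width_def nn_integral_cmult_indicator ennreal_mult)

lemma weighted_mass_cell_density_finite:
  assumes Q: "\<And>n. Q n \<ge> 0" and summable: "(\<lambda>n. Q n / remoteness n) summable_on UNIV"
  shows "weighted_mass 1 (cell_density Q) < top"
proof -
  define v where "v i = Q (int_decode i) / width (int_decode i) / remoteness (int_decode i)" for i
  have v_nonneg: "v i \<ge> 0" for i
    using Q[of "int_decode i"] width_pos[of "int_decode i"] remoteness_pos[of "int_decode i"]
    by (simp add: v_def)
  have "weighted_mass 1 (cell_density Q)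
      \<le> (\<integral>\<^sup>+x. (\<Sum>i. ennreal (v i) * indicator (cell (int_decode i)) x) \<partial>lborel)"
    unfolding weighted_mass_def
  proof (rule nn_integral_mono)
    fix x
    define i where "i = int_encode (cell_of x)"
    have "1 / (1 + x\<^sup>2) \<le> 1 / remoteness (cell_of x)"
      using remoteness_le[OF in_cell_of[of x]] remoteness_pos[of "cell_of x"]
      by (intro divide_left_mono mult_pos_pos) (auto simp: add_pos_nonneg)
    from mult_left_mono[OF this cell_density_nonneg[OF Q]]
    have "cell_density Q x * weight 1 x \<le> v i" by (simp add: weight_def v_def i_def cell_density_def)
    then have "ennreal (cell_density Q x * weight 1 x) \<le> ennreal (v i) * indicator (cell (int_decode i)) x"
      using in_cell_of[of x] by (simp add: i_def ennreal_leI)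
    also have "\<dots> \<le> (\<Sum>k. ennreal (v k) * indicator (cell (int_decode k)) x)"
    proof -
      have "f i \<le> suminf f" for f :: "nat \<Rightarrow> ennreal" using sum_le_suminf[of f "{i}"] by simp
      then show ?thesis .
    qed
    finally show "ennreal (cell_density Q x * weight 1 x)
        \<le> (\<Sum>k. ennreal (v k) * indicator (cell (int_decode k)) x)" .
  qed
  also have "\<dots> = (\<Sum>i. \<integral>\<^sup>+x. ennreal (v i) * indicator (cell (int_decode i)) x \<partial>lborel)"
    by (rule nn_integral_suminf) (auto simp: part_int_def)
  also have "\<dots> = (\<Sum>i. ennreal (Q (int_decode i) / remoteness (int_decode i)))"
    using v_nonneg width_pos
    by (intro suminf_cong) (simp add: nn_integral_cell_const v_def less_imp_neq[symmetric])
  also have "\<dots> < top"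
  proof -
    have "(\<lambda>i. Q (int_decode i) / remoteness (int_decode i)) summable_on UNIV"
      using summable_on_reindex_bij_betw[OF bij_int_decode, of "\<lambda>n. Q n / remoteness n"] summable by simp
    then have "summable (\<lambda>i. Q (int_decode i) / remoteness (int_decode i))" by (rule summable_on_imp_summable)
    then show ?thesis using Q remoteness_pos by (subst suminf_ennreal2) (auto simp: less_imp_le)
  qed
  finally show ?thesis .
qed

lemma sum_le_window_mass:
  assumes Q: "\<And>n. Q n \<ge> 0" and fin: "finite F" and sub: "\<And>n. n \<in> F \<Longrightarrow> cell n \<subseteq> {x. \<bar>x - t\<bar> < r}"
  shows "ennreal (\<Sum>n\<in>F. Q n) \<le> window_mass (cell_density Q) t r"
proof -
  have "ennreal (\<Sum>n\<in>F. Q n) = (\<Sum>n\<in>F. ennreal (Q n))" using Q by simp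
  also have "\<dots> = (\<Sum>n\<in>F. \<integral>\<^sup>+x. ennreal (Q n / width n) * indicator (cell n) x \<partial>lborel)"
    using Q width_pos
    by (intro sum.cong refl) (simp add: nn_integral_cell_const less_imp_neq[symmetric] less_imp_le)
  also have "\<dots> = (\<Sum>n\<in>F. \<integral>\<^sup>+x. ennreal (cell_density Q x) * indicator (cell n) x \<partial>lborel)"
    by (intro sum.cong refl nn_integral_cong) (auto simp: indicator_def cell_density_eq)
  also have "\<dots> = (\<integral>\<^sup>+x. (\<Sum>n\<in>F. ennreal (cell_density Q x) * indicator (cell n) x) \<partial>lborel)"
    by (rule nn_integral_sum[symmetric]) (auto simp: part_int_def)
  also have "\<dots> \<le> window_mass (cell_density Q) t r"
    unfolding window_mass_def
    by (intro nn_integral_mono disjoint_sum_indicator_le fin) (use cell_unique sub in \<open>auto simp: subset_iff\<close>)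
  finally show ?thesis .
qed

lemma cell_window_overlap:
  assumes n: "n \<in> active t s" and s: "s > 0"
  shows "ennreal (min (width n) (2 * s)) \<le> emeasure lborel (cell n \<inter> {x. \<bar>x - t\<bar> < 3 * s})"
proof -
  define p where "p = max (c n) (t - 3 * s)"
  define p' where "p' = min (c (n+1)) (t + 3 * s)"
  obtain y where "y \<in> cell n" "t - s \<le> y" "y \<le> t + s" using n unfolding active_def by auto
  then have "min (width n) (2 * s) \<le> p' - p" "p \<le> p'"
    using s width_pos[of n] by (auto simp: p_def p'_def width_def part_int_def)
  then have "ennreal (min (width n) (2 * s)) \<le> emeasure lborel {p<..<p'}" by (simp add: ennreal_leI)
  also have "\<dots> \<le> emeasure lborel (cell n \<inter> {x. \<bar>x - t\<bar> < 3 * s})"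
    by (rule emeasure_mono) (auto simp: p_def p'_def part_int_def abs_less_iff)
  finally show ?thesis .
qed

text \<open>A cell meeting the window must be short, since \<open>cell_density Q\<close> is at least \<open>A * width n\<close> on it.\<close>

lemma width_le_of_light_window:
  assumes Q: "\<And>n. Q n \<ge> A * (width n)\<^sup>2" and A: "A \<ge> 1" "1 \<le> A * \<rho>\<^sup>2" and \<rho>: "\<rho> > 0" and s: "s > 0"
    and light: "window_mass (cell_density Q) t (3 * s) < ennreal (s\<^sup>2)" and n: "n \<in> active t s"
  shows "width n \<le> \<rho> * s"
proof -
  define overlap where "overlap = min (width n) (2 * s)"
  have "ennreal (A * width n * overlap) = ennreal (A * width n) * ennreal overlap"
    using A width_pos[of n] s by (simp add: overlap_def ennreal_mult)
  also have "\<dots> \<le> ennreal (A * width n) * emeasure lborel (cell n \<inter> {x. \<bar>x - t\<bar> < 3 * s})"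
    unfolding overlap_def by (intro mult_left_mono cell_window_overlap n s) simp
  also have "\<dots> = (\<integral>\<^sup>+x. ennreal (A * width n) * indicator (cell n \<inter> {x. \<bar>x - t\<bar> < 3 * s}) x \<partial>lborel)"
    by (rule nn_integral_cmult_indicator[symmetric]) (simp add: part_int_def)
  also have "\<dots> \<le> window_mass (cell_density Q) t (3 * s)"
    unfolding window_mass_def
  proof (rule nn_integral_mono)
    fix x
    have "A * width n \<le> cell_density Q x" if "x \<in> cell n"
      using Q[of n] width_pos[of n] by (simp add: cell_density_eq[OF that] field_simps power2_eq_square)
    then show "ennreal (A * width n) * indicator (cell n \<inter> {x. \<bar>x - t\<bar> < 3 * s}) x
        \<le> ennreal (cell_density Q x) * indicator {x. \<bar>x - t\<bar> < 3 * s} x" by (auto simp: indicator_def ennreal_leI)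
  qed
  also note light
  finally have small: "A * width n * overlap < s\<^sup>2"
    using s A width_pos[of n] by (simp add: ennreal_less_iff overlap_def)
  have "width n \<le> 2 * s"
  proof (rule ccontr)
    assume "\<not> ?thesis"
    then have "(1 * (2 * s)) * (2 * s) \<le> (A * width n) * overlap"
      using A s by (intro mult_mono) (auto simp: overlap_def)
    moreover have "s * s > 0" using s by simp
    ultimately show False using small unfolding power2_eq_square by argo
  qed
  then have "A * (width n)\<^sup>2 < s\<^sup>2" using small by (simp add: overlap_def power2_eq_square mult.assoc)
  also have "s\<^sup>2 \<le> A * \<rho>\<^sup>2 * s\<^sup>2" using A s by (simp add: mult_le_cancel_right1)
  finally have "(width n)\<^sup>2 < (\<rho> * s)\<^sup>2" using A by (simp add: power_mult_distrib mult.assoc)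
  then show ?thesis using power2_less_imp_less[of "width n" "\<rho> * s"] \<rho> s by simp
qed

lemma active_cell_subset:
  assumes n: "n \<in> active t s" and width: "width n \<le> s"
  shows "cell n \<subseteq> {x. \<bar>x - t\<bar> < 3 * s}"
proof
  fix z assume z: "z \<in> cell n"
  obtain y where y: "y \<in> cell n" "t - s \<le> y" "y \<le> t + s" using n unfolding active_def by auto
  have "\<bar>z - y\<bar> < s" using cell_diff[OF z y(1)] width by linarith
  then show "z \<in> {x. \<bar>x - t\<bar> < 3 * s}" using y by (auto simp: abs_less_iff)
qed

lemma sum_active_less_of_light_window:
  assumes Q: "\<And>n. Q n \<ge> 0" and widths: "\<And>n. n \<in> active t s \<Longrightarrow> width n \<le> s"
    and light: "window_mass (cell_density Q) t (3 * s) < ennreal (s\<^sup>2)"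
  shows "(\<Sum>n\<in>active t s. Q n) < s\<^sup>2"
proof -
  have "ennreal (\<Sum>n\<in>active t s. Q n) < ennreal (s\<^sup>2)"
    by (rule le_less_trans[OF sum_le_window_mass[OF Q finite_active active_cell_subset[OF _ widths]] light])
  then show ?thesis using Q by (simp add: ennreal_less_iff sum_nonneg)
qed

lemma sum_exceptional_width_le:
  assumes E: "finite E" and F: "finite F" and A: "A \<ge> 1" "1 \<le> A * \<rho>\<^sup>2" and \<rho>: "\<rho> > 0" and s: "s > 0"
    and Q: "\<And>n. Q n \<ge> 0" "\<And>n. n \<in> E \<Longrightarrow> A * (real (card E) * width n)\<^sup>2 \<le> Q n"
    and total: "(\<Sum>n\<in>F. Q n) < s\<^sup>2"
  shows "(\<Sum>n\<in>F \<inter> E. width n) \<le> \<rho> * s"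
proof (cases "E = {}")
  case False
  then have card: "real (card E) \<ge> 1" using E by (simp add: Suc_le_eq card_gt_0_iff)
  have "width n \<le> \<rho> * s / real (card E)" if n: "n \<in> F \<inter> E" for n
  proof -
    have "A * (real (card E) * width n)\<^sup>2 \<le> Q n" using Q(2) n by simp
    also have "Q n \<le> (\<Sum>n\<in>F. Q n)" using n F Q(1) by (intro member_le_sum) auto
    also have "\<dots> < s\<^sup>2" by (rule total)
    also have "s\<^sup>2 \<le> (A * \<rho>\<^sup>2) * s\<^sup>2" using A mult_right_mono[of 1 "A * \<rho>\<^sup>2" "s\<^sup>2"] by simp
    finally have "(real (card E) * width n)\<^sup>2 < (\<rho> * s)\<^sup>2"
      using A(1) by (simp add: power_mult_distrib mult.assoc)
    then have "real (card E) * width n < \<rho> * s"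
      using \<rho> s power2_less_imp_less[of "real (card E) * width n" "\<rho> * s"] by simp
    then show ?thesis using card by (simp add: field_simps)
  qed
  then have "(\<Sum>n\<in>F \<inter> E. width n) \<le> (\<Sum>n\<in>F \<inter> E. \<rho> * s / real (card E))" by (rule sum_mono)
  also have "\<dots> = real (card (F \<inter> E)) * (\<rho> * s / real (card E))" by simp
  also have "\<dots> \<le> real (card E) * (\<rho> * s / real (card E))"
    using E \<rho> s by (intro mult_right_mono) (auto simp: card_mono)
  finally show ?thesis using card by simp
qed (use \<rho> s in simp)

end

subsection \<open>Uniform sequences\<close>

locale uniform_partition = partitioned_points a c \<delta> D
  for a c :: "int \<Rightarrow> real" and \<delta> D :: real +
  fixes d :: real
  assumes uneven_finite: "\<And>e. e > 0 \<Longrightarrow> finite {n. \<not> \<bar>real (card (members n)) - d * width n\<bar> \<le> e * width n}"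
    and narrow_finite: "\<And>R. finite {n. \<not> R \<le> width n}"
    and width_summable: "(\<lambda>n. (width n)\<^sup>2 / remoteness n) summable_on UNIV"
    and energy_summable: "(\<lambda>n. ((real (card (members n)))\<^sup>2 * ln (width n) - energy (range a \<inter> cell n))
      / remoteness n) summable_on UNIV"

lemma finite_int_exceptions:
  assumes "eventually P (at_top :: int filter)" "eventually P (at_bot :: int filter)"
  shows "finite {n. \<not> P n}"
proof -
  obtain M N where MN: "\<And>n. n \<ge> M \<Longrightarrow> P n" "\<And>n. n \<le> N \<Longrightarrow> P n"
    using assms by (auto simp: eventually_at_top_linorder eventually_at_bot_linorder)
  have "N \<le> n \<and> n \<le> M" if "\<not> P n" for n using MN[of n] that by (meson linorder_linear)
  then have "{n. \<not> P n} \<subseteq> {N..M}" by auto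
  then show ?thesis by (rule finite_subset) simp
qed

lemma bounded_of_finite_exceptions:
  fixes f :: "'a \<Rightarrow> real"
  assumes "finite {n. \<not> f n \<le> B}"
  shows "\<exists>C\<ge>B. \<forall>n. f n \<le> C"
proof (intro exI[of _ "Max (insert B (f ` {n. \<not> f n \<le> B}))"] conjI allI)
  show "B \<le> Max (insert B (f ` {n. \<not> f n \<le> B}))" using assms by (intro Max_ge) auto
  show "f n \<le> Max (insert B (f ` {n. \<not> f n \<le> B}))" for n
  proof (cases "f n \<le> B")
    case True
    also have "B \<le> Max (insert B (f ` {n. \<not> f n \<le> B}))" using assms by (intro Max_ge) auto
    finally show ?thesis .
  next
    case False
    then show ?thesis using assms by (intro Max_ge) auto
  qed
qed

lemma positive_lower_bound_of_finite_exceptions: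
  fixes L :: "'a \<Rightarrow> real"
  assumes L: "\<And>n. L n > 0" and narrow: "\<And>R. finite {n. \<not> R \<le> L n}"
  shows "\<exists>\<delta>>0. \<forall>n. \<delta> \<le> L n"
proof -
  have "1 / L n \<le> 1 \<longleftrightarrow> 1 \<le> L n" for n using L[of n] by simp
  then have "finite {n. \<not> 1 / L n \<le> 1}" using narrow[of 1] by simp
  then obtain C where C: "C \<ge> 1" "\<And>n. 1 / L n \<le> C"
    using bounded_of_finite_exceptions[of "\<lambda>n. 1 / L n" 1] by blast
  have "1 / C \<le> L n" for n using C(1) C(2)[of n] L[of n] by (simp add: field_simps)
  then show ?thesis using C(1) by (intro exI[of _ "1 / C"]) auto
qed

lemma ratio_bound_of_finite_exceptions:
  fixes N L :: "'a \<Rightarrow> real"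
  assumes L: "\<And>n. L n > 0" and uneven: "finite {n. \<not> \<bar>N n - d * L n\<bar> \<le> r * L n}"
  shows "\<exists>D\<ge>d + r. \<forall>n. N n \<le> D * L n"
proof -
  have "N n / L n \<le> d + r" if "\<bar>N n - d * L n\<bar> \<le> r * L n" for n
  proof -
    have "N n \<le> (d + r) * L n" using that unfolding distrib_right by linarith
    then show ?thesis using L[of n] by (simp add: pos_divide_le_eq)
  qed
  then have "{n. \<not> N n / L n \<le> d + r} \<subseteq> {n. \<not> \<bar>N n - d * L n\<bar> \<le> r * L n}" by blast
  then have "finite {n. \<not> N n / L n \<le> d + r}" using uneven by (rule finite_subset)
  then obtain D where D: "D \<ge> d + r" "\<And>n. N n / L n \<le> D"
    using bounded_of_finite_exceptions[of "\<lambda>n. N n / L n" "d + r"] by blast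
  have "N n \<le> D * L n" for n using D(2)[of n] L[of n] by (simp add: pos_divide_le_eq)
  then show ?thesis using D(1) by blast
qed

lemma discrete_set_preimage:
  assumes inj: "inj a" and discrete: "discrete_set (range a)"
  shows "finite {k. a k \<in> part_int c n}" "card (range a \<inter> part_int c n) = card {k. a k \<in> part_int c n}"
proof -
  have image: "range a \<inter> part_int c n = a ` {k. a k \<in> part_int c n}" by auto
  have "finite (range a \<inter> {c n..c (n+1)})" using discrete by (auto simp: discrete_set_def)
  then have "finite (a ` {k. a k \<in> part_int c n})" by (rule finite_subset[rotated]) (auto simp: part_int_def)
  then show "finite {k. a k \<in> part_int c n}" using inj by (simp add: finite_image_iff inj_on_subset)
  show "card (range a \<inter> part_int c n) = card {k. a k \<in> part_int c n}"
    unfolding image using inj by (simp add: card_image inj_on_subset)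
qed

lemma uniform_partition_exists:
  assumes a: "strict_mono a" and uniform: "d_uniform d (range a)"
  obtains c \<delta> D where "uniform_partition a c \<delta> D d"
proof -
  obtain c where short: "short_partition c" and d: "d > 0" and discrete: "discrete_set (range a)"
    and count_top: "(\<lambda>n. real (card (range a \<inter> part_int c n)) - d * (c (n+1) - c n)) \<in> o[at_top](\<lambda>n. c (n+1) - c n)"
    and count_bot: "(\<lambda>n. real (card (range a \<inter> part_int c n)) - d * (c (n+1) - c n)) \<in> o[at_bot](\<lambda>n. c (n+1) - c n)"
    and energy: "(\<lambda>n. ((real (card (range a \<inter> part_int c n)))\<^sup>2 * ln (c (n+1) - c n) - energy (range a \<inter> part_int c n))
        / (1 + (infdist 0 (part_int c n))\<^sup>2)) summable_on UNIV"
    using uniform by (auto simp: d_uniform_def Let_def)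
  define L where "L n = c (n+1) - c n" for n
  define N where "N n = real (card {k. a k \<in> part_int c n})" for n
  have c: "strict_mono c" and L_top: "filterlim L at_top at_top" and L_bot: "filterlim L at_top at_bot"
    and L_summable: "(\<lambda>n. (L n)\<^sup>2 / (1 + (infdist 0 (part_int c n))\<^sup>2)) summable_on UNIV"
    using short by (auto simp: short_partition_def L_def[abs_def])
  have L_pos: "L n > 0" for n using c by (simp add: L_def strict_mono_less)
  note preimage = discrete_set_preimage[OF strict_mono_imp_inj_on[OF a] discrete]
  have N_eq: "real (card (range a \<inter> part_int c n)) = N n" for n by (simp add: N_def preimage)
  have narrow: "finite {n. \<not> R \<le> L n}" for R
    using L_top L_bot by (intro finite_int_exceptions) (auto simp: filterlim_at_top)
  have uneven: "finite {n. \<not> \<bar>N n - d * L n\<bar> \<le> e * L n}" if "e > 0" for e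
    using landau_o.smallD[OF count_top that] landau_o.smallD[OF count_bot that] L_pos
    by (intro finite_int_exceptions) (simp_all add: N_eq L_def less_imp_le)
  obtain \<delta> where \<delta>: "\<delta> > 0" "\<And>n. \<delta> \<le> L n"
    using positive_lower_bound_of_finite_exceptions[OF L_pos narrow] by blast
  obtain D where D: "D \<ge> d + 1" "\<And>n. N n \<le> D * L n"
    using ratio_bound_of_finite_exceptions[OF L_pos uneven[OF zero_less_one]] by blast
  interpret partitioned_points a c \<delta> D
    by standard (use a c \<delta> D d preimage in \<open>auto simp: N_def L_def\<close>)
  have "uniform_partition a c \<delta> D d"
    by standard
      (use uneven narrow L_summable energy in
        \<open>simp_all add: N_eq[unfolded N_def] N_def L_def members_def width_def remoteness_def\<close>)
  then show thesis by (rule that)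
qed

context uniform_partition
begin

lemma sum_cell_energy:
  "(\<Sum>l\<in>members n. cell_energy l)
    = (real (card (members n)))\<^sup>2 * ln (width n) - energy (range a \<inter> cell n) - real (card (members n)) * ln (width n)"
proof -
  have inj: "inj a" using a_mono by (rule strict_mono_imp_inj_on)
  define pairs where "pairs = Sigma (members n) (\<lambda>l. members n - {l})"
  have "range a \<inter> cell n = a ` members n" by (auto simp: members_def)
  then have "{(x,y). x \<in> range a \<inter> cell n \<and> y \<in> range a \<inter> cell n \<and> x \<noteq> y} = (\<lambda>(l,j). (a l, a j)) ` pairs"
    by (auto simp: pairs_def inj_eq[OF inj])
  moreover have "inj_on (\<lambda>(l,j). (a l, a j)) pairs" by (auto simp: inj_on_def inj_eq[OF inj])
  ultimately have "energy (range a \<inter> cell n) = (\<Sum>(l,j)\<in>pairs. ln \<bar>a l - a j\<bar>)"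
    unfolding energy_def by (simp only: sum.reindex) (simp add: case_prod_unfold o_def)
  also have "\<dots> = (\<Sum>l\<in>members n. \<Sum>j\<in>members n - {l}. ln \<bar>a l - a j\<bar>)"
    unfolding pairs_def by (rule sum.Sigma[symmetric]) (use finite_members in auto)
  finally have energy_eq: "energy (range a \<inter> cell n) = (\<Sum>l\<in>members n. \<Sum>j\<in>members n - {l}. ln \<bar>a l - a j\<bar>)" .
  have "cell_energy l = (\<Sum>j\<in>members n - {l}. ln (width n) - ln \<bar>a l - a j\<bar>)" if "l \<in> members n" for l
    unfolding cell_energy_def using that width_pos[of n] a_diff_pos
    by (intro sum.cong) (auto simp: members_iff width_at_def ln_div abs_minus_commute)
  then have "(\<Sum>l\<in>members n. cell_energy l)
      = (\<Sum>l\<in>members n. \<Sum>j\<in>members n - {l}. ln (width n) - ln \<bar>a l - a j\<bar>)"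
    by (rule sum.cong[OF refl])
  also have "\<dots> = (\<Sum>l\<in>members n. real (card (members n) - 1) * ln (width n)) - energy (range a \<inter> cell n)"
    unfolding energy_eq sum_subtractf[symmetric]
    by (intro sum.cong refl) (use finite_members in \<open>simp add: sum_subtractf\<close>)
  also have "(\<Sum>l\<in>members n. real (card (members n) - 1) * ln (width n))
      = (real (card (members n)))\<^sup>2 * ln (width n) - real (card (members n)) * ln (width n)"
    by (cases "card (members n)") (simp_all add: power2_eq_square algebra_simps)
  finally show ?thesis by simp
qed

lemma abs_ln_width_le: "\<bar>ln (width n)\<bar> \<le> (1 + 1 / \<delta>\<^sup>2) * width n"
proof -
  have "\<delta> * \<delta> \<le> width n * width n" using \<delta>_pos width_ge[of n] by (intro mult_mono) auto
  then have "1 / width n \<le> 1 / \<delta>\<^sup>2 * width n"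
    using width_pos[of n] \<delta>_pos by (simp add: field_simps power2_eq_square)
  moreover have "- ln (width n) \<le> 1 / width n"
    using ln_le_minus_one[of "1 / width n"] width_pos[of n] by (simp add: ln_div)
  moreover have "ln (width n) \<le> width n" using ln_le_minus_one[OF width_pos[of n]] by linarith
  moreover have "0 \<le> 1 / \<delta>\<^sup>2 * width n" using width_pos[of n] by simp
  ultimately show ?thesis using width_pos[of n] unfolding distrib_right abs_le_iff by linarith
qed

lemma cell_energy_summable: "(\<lambda>n. (\<Sum>l\<in>members n. cell_energy l) / remoteness n) summable_on UNIV"
proof (rule summable_on_nonneg_le)
  define excess where
    "excess n = ((real (card (members n)))\<^sup>2 * ln (width n) - energy (range a \<inter> cell n)) / remoteness n" for n
  define K where "K = D * (1 + 1 / \<delta>\<^sup>2)"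
  have "(\<lambda>n. \<bar>excess n\<bar>) summable_on UNIV"
    using energy_summable summable_on_iff_abs_summable_on_real[of excess UNIV]
    by (simp add: excess_def[abs_def])
  then show "(\<lambda>n. \<bar>excess n\<bar> + K * ((width n)\<^sup>2 / remoteness n)) summable_on UNIV"
    by (intro summable_on_add summable_on_cmult_right width_summable)
  show "0 \<le> (\<Sum>l\<in>members n. cell_energy l) / remoteness n" for n
    using cell_energy_nonneg remoteness_pos[of n] by (simp add: sum_nonneg)
  fix n
  have "- (real (card (members n)) * ln (width n)) \<le> real (card (members n)) * \<bar>ln (width n)\<bar>"
    by (metis abs_ge_minus_self mult_left_mono mult_minus_right of_nat_0_le_iff)
  also have "\<dots> \<le> (D * width n) * ((1 + 1 / \<delta>\<^sup>2) * width n)"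
    using card_members[of n] abs_ln_width_le[of n] D_ge_one width_pos[of n] by (intro mult_mono) auto
  also have "\<dots> = K * (width n)\<^sup>2" by (simp add: K_def power2_eq_square mult_ac)
  finally have "- (real (card (members n)) * ln (width n)) / remoteness n \<le> K * (width n)\<^sup>2 / remoteness n"
    using remoteness_pos[of n] by (intro divide_right_mono) auto
  moreover have "(\<Sum>l\<in>members n. cell_energy l) / remoteness n
      = excess n + - (real (card (members n)) * ln (width n)) / remoteness n"
    unfolding sum_cell_energy excess_def by (simp add: diff_divide_distrib)
  ultimately show "(\<Sum>l\<in>members n. cell_energy l) / remoteness n
      \<le> \<bar>excess n\<bar> + K * ((width n)\<^sup>2 / remoteness n)"
    using abs_ge_self[of "excess n"] by simp
qed

lemma width_sq_le: "(width n)\<^sup>2 \<le> (\<Sum>\<^sub>\<infinity>n. (width n)\<^sup>2 / remoteness n) * remoteness n"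
proof -
  have "(width n)\<^sup>2 / remoteness n \<le> (\<Sum>\<^sub>\<infinity>n. (width n)\<^sup>2 / remoteness n)"
    using finite_sum_le_infsum[OF width_summable, of "{n}"] remoteness_pos by (simp add: less_imp_le)
  then show ?thesis using remoteness_pos[of n] by (simp add: pos_divide_le_eq)
qed

lemma index_diff_le: "\<bar>real_of_int (k - l)\<bar> \<le> D * (\<bar>a k - a l\<bar> + width_at k + width_at l)"
proof (induction k l rule: linorder_wlog)
  case (le k l)
  define A where "A = c (cell_of (a k))"
  define B where "B = c (cell_of (a l) + 1)"
  have k: "a k \<in> cell (cell_of (a k))" and l: "a l \<in> cell (cell_of (a l))" by (rule in_cell_of)+
  have a_le: "a k \<le> a l" using le a_mono by (simp add: strict_mono_less_eq)
  have "real (card {k..l}) \<le> D * (B - A)"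
  proof (rule card_members_le[of "{cell_of (a k)..cell_of (a l)}"])
    show "A \<le> B" using k l a_le by (auto simp: A_def B_def part_int_def)
    show "cell n \<subseteq> {A..B}" if "n \<in> {cell_of (a k)..cell_of (a l)}" for n
    proof -
      have "A \<le> c n" "c (n+1) \<le> B" using that by (auto simp: A_def B_def c_le_iff)
      then show ?thesis by (auto simp: part_int_def)
    qed
    show "{k..l} \<subseteq> (\<Union>n\<in>{cell_of (a k)..cell_of (a l)}. members n)"
    proof
      fix j assume "j \<in> {k..l}"
      then have "a k \<le> a j" "a j \<le> a l" using a_mono by (auto simp: strict_mono_less_eq)
      then have "c (cell_of (a k)) < c (cell_of (a j) + 1)" "c (cell_of (a j)) < c (cell_of (a l) + 1)"
        using k l in_cell_of[of "a j"] by (auto simp: part_int_def)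
      then have "cell_of (a j) \<in> {cell_of (a k)..cell_of (a l)}" by (auto simp: c_less_iff)
      then show "j \<in> (\<Union>n\<in>{cell_of (a k)..cell_of (a l)}. members n)" using members_iff by blast
    qed
  qed simp
  also have "\<dots> \<le> D * (\<bar>a k - a l\<bar> + width_at k + width_at l)"
    using k l D_ge_one by (intro mult_left_mono) (auto simp: A_def B_def part_int_def width_at_def width_def)
  finally show ?case using le by simp
qed (simp add: abs_minus_commute add_ac)

lemma index_sq_le: "\<exists>K>0. \<forall>k. 1 + (real_of_int k)\<^sup>2 \<le> K * remoteness (cell_of (a k))"
proof -
  define K1 where "K1 = (\<Sum>\<^sub>\<infinity>n. (width n)\<^sup>2 / remoteness n)"
  define e where "e = \<bar>a 0\<bar> + width_at 0"
  define K where "K = 1 + 3 * D\<^sup>2 * (1 + 4 * K1 + e\<^sup>2)"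
  have "K1 \<ge> 0" unfolding K1_def using remoteness_pos by (intro infsum_nonneg) (simp add: less_imp_le)
  then have "K > 0" unfolding K_def by (intro add_pos_nonneg mult_nonneg_nonneg) auto
  moreover have "1 + (real_of_int k)\<^sup>2 \<le> K * remoteness (cell_of (a k))" for k
  proof -
    define r where "r = infdist 0 (cell (cell_of (a k)))"
    define w where "w = width_at k"
    have "\<bar>a k\<bar> \<le> r + w"
      using infdist_part_int(2)[OF in_cell_of[of "a k"]] by (simp add: r_def w_def width_at_def width_def)
    then have "\<bar>a k - a 0\<bar> + width_at k + width_at 0 \<le> r + 2 * w + e" by (simp add: e_def w_def)
    then have "D * (\<bar>a k - a 0\<bar> + width_at k + width_at 0) \<le> D * (r + 2 * w + e)"
      using D_ge_one by (intro mult_left_mono) auto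
    then have "\<bar>real_of_int k\<bar> \<le> D * (r + 2 * w + e)" using index_diff_le[of k 0] by simp
    then have "\<bar>real_of_int k\<bar>\<^sup>2 \<le> (D * (r + 2 * w + e))\<^sup>2" by (rule power_mono) simp
    also have "\<dots> \<le> D\<^sup>2 * (3 * (r\<^sup>2 + 4 * w\<^sup>2 + e\<^sup>2))"
    proof -
      have "0 \<le> (r - 2 * w)\<^sup>2 + (2 * w - e)\<^sup>2 + (r - e)\<^sup>2" by simp
      then have "(r + 2 * w + e)\<^sup>2 \<le> 3 * (r\<^sup>2 + 4 * w\<^sup>2 + e\<^sup>2)" by (simp add: power2_eq_square algebra_simps)
      then show ?thesis unfolding power_mult_distrib by (rule mult_left_mono) simp
    qed
    also have "\<dots> \<le> D\<^sup>2 * (3 * (remoteness (cell_of (a k)) + 4 * (K1 * remoteness (cell_of (a k))) + e\<^sup>2 * remoteness (cell_of (a k))))"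
      using width_sq_le[of "cell_of (a k)"] mult_left_mono[OF remoteness_ge_one[of "cell_of (a k)"], of "e\<^sup>2"]
      by (intro mult_left_mono add_mono) (auto simp: r_def w_def K1_def remoteness_def width_at_def)
    finally have "(real_of_int k)\<^sup>2 \<le> 3 * D\<^sup>2 * (1 + 4 * K1 + e\<^sup>2) * remoteness (cell_of (a k))"
      by (simp add: algebra_simps)
    then show ?thesis using remoteness_ge_one[of "cell_of (a k)"] by (simp add: K_def distrib_right)
  qed
  ultimately show ?thesis by blast
qed

lemma member_weight_summable:
  assumes W: "\<And>k. W k \<ge> 0" "(\<lambda>k. W k / (1 + (real_of_int k)\<^sup>2)) summable_on UNIV"
  shows "(\<lambda>n. (\<Sum>k\<in>members n. W k) / remoteness n) summable_on UNIV"
proof -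
  obtain K where K: "K > 0" "\<And>k. 1 + (real_of_int k)\<^sup>2 \<le> K * remoteness (cell_of (a k))"
    using index_sq_le by blast
  have "W k / remoteness n \<le> K * (W k / (1 + (real_of_int k)\<^sup>2))" if "k \<in> members n" for k n
  proof -
    have "W k * (1 + (real_of_int k)\<^sup>2) \<le> W k * (K * remoteness n)"
      using K(2)[of k] W(1)[of k] that by (intro mult_left_mono) (auto simp: members_iff)
    moreover have "1 + (real_of_int k)\<^sup>2 > 0" by (simp add: add_pos_nonneg)
    ultimately show ?thesis using remoteness_pos[of n] by (simp add: divide_simps mult_ac)
  qed
  then have "(\<Sum>k\<in>members n. W k / remoteness n) \<le> (\<Sum>k\<in>members n. K * (W k / (1 + (real_of_int k)\<^sup>2)))" for n
    by (rule sum_mono)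
  then have term_le: "(\<Sum>k\<in>members n. W k) / remoteness n
      \<le> K * (\<Sum>k\<in>members n. W k / (1 + (real_of_int k)\<^sup>2))" for n
    by (simp only: sum_divide_distrib sum_distrib_left)
  have "(\<lambda>n. \<Sum>k\<in>members n. W k / (1 + (real_of_int k)\<^sup>2)) summable_on UNIV"
    by (rule summable_on_sum_disjoint[OF W(2)]) (use W(1) finite_members in \<open>auto simp: members_iff\<close>)
  then have "(\<lambda>n. K * (\<Sum>k\<in>members n. W k / (1 + (real_of_int k)\<^sup>2))) summable_on UNIV"
    by (rule summable_on_cmult_right)
  then show ?thesis
    by (rule summable_on_nonneg_le[OF _ _ term_le]) (use W(1) remoteness_pos in \<open>auto simp: sum_nonneg less_imp_le\<close>)
qed

definition node_cost :: "real \<Rightarrow> (int \<Rightarrow> real) \<Rightarrow> int set \<Rightarrow> int \<Rightarrow> real" where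
  "node_cost A W E n = A * ((width n)\<^sup>2 + (\<Sum>l\<in>members n. cell_energy l) + (\<Sum>k\<in>members n. W k)
     + (if n \<in> E then (real (card E) * width n)\<^sup>2 else 0))"

lemma node_cost_ge:
  assumes W: "\<And>k. W k \<ge> 0" and A: "A \<ge> 1"
  shows "node_cost A W E n \<ge> 0" "node_cost A W E n \<ge> A * (width n)\<^sup>2"
    "node_cost A W E n \<ge> A * (\<Sum>l\<in>members n. cell_energy l)" "node_cost A W E n \<ge> A * (\<Sum>k\<in>members n. W k)"
    "n \<in> E \<Longrightarrow> node_cost A W E n \<ge> A * (real (card E) * width n)\<^sup>2"
proof -
  have "(\<Sum>l\<in>members n. cell_energy l) \<ge> 0" "(\<Sum>k\<in>members n. W k) \<ge> 0"
    by (auto intro!: sum_nonneg cell_energy_nonneg W)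
  then show "node_cost A W E n \<ge> 0" "node_cost A W E n \<ge> A * (width n)\<^sup>2"
    "node_cost A W E n \<ge> A * (\<Sum>l\<in>members n. cell_energy l)" "node_cost A W E n \<ge> A * (\<Sum>k\<in>members n. W k)"
    "n \<in> E \<Longrightarrow> node_cost A W E n \<ge> A * (real (card E) * width n)\<^sup>2"
    unfolding node_cost_def using A by (auto intro!: mult_left_mono mult_nonneg_nonneg add_nonneg_nonneg)
qed

lemma node_cost_summable:
  assumes W: "\<And>k. W k \<ge> 0" "(\<lambda>k. W k / (1 + (real_of_int k)\<^sup>2)) summable_on UNIV" and E: "finite E"
  shows "(\<lambda>n. node_cost A W E n / remoteness n) summable_on UNIV"
proof -
  let ?exceptional = "\<lambda>n. (if n \<in> E then (real (card E) * width n)\<^sup>2 else 0) / remoteness n"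
  have "?exceptional summable_on E" using E by (rule summable_on_finite)
  then have "?exceptional summable_on UNIV" by (rule summable_on_cong_neutral[THEN iffD1, rotated -1]) auto
  then have "(\<lambda>n. A * ((width n)\<^sup>2 / remoteness n + (\<Sum>l\<in>members n. cell_energy l) / remoteness n
      + (\<Sum>k\<in>members n. W k) / remoteness n + ?exceptional n)) summable_on UNIV"
    by (intro summable_on_cmult_right summable_on_add width_summable cell_energy_summable member_weight_summable W)
  then show ?thesis unfolding node_cost_def by (simp add: add_divide_distrib[symmetric])
qed

end

lemma small_entropy_factor:
  fixes C \<tau> :: real
  assumes C: "C \<ge> 1" and \<tau>: "\<tau> > 0"
  shows "\<exists>\<kappa>>0. 3 * \<kappa> \<le> 1 \<and> C * \<kappa> * (1 + ln (1 / \<kappa>)) \<le> \<tau>"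
proof -
  have "((\<lambda>\<kappa>. C * \<kappa> * (1 + ln (1 / \<kappa>))) \<longlongrightarrow> 0) (at_right 0)" by real_asymp
  then have "\<forall>\<^sub>F \<kappa> in at_right 0. C * \<kappa> * (1 + ln (1 / \<kappa>)) < \<tau>" using \<tau> by (rule order_tendstoD)
  moreover have "\<forall>\<^sub>F \<kappa> in at_right 0. 3 * \<kappa> \<le> (1 :: real)" by real_asymp
  moreover have "\<forall>\<^sub>F \<kappa> in at_right 0. \<kappa> > (0 :: real)" by (rule eventually_at_right_less)
  ultimately have "\<forall>\<^sub>F \<kappa> in at_right 0. \<kappa> > 0 \<and> 3 * \<kappa> \<le> 1 \<and> C * \<kappa> * (1 + ln (1 / \<kappa>)) \<le> \<tau>"
    by eventually_elim simp
  from eventually_happens'[OF trivial_limit_at_right_real this] show ?thesis by blast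
qed

lemma eventually_mult_le_at_right_0:
  fixes K r :: real
  assumes "r > 0"
  shows "\<forall>\<^sub>F \<rho> in at_right 0. K * \<rho> \<le> r"
proof -
  have "((\<lambda>\<rho>. K * \<rho>) \<longlongrightarrow> K * 0) (at_right 0)" by (intro tendsto_intros)
  then have "\<forall>\<^sub>F \<rho> in at_right 0. K * \<rho> < r" using assms by (intro order_tendstoD(2)) auto
  then show ?thesis by eventually_elim simp
qed

lemma small_positive_exists:
  fixes K r :: "'a \<Rightarrow> real"
  assumes "finite I" "\<And>i. i \<in> I \<Longrightarrow> r i > 0"
  shows "\<exists>\<rho>>0. \<forall>i\<in>I. K i * \<rho> \<le> r i"
proof -
  have "\<forall>\<^sub>F \<rho> in at_right 0. \<forall>i\<in>I. K i * \<rho> \<le> r i"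
    using assms by (intro eventually_ball_finite ballI eventually_mult_le_at_right_0)
  then have "\<forall>\<^sub>F \<rho> in at_right 0. \<rho> > 0 \<and> (\<forall>i\<in>I. K i * \<rho> \<le> r i)"
    using eventually_at_right_less by (rule eventually_conj[rotated])
  from eventually_happens'[OF trivial_limit_at_right_real this] show ?thesis by blast
qed

lemma selection_constants_exist:
  fixes \<kappa> \<xi> \<delta> :: real
  assumes \<kappa>: "\<kappa> > 0" and \<xi>: "\<xi> > 0" and \<delta>: "\<delta> > 0" and m: "m \<ge> (1 :: nat)"
  shows "\<exists>\<rho> A. \<rho> > 0 \<and> \<rho> \<le> 1 \<and> \<rho> \<le> 3 * \<kappa> \<and> (d2 + 2 * \<xi>) * (3 * \<rho>) \<le> \<xi> / real m \<and> (\<bar>s\<^sub>0\<bar> + 1) * \<rho> \<le> \<delta>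
    \<and> A \<ge> 1 \<and> 1 \<le> A * \<rho>\<^sup>2 \<and> 1 / A / \<tau> + 4 * (1 + 16 * D / \<xi>) * (1 / A) / \<tau> \<le> \<xi> / real m"
proof -
  have "\<exists>\<rho>>0. \<forall>i\<in>{(1, 1), (1, 3 * \<kappa>), (3 * (d2 + 2 * \<xi>), \<xi> / real m), (\<bar>s\<^sub>0\<bar> + 1, \<delta>)}. fst i * \<rho> \<le> snd i"
    by (rule small_positive_exists) (use \<kappa> \<xi> \<delta> m in auto)
  then obtain \<rho> where \<rho>: "\<rho> > 0" "\<rho> \<le> 1" "\<rho> \<le> 3 * \<kappa>" "3 * (d2 + 2 * \<xi>) * \<rho> \<le> \<xi> / real m"
    "(\<bar>s\<^sub>0\<bar> + 1) * \<rho> \<le> \<delta>" by auto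
  have "\<exists>\<epsilon>>0. \<forall>i\<in>{(1, 1), (1, \<rho>\<^sup>2), (1 / \<tau> + 4 * (1 + 16 * D / \<xi>) / \<tau>, \<xi> / real m)}. fst i * \<epsilon> \<le> snd i"
    by (rule small_positive_exists) (use \<rho>(1) \<xi> m in auto)
  then obtain \<epsilon> where \<epsilon>: "\<epsilon> > 0" "\<epsilon> \<le> 1" "\<epsilon> \<le> \<rho>\<^sup>2" "(1 / \<tau> + 4 * (1 + 16 * D / \<xi>) / \<tau>) * \<epsilon> \<le> \<xi> / real m"
    by auto
  define A where "A = 1 / \<epsilon>"
  have A: "A \<ge> 1" "1 \<le> A * \<rho>\<^sup>2" "1 / A = \<epsilon>" using \<epsilon> by (simp_all add: A_def field_simps)
  have "(d2 + 2 * \<xi>) * (3 * \<rho>) \<le> \<xi> / real m" using \<rho>(4) by (simp add: mult_ac)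
  moreover have "1 / A / \<tau> + 4 * (1 + 16 * D / \<xi>) * (1 / A) / \<tau> \<le> \<xi> / real m"
    using \<epsilon>(4) unfolding A(3) by (simp only: distrib_right[of _ _ \<epsilon>] times_divide_eq_left mult_1)
  ultimately show ?thesis using \<rho> A by blast
qed

context uniform_partition
begin

definition irregular :: "real \<Rightarrow> int set" where
  "irregular \<xi> = {n. \<not> \<bar>real (card (members n)) - d * width n\<bar> \<le> \<xi> * width n} \<union> {n. \<not> 4 / \<xi> \<le> width n}"

lemma finite_irregular: "\<xi> > 0 \<Longrightarrow> finite (irregular \<xi>)"
  by (simp add: irregular_def uneven_finite narrow_finite)

lemma node_selection_of_light_window:
  assumes W: "\<And>k. W k \<ge> 0" and x: "perturbation a x" and s: "s > 0" and d2: "d2 > 0" "d2 + 4 * \<xi> = d"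
    and \<xi>: "\<xi> > 0"
    and \<tau>: "\<tau> > 0" and \<kappa>: "\<kappa> > 0" "3 * \<kappa> \<le> 1" "12 * D * \<kappa> * (1 + ln (1 / \<kappa>)) \<le> \<tau> / 2"
    and \<rho>: "\<rho> > 0" "\<rho> \<le> 1" "\<rho> \<le> 3 * \<kappa>" and A: "A \<ge> 1" "1 \<le> A * \<rho>\<^sup>2"
    and light: "window_mass (cell_density (node_cost A W (irregular \<xi>))) t (3 * s) < ennreal (s\<^sup>2)"
  shows "node_selection a c \<delta> D W x (irregular \<xi>) t s d2 \<xi> \<tau> \<kappa> \<rho> (1 / A)"
proof -
  let ?Q = "node_cost A W (irregular \<xi>)"
  note cost_ge = node_cost_ge[OF W A(1), where E = "irregular \<xi>"]
  have widths: "width n \<le> \<rho> * s" if "n \<in> active t s" for n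
    by (rule width_le_of_light_window[OF cost_ge(2) A \<rho>(1) s light that])
  have "\<rho> * s \<le> 1 * s" using \<rho>(2) s by (intro mult_right_mono) auto
  then have total: "(\<Sum>n\<in>active t s. ?Q n) < s\<^sup>2"
    using widths by (intro sum_active_less_of_light_window[OF cost_ge(1) _ light]) force
  have part: "(\<Sum>n\<in>active t s. f n) \<le> 1 / A * s\<^sup>2" if "\<And>n. A * f n \<le> ?Q n" for f
  proof -
    have "A * (\<Sum>n\<in>active t s. f n) \<le> (\<Sum>n\<in>active t s. ?Q n)"
      unfolding sum_distrib_left by (intro sum_mono that)
    then have "A * (\<Sum>n\<in>active t s. f n) \<le> s\<^sup>2" using total by linarith
    then show ?thesis using A(1) by (simp add: field_simps)
  qed
  show ?thesis
  proof
    show "(\<Sum>n\<in>active t s \<inter> irregular \<xi>. width n) \<le> \<rho> * s"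
      using finite_irregular[OF \<xi>] finite_active A \<rho>(1) s cost_ge(1,5) total
      by (rule sum_exceptional_width_le)
    fix n assume n: "n \<notin> irregular \<xi>"
    then have "\<bar>real (card (members n)) - d * width n\<bar> \<le> \<xi> * width n" by (auto simp: irregular_def)
    moreover have "(d2 + 3 * \<xi>) * width n = d * width n - \<xi> * width n"
      unfolding d2(2)[symmetric] by (simp add: algebra_simps)
    ultimately show "(d2 + 3 * \<xi>) * width n \<le> real (card (members n))" by linarith
    show "4 \<le> \<xi> * width n" using n \<xi> by (simp add: irregular_def field_simps)
  qed (use W x s d2(1) \<xi> \<tau> \<kappa> \<rho>(3) widths part[OF cost_ge(3)] part[OF cost_ge(4)] in auto)
qed

lemma node_density:
  fixes W :: "int \<Rightarrow> real" and m :: nat and s\<^sub>0 :: real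
  assumes d2: "0 < d2" "d2 < d" and W: "\<And>k. W k \<ge> 0" "(\<lambda>k. W k / (1 + (real_of_int k)\<^sup>2)) summable_on UNIV"
    and \<tau>: "\<tau> > 0" and \<kappa>: "\<kappa> > 0" "3 * \<kappa> \<le> 1" "12 * D * \<kappa> * (1 + ln (1 / \<kappa>)) \<le> \<tau> / 2" and m: "m \<ge> 1"
  shows "\<exists>q\<in>borel_measurable borel. (\<forall>x. 0 \<le> q x) \<and> weighted_mass 1 q < top \<and>
    (\<forall>t s x. s > 0 \<longrightarrow> window_mass q t (3 * s) < ennreal (s\<^sup>2) \<longrightarrow> perturbation a x \<longrightarrow>
      s\<^sub>0 \<le> s \<and> (\<exists>S. (\<forall>k\<in>S. W k \<le> \<tau> * s) \<and> fills_cells d2 m t s (x ` S) \<and> low_energy \<kappa> \<tau> s (x ` S)))"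
proof -
  define \<xi> where "\<xi> = (d - d2) / 4"
  have \<xi>: "\<xi> > 0" "d2 + 4 * \<xi> = d" using d2 by (simp_all add: \<xi>_def field_simps)
  obtain \<rho> A where \<rho>: "\<rho> > 0" "\<rho> \<le> 1" "\<rho> \<le> 3 * \<kappa>" "(d2 + 2 * \<xi>) * (3 * \<rho>) \<le> \<xi> / real m" "(\<bar>s\<^sub>0\<bar> + 1) * \<rho> \<le> \<delta>"
    and A: "A \<ge> 1" "1 \<le> A * \<rho>\<^sup>2" "1 / A / \<tau> + 4 * (1 + 16 * D / \<xi>) * (1 / A) / \<tau> \<le> \<xi> / real m"
    using selection_constants_exist[OF \<kappa>(1) \<xi>(1) \<delta>_pos m, of d2 s\<^sub>0 \<tau> D] by blast
  let ?Q = "node_cost A W (irregular \<xi>)"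
  note cost_ge = node_cost_ge[OF W(1) A(1), where E = "irregular \<xi>"]
  show ?thesis
  proof (intro bexI[of _ "cell_density ?Q"] conjI allI impI)
    show "cell_density ?Q \<in> borel_measurable borel" by (rule cell_density_measurable)
    show "0 \<le> cell_density ?Q x" for x by (rule cell_density_nonneg[OF cost_ge(1)])
    show "weighted_mass 1 (cell_density ?Q) < top"
      using \<xi>(1) by (intro weighted_mass_cell_density_finite cost_ge(1) node_cost_summable W finite_irregular)
  next
    fix t s and x :: "int \<Rightarrow> real"
    assume s: "s > 0" and light: "window_mass (cell_density ?Q) t (3 * s) < ennreal (s\<^sup>2)"
      and x: "perturbation a x"
    have "width (cell_of t) \<le> \<rho> * s"
      by (rule width_le_of_light_window[OF cost_ge(2) A(1,2) \<rho>(1) s light cell_of_active]) (use s in simp)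
    then have "(\<bar>s\<^sub>0\<bar> + 1) * \<rho> \<le> s * \<rho>" using \<rho>(5) width_ge[of "cell_of t"] by (simp add: mult.commute)
    then have "\<bar>s\<^sub>0\<bar> + 1 \<le> s" using \<rho>(1) by simp
    then show "s\<^sub>0 \<le> s" by linarith
    interpret node_selection a c \<delta> D W x "irregular \<xi>" t s d2 \<xi> \<tau> \<kappa> \<rho> "1 / A"
      by (rule node_selection_of_light_window[OF W(1) x s d2(1) \<xi>(2,1) \<tau> \<kappa> \<rho>(1-3) A(1,2) light])
    show "\<exists>S. (\<forall>k\<in>S. W k \<le> \<tau> * s) \<and> fills_cells d2 m t s (x ` S) \<and> low_energy \<kappa> \<tau> s (x ` S)"
      using selected_weight_le fills_cells_selected[OF m \<rho>(4) A(3)] low_energy_selected by blast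
  qed
qed

end

section \<open>Duality\<close>

lemma quadratic_nonneg_imp:
  fixes p e N :: real
  assumes nonneg: "\<And>r. 0 \<le> e + 2 * r * p + r\<^sup>2 * N" and N: "N \<ge> 0"
  shows "p\<^sup>2 \<le> e * N"
proof (cases "N = 0")
  case True
  have "p = 0"
  proof (rule ccontr)
    assume "p \<noteq> 0"
    then show False using nonneg[of "- (e + 1) / (2 * p)"] True by (simp add: field_simps)
  qed
  then show ?thesis using True by simp
next
  case False
  then have "N > 0" using N by simp
  then show ?thesis using nonneg[of "- p / N"] by (simp add: field_simps power2_eq_square)
qed

locale dominating_weights =
  fixes c :: "nat \<Rightarrow> real"
  assumes c_summable: "summable c" and c_nonneg: "\<And>i. 0 \<le> c i" and c_le_one: "\<And>i. c i \<le> 1"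
begin

definition dominated :: "(nat \<Rightarrow> real) \<Rightarrow> bool" where
  "dominated v \<longleftrightarrow> (\<exists>B. \<forall>i. \<bar>v i\<bar> \<le> B * c i)"

definition pairing :: "(nat \<Rightarrow> real) \<Rightarrow> (nat \<Rightarrow> real) \<Rightarrow> real" where
  "pairing u v = (\<Sum>i. u i * v i)"

lemma dominated_add:
  assumes "dominated u" "dominated v"
  shows "dominated (\<lambda>i. u i + v i)"
proof -
  obtain B B' where B: "\<And>i. \<bar>u i\<bar> \<le> B * c i" "\<And>i. \<bar>v i\<bar> \<le> B' * c i" using assms by (auto simp: dominated_def)
  have "\<bar>u i + v i\<bar> \<le> (B + B') * c i" for i using B(1)[of i] B(2)[of i] by (simp add: distrib_right)
  then show ?thesis by (auto simp: dominated_def)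
qed

lemma dominated_scale:
  assumes "dominated v"
  shows "dominated (\<lambda>i. r * v i)"
proof -
  obtain B where B: "\<And>i. \<bar>v i\<bar> \<le> B * c i" using assms by (auto simp: dominated_def)
  have "\<bar>r * v i\<bar> \<le> (\<bar>r\<bar> * B) * c i" for i
    using mult_left_mono[OF B[of i], of "\<bar>r\<bar>"] by (simp add: abs_mult mult.assoc)
  then show ?thesis by (auto simp: dominated_def)
qed

lemma summable_bounded_dominated:
  assumes u: "\<And>i. \<bar>u i\<bar> \<le> M" and v: "dominated v"
  shows "summable (\<lambda>i. u i * v i)"
proof -
  obtain B where B: "\<And>i. \<bar>v i\<bar> \<le> B * c i" using v by (auto simp: dominated_def)
  have "summable (\<lambda>i. M * (B * c i))" by (intro summable_mult c_summable)
  then show ?thesis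
  proof (rule summable_comparison_test')
    fix i
    show "norm (u i * v i) \<le> M * (B * c i)"
      using mult_mono[OF u[of i] B[of i] order.trans[OF abs_ge_zero u[of i]]] by (simp add: abs_mult)
  qed
qed

lemma dominated_bounded:
  assumes "dominated v"
  shows "\<exists>M. \<forall>i. \<bar>v i\<bar> \<le> M"
proof -
  obtain B where B: "\<And>i. \<bar>v i\<bar> \<le> B * c i" using assms by (auto simp: dominated_def)
  have "B * c i \<le> \<bar>B\<bar>" for i
    using mult_mono[OF abs_ge_self[of B] c_le_one[of i]] c_nonneg[of i] by simp
  then have "\<bar>v i\<bar> \<le> \<bar>B\<bar>" for i by (rule order.trans[OF B])
  then show ?thesis by blast
qed

lemma summable_pairing: "dominated u \<Longrightarrow> dominated v \<Longrightarrow> summable (\<lambda>i. u i * v i)"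
  using dominated_bounded summable_bounded_dominated by metis

lemma pairing_add_right:
  "dominated u \<Longrightarrow> dominated v \<Longrightarrow> dominated w \<Longrightarrow> pairing u (\<lambda>i. v i + w i) = pairing u v + pairing u w"
  unfolding pairing_def
  using suminf_add[OF summable_pairing summable_pairing, of u v u w] by (simp add: distrib_left)

lemma pairing_scale_right: "dominated u \<Longrightarrow> dominated v \<Longrightarrow> pairing u (\<lambda>i. r * v i) = r * pairing u v"
  unfolding pairing_def using suminf_mult[OF summable_pairing, of u v r] by (simp add: mult_ac)

lemma pairing_commute: "pairing u v = pairing v u"
  by (simp add: pairing_def mult.commute)

lemma pairing_self_nonneg: "dominated v \<Longrightarrow> pairing v v \<ge> 0"
  unfolding pairing_def by (rule suminf_nonneg[OF summable_pairing]) auto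

lemma sq_le_pairing_self: "dominated v \<Longrightarrow> (v i)\<^sup>2 \<le> pairing v v"
  using sum_le_suminf[OF summable_pairing, of v v "{i}"] by (simp add: pairing_def power2_eq_square)

lemma pairing_add_scaled_self:
  assumes w: "dominated w" and u: "dominated u"
  shows "pairing (\<lambda>i. w i + r * u i) (\<lambda>i. w i + r * u i)
      = pairing w w + 2 * r * pairing w u + r\<^sup>2 * pairing u u"
proof -
  have ru: "dominated (\<lambda>i. r * u i)" by (rule dominated_scale[OF u])
  have sum: "dominated (\<lambda>i. w i + r * u i)" by (rule dominated_add[OF w ru])
  have "pairing (\<lambda>i. w i + r * u i) v = pairing w v + r * pairing u v" if "dominated v" for v
    using pairing_add_right[OF that w ru] pairing_scale_right[OF that u] pairing_commute by metis
  then have "pairing (\<lambda>i. w i + r * u i) (\<lambda>i. w i + r * u i)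
      = pairing w (\<lambda>i. w i + r * u i) + r * pairing u (\<lambda>i. w i + r * u i)" using sum by blast
  also have "\<dots> = (pairing w w + r * pairing w u) + r * (pairing u w + r * pairing u u)"
    using pairing_add_right[OF _ w ru] pairing_scale_right[OF _ u] w u by simp
  finally show ?thesis by (simp add: pairing_commute[of u w] power2_eq_square algebra_simps)
qed

lemma pairing_tendsto:
  assumes w: "\<And>i. (\<lambda>n. w n i) \<longlonglongrightarrow> T i" and bounded: "\<And>n i. \<bar>w n i\<bar> \<le> M" and u: "dominated u"
  shows "(\<lambda>n. pairing (w n) u) \<longlonglongrightarrow> pairing T u"
proof -
  obtain B where B: "\<And>i. \<bar>u i\<bar> \<le> B * c i" using u by (auto simp: dominated_def)
  have M: "M \<ge> 0" using bounded[of 0 0] by linarith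
  have "eventually (\<lambda>n. summable (\<lambda>i. norm (w n i * u i))) sequentially \<and> summable (\<lambda>i. norm (T i * u i)) \<and>
      ((\<lambda>n. \<Sum>i. w n i * u i) \<longlonglongrightarrow> (\<Sum>i. T i * u i))"
  proof (rule tannerys_theorem[where M = "\<lambda>i. M * (B * c i)"])
    show "(\<lambda>n. w n i * u i) \<longlonglongrightarrow> T i * u i" for i by (intro tendsto_intros w)
    show "summable (\<lambda>i. M * (B * c i))" by (intro summable_mult c_summable)
    show "\<forall>\<^sub>F (i, n) in sequentially \<times>\<^sub>F sequentially. norm (w n i * u i) \<le> M * (B * c i)"
    proof (rule always_eventually, clarify)
      fix i n show "norm (w n i * u i) \<le> M * (B * c i)"
        using mult_mono[OF bounded[of n i] B[of i] M] by (simp add: abs_mult)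
    qed
  qed simp
  then show ?thesis by (simp add: pairing_def)
qed

end

text \<open>Hilbert-space projection of \<open>v0\<close> away from \<open>V\<close>, carried out on dominated sequences: a minimising
  sequence converges coordinatewise, and domination turns this into convergence of the pairings.\<close>

locale subspace_at_distance = dominating_weights +
  fixes V :: "(nat \<Rightarrow> real) set" and v0 :: "nat \<Rightarrow> real" and \<delta> :: real
  assumes V_dominated: "\<And>v. v \<in> V \<Longrightarrow> dominated v" and v0_dominated: "dominated v0"
    and zero_in_V: "(\<lambda>i. 0) \<in> V" and add_in_V: "\<And>u v. u \<in> V \<Longrightarrow> v \<in> V \<Longrightarrow> (\<lambda>i. u i + v i) \<in> V"
    and scale_in_V: "\<And>r v. v \<in> V \<Longrightarrow> (\<lambda>i. r * v i) \<in> V"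
    and \<delta>_pos: "\<delta> > 0" and distance: "\<And>v. v \<in> V \<Longrightarrow> \<delta> \<le> (\<Sum>i. (v0 i + v i)\<^sup>2)"
begin

definition translates :: "(nat \<Rightarrow> real) set" where
  "translates = (\<lambda>v i. v0 i + v i) ` V"

definition min_energy :: real where
  "min_energy = (INF w\<in>translates. pairing w w)"

lemma translates_dominated: "w \<in> translates \<Longrightarrow> dominated w"
  by (auto simp: translates_def intro: dominated_add v0_dominated V_dominated)

lemma translates_add: "w \<in> translates \<Longrightarrow> u \<in> V \<Longrightarrow> (\<lambda>i. w i + r * u i) \<in> translates"
  unfolding translates_def using add_in_V[OF _ scale_in_V[of u r]] by (force simp: add.assoc)

lemma translates_diff:
  assumes "w \<in> translates" "w' \<in> translates"
  shows "(\<lambda>i. w i - w' i) \<in> V"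
proof -
  obtain v v' where v: "v \<in> V" "v' \<in> V" "w = (\<lambda>i. v0 i + v i)" "w' = (\<lambda>i. v0 i + v' i)"
    using assms by (auto simp: translates_def)
  have "(\<lambda>i. v i + (-1) * v' i) \<in> V" by (intro add_in_V scale_in_V v)
  then show ?thesis by (simp add: v)
qed

lemma translates_distance: "w \<in> translates \<Longrightarrow> \<delta> \<le> pairing w w"
  using distance by (auto simp: translates_def pairing_def power2_eq_square)

lemma min_energy_le: "w \<in> translates \<Longrightarrow> min_energy \<le> pairing w w"
  unfolding min_energy_def by (intro cINF_lower bdd_belowI2[of _ \<delta>] translates_distance)

lemma near_minimal_exists:
  assumes "e > 0"
  shows "\<exists>w\<in>translates. pairing w w \<le> min_energy + e"
proof -
  have "translates \<noteq> {}" using zero_in_V by (auto simp: translates_def)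
  moreover have "bdd_below ((\<lambda>w. pairing w w) ` translates)"
    by (intro bdd_belowI2[of _ \<delta>] translates_distance)
  moreover have "(INF w\<in>translates. pairing w w) < min_energy + e" using assms by (simp add: min_energy_def)
  ultimately show ?thesis by (subst (asm) cINF_less_iff) (auto intro: less_imp_le)
qed

lemma near_minimal_orthogonal:
  assumes w: "w \<in> translates" "pairing w w \<le> min_energy + e" and u: "u \<in> V"
  shows "\<bar>pairing w u\<bar> \<le> sqrt e * sqrt (pairing u u)"
proof -
  have "0 \<le> e + 2 * r * pairing w u + r\<^sup>2 * pairing u u" for r
    using min_energy_le[OF translates_add[OF w(1) u, of r]] w(2)
      pairing_add_scaled_self[OF translates_dominated[OF w(1)] V_dominated[OF u], of r] by linarith
  then have "(pairing w u)\<^sup>2 \<le> e * pairing u u"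
    by (rule quadratic_nonneg_imp) (rule pairing_self_nonneg[OF V_dominated[OF u]])
  then have "sqrt ((pairing w u)\<^sup>2) \<le> sqrt (e * pairing u u)" by (rule real_sqrt_le_mono)
  then show ?thesis by (simp add: real_sqrt_mult)
qed

lemma near_minimal_close:
  assumes w: "w \<in> translates" "pairing w w \<le> min_energy + e"
    and w': "w' \<in> translates" "pairing w' w' \<le> min_energy + e'"
    and e: "e \<ge> 0" "e' \<ge> 0"
  shows "sqrt (pairing (\<lambda>i. w i - w' i) (\<lambda>i. w i - w' i)) \<le> sqrt e + sqrt e'"
proof -
  define u where "u = (\<lambda>i. w i - w' i)"
  have u: "u \<in> V" unfolding u_def by (rule translates_diff[OF w(1) w'(1)])
  note dominated = V_dominated[OF u] translates_dominated[OF w(1)] translates_dominated[OF w'(1)]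
  have "pairing u u = pairing u (\<lambda>i. w i + (-1) * w' i)" by (simp add: u_def)
  also have "\<dots> = pairing w u - pairing w' u"
    using pairing_add_right[OF dominated(1,2) dominated_scale[OF dominated(3), of "-1"]]
      pairing_scale_right[OF dominated(1,3), of "-1"] by (simp add: pairing_commute)
  also have "\<dots> \<le> sqrt e * sqrt (pairing u u) + sqrt e' * sqrt (pairing u u)"
    using near_minimal_orthogonal[OF w u] near_minimal_orthogonal[OF w' u] by linarith
  finally have "sqrt (pairing u u) * sqrt (pairing u u) \<le> (sqrt e + sqrt e') * sqrt (pairing u u)"
    using pairing_self_nonneg[OF dominated(1)] by (simp add: distrib_right)
  then have "sqrt (pairing u u) \<le> sqrt e + sqrt e'"
    using pairing_self_nonneg[OF dominated(1)] e
      mult_right_le_imp_le[of "sqrt (pairing u u)" "sqrt (pairing u u)"]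
    by (cases "pairing u u = 0") auto
  then show ?thesis by (simp add: u_def)
qed

lemma near_minimal_pairing_ge:
  assumes w: "w \<in> translates" "pairing w w \<le> min_energy + e"
    and w': "w' \<in> translates" "pairing w' w' \<le> min_energy + e'"
    and e: "e \<ge> 0" "e \<le> 1" "e' \<ge> 0" "e' \<le> 1"
  shows "\<delta> - sqrt e * 2 \<le> pairing w w'"
proof -
  define u where "u = (\<lambda>i. w' i - w i)"
  have u: "u \<in> V" unfolding u_def by (rule translates_diff[OF w'(1) w(1)])
  have "sqrt (pairing u u) \<le> sqrt e' + sqrt e" unfolding u_def by (intro near_minimal_close w w' e)
  also have "\<dots> \<le> 1 + 1" using e by (intro add_mono) auto
  finally have "sqrt e * sqrt (pairing u u) \<le> sqrt e * 2" using e by (intro mult_left_mono) auto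
  then have "\<bar>pairing w u\<bar> \<le> sqrt e * 2" using near_minimal_orthogonal[OF w u] by linarith
  moreover have "pairing w w' = pairing w (\<lambda>i. w i + u i)" by (simp add: u_def)
  moreover have "\<dots> = pairing w w + pairing w u"
    by (intro pairing_add_right translates_dominated w V_dominated u)
  ultimately show ?thesis using translates_distance[OF w(1)] by linarith
qed

lemma minimising_sequence:
  "\<exists>w T. (\<forall>n. w n \<in> translates) \<and> (\<forall>n. pairing (w n) (w n) \<le> min_energy + 1 / (real n + 1))
      \<and> (\<forall>i. (\<lambda>n. w n i) \<longlonglongrightarrow> T i)"
proof -
  define e where "e n = 1 / (real n + 1)" for n
  have e: "e n > 0" for n by (simp add: e_def add_nonneg_pos)
  obtain w where w: "\<And>n. w n \<in> translates" "\<And>n. pairing (w n) (w n) \<le> min_energy + e n"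
    using near_minimal_exists[OF e] by metis
  have close: "\<bar>w m i - w n i\<bar> \<le> sqrt (e m) + sqrt (e n)" for m n i
  proof -
    have "sqrt ((w m i - w n i)\<^sup>2) \<le> sqrt (pairing (\<lambda>i. w m i - w n i) (\<lambda>i. w m i - w n i))"
      using sq_le_pairing_self[OF V_dominated[OF translates_diff[OF w(1) w(1)]]] by (rule real_sqrt_le_mono)
    also have "\<dots> \<le> sqrt (e m) + sqrt (e n)" by (intro near_minimal_close w less_imp_le e)
    finally show ?thesis by simp
  qed
  have sqrt_e: "(\<lambda>n. sqrt (e n)) \<longlonglongrightarrow> 0" unfolding e_def by real_asymp
  have "Cauchy (\<lambda>n. w n i)" for i
  proof (rule metric_CauchyI)
    fix \<epsilon> :: real assume "\<epsilon> > 0"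
    then have "eventually (\<lambda>n. sqrt (e n) < \<epsilon> / 2) sequentially" by (intro order_tendstoD(2)[OF sqrt_e]) auto
    then obtain N where N: "\<And>n. n \<ge> N \<Longrightarrow> sqrt (e n) < \<epsilon> / 2" by (auto simp: eventually_sequentially)
    have "dist (w m i) (w n i) < \<epsilon>" if "m \<ge> N" "n \<ge> N" for m n
      using close[of m i n] N[OF that(1)] N[OF that(2)] by (simp add: dist_real_def)
    then show "\<exists>M. \<forall>m\<ge>M. \<forall>n\<ge>M. dist (w m i) (w n i) < \<epsilon>" by blast
  qed
  then have "\<exists>t. (\<lambda>n. w n i) \<longlonglongrightarrow> t" for i using convergent_eq_Cauchy by blast
  then obtain T where "\<And>i. (\<lambda>n. w n i) \<longlonglongrightarrow> T i" by metis
  then show ?thesis using w unfolding e_def by blast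
qed

theorem annihilator_exists:
  "\<exists>T M. (\<forall>i. \<bar>T i\<bar> \<le> M) \<and> (\<forall>v\<in>V. pairing T v = 0) \<and> pairing T v0 \<noteq> 0"
proof -
  obtain w T where w: "\<And>n. w n \<in> translates" "\<And>n. pairing (w n) (w n) \<le> min_energy + 1 / (real n + 1)"
    and T: "\<And>i. (\<lambda>n. w n i) \<longlonglongrightarrow> T i" using minimising_sequence by blast
  define e where "e n = 1 / (real n + 1)" for n
  have e: "e n \<ge> 0" "e n \<le> 1" "pairing (w n) (w n) \<le> min_energy + e n" for n
    using w(2)[of n] by (auto simp: e_def)
  have sqrt_e: "(\<lambda>n. sqrt (e n)) \<longlonglongrightarrow> 0" unfolding e_def by real_asymp
  have bounded: "\<bar>w n i\<bar> \<le> sqrt (min_energy + 1)" for n i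
  proof -
    have "(w n i)\<^sup>2 \<le> min_energy + 1"
      using sq_le_pairing_self[OF translates_dominated[OF w(1)[of n]], of i] e(2,3)[of n] by linarith
    then have "sqrt ((w n i)\<^sup>2) \<le> sqrt (min_energy + 1)" by (rule real_sqrt_le_mono)
    then show ?thesis by simp
  qed
  note lim = pairing_tendsto[OF T bounded]
  have orthogonal: "pairing T u = 0" if u: "u \<in> V" for u
  proof (rule LIMSEQ_unique[OF lim[OF V_dominated[OF u]]])
    have "\<forall>n. norm (pairing (w n) u) \<le> sqrt (e n) * sqrt (pairing u u)"
      unfolding real_norm_def by (intro allI near_minimal_orthogonal w(1) e(3) u)
    from Lim_null_comparison[OF always_eventually[OF this] tendsto_mult_left_zero[OF sqrt_e]]
    show "(\<lambda>n. pairing (w n) u) \<longlonglongrightarrow> 0" .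
  qed
  have T_bounded: "\<bar>T i\<bar> \<le> sqrt (min_energy + 1)" for i
    by (rule Lim_bounded[OF tendsto_rabs[OF T[of i]]]) (use bounded in auto)
  obtain v where v: "v \<in> V" "w 0 = (\<lambda>i. v0 i + v i)" using w(1)[of 0] by (auto simp: translates_def)
  have "(\<lambda>n. \<delta> - sqrt (e n) * 2) \<longlonglongrightarrow> \<delta> - 0 * 2" by (intro tendsto_intros sqrt_e)
  then have "\<delta> - 0 * 2 \<le> pairing T (w 0)"
    by (rule LIMSEQ_le[OF _ lim[OF translates_dominated[OF w(1)]]])
      (use near_minimal_pairing_ge[OF w(1) e(3) w(1) e(3) e(1) e(2)] e(1,2) in auto)
  also have "pairing T (w 0) = pairing T v0 + pairing T v"
    unfolding v(2) pairing_def distrib_left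
    by (intro suminf_add[symmetric] summable_bounded_dominated[OF T_bounded] v0_dominated V_dominated v)
  finally have "pairing T v0 \<noteq> 0" using orthogonal[OF v(1)] \<delta>_pos by simp
  then show ?thesis using T_bounded orthogonal by blast
qed

end

section \<open>Interpolation along a uniform sequence\<close>

definition node_bounded :: "(int \<Rightarrow> real) \<Rightarrow> (int \<Rightarrow> real) \<Rightarrow> real \<Rightarrow> (complex \<Rightarrow> complex) \<Rightarrow> bool" where
  "node_bounded a W b h \<longleftrightarrow> decaying_exp_type b h \<and>
     (\<exists>x. perturbation a x \<and> (\<forall>k. norm (h (of_real (x k))) \<le> exp (W k)))"

lemma node_bounded_scaled_down: "node_bounded a W b h \<Longrightarrow> c \<ge> 0 \<Longrightarrow> node_bounded a W b (scaled_down c h)"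
  using norm_scaled_down_le decaying_exp_type_scaled_down order.trans unfolding node_bounded_def by blast

theorem node_bounded_uniformly_at_i:
  assumes a: "strict_mono a" and uniform: "d_uniform d (range a)"
    and W: "\<And>k. W k \<ge> 0" "(\<lambda>k. W k / (1 + (real_of_int k)\<^sup>2)) summable_on UNIV"
    and b: "0 \<le> b" "b < pi * d"
  shows "\<exists>C. \<forall>h. node_bounded a W b h \<longrightarrow> norm (h \<i>) \<le> C"
proof -
  have "b / pi < d" using b by (simp add: divide_less_eq mult.commute)
  then obtain d2 where d2: "b / pi < d2" "d2 < d" using dense by blast
  have type: "b < pi * d2" using d2(1) by (simp add: divide_less_eq mult.commute)
  have d2_pos: "0 < d2" using b(1) d2(1) by (meson divide_nonneg_pos le_less_trans pi_gt_zero)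
  define \<Theta> where "\<Theta> = (pi * d2 - b) / 16 / growth_factor"
  have \<Theta>: "\<Theta> > 0" "\<Theta> * growth_factor = (pi * d2 - b) / 16"
    using type by (auto simp: \<Theta>_def growth_factor_def tail_threshold_def jump_ratio_def)
  obtain c \<delta> D where "uniform_partition a c \<delta> D d" using uniform_partition_exists[OF a uniform] .
  then interpret uniform_partition a c \<delta> D d .
  obtain \<kappa> where \<kappa>: "\<kappa> > 0" "3 * \<kappa> \<le> 1" "12 * D * \<kappa> * (1 + ln (1 / \<kappa>)) \<le> \<Theta> / 8 / 2"
    using small_entropy_factor[of "12 * D" "\<Theta> / 8 / 2"] D_ge_one \<Theta>(1) by auto
  obtain m s\<^sub>0 where m: "m \<ge> 1" and disc: "\<And>s h t Z. s\<^sub>0 \<le> s \<Longrightarrow> h holomorphic_on UNIV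
      \<Longrightarrow> (\<And>z. norm (z - of_real t) \<le> s \<Longrightarrow> norm (h z) \<le> exp (b * \<bar>Im z\<bar> + (pi * d2 - b) / 16 * s))
      \<Longrightarrow> fills_cells d2 m t s Z \<Longrightarrow> low_energy \<kappa> (\<Theta> / 8) s Z
      \<Longrightarrow> (\<And>y. y \<in> Z \<Longrightarrow> norm (h (of_real y)) \<le> exp (\<Theta> / 8 * s)) \<Longrightarrow> norm (h (of_real t)) < exp (\<Theta> * s)"
    using interpolation_disc[OF b(1) type \<Theta>(1) \<kappa>(1)] \<kappa> unfolding eventually_at_top_linorder by force
  obtain q where q: "q \<in> borel_measurable borel" "\<And>x. 0 \<le> q x" "weighted_mass 1 q < top"
    and nodes: "\<And>t s x. s > 0 \<Longrightarrow> window_mass q t (3 * s) < ennreal (s\<^sup>2) \<Longrightarrow> perturbation a x \<Longrightarrow>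
      s\<^sub>0 \<le> s \<and> (\<exists>S. (\<forall>k\<in>S. W k \<le> \<Theta> / 8 * s) \<and> fills_cells d2 m t s (x ` S) \<and> low_energy \<kappa> (\<Theta> / 8) s (x ` S))"
    using node_density[OF d2_pos d2(2) W _ \<kappa> m, of s\<^sub>0] \<Theta>(1) by auto
  interpret contact_controlled_class "node_bounded a W b" b \<Theta> q
  proof
    fix h t s
    assume h: "node_bounded a W b h" and s: "s > 0" and light: "window_mass q t (3 * s) < ennreal (s\<^sup>2)"
      and growth: "\<And>z. norm (z - of_real t) \<le> s \<Longrightarrow> norm (h z) \<le> exp (b * \<bar>Im z\<bar> + \<Theta> * growth_factor * s)"
    obtain x where x: "perturbation a x" "\<And>k. norm (h (of_real (x k))) \<le> exp (W k)"
      using h by (auto simp: node_bounded_def)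
    obtain S where S: "s\<^sub>0 \<le> s" "\<And>k. k \<in> S \<Longrightarrow> W k \<le> \<Theta> / 8 * s" "fills_cells d2 m t s (x ` S)"
      "low_energy \<kappa> (\<Theta> / 8) s (x ` S)"
      using nodes[OF s light x(1)] by blast
    have "norm (h (of_real y)) \<le> exp (\<Theta> / 8 * s)" if "y \<in> x ` S" for y
      using that S(2) order.trans[OF x(2)] by (auto simp del: times_divide_eq_left)
    then show "norm (h (of_real t)) < exp (\<Theta> * s)"
      using h growth \<Theta>(2) by (intro disc[OF S(1) _ _ S(3,4)]) (auto simp: node_bounded_def decaying_exp_type_def)
  next
    show "decaying_exp_type b h" if "node_bounded a W b h" for h using that by (simp add: node_bounded_def)
  qed (use \<Theta>(1) q node_bounded_scaled_down in auto)
  show ?thesis by (rule uniform_bound_at_i)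
qed

section \<open>Entire functions of exponential type\<close>

lemma
  fixes z :: complex
  shows norm_sin_le_exp_Im: "norm (sin z) \<le> exp \<bar>Im z\<bar>"
    and norm_cos_le_exp_Im: "norm (cos z) \<le> exp \<bar>Im z\<bar>"
proof -
  have exps: "(norm (exp (\<i> * z)) + norm (exp (- (\<i> * z)))) / 2 \<le> exp \<bar>Im z\<bar>"
    by (simp add: norm_exp_eq_Re abs_if)
  have "norm (sin z) = norm (exp (\<i> * z) - exp (- (\<i> * z))) / 2"
    by (simp add: sin_exp_eq norm_divide norm_mult)
  also have "\<dots> \<le> (norm (exp (\<i> * z)) + norm (exp (- (\<i> * z)))) / 2"
    by (intro divide_right_mono norm_triangle_ineq4) simp
  finally show "norm (sin z) \<le> exp \<bar>Im z\<bar>" using exps by linarith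
  have "norm (cos z) = norm (exp (\<i> * z) + exp (- (\<i> * z))) / 2" by (simp add: cos_exp_eq norm_divide)
  also have "\<dots> \<le> (norm (exp (\<i> * z)) + norm (exp (- (\<i> * z)))) / 2"
    by (intro divide_right_mono norm_triangle_ineq) simp
  finally show "norm (cos z) \<le> exp \<bar>Im z\<bar>" using exps by linarith
qed

lemma norm_mult_one_plus_norm_le:
  fixes w z :: complex
  assumes near: "norm z \<le> 1 \<Longrightarrow> norm w \<le> B" and far: "norm (z * w) \<le> E" and B: "B \<ge> 0" and E: "E \<ge> 1"
  shows "norm w * (1 + norm z) \<le> 2 * max B 1 * E"
proof (cases "norm z \<le> 1")
  case True
  then have "norm w * (1 + norm z) \<le> B * 2" using near B by (intro mult_mono) auto
  also have "\<dots> \<le> (2 * max B 1) * 1" by simp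
  also have "\<dots> \<le> (2 * max B 1) * E" using E by (intro mult_left_mono) auto
  finally show ?thesis .
next
  case False
  then have "norm w * (1 + norm z) \<le> norm w * (2 * norm z)" by (intro mult_left_mono) auto
  also have "\<dots> \<le> 2 * E" using far by (simp add: norm_mult mult_ac)
  also have "\<dots> \<le> 2 * max B 1 * E" using E by (intro mult_right_mono) auto
  finally show ?thesis .
qed

lemma decaying_exp_type_exists:
  fixes \<eta> :: real
  assumes \<eta>: "\<eta> > 0"
  shows "\<exists>S. decaying_exp_type \<eta> S \<and> S \<i> \<noteq> 0"
proof -
  define f where "f z = sin (of_real \<eta> * z)" for z :: complex
  define S where "S z = (if z = 0 then deriv f 0 else (f z - f 0) / (z - 0))" for z
  have "f holomorphic_on UNIV" unfolding f_def by (intro holomorphic_intros)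
  then have S: "S holomorphic_on UNIV" unfolding S_def using pole_lemma_open[of f UNIV 0] by simp
  have "compact (S ` cball 0 1)"
    by (intro compact_continuous_image holomorphic_on_imp_continuous_on holomorphic_on_subset[OF S]) auto
  then obtain B where B: "B > 0" "\<And>z. norm z \<le> 1 \<Longrightarrow> norm (S z) \<le> B"
    using compact_imp_bounded by (force simp: bounded_pos)
  have "norm (S z) \<le> 2 * max B 1 * exp (\<eta> * \<bar>Im z\<bar>) / (1 + norm z)" for z
  proof -
    have "z * S z = f z" by (simp add: S_def f_def)
    then have "norm (z * S z) \<le> exp (\<eta> * \<bar>Im z\<bar>)"
      using norm_sin_le_exp_Im[of "of_real \<eta> * z"] \<eta> by (simp add: f_def abs_mult)
    then have "norm (S z) * (1 + norm z) \<le> 2 * max B 1 * exp (\<eta> * \<bar>Im z\<bar>)"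
      using B \<eta> by (intro norm_mult_one_plus_norm_le) auto
    then show ?thesis by (simp add: pos_le_divide_eq add_pos_nonneg)
  qed
  moreover have "S \<i> \<noteq> 0"
  proof
    assume "S \<i> = 0"
    then obtain n :: int where "of_real \<eta> * \<i> = complex_of_real (of_int n * pi)"
      by (auto simp: S_def f_def sin_eq_0)
    then have "Im (of_real \<eta> * \<i>) = Im (complex_of_real (of_int n * pi))" by (rule arg_cong)
    then show False using \<eta> by simp
  qed
  ultimately show ?thesis using S unfolding decaying_exp_type_def by blast
qed

lemma fast_decaying_exp_type_exists:
  fixes \<eta> :: real
  assumes \<eta>: "\<eta> > 0" and n: "n \<ge> 1"
  shows "\<exists>G. G holomorphic_on UNIV \<and> (\<forall>z. norm (G z) \<le> exp (\<eta> * \<bar>Im z\<bar>) / (1 + norm z) ^ n) \<and> G \<i> \<noteq> 0"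
proof -
  have "\<eta> / real n > 0" using \<eta> n by simp
  from decaying_exp_type_exists[OF this] obtain S C where S: "S holomorphic_on UNIV" "S \<i> \<noteq> 0"
    and C: "\<And>z. norm (S z) \<le> C * exp (\<eta> / real n * \<bar>Im z\<bar>) / (1 + norm z)"
      by (auto simp: decaying_exp_type_def)
  have "0 < norm (S \<i>)" using S(2) by simp
  also have "\<dots> \<le> C * (exp (\<eta> / real n * 1) / (1 + 1))" using C[of \<i>] by simp
  finally have C_pos: "C > 0" by (simp add: zero_less_mult_iff)
  define G where "G z = (S z / of_real C) ^ n" for z
  have "norm (G z) \<le> exp (\<eta> * \<bar>Im z\<bar>) / (1 + norm z) ^ n" for z
  proof -
    have "norm (S z / of_real C) = norm (S z) / C" using C_pos by (simp add: norm_divide)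
    also have "\<dots> \<le> (C * exp (\<eta> / real n * \<bar>Im z\<bar>) / (1 + norm z)) / C"
      using C_pos by (intro divide_right_mono C) simp
    also have "\<dots> = exp (\<eta> / real n * \<bar>Im z\<bar>) / (1 + norm z)" using C_pos by simp
    finally have "norm (G z) \<le> (exp (\<eta> / real n * \<bar>Im z\<bar>) / (1 + norm z)) ^ n"
      unfolding G_def norm_power by (intro power_mono) auto
    also have "\<dots> = exp (\<eta> * \<bar>Im z\<bar>) / (1 + norm z) ^ n"
      using n by (simp add: power_divide exp_of_nat_mult[symmetric])
    finally show ?thesis .
  qed
  moreover have "G holomorphic_on UNIV" unfolding G_def using C_pos by (intro holomorphic_intros S) auto
  moreover have "G \<i> \<noteq> 0" using S(2) C_pos by (simp add: G_def)
  ultimately show ?thesis by blast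
qed

definition real_exp_type :: "real \<Rightarrow> (complex \<Rightarrow> complex) \<Rightarrow> bool" where
  "real_exp_type b h \<longleftrightarrow> h holomorphic_on UNIV \<and> (\<forall>x::real. h (of_real x) \<in> \<real>) \<and>
     (\<exists>M. \<forall>z. norm (h z) \<le> M * exp (b * \<bar>Im z\<bar>))"

definition on_reals :: "(complex \<Rightarrow> complex) \<Rightarrow> real \<Rightarrow> real" where
  "on_reals h x = Re (h (of_real x))"

lemma real_exp_type_of_real: "real_exp_type b h \<Longrightarrow> h (of_real x) = of_real (on_reals h x)"
  by (simp add: real_exp_type_def on_reals_def)

lemma real_exp_type_zero: "real_exp_type b (\<lambda>z. 0)"
  by (auto simp: real_exp_type_def intro!: exI[of _ 0])

lemma real_exp_type_add:
  assumes g: "real_exp_type b g" and h: "real_exp_type b h"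
  shows "real_exp_type b (\<lambda>z. g z + h z)"
proof -
  obtain M M' where M: "\<And>z. norm (g z) \<le> M * exp (b * \<bar>Im z\<bar>)" "\<And>z. norm (h z) \<le> M' * exp (b * \<bar>Im z\<bar>)"
    using g h by (auto simp: real_exp_type_def)
  have "norm (g z + h z) \<le> (M + M') * exp (b * \<bar>Im z\<bar>)" for z
    using norm_triangle_ineq[of "g z" "h z"] M(1)[of z] M(2)[of z] by (simp add: distrib_right)
  then show ?thesis using g h unfolding real_exp_type_def by (auto intro!: holomorphic_intros)
qed

lemma real_exp_type_scale:
  assumes h: "real_exp_type b h"
  shows "real_exp_type b (\<lambda>z. of_real r * h z)"
proof -
  obtain M where M: "\<And>z. norm (h z) \<le> M * exp (b * \<bar>Im z\<bar>)" using h by (auto simp: real_exp_type_def)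
  have "norm (of_real r * h z) \<le> (\<bar>r\<bar> * M) * exp (b * \<bar>Im z\<bar>)" for z
    using mult_left_mono[OF M[of z], of "\<bar>r\<bar>"] by (simp add: norm_mult mult.assoc)
  then show ?thesis using h unfolding real_exp_type_def by (auto intro!: holomorphic_intros)
qed

lemma
  assumes "\<bar>l\<bar> \<le> b"
  shows real_exp_type_cos: "real_exp_type b (\<lambda>z. cos (of_real l * z))"
    and real_exp_type_sin: "real_exp_type b (\<lambda>z. sin (of_real l * z))"
proof -
  have exp_le: "exp \<bar>Im (of_real l * z)\<bar> \<le> 1 * exp (b * \<bar>Im z\<bar>)" for z
    using mult_right_mono[OF assms, of "\<bar>Im z\<bar>"] by (simp add: abs_mult)
  show "real_exp_type b (\<lambda>z. cos (of_real l * z))"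
    unfolding real_exp_type_def
    by (intro conjI holomorphic_intros allI exI[of _ 1] order.trans[OF norm_cos_le_exp_Im exp_le])
      (simp flip: of_real_mult cos_of_real)
  show "real_exp_type b (\<lambda>z. sin (of_real l * z))"
    unfolding real_exp_type_def
    by (intro conjI holomorphic_intros allI exI[of _ 1] order.trans[OF norm_sin_le_exp_Im exp_le])
      (simp flip: of_real_mult sin_of_real)
qed

lemma on_reals_continuous:
  assumes "real_exp_type b h"
  shows "continuous_on UNIV (on_reals h)"
proof -
  have "continuous_on UNIV (\<lambda>x. h (complex_of_real x))"
    by (rule continuous_on_compose2[OF holomorphic_on_imp_continuous_on])
      (use assms in \<open>auto simp: real_exp_type_def intro!: continuous_intros\<close>)
  then show ?thesis unfolding on_reals_def[abs_def] by (intro continuous_intros)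
qed

lemma on_reals_bounded:
  assumes "real_exp_type b h"
  shows "\<exists>M. \<forall>x. \<bar>on_reals h x\<bar> \<le> M"
proof -
  obtain M where M: "\<And>z. norm (h z) \<le> M * exp (b * \<bar>Im z\<bar>)" using assms by (auto simp: real_exp_type_def)
  have "\<bar>on_reals h x\<bar> \<le> M" for x
    using abs_Re_le_cmod[of "h (of_real x)"] M[of "of_real x"] by (simp add: on_reals_def)
  then show ?thesis by blast
qed

definition damped_multiple :: "(complex \<Rightarrow> complex) \<Rightarrow> (complex \<Rightarrow> complex) \<Rightarrow> complex \<Rightarrow> complex" where
  "damped_multiple G h z = G z * (1 + (1 + z\<^sup>2) * h z)"

lemma decaying_exp_type_damped_multiple:
  assumes G: "G holomorphic_on UNIV" "\<And>z. norm (G z) \<le> exp (\<eta> * \<bar>Im z\<bar>) / (1 + norm z) ^ 3"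
    and h: "real_exp_type b h" and b: "b \<ge> 0"
  shows "decaying_exp_type (b + \<eta>) (damped_multiple G h)"
proof -
  obtain M where holo: "h holomorphic_on UNIV" and M: "\<And>z. norm (h z) \<le> M * exp (b * \<bar>Im z\<bar>)"
    using h by (auto simp: real_exp_type_def)
  have M_nonneg: "M \<ge> 0" using order.trans[OF norm_ge_zero M[of 0]] by simp
  have "norm (damped_multiple G h z) \<le> (1 + M) * exp ((b + \<eta>) * \<bar>Im z\<bar>) / (1 + norm z)" for z
  proof -
    define n where "n = 1 + norm z"
    have n: "n \<ge> 1" by (simp add: n_def)
    have sq_le: "1 + (norm z)\<^sup>2 \<le> n\<^sup>2" by (simp add: n_def power2_eq_square algebra_simps)
    have "norm (1 + (1 + z\<^sup>2) * h z) \<le> 1 + (1 + (norm z)\<^sup>2) * (M * exp (b * \<bar>Im z\<bar>))"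
      using norm_triangle_ineq[of 1 "z\<^sup>2"]
      by (intro order.trans[OF norm_triangle_ineq] add_mono) (auto simp: norm_mult norm_power intro!: mult_mono M)
    also have "\<dots> \<le> n\<^sup>2 * exp (b * \<bar>Im z\<bar>) + n\<^sup>2 * (M * exp (b * \<bar>Im z\<bar>))"
    proof (intro add_mono mult_right_mono sq_le)
      have "1 * 1 \<le> n\<^sup>2 * exp (b * \<bar>Im z\<bar>)" using n b by (intro mult_mono one_le_power) auto
      then show "1 \<le> n\<^sup>2 * exp (b * \<bar>Im z\<bar>)" by simp
    qed (use M_nonneg in simp)
    finally have factor_le: "norm (1 + (1 + z\<^sup>2) * h z) \<le> (1 + M) * n\<^sup>2 * exp (b * \<bar>Im z\<bar>)"
      by (simp add: algebra_simps)
    have "norm (damped_multiple G h z) \<le> (exp (\<eta> * \<bar>Im z\<bar>) / n ^ 3) * ((1 + M) * n\<^sup>2 * exp (b * \<bar>Im z\<bar>))"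
      unfolding damped_multiple_def norm_mult
      using G(2)[of z] n by (intro mult_mono factor_le) (auto simp: n_def)
    also have "\<dots> = (1 + M) * (exp (b * \<bar>Im z\<bar>) * exp (\<eta> * \<bar>Im z\<bar>)) * (n\<^sup>2 / n ^ 3)" by simp
    also have "\<dots> = (1 + M) * exp ((b + \<eta>) * \<bar>Im z\<bar>) / n"
      using n by (simp add: power2_eq_square power3_eq_cube distrib_right exp_add)
    finally show ?thesis by (simp add: n_def)
  qed
  moreover have "damped_multiple G h holomorphic_on UNIV"
    unfolding damped_multiple_def[abs_def] by (intro holomorphic_intros G(1) holo)
  ultimately show ?thesis unfolding decaying_exp_type_def by blast
qed

lemma norm_damped_multiple_real_le:
  assumes G: "\<And>z. norm (G z) \<le> exp (\<eta> * \<bar>Im z\<bar>) / (1 + norm z) ^ 3" and h: "real_exp_type b h"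
  shows "norm (damped_multiple G h (of_real x)) \<le> \<bar>1 / (1 + x\<^sup>2) + on_reals h x\<bar>"
proof -
  define g where "g = 1 / (1 + x\<^sup>2) + on_reals h x"
  have pos: "1 + x\<^sup>2 > 0" by (simp add: add_pos_nonneg)
  have "1 + (1 + (complex_of_real x)\<^sup>2) * h (of_real x) = of_real ((1 + x\<^sup>2) * g)"
    unfolding real_exp_type_of_real[OF h] g_def using pos by (simp add: distrib_left)
  then have "norm (damped_multiple G h (of_real x)) = norm (G (of_real x)) * ((1 + x\<^sup>2) * \<bar>g\<bar>)"
    unfolding damped_multiple_def norm_mult[of "G _"]
    using pos by (simp only: norm_of_real abs_mult abs_of_pos)
  also have "\<dots> \<le> (1 / (1 + \<bar>x\<bar>) ^ 3) * ((1 + x\<^sup>2) * \<bar>g\<bar>)"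
    using G[of "of_real x"] pos by (intro mult_right_mono) auto
  also have "\<dots> = (1 + x\<^sup>2) / (1 + \<bar>x\<bar>) ^ 3 * \<bar>g\<bar>" by simp
  also have "\<dots> \<le> 1 * \<bar>g\<bar>"
  proof (rule mult_right_mono)
    have "1 + x\<^sup>2 \<le> (1 + \<bar>x\<bar>)\<^sup>2" by (simp add: power2_sum)
    also have "\<dots> \<le> (1 + \<bar>x\<bar>) ^ 3" by (rule power_increasing) auto
    finally show "(1 + x\<^sup>2) / (1 + \<bar>x\<bar>) ^ 3 \<le> 1" by (simp add: divide_le_eq zero_less_power add_pos_nonneg)
  qed simp
  finally show ?thesis by (simp add: g_def)
qed

section \<open>Sampling a measure on intervals\<close>

lemma (in finite_measure) exists_le_average:
  fixes g :: "'a \<Rightarrow> real"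
  assumes U: "U \<in> sets M" and pos: "measure M U > 0" and g: "integrable M (\<lambda>x. indicator U x * g x)"
  shows "\<exists>x\<in>U. g x * measure M U \<le> (LINT x|M. indicator U x * g x)"
proof (rule ccontr)
  define m where "m = (LINT x|M. indicator U x * g x) / measure M U"
  assume "\<not> ?thesis"
  then have above: "m < g x" if "x \<in> U" for x using that pos by (simp add: m_def pos_divide_less_eq not_le)
  have U_integrable: "integrable M (\<lambda>x. indicator U x * m)"
    using U by (intro integrable_mult_left integrable_real_indicator) (auto simp: less_top[symmetric])
  have "(LINT x|M. indicator U x * g x - indicator U x * m) = 0"
    using pos g U_integrable U by (simp add: m_def sets.Int_space_eq2)
  then have "AE x in M. indicator U x * g x - indicator U x * m = 0"
    by (subst (asm) integral_nonneg_eq_0_iff_AE)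
      (use g U_integrable above in \<open>auto simp: indicator_def less_imp_le intro!: AE_I2\<close>)
  then have "AE x in M. x \<notin> U"
  proof eventually_elim
    case (elim x)
    then show ?case using above[of x] by (cases "x \<in> U") auto
  qed
  then have "emeasure M {x\<in>space M. x \<in> U} = 0" by (rule emeasure_eq_0_AE)
  moreover have "{x\<in>space M. x \<in> U} = U" using sets.sets_into_space[OF U] by auto
  ultimately show False using pos by (simp add: measure_def)
qed

lemma mean_value_on_connected:
  fixes g :: "'a :: topological_space \<Rightarrow> real"
  assumes "finite_measure M" and U: "U \<in> sets M" "connected U" "measure M U > 0" and cont: "continuous_on U g"
    and g: "integrable M (\<lambda>x. indicator U x * g x)"
  shows "\<exists>x\<in>U. (LINT x|M. indicator U x * g x) = g x * measure M U"
proof -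
  interpret finite_measure M by fact
  obtain y where y: "y \<in> U" "g y * measure M U \<le> (LINT x|M. indicator U x * g x)"
    using exists_le_average[OF U(1,3) g] by blast
  obtain z where z: "z \<in> U" "- g z * measure M U \<le> (LINT x|M. indicator U x * - g x)"
    using exists_le_average[OF U(1,3), of "\<lambda>x. - g x"] g by auto
  have "(LINT x|M. indicator U x * g x) / measure M U \<in> g ` U"
  proof (rule connectedD_interval[OF connected_continuous_image[OF cont U(2)]])
    show "g y \<in> g ` U" "g z \<in> g ` U" using y z by auto
    show "g y \<le> (LINT x|M. indicator U x * g x) / measure M U" using y U(3) by (simp add: pos_le_divide_eq)
    show "(LINT x|M. indicator U x * g x) / measure M U \<le> g z" using z U(3) by (simp add: pos_divide_le_eq)
  qed
  then obtain x where "x \<in> U" "(LINT x|M. indicator U x * g x) / measure M U = g x" by blast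
  then show ?thesis using U(3) by (intro bexI[of _ x]) (auto simp: divide_eq_eq)
qed

locale sampled_measure = finite_measure \<mu> + dominating_weights c
  for \<mu> :: "'a measure" and c :: "nat \<Rightarrow> real" +
  fixes V :: "nat \<Rightarrow> 'a set"
  assumes V_sets [measurable]: "\<And>i. V i \<in> sets \<mu>"
begin

definition sample :: "('a \<Rightarrow> real) \<Rightarrow> nat \<Rightarrow> real" where
  "sample g i = c i * (LINT x|\<mu>. indicator (V i) x * g x)"

definition synthesis :: "(nat \<Rightarrow> real) \<Rightarrow> 'a \<Rightarrow> real" where
  "synthesis T x = (\<Sum>i. T i * c i * indicator (V i) x)"

definition bounded_measurable :: "('a \<Rightarrow> real) \<Rightarrow> bool" where
  "bounded_measurable g \<longleftrightarrow> g \<in> borel_measurable \<mu> \<and> (\<exists>B. \<forall>x. \<bar>g x\<bar> \<le> B)"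

lemma integrable_indicator_mult:
  assumes "bounded_measurable g" and A: "A \<in> sets \<mu>"
  shows "integrable \<mu> (\<lambda>x. indicator A x * g x)"
proof -
  obtain B where B: "g \<in> borel_measurable \<mu>" "\<And>x. \<bar>g x\<bar> \<le> B"
    using assms(1) by (auto simp: bounded_measurable_def)
  have "integrable \<mu> g" by (rule integrable_const_bound[where B = B]) (use B in auto)
  from integrable_real_mult_indicator[OF A this] show ?thesis by (simp add: mult.commute)
qed

lemma bounded_measurable_add:
  assumes "bounded_measurable g" "bounded_measurable h"
  shows "bounded_measurable (\<lambda>x. g x + h x)"
proof -
  obtain B B' where [measurable]: "g \<in> borel_measurable \<mu>" "h \<in> borel_measurable \<mu>"
    and B: "\<And>x. \<bar>g x\<bar> \<le> B" "\<And>x. \<bar>h x\<bar> \<le> B'" using assms by (auto simp: bounded_measurable_def)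
  have "\<bar>g x + h x\<bar> \<le> B + B'" for x using B(1)[of x] B(2)[of x] by linarith
  moreover have "(\<lambda>x. g x + h x) \<in> borel_measurable \<mu>" by measurable
  ultimately show ?thesis unfolding bounded_measurable_def by blast
qed

lemma sample_dominated:
  assumes g: "bounded_measurable g"
  shows "dominated (sample g)"
proof -
  obtain B where B: "\<And>x. \<bar>g x\<bar> \<le> B" using g by (auto simp: bounded_measurable_def)
  have B_nonneg: "B \<ge> 0" using order.trans[OF abs_ge_zero B] .
  have "\<bar>LINT x|\<mu>. indicator (V i) x * g x\<bar> \<le> measure \<mu> (space \<mu>) * B" for i
  proof -
    have "\<bar>LINT x|\<mu>. indicator (V i) x * g x\<bar> \<le> (LINT x|\<mu>. \<bar>indicator (V i) x * g x\<bar>)"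
      by (rule integral_abs_bound)
    also have "\<dots> \<le> (LINT x|\<mu>. B)"
      by (intro integral_mono integrable_abs integrable_indicator_mult g V_sets)
        (use B B_nonneg in \<open>auto simp: indicator_def\<close>)
    finally show ?thesis by simp
  qed
  from mult_left_mono[OF this c_nonneg] have "\<bar>sample g i\<bar> \<le> (measure \<mu> (space \<mu>) * B) * c i" for i
    by (simp add: sample_def abs_mult c_nonneg mult.commute)
  then show ?thesis by (auto simp: dominated_def)
qed

lemma sample_add:
  assumes "bounded_measurable g" "bounded_measurable h"
  shows "sample (\<lambda>x. g x + h x) = (\<lambda>i. sample g i + sample h i)"
  using integrable_indicator_mult[OF assms(1) V_sets] integrable_indicator_mult[OF assms(2) V_sets]
  by (simp add: sample_def fun_eq_iff distrib_left)

lemma sample_scale: "sample (\<lambda>x. r * g x) = (\<lambda>i. r * sample g i)"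
proof
  fix i
  have "(LINT x|\<mu>. indicator (V i) x * (r * g x)) = (LINT x|\<mu>. r * (indicator (V i) x * g x))"
    by (rule Bochner_Integration.integral_cong) auto
  then show "sample (\<lambda>x. r * g x) i = r * sample g i" by (simp add: sample_def)
qed

lemma synthesis_term_le:
  assumes "\<And>i. \<bar>T i\<bar> \<le> B"
  shows "\<bar>T i * c i * indicator (V i) x\<bar> \<le> B * c i"
proof -
  have "B \<ge> 0" using order.trans[OF abs_ge_zero assms] .
  then show ?thesis using mult_right_mono[OF assms[of i] c_nonneg[of i]] c_nonneg[of i]
    by (auto simp: abs_mult indicator_def)
qed

lemma synthesis_summable:
  assumes "\<And>i. \<bar>T i\<bar> \<le> B"
  shows "summable (\<lambda>i. \<bar>T i * c i * indicator (V i) x\<bar>)"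
  by (rule summable_comparison_test'[of "\<lambda>i. B * c i"])
    (use synthesis_term_le[OF assms] c_summable in \<open>auto intro: summable_mult\<close>)

lemma synthesis_bounded_measurable:
  assumes T: "\<And>i. \<bar>T i\<bar> \<le> B"
  shows "bounded_measurable (synthesis T)"
  unfolding bounded_measurable_def
proof (intro conjI exI allI)
  show "synthesis T \<in> borel_measurable \<mu>" unfolding synthesis_def[abs_def] by measurable
  fix x
  have "\<bar>synthesis T x\<bar> \<le> (\<Sum>i. \<bar>T i * c i * indicator (V i) x\<bar>)"
    unfolding synthesis_def using synthesis_summable[OF T] by (rule summable_rabs)
  also have "\<dots> \<le> (\<Sum>i. B * c i)"
    by (intro suminf_le synthesis_term_le[OF T] synthesis_summable[OF T] summable_mult c_summable)
  finally show "\<bar>synthesis T x\<bar> \<le> (\<Sum>i. B * c i)" .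
qed

lemma integral_synthesis:
  assumes T: "\<And>i. \<bar>T i\<bar> \<le> B" and g: "bounded_measurable g"
  shows "(LINT x|\<mu>. synthesis T x * g x) = pairing T (sample g)"
proof -
  obtain Bg where [measurable]: "g \<in> borel_measurable \<mu>" and Bg: "\<And>x. \<bar>g x\<bar> \<le> Bg"
    using g by (auto simp: bounded_measurable_def)
  have B_nonneg: "B \<ge> 0" using order.trans[OF abs_ge_zero T] .
  let ?term = "\<lambda>i x. T i * c i * indicator (V i) x * g x"
  have term_le: "norm (?term i x) \<le> B * c i * Bg" for i x
  proof -
    have "\<bar>T i * c i * indicator (V i) x\<bar> \<le> B * c i" by (rule synthesis_term_le[OF T])
    from mult_mono[OF this Bg[of x]] show ?thesis using B_nonneg c_nonneg[of i] by (simp add: abs_mult)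
  qed
  have bound_summable: "summable (\<lambda>i. B * c i * Bg)" by (intro summable_mult summable_mult2 c_summable)
  have integrable: "integrable \<mu> (?term i)" for i
    using integrable_mult_right[OF integrable_indicator_mult[OF g V_sets[of i]], of "T i * c i"]
    by (simp add: mult.assoc)
  have "synthesis T x * g x = (\<Sum>i. ?term i x)" for x
    unfolding synthesis_def by (rule suminf_mult2[OF summable_rabs_cancel[OF synthesis_summable[OF T]]])
  then have "(LINT x|\<mu>. synthesis T x * g x) = (LINT x|\<mu>. (\<Sum>i. ?term i x))" by simp
  also have "\<dots> = (\<Sum>i. LINT x|\<mu>. ?term i x)"
  proof (rule integral_suminf[OF integrable])
    show "AE x in \<mu>. summable (\<lambda>i. norm (?term i x))"
      by (intro AE_I2 summable_comparison_test'[OF bound_summable]) (use term_le in simp)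
    show "summable (\<lambda>i. LINT x|\<mu>. norm (?term i x))"
    proof (rule summable_comparison_test')
      show "summable (\<lambda>i. measure \<mu> (space \<mu>) * (B * c i * Bg))" by (intro summable_mult bound_summable)
      show "norm (LINT x|\<mu>. norm (?term i x)) \<le> measure \<mu> (space \<mu>) * (B * c i * Bg)" for i
        using integral_mono[OF integrable_norm[OF integrable[of i]] _ term_le] by (simp add: integral_nonneg)
    qed
  qed
  also have "\<dots> = pairing T (sample g)"
    unfolding pairing_def sample_def
    by (simp add: mult.assoc flip: integral_mult_right_zero)
  finally show ?thesis .
qed

end

lemma gap_witness_of_real_annihilator:
  fixes f :: "real \<Rightarrow> real"
  assumes sets: "sets \<mu> = sets borel" and fin: "finite_measure \<mu>" and b: "b > 0"
    and f_measurable [measurable]: "f \<in> borel_measurable \<mu>" and f_bounded: "\<And>x. \<bar>f x\<bar> \<le> B"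
    and nonzero: "\<not> (AE x in \<mu>. f x = 0)"
    and cos_zero: "\<And>l. \<bar>l\<bar> \<le> b \<Longrightarrow> (LINT x|\<mu>. f x * cos (l * x)) = 0"
    and sin_zero: "\<And>l. \<bar>l\<bar> \<le> b \<Longrightarrow> (LINT x|\<mu>. f x * sin (l * x)) = 0"
  shows "gap_witness \<mu> (2 * b)"
  unfolding gap_witness_def
proof (intro conjI exI[of _ "\<lambda>x. complex_of_real (f x) * cis (- b * x)"] ballI)
  interpret finite_measure \<mu> by (rule fin)
  have [measurable]: "(\<lambda>x::real. x) \<in> borel_measurable \<mu>" by (simp add: measurable_cong_sets[OF sets refl])
  have "(\<lambda>x. cis (- b * x)) \<in> borel_measurable \<mu>"
    unfolding measurable_cong_sets[OF sets refl] cis_conv_exp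
    by (intro borel_measurable_continuous_onI continuous_intros)
  then show "(\<lambda>x. complex_of_real (f x) * cis (- b * x)) \<in> borel_measurable \<mu>" by measurable
  show "2 * b > 0" using b by simp
  show "\<exists>C. AE x in \<mu>. norm (complex_of_real (f x) * cis (- b * x)) \<le> C"
    using f_bounded by (intro exI[of _ B]) (simp add: norm_mult)
  show "\<not> (AE x in \<mu>. complex_of_real (f x) * cis (- b * x) = 0)" using nonzero by simp
  have "\<bar>f x * cos y\<bar> \<le> B" "\<bar>f x * sin y\<bar> \<le> B" for x y
    unfolding abs_mult
    using mult_mono[OF f_bounded[of x] abs_cos_le_one order.trans[OF abs_ge_zero f_bounded]]
      mult_mono[OF f_bounded[of x] abs_sin_le_one order.trans[OF abs_ge_zero f_bounded]] by auto
  then have integrable: "integrable \<mu> (\<lambda>x. f x * cos (l * x))" "integrable \<mu> (\<lambda>x. f x * sin (l * x))" for l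
    by (auto intro!: integrable_const_bound[where B = B])
  fix t assume t: "t \<in> {0..2 * b}"
  define l where "l = t - b"
  have l: "\<bar>l\<bar> \<le> b" using t by (auto simp: l_def)
  have "complex_of_real (f x) * cis (- b * x) * cis (t * x)
      = complex_of_real (f x * cos (l * x)) + \<i> * complex_of_real (f x * sin (l * x))" for x
  proof -
    have "complex_of_real (f x) * cis (- b * x) * cis (t * x) = complex_of_real (f x) * cis (l * x)"
      by (simp add: cis_mult l_def mult.assoc algebra_simps)
    then show ?thesis by (simp add: complex_eq_iff)
  qed
  then have "(LINT x|\<mu>. complex_of_real (f x) * cis (- b * x) * cis (t * x))
      = (LINT x|\<mu>. complex_of_real (f x * cos (l * x))) + (LINT x|\<mu>. \<i> * complex_of_real (f x * sin (l * x)))"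
    by (simp only:) (intro Bochner_Integration.integral_add integrable_of_real integrable_mult_right integrable)
  also have "\<dots> = complex_of_real (LINT x|\<mu>. f x * cos (l * x))
      + \<i> * complex_of_real (LINT x|\<mu>. f x * sin (l * x))"
    by (simp only: integral_mult_right_zero integral_complex_of_real)
  finally show "(LINT x|\<mu>. complex_of_real (f x) * cis (- b * x) * cis (t * x)) = 0"
    using cos_zero[OF l] sin_zero[OF l] by simp
qed

lemma summable_on_even_int:
  fixes f :: "int \<Rightarrow> real"
  assumes f: "summable (\<lambda>n::nat. f (int n))" "\<And>k. f (- k) = f k" "\<And>k. f k \<ge> 0"
  shows "f summable_on UNIV"
proof -
  have nat: "(\<lambda>n::nat. f (int n)) summable_on UNIV" using f by (simp add: summable_on_UNIV_nonneg_real_iff)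
  have "f summable_on range int" using nat by (subst summable_on_reindex) (auto simp: o_def)
  moreover have "f summable_on range (\<lambda>n. - int n)"
    using nat f(2) by (subst summable_on_reindex) (auto simp: o_def inj_on_def)
  moreover have "(UNIV :: int set) = range int \<union> range (\<lambda>n. - int n)"
    by (auto intro: int_cases2)
  ultimately show ?thesis using summable_on_union by metis
qed

lemma summable_on_int_inverse_square: "(\<lambda>k::int. 1 / (1 + (real_of_int k)\<^sup>2)) summable_on UNIV"
  and summable_on_int_ln_over_square: "(\<lambda>k::int. ln (1 + (real_of_int k)\<^sup>2) / (1 + (real_of_int k)\<^sup>2)) summable_on UNIV"
proof -
  have powr: "summable (\<lambda>n. norm (real n powr (- 3 / 2)))" by (simp add: summable_real_powr_iff)
  have "(\<lambda>n::nat. 1 / (1 + (real n)\<^sup>2)) \<in> O(\<lambda>n. real n powr (- 3 / 2))" by real_asymp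
  from summable_comparison_test_bigo[OF powr this]
  show "(\<lambda>k::int. 1 / (1 + (real_of_int k)\<^sup>2)) summable_on UNIV"
    by (intro summable_on_even_int) auto
  have "(\<lambda>n::nat. ln (1 + (real n)\<^sup>2) / (1 + (real n)\<^sup>2)) \<in> O(\<lambda>n. real n powr (- 3 / 2))" by real_asymp
  from summable_comparison_test_bigo[OF powr this]
  show "(\<lambda>k::int. ln (1 + (real_of_int k)\<^sup>2) / (1 + (real_of_int k)\<^sup>2)) summable_on UNIV"
    by (intro summable_on_even_int) (auto intro!: divide_nonneg_nonneg ln_ge_zero)
qed

section \<open>The spectral gap\<close>

definition gap_interval :: "(int \<Rightarrow> real) \<Rightarrow> int \<Rightarrow> real set" where
  "gap_interval a k = {a k - gap_radius a k<..<a k + gap_radius a k}"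

lemma perturbation_iff: "perturbation a x \<longleftrightarrow> (\<forall>k. x k \<in> gap_interval a k)"
  by (auto simp: perturbation_def gap_interval_def abs_less_iff algebra_simps)

locale charged_gaps = finite_measure \<mu>
  for \<mu> :: "real measure" +
  fixes a :: "int \<Rightarrow> real" and d :: real
  assumes sets_borel: "sets \<mu> = sets borel" and a_mono: "strict_mono a" and uniform: "d_uniform d (range a)"
    and mass_pos: "\<And>k. measure \<mu> (gap_interval a k) > 0"
    and log_mass_summable: "(\<lambda>k. ln (measure \<mu> (gap_interval a k)) / (1 + (real_of_int k)\<^sup>2)) summable_on UNIV"
begin

definition index_weight :: "nat \<Rightarrow> real" where
  "index_weight i = 1 / (1 + (real_of_int (int_decode i))\<^sup>2)"

sublocale sampled_measure \<mu> index_weight "\<lambda>i. gap_interval a (int_decode i)"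
proof
  have "index_weight summable_on UNIV" unfolding index_weight_def
    using summable_on_reindex_bij_betw[OF bij_int_decode, of "\<lambda>k. 1 / (1 + (real_of_int k)\<^sup>2)"]
      summable_on_int_inverse_square by simp
  then show "summable index_weight" by (rule summable_on_imp_summable)
  show "gap_interval a (int_decode i) \<in> sets \<mu>" for i by (simp add: gap_interval_def sets_borel)
qed (simp_all add: index_weight_def add_pos_nonneg)

definition node_weight :: "int \<Rightarrow> real" where
  "node_weight k = ln (1 + (real_of_int k)\<^sup>2) + \<bar>ln (measure \<mu> (gap_interval a k))\<bar>"

lemma node_weight_nonneg: "node_weight k \<ge> 0"
  unfolding node_weight_def by (intro add_nonneg_nonneg ln_ge_zero) auto

lemma node_weight_summable: "(\<lambda>k. node_weight k / (1 + (real_of_int k)\<^sup>2)) summable_on UNIV"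
proof -
  from log_mass_summable[THEN summable_on_iff_abs_summable_on_real[THEN iffD1]]
  have "(\<lambda>k. \<bar>ln (measure \<mu> (gap_interval a k))\<bar> / (1 + (real_of_int k)\<^sup>2)) summable_on UNIV"
    by (simp add: abs_divide add_pos_nonneg abs_of_pos)
  from summable_on_add[OF summable_on_int_ln_over_square this] show ?thesis
    by (simp add: node_weight_def add_divide_distrib)
qed

lemma inverse_mass_le: "(1 + (real_of_int k)\<^sup>2) / measure \<mu> (gap_interval a k) \<le> exp (node_weight k)"
proof -
  have "1 / measure \<mu> (gap_interval a k) = exp (- ln (measure \<mu> (gap_interval a k)))"
    using mass_pos[of k] by (simp add: exp_minus divide_inverse)
  also have "\<dots> \<le> exp \<bar>ln (measure \<mu> (gap_interval a k))\<bar>" by simp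
  finally have "(1 + (real_of_int k)\<^sup>2) * (1 / measure \<mu> (gap_interval a k))
      \<le> (1 + (real_of_int k)\<^sup>2) * exp \<bar>ln (measure \<mu> (gap_interval a k))\<bar>" by (intro mult_left_mono) auto
  also have "\<dots> = exp (node_weight k)" by (simp add: node_weight_def exp_add add_pos_nonneg)
  finally show ?thesis by simp
qed

lemma bounded_measurable_continuous:
  assumes "continuous_on UNIV g" "\<exists>B. \<forall>x. \<bar>g x\<bar> \<le> B"
  shows "bounded_measurable g"
  using assms borel_measurable_continuous_onI[of g] measurable_cong_sets[OF sets_borel refl]
  by (auto simp: bounded_measurable_def)

lemma bounded_measurable_on_reals: "real_exp_type b h \<Longrightarrow> bounded_measurable (on_reals h)"
  by (intro bounded_measurable_continuous on_reals_continuous on_reals_bounded)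

definition lorentzian :: "real \<Rightarrow> real" where
  "lorentzian x = 1 / (1 + x\<^sup>2)"

lemma lorentzian_continuous: "continuous_on UNIV lorentzian"
proof -
  have "1 + x\<^sup>2 \<noteq> 0" for x :: real by (metis add_pos_nonneg less_irrefl zero_le_power2 zero_less_one)
  then show ?thesis unfolding lorentzian_def[abs_def] by (intro continuous_intros) auto
qed

lemma bounded_measurable_lorentzian: "bounded_measurable lorentzian"
proof (rule bounded_measurable_continuous[OF lorentzian_continuous])
  have "\<bar>lorentzian x\<bar> \<le> 1" for x by (simp add: lorentzian_def add_pos_nonneg)
  then show "\<exists>B. \<forall>x. \<bar>lorentzian x\<bar> \<le> B" by blast
qed

lemma perturbation_of_small_samples:
  assumes g: "bounded_measurable g" and cont: "continuous_on UNIV g" and small: "\<And>i. \<bar>sample g i\<bar> \<le> \<delta>"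
    and \<delta>: "\<delta> \<ge> 0"
  shows "\<exists>x. perturbation a x \<and> (\<forall>k. \<bar>g (x k)\<bar> \<le> \<delta> * exp (node_weight k))"
proof -
  have "\<exists>x\<in>gap_interval a k. \<bar>g x\<bar> \<le> \<delta> * exp (node_weight k)" for k
  proof -
    let ?I = "gap_interval a k"
    have I: "?I \<in> sets \<mu>" by (simp add: gap_interval_def sets_borel)
    have "connected ?I" by (simp add: gap_interval_def)
    then obtain x where x: "x \<in> ?I" "(LINT y|\<mu>. indicator ?I y * g y) = g x * measure \<mu> ?I"
      using mean_value_on_connected[OF finite_measure_axioms I _ mass_pos continuous_on_subset[OF cont]
        integrable_indicator_mult[OF g I]] by blast
    have "\<bar>g x\<bar> * measure \<mu> ?I / (1 + (real_of_int k)\<^sup>2) = \<bar>sample g (int_encode k)\<bar>"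
      using mass_pos[of k] x(2)
      by (simp add: sample_def index_weight_def abs_mult abs_divide add_pos_nonneg abs_of_pos)
    also have "\<dots> \<le> \<delta>" by (rule small)
    finally have "\<bar>g x\<bar> * measure \<mu> ?I \<le> \<delta> * (1 + (real_of_int k)\<^sup>2)"
      by (simp add: divide_le_eq add_pos_nonneg)
    then have "\<bar>g x\<bar> \<le> \<delta> * ((1 + (real_of_int k)\<^sup>2) / measure \<mu> ?I)"
      using mass_pos[of k] by (simp add: pos_le_divide_eq)
    also have "\<dots> \<le> \<delta> * exp (node_weight k)" using inverse_mass_le \<delta> by (rule mult_left_mono)
    finally show ?thesis using x(1) by blast
  qed
  then show ?thesis unfolding perturbation_iff by metis
qed

text \<open>If all samples of \<open>lorentzian + h\<close> were tiny, the multiple \<open>G * (1 + (1 + z\<^sup>2) * h)\<close> would be bounded on a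
  perturbation of \<open>a\<close>, yet its value \<open>G \<i>\<close> at \<open>\<i>\<close> does not depend on \<open>h\<close>.\<close>

lemma samples_bounded_below:
  assumes b: "0 \<le> b" "b < pi * d"
  shows "\<exists>\<delta>>0. \<forall>h. real_exp_type b h \<longrightarrow> (\<exists>i. \<delta> < \<bar>sample (\<lambda>x. lorentzian x + on_reals h x) i\<bar>)"
proof -
  define \<eta> where "\<eta> = (pi * d - b) / 2"
  have \<eta>: "\<eta> > 0" "0 \<le> b + \<eta>" "b + \<eta> < pi * d" using b by (simp_all add: \<eta>_def field_simps)
  obtain G where G: "G holomorphic_on UNIV" "\<And>z. norm (G z) \<le> exp (\<eta> * \<bar>Im z\<bar>) / (1 + norm z) ^ 3" "G \<i> \<noteq> 0"
    using fast_decaying_exp_type_exists[OF \<eta>(1), of 3] by auto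
  obtain C where C: "\<And>h. node_bounded a node_weight (b + \<eta>) h \<Longrightarrow> norm (h \<i>) \<le> C"
    using node_bounded_uniformly_at_i[OF a_mono uniform node_weight_nonneg node_weight_summable \<eta>(2,3)] by blast
  define \<delta> where "\<delta> = norm (G \<i>) / (\<bar>C\<bar> + 1)"
  have \<delta>: "\<delta> > 0" using G(3) by (simp add: \<delta>_def add_nonneg_pos)
  have "\<exists>i. \<delta> < \<bar>sample (\<lambda>x. lorentzian x + on_reals h x) i\<bar>" if h: "real_exp_type b h" for h
  proof (rule ccontr)
    let ?g = "\<lambda>x. lorentzian x + on_reals h x"
    assume "\<not> ?thesis"
    then have small: "\<bar>sample ?g i\<bar> \<le> \<delta>" for i by (simp add: not_less)
    have cont: "continuous_on UNIV ?g"
      by (intro continuous_on_add lorentzian_continuous on_reals_continuous[OF h])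
    have g: "bounded_measurable ?g"
      by (rule bounded_measurable_add[OF bounded_measurable_lorentzian bounded_measurable_on_reals[OF h]])
    obtain x where x: "perturbation a x" "\<And>k. \<bar>?g (x k)\<bar> \<le> \<delta> * exp (node_weight k)"
      using perturbation_of_small_samples[OF g cont small] \<delta> by auto
    define H where "H = scaled_down (ln \<delta>) (damped_multiple G h)"
    have norm_H: "norm (H z) = norm (damped_multiple G h z) / \<delta>" for z
      using \<delta> by (simp add: H_def norm_scaled_down exp_minus divide_inverse mult.commute)
    have "norm (H (of_real (x k))) \<le> exp (node_weight k)" for k
      using order.trans[OF norm_damped_multiple_real_le[OF G(2) h] x(2)[of k, unfolded lorentzian_def]] \<delta>
      by (simp add: norm_H pos_divide_le_eq mult.commute)
    moreover have "decaying_exp_type (b + \<eta>) H" unfolding H_def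
      by (intro decaying_exp_type_scaled_down decaying_exp_type_damped_multiple G(1,2) h b(1))
    ultimately have "norm (H \<i>) \<le> C" using x(1) by (intro C) (auto simp: node_bounded_def)
    moreover have "norm (H \<i>) = \<bar>C\<bar> + 1" using G(3) by (simp add: norm_H damped_multiple_def \<delta>_def)
    ultimately show False by linarith
  qed
  then show ?thesis using \<delta> by blast
qed

definition samples :: "real \<Rightarrow> (nat \<Rightarrow> real) set" where
  "samples b = {sample (on_reals h) | h. real_exp_type b h}"

lemma sample_add_on_reals:
  "bounded_measurable g \<Longrightarrow> real_exp_type b h
    \<Longrightarrow> sample (\<lambda>x. g x + on_reals h x) = (\<lambda>i. sample g i + sample (on_reals h) i)"
  by (rule sample_add[OF _ bounded_measurable_on_reals])

lemma samples_zero: "(\<lambda>i. 0) \<in> samples b"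
proof -
  have "sample (on_reals (\<lambda>z. 0)) = (\<lambda>i. 0)" by (simp add: sample_def on_reals_def fun_eq_iff)
  then show ?thesis unfolding samples_def using real_exp_type_zero by force
qed

lemma samples_add:
  assumes "u \<in> samples b" "v \<in> samples b"
  shows "(\<lambda>i. u i + v i) \<in> samples b"
proof -
  obtain g h where gh: "real_exp_type b g" "u = sample (on_reals g)" "real_exp_type b h"
    "v = sample (on_reals h)"
    using assms by (auto simp: samples_def)
  have "(\<lambda>i. u i + v i) = sample (on_reals (\<lambda>z. g z + h z))"
    unfolding gh(2,4) sample_add_on_reals[OF bounded_measurable_on_reals[OF gh(1)] gh(3), symmetric]
    by (simp add: on_reals_def[abs_def])
  then show ?thesis unfolding samples_def using real_exp_type_add[OF gh(1,3)] by blast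
qed

lemma samples_scale:
  assumes "v \<in> samples b"
  shows "(\<lambda>i. r * v i) \<in> samples b"
proof -
  obtain h where h: "real_exp_type b h" "v = sample (on_reals h)" using assms by (auto simp: samples_def)
  have "(\<lambda>i. r * v i) = sample (on_reals (\<lambda>z. of_real r * h z))"
    unfolding h(2) sample_scale[symmetric] by (simp add: on_reals_def[abs_def])
  then show ?thesis unfolding samples_def using real_exp_type_scale[OF h(1), of r] by blast
qed

lemma real_annihilator_exists:
  assumes b: "0 \<le> b" "b < pi * d"
  shows "\<exists>T B. (\<forall>i. \<bar>T i\<bar> \<le> B) \<and> (\<forall>h. real_exp_type b h \<longrightarrow> pairing T (sample (on_reals h)) = 0)
    \<and> pairing T (sample lorentzian) \<noteq> 0"
proof -
  obtain \<delta> where \<delta>: "\<delta> > 0" "\<And>h. real_exp_type b h \<Longrightarrow> \<exists>i. \<delta> < \<bar>sample (\<lambda>x. lorentzian x + on_reals h x) i\<bar>"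
    using samples_bounded_below[OF b] by blast
  interpret subspace_at_distance index_weight "samples b" "sample lorentzian" "\<delta>\<^sup>2"
  proof
    show "dominated v" if "v \<in> samples b" for v
      using that by (auto simp: samples_def intro: sample_dominated bounded_measurable_on_reals)
    show "dominated (sample lorentzian)" by (rule sample_dominated[OF bounded_measurable_lorentzian])
    show "\<delta>\<^sup>2 \<le> (\<Sum>i. (sample lorentzian i + v i)\<^sup>2)" if v: "v \<in> samples b" for v
    proof -
      obtain h where h: "real_exp_type b h" "v = sample (on_reals h)" using v by (auto simp: samples_def)
      define u where "u = sample (\<lambda>x. lorentzian x + on_reals h x)"
      obtain i where "\<delta> < \<bar>u i\<bar>" using \<delta>(2)[OF h(1)] by (auto simp: u_def)
      then have "\<delta>\<^sup>2 \<le> (u i)\<^sup>2" using \<delta>(1) by (simp add: abs_le_square_iff[symmetric])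
      also have "\<dots> \<le> pairing u u" unfolding u_def
        by (intro sq_le_pairing_self sample_dominated bounded_measurable_add bounded_measurable_lorentzian
          bounded_measurable_on_reals[OF h(1)])
      finally show ?thesis
        by (simp add: u_def pairing_def h(2) sample_add_on_reals[OF bounded_measurable_lorentzian h(1)] power2_eq_square)
    qed
  qed (use \<delta>(1) samples_zero samples_add samples_scale in auto)
  show ?thesis using annihilator_exists by (auto simp: samples_def)
qed

lemma gap_witness_below:
  assumes b: "0 < b" "b < pi * d"
  shows "gap_witness \<mu> (2 * b)"
proof -
  obtain T B where T: "\<And>i. \<bar>T i\<bar> \<le> B"
    and orthogonal: "\<And>h. real_exp_type b h \<Longrightarrow> pairing T (sample (on_reals h)) = 0"
    and nonzero: "pairing T (sample lorentzian) \<noteq> 0" using real_annihilator_exists[of b] b by auto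
  obtain K where f: "synthesis T \<in> borel_measurable \<mu>" "\<And>x. \<bar>synthesis T x\<bar> \<le> K"
    using synthesis_bounded_measurable[of T B] T by (auto simp: bounded_measurable_def)
  have annihilates: "(LINT x|\<mu>. synthesis T x * on_reals h x) = 0" if "real_exp_type b h" for h
    using integral_synthesis[OF T bounded_measurable_on_reals[OF that]] orthogonal[OF that] by simp
  show ?thesis
  proof (rule gap_witness_of_real_annihilator[OF sets_borel finite_measure_axioms b(1) f])
    show "\<not> (AE x in \<mu>. synthesis T x = 0)"
    proof
      assume "AE x in \<mu>. synthesis T x = 0"
      then have "AE x in \<mu>. synthesis T x * lorentzian x = 0" by eventually_elim simp
      then have "(LINT x|\<mu>. synthesis T x * lorentzian x) = 0" by (rule integral_eq_zero_AE)
      then show False using nonzero integral_synthesis[OF T bounded_measurable_lorentzian] by simp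
    qed
    fix l assume l: "\<bar>l\<bar> \<le> b"
    have "on_reals (\<lambda>z. cos (of_real l * z)) = (\<lambda>x. cos (l * x))"
      "on_reals (\<lambda>z. sin (of_real l * z)) = (\<lambda>x. sin (l * x))"
      unfolding on_reals_def fun_eq_iff of_real_mult[symmetric] cos_of_real sin_of_real by simp_all
    then show "(LINT x|\<mu>. synthesis T x * cos (l * x)) = 0" "(LINT x|\<mu>. synthesis T x * sin (l * x)) = 0"
      using annihilates[OF real_exp_type_cos[OF l]] annihilates[OF real_exp_type_sin[OF l]] by simp_all
  qed
qed

end

lemma gap_infty_ge:
  assumes L: "L > 0" and witness: "\<And>r. 0 < r \<Longrightarrow> r < L \<Longrightarrow> gap_witness \<mu> r"
  shows "ereal L \<le> gap_infty \<mu>"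
proof -
  have "ereal L \<le> Sup (ereal ` {r. gap_witness \<mu> r})"
  proof (rule dense_le)
    fix y assume y: "y < ereal L"
    obtain r where "max y 0 < ereal r" "r < L" using ereal_dense2[of "max y 0" "ereal L"] y L by auto
    then have "0 < r" "y \<le> ereal r" by (auto simp: zero_ereal_def)
    then have "ereal r \<in> ereal ` {r. gap_witness \<mu> r}" using witness \<open>r < L\<close> by blast
    then show "y \<le> Sup (ereal ` {r. gap_witness \<mu> r})" using \<open>y \<le> ereal r\<close> by (rule Sup_upper2)
  qed
  moreover have "{r. gap_witness \<mu> r} \<noteq> {}" using witness[of "L / 2"] L by auto
  ultimately show ?thesis unfolding gap_infty_def by (simp only: if_False)
qed

theorem theorem5:
  fixes \<mu> :: "real measure" and a :: "int \<Rightarrow> real" and d :: real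
  assumes "sets \<mu> = sets borel"
    and "finite_measure \<mu>"
    and "strict_mono a"
    and "d_uniform d (range a)"
    and "\<forall>n. measure \<mu> {a n - min (a (n+1) - a n) (a n - a (n-1)) / 3 <..<
                            a n + min (a (n+1) - a n) (a n - a (n-1)) / 3} > 0"
    and "(\<lambda>n::int. ln (measure \<mu> {a n - min (a (n+1) - a n) (a n - a (n-1)) / 3 <..<
                            a n + min (a (n+1) - a n) (a n - a (n-1)) / 3})
                   / (1 + (real_of_int n)\<^sup>2)) summable_on UNIV"
  shows "gap_infty \<mu> \<ge> ereal (2 * pi * d)"
proof -
  interpret finite_measure \<mu> by (rule assms(2))
  interpret charged_gaps \<mu> a d
    by unfold_locales (use assms in \<open>simp_all add: gap_interval_def gap_radius_def\<close>)
  show ?thesis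
  proof (rule gap_infty_ge)
    show "2 * pi * d > 0" using uniform by (simp add: d_uniform_def)
    show "gap_witness \<mu> r" if "0 < r" "r < 2 * pi * d" for r
      using gap_witness_below[of "r / 2"] that by simp
  qed
qed

end
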